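(* Let $n\ge 3$ be an integer, $2_*<q<2^*$, $K_1>0$ and $K_2<0$, and consider the equation $$u''+\frac{n-1}{r}u'+k(r)\,u|u|^{q-2}=0,\qquad k(r)=\begin{cases}K_1 & r\le 1,\\ K_2 & r>1.\end{cases}$$ Then there is an increasing sequence of positive numbers $(L_k)_{k\ge0}$ converging to some $L_\infty<\infty$ such that: (i) $v(r,L_0)$ is a ground state with fast decay, and $v(r,L_k)$ is a regular fast decay solution with exactly $k$ nondegenerate zeroes; (ii) $v(r,L)$ is a singular ground state with fast decay for any $0<L<L_0$; (iii) for any $k\ge1$, $v(r,L)$ is a singular fast decay solution with exactly $k$ nondegenerate zeroes whenever $L_{k-1}<L<L_k$. Consequently there is an increasing sequence $D_k\nearrow\infty$ such that $u(r,D_k)$ is a regular fast decay solution with exactly $k$ nondegenerate zeroes for any $k\ge0$.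
   Context: $2_*=2\frac{n-1}{n-2}$ and $2^*=\frac{2n}{n-2}$. Solutions are understood as $C^1$ functions satisfying the equation for $r\ne1$. For $d\in\mathbb R$, $u(r,d)$ denotes the regular solution, i.e. the solution with $u(0,d)=d$, $u'(0,d)=0$. A solution defined near $r=0^+$ is singular if $\lim_{r\to0}u(r)=+\infty$ (or $-\infty$, for solutions that are negative near $0$). A solution defined for large $r$ is a fast decay solution if $\lim_{r\to\infty}u(r)r^{n-2}=L$ for some $L\in\mathbb R$, and $v(r,L)$ denotes the fast decay solution with $\lim_{r\to\infty}r^{n-2}v(r,L)=L$. A ground state (respectively singular ground state) is a regular (respectively singular) solution that is defined and positive for all $r>0$ and satisfies $\lim_{r\to\infty}u(r)=0$. "Exactly $k$ nondegenerate zeroes" means that the solution has exactly $k$ zeroes in $(0,\infty)$, and at each of them the derivative is nonzero. *)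

theory Defs
  imports "HOL-Analysis.Analysis"
begin

definition lower_exponent :: "nat \<Rightarrow> real" where
  "lower_exponent n = 2 * ((real n - 1) / (real n - 2))"

definition upper_exponent :: "nat \<Rightarrow> real" where
  "upper_exponent n = 2 * real n / (real n - 2)"

definition weight :: "real \<Rightarrow> real \<Rightarrow> real \<Rightarrow> real" where
  "weight K1 K2 r = (if r \<le> 1 then K1 else K2)"

text \<open>\<open>I\<close> is an interval contained in \<open>{0..}\<close>. Solutions are \<open>C\<^sup>1\<close> on \<open>I\<close>, one-sidedly at \<open>0\<close>
  if \<open>0\<close> belongs to \<open>I\<close>; the equation is not required at \<open>r = 1\<close>, where the weight jumps, nor
  at \<open>r = 0\<close>, where it is singular.\<close>

definition solves_on ::
  "nat \<Rightarrow> real \<Rightarrow> real \<Rightarrow> real \<Rightarrow> real set \<Rightarrow> (real \<Rightarrow> real) \<Rightarrow> bool" where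
  "solves_on n q K1 K2 I u \<longleftrightarrow>
     (\<exists>u' u''.
        (\<forall>r\<in>I. (u has_real_derivative u' r) (at r within I)) \<and>
        continuous_on I u' \<and>
        (\<forall>r\<in>I - {0, 1}.
           (u' has_real_derivative u'' r) (at r within I) \<and>
           u'' r + (real n - 1) / r * u' r
             + weight K1 K2 r * (u r * \<bar>u r\<bar> powr (q - 2)) = 0))"

definition regular_on ::
  "nat \<Rightarrow> real \<Rightarrow> real \<Rightarrow> real \<Rightarrow> real set \<Rightarrow> real \<Rightarrow> (real \<Rightarrow> real) \<Rightarrow> bool" where
  "regular_on n q K1 K2 I d u \<longleftrightarrow>
     solves_on n q K1 K2 I u \<and> u 0 = d \<and> (u has_real_derivative 0) (at 0 within I)"

definition decays_with :: "nat \<Rightarrow> real \<Rightarrow> (real \<Rightarrow> real) \<Rightarrow> bool" where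
  "decays_with n L u \<longleftrightarrow> ((\<lambda>r. u r * r ^ (n - 2)) \<longlongrightarrow> L) at_top"

text \<open>\<open>u(r,d)\<close> and \<open>v(r,L)\<close> are the maximally continued solutions: their value at \<open>r\<close> is the
  common value at \<open>r\<close> of all solutions with the given initial (resp. asymptotic) datum whose
  interval of definition reaches \<open>r\<close>. Such solutions may blow up in finite \<open>r\<close>; beyond the
  maximal interval the values are unspecified.\<close>

definition regular_sol ::
  "nat \<Rightarrow> real \<Rightarrow> real \<Rightarrow> real \<Rightarrow> real \<Rightarrow> real \<Rightarrow> real" where
  "regular_sol n q K1 K2 d r =
     (THE y. \<exists>b w. 0 \<le> r \<and> r < b \<and> regular_on n q K1 K2 {0..<b} d w \<and> y = w r)"

definition fast_decay_sol ::
  "nat \<Rightarrow> real \<Rightarrow> real \<Rightarrow> real \<Rightarrow> real \<Rightarrow> real \<Rightarrow> real" where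
  "fast_decay_sol n q K1 K2 L r =
     (THE y. \<exists>a w. 0 \<le> a \<and> a < r \<and> solves_on n q K1 K2 {a<..} w \<and> decays_with n L w \<and> y = w r)"

text \<open>The remaining predicates concern solutions defined for all \<open>r > 0\<close>; the value of \<open>u\<close> at
  \<open>0\<close> is irrelevant. Regularity means that \<open>u\<close> extends to a regular solution on \<open>{0..}\<close>.\<close>

definition regular :: "nat \<Rightarrow> real \<Rightarrow> real \<Rightarrow> real \<Rightarrow> (real \<Rightarrow> real) \<Rightarrow> bool" where
  "regular n q K1 K2 u \<longleftrightarrow> (\<exists>d. regular_on n q K1 K2 {0..} d (u(0 := d)))"

definition singular :: "nat \<Rightarrow> real \<Rightarrow> real \<Rightarrow> real \<Rightarrow> (real \<Rightarrow> real) \<Rightarrow> bool" where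
  "singular n q K1 K2 u \<longleftrightarrow>
     solves_on n q K1 K2 {0<..} u \<and>
     (filterlim u at_top (at_right 0) \<or> filterlim u at_bot (at_right 0))"

definition fast_decay :: "nat \<Rightarrow> real \<Rightarrow> real \<Rightarrow> real \<Rightarrow> (real \<Rightarrow> real) \<Rightarrow> bool" where
  "fast_decay n q K1 K2 u \<longleftrightarrow>
     solves_on n q K1 K2 {0<..} u \<and> (\<exists>L. decays_with n L u)"

definition ground_state :: "nat \<Rightarrow> real \<Rightarrow> real \<Rightarrow> real \<Rightarrow> (real \<Rightarrow> real) \<Rightarrow> bool" where
  "ground_state n q K1 K2 u \<longleftrightarrow>
     regular n q K1 K2 u \<and> (\<forall>r>0. u r > 0) \<and> (u \<longlongrightarrow> 0) at_top"

definition singular_ground_state ::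
  "nat \<Rightarrow> real \<Rightarrow> real \<Rightarrow> real \<Rightarrow> (real \<Rightarrow> real) \<Rightarrow> bool" where
  "singular_ground_state n q K1 K2 u \<longleftrightarrow>
     singular n q K1 K2 u \<and> (\<forall>r>0. u r > 0) \<and> (u \<longlongrightarrow> 0) at_top"

definition nondegenerate_zeroes :: "nat \<Rightarrow> (real \<Rightarrow> real) \<Rightarrow> bool" where
  "nondegenerate_zeroes k u \<longleftrightarrow>
     finite {r. r > 0 \<and> u r = 0} \<and> card {r. r > 0 \<and> u r = 0} = k \<and>
     (\<forall>r>0. u r = 0 \<longrightarrow> deriv u r \<noteq> 0)"

end

theory Submission
  imports Defs
begin

text \<open>
  Put \<open>\<alpha> = 2 / (q - 2)\<close> and \<open>\<mu> = n - 2 - \<alpha>\<close>; the bounds on \<open>q\<close> say exactly that \<open>0 < \<mu> < \<alpha>\<close>.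
  With \<open>u r = r powr (- \<alpha>) * x (ln r)\<close> and \<open>y = x'\<close> the equation becomes the planar system
  \<open>x' = y\<close>, \<open>y' = A * y + B * x - k * x * \<bar>x\<bar> powr (q - 2)\<close> with \<open>A = \<alpha> - \<mu> > 0\<close>, \<open>B = \<alpha> * \<mu> > 0\<close>,
  which is autonomous on either side of \<open>t = 0\<close>: the inner system has \<open>k = K1 > 0\<close> for \<open>t \<le> 0\<close>, the
  outer system \<open>k = K2 < 0\<close> for \<open>t > 0\<close>. The origin is a saddle of both, with eigenvalues \<open>\<alpha>\<close> and
  \<open>- \<mu>\<close>. A solution is regular at \<open>r = 0\<close> with value \<open>d\<close> if \<open>x\<close> behaves like \<open>d * exp (\<alpha> * t)\<close> at
  \<open>- \<infinity>\<close>, and decays fast with constant \<open>L\<close> if \<open>x\<close> behaves like \<open>L * exp (- \<mu> * t)\<close> at \<open>\<infinity>\<close>. Either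
  family consists, up to sign, of the time translates of a single trajectory: \<open>U\<close>, which leaves the
  origin of the inner system, and the stable trajectory, which enters the origin of the outer one.

  The stable trajectory in \<open>x > 0\<close> is the graph of a negative function \<open>hs\<close> on \<open>{0<..}\<close>
  (lemmas \<open>hs_deriv\<close>, \<open>hs_neg\<close>), and \<open>v(r,L)\<close> passes at \<open>r = 1\<close> through the point of this graph whose
  abscissa grows with \<open>L\<close>. Hence the theorem asks what inner trajectories through the points of
  the graph do backward in time. Superlinear growth makes the stable trajectory run through the
  whole graph after some finite time (\<open>dom_bounded_below\<close>); this bounds the relevant constants \<open>L\<close>.

  The answer rests on the energy \<open>y\<^sup>2 / 2 + pot x\<close> of the inner system, which never decreases as \<open>A > 0\<close>.
  \<^item> \<open>U\<close> has positive energy and winds around the origin for ever (\<open>no_escape\<close>, \<open>zeros_of_U_exist\<close>).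
    At a point of the graph the inner field is that of the outer system, which is tangent, minus
    a positive multiple of the \<open>y\<close> direction. So inner trajectories cross the graph downwards only
    (\<open>hs_cross\<close>), and every half turn of \<open>U\<close>, reflected into \<open>x > 0\<close>, meets it exactly once.
    The abscissa of the \<open>k\<close>-th crossing is \<open>X k\<close>; these points give the regular fast decay solutions.
  \<^item> Two half turns that start at the same abscissa keep the order of their energies
    (\<open>half_turn_compare\<close>), and the one with more energy meets the graph farther out
    (\<open>below_graph\<close>). Therefore \<open>X\<close> increases, which gives the order of the \<open>L\<^sub>k\<close>.
  \<^item> A trajectory on the graph whose energy was never negative tends to the origin backward in time
    with the rate of a regular solution, so it is a translate of \<open>\<plusminus>U\<close> (\<open>backward_regular\<close>,
    \<open>regular_on_graph\<close>). Every other one had negative energy at some time, which keeps \<open>x\<close> away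
    from 0 before that time (\<open>negative_energy_singular\<close>): \<open>u\<close> is singular.
  \<^item> Such a singular trajectory starts its first half turn inside that of \<open>U\<close>, and the comparison of
    half turns then interlaces its energies at successive zeros with those of \<open>U\<close>.
    If it ends on the graph between \<open>X (k - 1)\<close> and \<open>X k\<close>, it has exactly \<open>k\<close> zeros (\<open>singular_zero_count\<close>).
\<close>

section \<open>Differential inequalities\<close>

lemma eventually_nhds_openI:
  "open S \<Longrightarrow> t \<in> S \<Longrightarrow> (\<And>s. s \<in> S \<Longrightarrow> P s) \<Longrightarrow> eventually P (nhds t)"
  by (auto simp: eventually_nhds)

lemma antimono_if_deriv_nonpos:
  fixes f :: "real \<Rightarrow> real"
  assumes "s \<le> t" "\<And>r. s \<le> r \<Longrightarrow> r \<le> t \<Longrightarrow> (f has_real_derivative f' r) (at r)"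
    "\<And>r. s \<le> r \<Longrightarrow> r \<le> t \<Longrightarrow> f' r \<le> 0"
  shows "f t \<le> f s"
  using DERIV_nonpos_imp_nonincreasing[OF assms(1), of f] assms(2,3) by blast

lemma mono_if_deriv_nonneg:
  fixes f :: "real \<Rightarrow> real"
  assumes "s \<le> t" "\<And>r. s \<le> r \<Longrightarrow> r \<le> t \<Longrightarrow> (f has_real_derivative f' r) (at r)"
    "\<And>r. s \<le> r \<Longrightarrow> r \<le> t \<Longrightarrow> f' r \<ge> 0"
  shows "f s \<le> f t"
  using DERIV_nonneg_imp_nondecreasing[OF assms(1), of f] assms(2,3) by blast

lemma first_zero:
  fixes x :: "real \<Rightarrow> real"
  assumes c: "continuous_on {a..b} x" and ab: "a \<le> b" and xa: "x a > 0" and xb: "x b \<le> 0"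
  shows "\<exists>e. a < e \<and> e \<le> b \<and> x e = 0 \<and> (\<forall>t\<in>{a..<e}. x t > 0)"
proof -
  define S where "S = {a..b} \<inter> x -` {..0}"
  have clS: "closed S" unfolding S_def
    by (rule continuous_closed_preimage) (use c in auto)
  have neS: "b \<in> S" using xb ab by (auto simp: S_def)
  have bdd: "bdd_below S" by (auto simp: S_def)
  define e where "e = Inf S"
  have e: "e \<in> S" unfolding e_def using closed_contains_Inf[OF _ bdd clS] neS by auto
  have before: "x t > 0" if "a \<le> t" "t < e" for t
  proof (rule ccontr)
    assume "\<not> x t > 0"
    then have "t \<in> S" using that e by (auto simp: S_def)
    then have "e \<le> t" unfolding e_def by (rule cInf_lower[OF _ bdd])
    then show False using that by simp
  qed
  have eab: "a \<le> e" "e \<le> b" "x e \<le> 0" using e by (auto simp: S_def)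
  have "a < e" using eab xa by (cases "a = e") auto
  moreover have "x e = 0"
  proof (rule ccontr)
    assume "x e \<noteq> 0"
    obtain t where "a \<le> t" "t \<le> e" "x t = 0"
      using IVT2'[of x e 0 a] eab xa continuous_on_subset[OF c, of "{a..e}"] by auto
    then show False using before[of t] \<open>x e \<noteq> 0\<close> by (cases "t = e") auto
  qed
  ultimately show ?thesis using before eab by auto
qed

text \<open>The first zero would be reached from values that are at least \<open>D a\<close>.\<close>

lemma increasing_while_positive:
  fixes D :: "real \<Rightarrow> real"
  assumes ab: "a \<le> b" and cont: "continuous_on {a..b} D"
    and der: "\<And>t. t \<in> {a<..<b} \<Longrightarrow> (D has_real_derivative D' t) (at t)"
    and pos: "D a > 0"
    and D': "\<And>t. t \<in> {a<..<b} \<Longrightarrow> D t > 0 \<Longrightarrow> D' t \<ge> 0"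
  shows "D a \<le> D b"
proof -
  have all: "D t > 0" if t: "t \<in> {a..b}" for t
  proof (rule ccontr)
    assume "\<not> D t > 0"
    then obtain \<tau> where \<tau>: "a < \<tau>" "\<tau> \<le> t" "D \<tau> = 0" "\<forall>s\<in>{a..<\<tau>}. D s > 0"
      using first_zero[of a t D] continuous_on_subset[OF cont, of "{a..t}"] t pos by auto
    have "D a \<le> D \<tau>"
    proof (rule DERIV_nonneg_imp_increasing_open[where f = D])
      show "a \<le> \<tau>" using \<tau> by simp
      show "continuous_on {a..\<tau>} D" by (rule continuous_on_subset[OF cont]) (use \<tau> t in auto)
      fix s assume "a < s" "s < \<tau>"
      then show "\<exists>y. DERIV D s :> y \<and> y \<ge> 0"
        using der[of s] D'[of s] \<tau> t by auto
    qed
    then show False using \<tau>(3) pos by simp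
  qed
  show ?thesis
  proof (rule DERIV_nonneg_imp_increasing_open[OF ab _ cont])
    fix s assume "a < s" "s < b"
    then show "\<exists>y. DERIV D s :> y \<and> y \<ge> 0"
      using der[of s] D'[of s] all[of s] by auto
  qed
qed

text \<open>The function \<open>g\<close> passes all its zeros downwards, so it cannot return to 0. This is the
  form in which curves that a flow crosses in one direction only are used as barriers.\<close>

lemma negative_after_zero:
  fixes g :: "real \<Rightarrow> real"
  assumes der: "\<And>t. t \<in> {a..b} \<Longrightarrow> (g has_real_derivative g' t) (at t within {a..b})"
    and g': "\<And>t. t \<in> {a..b} \<Longrightarrow> g t = 0 \<Longrightarrow> g' t < 0"
    and ab: "a < b" and ga: "g a \<le> 0"
  shows "g b < 0"
proof (rule ccontr)
  assume nb: "\<not> g b < 0"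
  have cont: "continuous_on {a..b} g"
    using der by (rule DERIV_continuous_on)
  have "\<exists>a'. a \<le> a' \<and> a' < b \<and> g a' < 0"
  proof (cases "g a < 0")
    case True then show ?thesis using ab by auto
  next
    case False
    then have "g a = 0" using ga by simp
    then obtain d where d: "d > 0" "\<And>h. h > 0 \<Longrightarrow> a + h \<in> {a..b} \<Longrightarrow> h < d \<Longrightarrow> g (a + h) < g a"
      using has_real_derivative_neg_dec_right[OF der[of a], of] g'[of a] ab by auto
    define h where "h = min d (b - a) / 2"
    have "h > 0" "h < d" "h < b - a" using d ab by (auto simp: h_def)
    then show ?thesis using d(2)[of h] \<open>g a = 0\<close> by (intro exI[of _ "a + h"]) auto
  qed
  then obtain a' where a': "a \<le> a'" "a' < b" "g a' < 0" by auto
  obtain \<tau> where \<tau>: "a' < \<tau>" "\<tau> \<le> b" "g \<tau> = 0" "\<forall>s\<in>{a'..<\<tau>}. g s < 0"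
    using first_zero[of a' b "\<lambda>t. - g t"] a' nb continuous_on_minus[OF continuous_on_subset[OF cont, of "{a'..b}"]]
    by auto
  obtain d where d: "d > 0" "\<And>h. h > 0 \<Longrightarrow> \<tau> - h \<in> {a..b} \<Longrightarrow> h < d \<Longrightarrow> g \<tau> < g (\<tau> - h)"
    using has_real_derivative_neg_dec_left[OF der[of \<tau>], of] g'[of \<tau>] a' \<tau> by auto
  define h where "h = min d (\<tau> - a') / 2"
  have "h > 0" "h < d" "h < \<tau> - a'" using d \<tau>(1) by (auto simp: h_def)
  then have "g \<tau> < g (\<tau> - h)" using d(2)[of h] a' \<tau> by auto
  moreover have "g (\<tau> - h) < 0" using \<tau>(4) \<open>h > 0\<close> \<open>h < \<tau> - a'\<close> by auto
  ultimately show False using \<tau>(3) by simp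
qed

lemma increment_le_of_deriv_le:
  fixes g :: "real \<Rightarrow> real"
  assumes ab: "a \<le> b" and cg: "continuous_on {a..b} g" and cp: "continuous_on {a..b} \<psi>"
    and dg: "\<And>t. t \<in> {a<..<b} \<Longrightarrow> (g has_real_derivative g' t) (at t)"
    and dp: "\<And>t. t \<in> {a<..<b} \<Longrightarrow> (\<psi> has_real_derivative \<psi>' t) (at t)"
    and le: "\<And>t. t \<in> {a<..<b} \<Longrightarrow> \<bar>g' t\<bar> \<le> \<psi>' t"
  shows "\<bar>g b - g a\<bar> \<le> \<psi> b - \<psi> a"
proof -
  have "\<psi> a - g a \<le> \<psi> b - g b"
  proof (rule DERIV_nonneg_imp_increasing_open[OF ab])
    show "continuous_on {a..b} (\<lambda>t. \<psi> t - g t)" using cg cp by (intro continuous_intros)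
    fix t assume t: "a < t" "t < b"
    then have "((\<lambda>t. \<psi> t - g t) has_real_derivative \<psi>' t - g' t) (at t)"
      using dg[of t] dp[of t] by (auto intro: DERIV_diff)
    then show "\<exists>y. DERIV (\<lambda>t. \<psi> t - g t) t :> y \<and> y \<ge> 0" using le[of t] t by auto
  qed
  moreover have "\<psi> a + g a \<le> \<psi> b + g b"
  proof (rule DERIV_nonneg_imp_increasing_open[OF ab])
    show "continuous_on {a..b} (\<lambda>t. \<psi> t + g t)" using cg cp by (intro continuous_intros)
    fix t assume t: "a < t" "t < b"
    then have "((\<lambda>t. \<psi> t + g t) has_real_derivative \<psi>' t + g' t) (at t)"
      using dg[of t] dp[of t] by (auto intro: DERIV_add)
    then show "\<exists>y. DERIV (\<lambda>t. \<psi> t + g t) t :> y \<and> y \<ge> 0" using le[of t] t by auto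
  qed
  ultimately show ?thesis by linarith
qed

section \<open>Volterra equations\<close>

lemma at_within_atLeast_eq:
  fixes t :: real assumes "t < T"
  shows "at t within {a..T} = at t within {a..}"
  using assms by (intro at_within_nhd[of t "{..<T}"]) auto

lemma continuous_on_atLeast_if:
  fixes g :: "real \<Rightarrow> real"
  assumes "\<And>T. continuous_on {a..T} g"
  shows "continuous_on {a..} g"
  unfolding continuous_on_eq_continuous_within
proof
  fix t assume "t \<in> {a..}"
  then have "continuous (at t within {a..t+1}) g"
    using assms[of "t+1"] by (auto simp: continuous_on_eq_continuous_within)
  then show "continuous (at t within {a..}) g" using at_within_atLeast_eq[of t "t+1" a] by simp
qed

lemma integral_deriv_atLeast:
  fixes g :: "real \<Rightarrow> real"
  assumes "continuous_on {0..} g" "t \<ge> 0"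
  shows "((\<lambda>x. integral {0..x} g) has_real_derivative g t) (at t within {0..})"
proof -
  have "((\<lambda>x. integral {0..x} g) has_real_derivative g t) (at t within {0..t+1})"
    by (rule integral_has_real_derivative) (use assms in \<open>auto intro: continuous_on_subset[OF assms(1)]\<close>)
  then show ?thesis using at_within_atLeast_eq[of t "t+1" 0] by simp
qed

lemma has_real_derivative_within_atLeast_at:
  assumes "(g has_real_derivative D) (at t within {a..})" "a < (t::real)"
  shows "(g has_real_derivative D) (at t)"
  using assms at_within_interior[of t "{a..}"] by simp

text \<open>Picard iteration for an equation whose right-hand side may depend on all past values of the
  solution. In the norm weighted by \<open>exp (- 2 * C * t)\<close> the iteration contracts by the factor
  \<open>1 / 2\<close>, so the iterates converge on all of \<open>{0..T}\<close> at once.\<close>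

lemma volterra_exists:
  fixes \<Phi> :: "(real \<Rightarrow> real) \<Rightarrow> real \<Rightarrow> real"
  assumes cont: "\<And>u. continuous_on {0..} u \<Longrightarrow> continuous_on {0..} (\<Phi> u)"
    and lip: "\<And>T. 0 \<le> T \<Longrightarrow> \<exists>C>0. \<forall>u v t e. continuous_on {0..} u \<longrightarrow> continuous_on {0..} v \<longrightarrow>
        t \<in> {0..T} \<longrightarrow> (\<forall>s\<in>{0..t}. \<bar>u s - v s\<bar> \<le> e) \<longrightarrow> \<bar>\<Phi> u t - \<Phi> v t\<bar> \<le> C * e"
  obtains u where "continuous_on {0..} u" "u 0 = d"
    "\<And>t. t \<ge> 0 \<Longrightarrow> (u has_real_derivative \<Phi> u t) (at t within {0..})"
proof -
  define U where "U = rec_nat (\<lambda>_. d) (\<lambda>_ u t. d + integral {0..t} (\<Phi> u))"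
  have U0: "U 0 = (\<lambda>_. d)" and US: "U (Suc j) = (\<lambda>t. d + integral {0..t} (\<Phi> (U j)))" for j
    by (simp_all add: U_def)
  have derI: "((\<lambda>t. d + integral {0..t} (\<Phi> v)) has_real_derivative \<Phi> v t) (at t within {0..})"
    if "continuous_on {0..} v" "t \<ge> 0" for v t
    using DERIV_add[OF DERIV_const[of d] integral_deriv_atLeast[OF cont[OF that(1)] that(2)]] by simp
  have cU: "continuous_on {0..} (U j)" for j
  proof (induction j)
    case 0 show ?case by (simp add: U0)
  next
    case (Suc j)
    show ?case unfolding US by (rule DERIV_continuous_on) (use derI[OF Suc] in auto)
  qed
  have dU: "(U (Suc j) has_real_derivative \<Phi> (U j) s) (at s)" if "s > 0" for j s
    using has_real_derivative_within_atLeast_at[OF derI[OF cU]] that unfolding US by auto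
  define u where "u = (\<lambda>t. d + (\<Sum>i. U (Suc i) t - U i t))"
  have ulim: "uniform_limit {0..T} U u sequentially" if T: "T \<ge> 0" for T
  proof -
    obtain C where C: "C > 0" and CL: "\<And>u v t e. continuous_on {0..} u \<Longrightarrow> continuous_on {0..} v \<Longrightarrow>
        t \<in> {0..T} \<Longrightarrow> (\<And>s. s\<in>{0..t} \<Longrightarrow> \<bar>u s - v s\<bar> \<le> e) \<Longrightarrow> \<bar>\<Phi> u t - \<Phi> v t\<bar> \<le> C * e"
      using lip[OF T] by blast
    have "compact ((\<lambda>t. U 1 t - U 0 t) ` {0..T})"
      by (intro compact_continuous_image continuous_intros continuous_on_subset[OF cU]) auto
    then have "bounded ((\<lambda>t. U 1 t - U 0 t) ` {0..T})" by (rule compact_imp_bounded)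
    then obtain M where M: "M > 0" "\<And>t. t \<in> {0..T} \<Longrightarrow> \<bar>U 1 t - U 0 t\<bar> \<le> M"
      unfolding bounded_pos by auto
    have est: "\<bar>U (Suc j) t - U j t\<bar> \<le> M * (1/2)^j * exp (2*C*t)" if "t \<in> {0..T}" for j t
      using that
    proof (induction j arbitrary: t)
      case 0
      have "M * 1 \<le> M * exp (2*C*t)" using M C 0 by (intro mult_left_mono) auto
      then show ?case using M(2)[OF 0] by simp
    next
      case (Suc j)
      have "\<bar>(U (Suc (Suc j)) t - U (Suc j) t) - (U (Suc (Suc j)) 0 - U (Suc j) 0)\<bar>
          \<le> M * (1/2)^Suc j * exp (2*C*t) - M * (1/2)^Suc j * exp (2*C*0)"
      proof (rule increment_le_of_deriv_le[where g' = "\<lambda>t. \<Phi> (U (Suc j)) t - \<Phi> (U j) t"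
            and \<psi>' = "\<lambda>t. C * (M * (1/2)^j * exp (2*C*t))"])
        show "continuous_on {0..t} (\<lambda>t. U (Suc (Suc j)) t - U (Suc j) t)"
          by (intro continuous_intros continuous_on_subset[OF cU]) auto
        fix s assume s: "s \<in> {0<..<t}"
        show "((\<lambda>t. U (Suc (Suc j)) t - U (Suc j) t) has_real_derivative
            \<Phi> (U (Suc j)) s - \<Phi> (U j) s) (at s)"
          using s by (intro DERIV_diff dU) auto
        show "((\<lambda>t. M * (1/2)^Suc j * exp (2*C*t)) has_real_derivative
            C * (M * (1/2)^j * exp (2*C* s))) (at s)"
          by (auto intro!: derivative_eq_intros)
        show "\<bar>\<Phi> (U (Suc j)) s - \<Phi> (U j) s\<bar> \<le> C * (M * (1/2)^j * exp (2*C* s))"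
        proof (rule CL[OF cU cU])
          show "s \<in> {0..T}" using s Suc.prems by auto
          fix r assume r: "r \<in> {0..s}"
          have "\<bar>U (Suc j) r - U j r\<bar> \<le> M * (1/2)^j * exp (2*C*r)"
            using Suc.IH[of r] r s Suc.prems by auto
          also have "\<dots> \<le> M * (1/2)^j * exp (2*C* s)" using r M C by (intro mult_left_mono) auto
          finally show "\<bar>U (Suc j) r - U j r\<bar> \<le> M * (1/2)^j * exp (2*C* s)" .
        qed
      qed (use Suc.prems in \<open>auto intro!: continuous_intros\<close>)
      moreover have "U (Suc (Suc j)) 0 - U (Suc j) 0 = 0" by (simp add: US)
      moreover have "M * (1/2)^Suc j * exp (2*C*0) \<ge> 0" using M by simp
      ultimately show ?case by linarith
    qed
    have "uniform_limit {0..T} (\<lambda>n t. \<Sum>i<n. U (Suc i) t - U i t) (\<lambda>t. \<Sum>i. U (Suc i) t - U i t) sequentially"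
    proof (rule Weierstrass_m_test)
      fix j t assume t: "t \<in> {0..T}"
      have "M * (1/2)^j * exp (2*C*t) \<le> M * (1/2)^j * exp (2*C*T)"
        using t M C by (intro mult_left_mono) auto
      then show "norm (U (Suc j) t - U j t) \<le> M * exp (2*C*T) * (1/2)^j"
        using est[OF t, of j] by (simp add: mult_ac)
    next
      show "summable (\<lambda>j. M * exp (2*C*T) * (1/2::real)^j)"
        by (intro summable_mult summable_geometric) auto
    qed
    then have "uniform_limit {0..T} (\<lambda>n t. d + (\<Sum>i<n. U (Suc i) t - U i t)) u sequentially"
      unfolding u_def by (intro uniform_limit_intros)
    moreover have "(\<lambda>n t. d + (\<Sum>i<n. U (Suc i) t - U i t)) = U"
      by (intro ext) (simp add: sum_lessThan_telescope[of "\<lambda>i. U i _"] U0)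
    ultimately show ?thesis by simp
  qed
  have cu: "continuous_on {0..} u"
  proof (rule continuous_on_atLeast_if)
    fix T :: real
    show "continuous_on {0..T} u"
    proof (cases "T \<ge> 0")
      case True
      show ?thesis
        by (rule uniform_limit_theorem[OF _ ulim[OF True]])
           (auto intro!: always_eventually continuous_on_subset[OF cU])
    qed auto
  qed
  have eq: "u t = d + integral {0..t} (\<Phi> u)" if t: "t \<ge> 0" for t
  proof -
    obtain C where C: "C > 0" and CL: "\<And>u v s e. continuous_on {0..} u \<Longrightarrow> continuous_on {0..} v \<Longrightarrow>
        s \<in> {0..t} \<Longrightarrow> (\<And>r. r\<in>{0..s} \<Longrightarrow> \<bar>u r - v r\<bar> \<le> e) \<Longrightarrow> \<bar>\<Phi> u s - \<Phi> v s\<bar> \<le> C * e"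
      using lip[OF t] by blast
    have "(\<lambda>j. integral {0..t} (\<Phi> (U j))) \<longlonglongrightarrow> integral {0..t} (\<Phi> u)"
    proof (rule LIMSEQ_I)
      fix r :: real assume r: "r > 0"
      define e where "e = r / (2 * C * (t + 1))"
      have e: "e > 0" using r C t by (auto simp: e_def)
      obtain N where N: "\<And>j s. j \<ge> N \<Longrightarrow> s \<in> {0..t} \<Longrightarrow> \<bar>U j s - u s\<bar> < e"
        using ulim[OF t] e unfolding uniform_limit_iff eventually_sequentially dist_real_def by metis
      have "norm (integral {0..t} (\<Phi> (U j)) - integral {0..t} (\<Phi> u)) < r" if j: "j \<ge> N" for j
      proof -
        have i: "\<Phi> (U j) integrable_on {0..t}" "\<Phi> u integrable_on {0..t}"
          by (intro integrable_continuous_interval continuous_on_subset[OF cont] cU cu; auto)+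
        have "norm (integral {0..t} (\<lambda>s. \<Phi> (U j) s - \<Phi> u s)) \<le> integral {0..t} (\<lambda>s. C * e)"
        proof (rule integral_norm_bound_integral)
          show "(\<lambda>s. \<Phi> (U j) s - \<Phi> u s) integrable_on {0..t}" using i by (rule integrable_diff)
          fix s assume s: "s \<in> {0..t}"
          have "\<bar>\<Phi> (U j) s - \<Phi> u s\<bar> \<le> C * e"
            by (rule CL[OF cU cu s]) (use N[OF j] s in \<open>auto intro: less_imp_le\<close>)
          then show "norm (\<Phi> (U j) s - \<Phi> u s) \<le> C * e" by simp
        qed auto
        also have "\<dots> = t * (C * e)" using t by simp
        also have "\<dots> < r"
        proof -
          have "C * e = r / 2 / (t + 1)" using C by (simp add: e_def)
          then have "t * (C * e) = r / 2 * (t / (t + 1))" by simp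
          also have "\<dots> \<le> r / 2 * 1" using r t by (intro mult_left_mono) auto
          finally show ?thesis using r by simp
        qed
        finally show ?thesis using integral_diff[OF i] by simp
      qed
      then show "\<exists>N. \<forall>j\<ge>N. norm (integral {0..t} (\<Phi> (U j)) - integral {0..t} (\<Phi> u)) < r" by blast
    qed
    then have "(\<lambda>j. U (Suc j) t) \<longlonglongrightarrow> d + integral {0..t} (\<Phi> u)"
      unfolding US by (intro tendsto_intros)
    moreover have "(\<lambda>j. U (Suc j) t) \<longlonglongrightarrow> u t"
      by (rule LIMSEQ_Suc, rule tendsto_uniform_limitI[OF ulim[OF t]]) (use t in auto)
    ultimately show ?thesis by (rule LIMSEQ_unique[symmetric])
  qed
  show ?thesis
  proof (rule that[OF cu])
    show "u 0 = d" using eq[of 0] by simp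
    fix t :: real assume "t \<ge> 0"
    have "(u has_real_derivative \<Phi> u t) (at t within {0..}) \<longleftrightarrow>
       ((\<lambda>t. d + integral {0..t} (\<Phi> u)) has_real_derivative \<Phi> u t) (at t within {0..})"
      by (rule has_field_derivative_cong_eventually)
         (use eq \<open>t \<ge> 0\<close> in \<open>auto simp: eventually_at_filter\<close>)
    then show "(u has_real_derivative \<Phi> u t) (at t within {0..})" using derI[OF cu \<open>t \<ge> 0\<close>] by simp
  qed
qed

text \<open>Gronwall's argument with memory: integrating the bound up to a point where
  \<open>\<bar>\<delta> t\<bar> * exp (- (2 * C * t))\<close> is maximal yields half of the maximum.\<close>

lemma volterra_unique:
  fixes \<delta> :: "real \<Rightarrow> real"
  assumes T: "0 \<le> T" and cont: "continuous_on {0..T} \<delta>" and z: "\<delta> 0 = 0"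
    and der: "\<And>t. t \<in> {0<..<T} \<Longrightarrow> (\<delta> has_real_derivative \<delta>' t) (at t)"
    and bd: "\<And>t e. t \<in> {0<..<T} \<Longrightarrow> (\<And>s. s \<in> {0..t} \<Longrightarrow> \<bar>\<delta> s\<bar> \<le> e) \<Longrightarrow> \<bar>\<delta>' t\<bar> \<le> C * e"
    and C: "C > 0" and t: "t \<in> {0..T}"
  shows "\<delta> t = 0"
proof -
  have "continuous_on {0..T} (\<lambda>t. \<bar>\<delta> t\<bar> * exp (- (2*C*t)))" by (intro continuous_intros cont)
  then obtain t0 where t0: "t0 \<in> {0..T}"
    and max: "\<And>s. s \<in> {0..T} \<Longrightarrow> \<bar>\<delta> s\<bar> * exp (- (2*C* s)) \<le> \<bar>\<delta> t0\<bar> * exp (- (2*C*t0))"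
    using continuous_attains_sup[of "{0..T}" "\<lambda>t. \<bar>\<delta> t\<bar> * exp (- (2*C*t))"] T by auto
  define N where "N = \<bar>\<delta> t0\<bar> * exp (- (2*C*t0))"
  have N0: "N \<ge> 0" by (simp add: N_def)
  have le: "\<bar>\<delta> s\<bar> \<le> N * exp (2*C* s)" if "s \<in> {0..T}" for s
  proof -
    have "\<bar>\<delta> s\<bar> * exp (- (2*C* s)) * exp (2*C* s) \<le> N * exp (2*C* s)"
      using max[OF that] unfolding N_def by (intro mult_right_mono) auto
    then show ?thesis by (simp add: mult.assoc flip: exp_add)
  qed
  have "\<bar>\<delta> t0 - \<delta> 0\<bar> \<le> N / 2 * exp (2*C*t0) - N / 2 * exp (2*C*0)"
  proof (rule increment_le_of_deriv_le[where g' = \<delta>' and \<psi>' = "\<lambda>s. C * (N * exp (2*C* s))"])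
    fix s assume s: "s \<in> {0<..<t0}"
    show "(\<delta> has_real_derivative \<delta>' s) (at s)" using der s t0 by auto
    show "((\<lambda>t. N / 2 * exp (2 * C * t)) has_real_derivative C * (N * exp (2 * C * s))) (at s)"
      by (auto intro!: derivative_eq_intros)
    show "\<bar>\<delta>' s\<bar> \<le> C * (N * exp (2 * C * s))"
    proof (rule bd)
      fix r assume r: "r \<in> {0..s}"
      have "\<bar>\<delta> r\<bar> \<le> N * exp (2*C*r)" using le[of r] r s t0 by auto
      also have "\<dots> \<le> N * exp (2*C* s)" using r C N0 by (intro mult_left_mono) auto
      finally show "\<bar>\<delta> r\<bar> \<le> N * exp (2*C* s)" .
    qed (use s t0 in auto)
  qed (use t0 in \<open>auto intro!: continuous_intros continuous_on_subset[OF cont]\<close>)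
  then have "\<bar>\<delta> t0\<bar> \<le> N / 2 * exp (2*C*t0)" using z N0 by simp
  moreover have "\<bar>\<delta> t0\<bar> = N * exp (2*C*t0)" by (simp add: N_def exp_minus)
  ultimately have "N * exp (2*C*t0) \<le> 0" by simp
  then have "N = 0" using N0 by (simp add: mult_le_0_iff)
  then show ?thesis using le[OF t] by simp
qed

section \<open>The regular singular point\<close>

text \<open>The equation \<open>z * u'' + \<nu> * u' = c * f u\<close> has a regular singular point at \<open>z = 0\<close>. Both the
  regular solutions at \<open>r = 0\<close> and the fast decay solutions at \<open>r = \<infinity>\<close> solve such an equation in a
  suitable variable \<open>z\<close>, so that one existence and one uniqueness statement serve both ends.\<close>

text \<open>If the flux \<open>\<pi>\<close> were larger than claimed at \<open>b\<close>, it would stay beyond some \<open>\<eta> > 0\<close> down to 0,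
  so \<open>\<delta>'\<close> would be at least \<open>\<eta> / t\<close> and \<open>\<delta>\<close> would grow like a logarithm. Boundedness of \<open>\<delta>\<close> is thus
  enough to exclude the singular solutions of the homogeneous equation.\<close>

lemma singular_flux_bound:
  fixes \<delta> \<pi> \<pi>' :: "real \<Rightarrow> real"
  assumes b: "b > 0" and \<nu>: "\<nu> \<ge> 1" and K: "K \<ge> 0"
    and d\<delta>: "\<And>t. t \<in> {0<..b} \<Longrightarrow> (\<delta> has_real_derivative \<pi> t / t powr \<nu>) (at t)"
    and d\<pi>: "\<And>t. t \<in> {0<..b} \<Longrightarrow> (\<pi> has_real_derivative \<pi>' t) (at t)"
    and \<pi>': "\<And>t. t \<in> {0<..b} \<Longrightarrow> \<bar>\<pi>' t\<bar> \<le> K * t powr (\<nu> - 1)"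
    and N: "\<And>t. t \<in> {0<..b} \<Longrightarrow> \<bar>\<delta> t\<bar> \<le> N"
  shows "\<bar>\<pi> b\<bar> \<le> K / \<nu> * b powr \<nu>"
proof -
  have main: "\<sigma> * \<pi> b \<le> K / \<nu> * b powr \<nu>" if \<sigma>: "\<sigma> = 1 \<or> \<sigma> = -1" for \<sigma> :: real
  proof (rule ccontr)
    assume neg: "\<not> \<sigma> * \<pi> b \<le> K / \<nu> * b powr \<nu>"
    define \<eta> where "\<eta> = \<sigma> * \<pi> b - K / \<nu> * b powr \<nu>"
    have \<eta>: "\<eta> > 0" using neg by (simp add: \<eta>_def)
    have abs\<sigma>: "\<bar>\<sigma> * x\<bar> = \<bar>x\<bar>" for x using \<sigma> by auto
    have low: "\<sigma> * \<pi> t \<ge> \<eta>" if t: "t \<in> {0<..b}" for t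
    proof -
      have "\<bar>\<sigma> * \<pi> b - \<sigma> * \<pi> t\<bar> \<le> K / \<nu> * b powr \<nu> - K / \<nu> * t powr \<nu>"
      proof (rule increment_le_of_deriv_le[where g' = "\<lambda>s. \<sigma> * \<pi>' s" and \<psi>' = "\<lambda>s. K * s powr (\<nu> - 1)"])
        show "continuous_on {t..b} (\<lambda>s. \<sigma> * \<pi> s)"
          using DERIV_isCont[OF d\<pi>] t
          by (intro continuous_on_mult_left continuous_at_imp_continuous_on ballI) auto
        show "continuous_on {t..b} (\<lambda>s. K / \<nu> * s powr \<nu>)"
          using t by (intro continuous_intros) auto
        fix s assume s: "s \<in> {t<..<b}"
        show "((\<lambda>s. \<sigma> * \<pi> s) has_real_derivative \<sigma> * \<pi>' s) (at s)"
          using d\<pi>[of s] s t by (auto intro!: derivative_eq_intros)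
        show "((\<lambda>s. K / \<nu> * s powr \<nu>) has_real_derivative K * s powr (\<nu> - 1)) (at s)"
          using s t \<nu> by (auto intro!: derivative_eq_intros)
        show "\<bar>\<sigma> * \<pi>' s\<bar> \<le> K * s powr (\<nu> - 1)" using \<pi>'[of s] s t abs\<sigma> by auto
      qed (use t in auto)
      moreover have "K / \<nu> * t powr \<nu> \<ge> 0" using K \<nu> by auto
      ultimately show ?thesis by (simp add: \<eta>_def)
    qed
    define b' where "b' = min b 1"
    have b': "b' > 0" "b' \<le> b" "b' \<le> 1" using b by (auto simp: b'_def)
    have key: "\<eta> * (ln b' - ln t) \<le> 2 * N" if t: "t \<in> {0<..b'}" for t
    proof -
      have "\<sigma> * \<delta> t - \<eta> * ln t \<le> \<sigma> * \<delta> b' - \<eta> * ln b'"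
      proof (rule DERIV_nonneg_imp_increasing_open[where f = "\<lambda>t. \<sigma> * \<delta> t - \<eta> * ln t"])
        show "t \<le> b'" using t by auto
        have "continuous_on {t..b'} \<delta>"
          using DERIV_isCont[OF d\<delta>] t b' by (intro continuous_at_imp_continuous_on ballI) auto
        then show "continuous_on {t..b'} (\<lambda>t. \<sigma> * \<delta> t - \<eta> * ln t)"
          using t by (intro continuous_intros) auto
        fix s assume s: "t < s" "s < b'"
        have s0: "0 < s" "s \<le> 1" "s \<in> {0<..b}" using s t b' by auto
        have "((\<lambda>t. \<sigma> * \<delta> t - \<eta> * ln t) has_real_derivative \<sigma> * (\<pi> s / s powr \<nu>) - \<eta> / s) (at s)"
          using d\<delta>[OF s0(3)] s0 by (auto intro!: derivative_eq_intros)
        moreover have "\<sigma> * (\<pi> s / s powr \<nu>) \<ge> \<eta> / s"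
        proof -
          have "s powr \<nu> \<le> s powr 1" using s0 \<nu> by (intro powr_mono') auto
          then have "\<eta> / s \<le> \<eta> / s powr \<nu>" using \<eta> s0 by (intro divide_left_mono) auto
          also have "\<dots> \<le> \<sigma> * \<pi> s / s powr \<nu>" using low[OF s0(3)] by (intro divide_right_mono) auto
          finally show ?thesis by simp
        qed
        ultimately show "\<exists>y. DERIV (\<lambda>t. \<sigma> * \<delta> t - \<eta> * ln t) s :> y \<and> y \<ge> 0" by force
      qed
      moreover have "\<bar>\<sigma> * \<delta> t\<bar> \<le> N" "\<bar>\<sigma> * \<delta> b'\<bar> \<le> N" using N[of t] N[of b'] t b' abs\<sigma> by auto
      ultimately show ?thesis by (simp add: algebra_simps)
    qed
    have N0: "N \<ge> 0" using N[of b] b abs_ge_zero[of "\<delta> b"] by force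
    \<comment> \<open>so close to 0 that the logarithmic growth exceeds the bound \<open>2 * N\<close>\<close>
    define t where "t = b' * exp (- ((2 * N + 1) / \<eta>))"
    have "exp (- ((2 * N + 1) / \<eta>)) \<le> 1" using N0 \<eta> by simp
    then have "t \<le> b' * 1" unfolding t_def using b' by (intro mult_left_mono) auto
    then have "\<eta> * (ln b' - ln t) \<le> 2 * N" using b' by (intro key) (auto simp: t_def)
    moreover have "ln t = ln b' - (2 * N + 1) / \<eta>" using b' by (simp add: t_def ln_mult)
    ultimately show False using \<eta> by simp
  qed
  show ?thesis using main[of 1] main[of "-1"] by (auto simp: abs_if)
qed

text \<open>Only the limit of the solution at 0 is prescribed; \<open>singular_flux_bound\<close> controls the difference
  of the derivatives by the past of the difference, as in \<open>volterra_unique\<close>.\<close>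

lemma singular_ivp_unique:
  fixes u1 u2 p1 p2 f :: "real \<Rightarrow> real"
  assumes \<nu>: "\<nu> \<ge> 1"
    and lip: "\<And>M. \<exists>G\<ge>0. \<forall>x\<in>{-M..M}. \<forall>y\<in>{-M..M}. \<bar>f x - f y\<bar> \<le> G * \<bar>x - y\<bar>"
    and u1: "\<And>t. t \<in> {0<..<Z} \<Longrightarrow> (u1 has_real_derivative p1 t) (at t)"
    and p1: "\<And>t. t \<in> {0<..<Z} \<Longrightarrow> (p1 has_real_derivative (c * f (u1 t) - \<nu> * p1 t) / t) (at t)"
    and u2: "\<And>t. t \<in> {0<..<Z} \<Longrightarrow> (u2 has_real_derivative p2 t) (at t)"
    and p2: "\<And>t. t \<in> {0<..<Z} \<Longrightarrow> (p2 has_real_derivative (c * f (u2 t) - \<nu> * p2 t) / t) (at t)"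
    and l1: "(u1 \<longlongrightarrow> d) (at_right 0)" and l2: "(u2 \<longlongrightarrow> d) (at_right 0)"
    and t: "t \<in> {0<..<Z}"
  shows "u1 t = u2 t"
proof -
  define v1 where "v1 = (\<lambda>s. if s = 0 then d else u1 s)"
  define v2 where "v2 = (\<lambda>s. if s = 0 then d else u2 s)"
  have cont: "continuous_on {0..t} (\<lambda>s. if s = 0 then d else u s)"
    if der: "\<And>t. t \<in> {0<..<Z} \<Longrightarrow> (u has_real_derivative p t) (at t)" and l: "(u \<longlongrightarrow> d) (at_right 0)"
    for u p :: "real \<Rightarrow> real"
    unfolding continuous_on_eq_continuous_within
  proof
    fix s assume s: "s \<in> {0..t}"
    show "continuous (at s within {0..t}) (\<lambda>s. if s = 0 then d else u s)"
    proof (cases "s = 0")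
      case True
      have "(u \<longlongrightarrow> d) (at 0 within {0..t})"
        using l t by (simp add: at_within_Icc_at_right)
      then have "((\<lambda>s. if s = 0 then d else u s) \<longlongrightarrow> d) (at 0 within {0..t})"
        by (rule Lim_transform_eventually) (auto simp: eventually_at_filter)
      then show ?thesis using True by (simp add: continuous_within)
    next
      case False
      then have "isCont u s" using der[of s] s t by (intro DERIV_isCont) auto
      moreover have "eventually (\<lambda>r. r \<noteq> 0) (nhds s)" using False by (rule t1_space_nhds)
      then have "eventually (\<lambda>r. (if r = 0 then d else u r) = u r) (nhds s)"
        by eventually_elim auto
      ultimately have "isCont (\<lambda>s. if s = 0 then d else u s) s"
        using isCont_cong by fastforce
      then show ?thesis by (rule continuous_at_imp_continuous_within)
    qed
  qed
  have c1: "continuous_on {0..t} v1" unfolding v1_def by (rule cont[OF u1 l1])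
  have c2: "continuous_on {0..t} v2" unfolding v2_def by (rule cont[OF u2 l2])
  have "bounded (v1 ` {0..t})" "bounded (v2 ` {0..t})"
    using c1 c2 by (auto intro!: compact_imp_bounded compact_continuous_image)
  then obtain M1 M2 where M: "\<And>s. s \<in> {0..t} \<Longrightarrow> \<bar>v1 s\<bar> \<le> M1" "\<And>s. s \<in> {0..t} \<Longrightarrow> \<bar>v2 s\<bar> \<le> M2"
    unfolding bounded_iff by (metis image_eqI real_norm_def)
  define M where "M = max M1 M2"
  obtain G where G: "G \<ge> 0" "\<forall>x\<in>{-M..M}. \<forall>y\<in>{-M..M}. \<bar>f x - f y\<bar> \<le> G * \<bar>x - y\<bar>"
    using lip by blast
  have u1M: "u1 s \<in> {-M..M}" and u2M: "u2 s \<in> {-M..M}" if "s \<in> {0<..t}" for s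
    using M(1)[of s] M(2)[of s] that by (auto simp: M_def v1_def v2_def abs_le_iff)
  define \<delta> where "\<delta> = (\<lambda>s. v1 s - v2 s)"
  have bd\<delta>: "\<bar>\<delta> s\<bar> \<le> 2 * M" if "s \<in> {0<..t}" for s
    using u1M[OF that] u2M[OF that] that by (auto simp: \<delta>_def v1_def v2_def)
  have d\<delta>: "(\<delta> has_real_derivative p1 s - p2 s) (at s)" if s: "s \<in> {0<..<Z}" for s
  proof -
    have "((\<lambda>s. u1 s - u2 s) has_real_derivative p1 s - p2 s) (at s)"
      using u1 u2 s by (intro DERIV_diff) auto
    moreover have "eventually (\<lambda>r. r \<noteq> 0) (nhds s)" using s by (intro t1_space_nhds) auto
    then have "eventually (\<lambda>r. \<delta> r = u1 r - u2 r) (nhds s)"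
      by eventually_elim (auto simp: \<delta>_def v1_def v2_def)
    ultimately show ?thesis by (subst DERIV_cong_ev[OF refl _ refl]) auto
  qed
  have "\<delta> t = 0"
  proof (rule volterra_unique[where \<delta> = \<delta> and T = t and \<delta>' = "\<lambda>s. p1 s - p2 s" and C = "\<bar>c\<bar> * G / \<nu> + 1"])
    show "continuous_on {0..t} \<delta>" unfolding \<delta>_def using c1 c2 by (intro continuous_intros)
    show "\<delta> 0 = 0" by (simp add: \<delta>_def v1_def v2_def)
    show "\<bar>c\<bar> * G / \<nu> + 1 > 0" using G \<nu> by (simp add: add_nonneg_pos)
    fix s assume s: "s \<in> {0<..<t}"
    show "(\<delta> has_real_derivative p1 s - p2 s) (at s)" using d\<delta> s t by auto
    fix e assume e: "\<And>r. r \<in> {0..s} \<Longrightarrow> \<bar>\<delta> r\<bar> \<le> e"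
    have e0: "e \<ge> 0" using e[of s] s abs_ge_zero[of "\<delta> s"] by force
    have "\<bar>s powr \<nu> * (p1 s - p2 s)\<bar> \<le> (\<bar>c\<bar> * G * e) / \<nu> * s powr \<nu>"
    proof (rule singular_flux_bound[where \<delta> = \<delta> and N = "2*M" and \<pi> = "\<lambda>s. s powr \<nu> * (p1 s - p2 s)"
        and \<pi>' = "\<lambda>s. c * (f (u1 s) - f (u2 s)) * s powr (\<nu> - 1)"])
      fix r assume r: "r \<in> {0<..s}"
      then have r': "r \<in> {0<..<Z}" "r \<in> {0<..t}" "r > 0" using s t by auto
      show "(\<delta> has_real_derivative r powr \<nu> * (p1 r - p2 r) / r powr \<nu>) (at r)"
        using d\<delta>[OF r'(1)] r' by simp
      have "((\<lambda>s. s powr \<nu> * (p1 s - p2 s)) has_real_derivative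
          (\<nu> * r powr (\<nu> - 1)) * (p1 r - p2 r) + ((c * f (u1 r) - \<nu> * p1 r) / r - (c * f (u2 r) - \<nu> * p2 r) / r) * r powr \<nu>) (at r)"
        using r' by (intro DERIV_mult DERIV_diff p1 p2 has_real_derivative_powr) auto
      moreover have "(\<nu> * r powr (\<nu> - 1)) * (p1 r - p2 r) + ((c * f (u1 r) - \<nu> * p1 r) / r - (c * f (u2 r) - \<nu> * p2 r) / r) * r powr \<nu>
         = c * (f (u1 r) - f (u2 r)) * r powr (\<nu> - 1)"
      proof -
        have "r powr \<nu> = r * r powr (\<nu> - 1)" using r' by (simp add: powr_diff)
        then show ?thesis using r' by (simp add: field_simps)
      qed
      ultimately show "((\<lambda>s. s powr \<nu> * (p1 s - p2 s)) has_real_derivative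
        c * (f (u1 r) - f (u2 r)) * r powr (\<nu> - 1)) (at r)" by simp
      have "\<bar>f (u1 r) - f (u2 r)\<bar> \<le> G * \<bar>u1 r - u2 r\<bar>" using G u1M u2M r' by blast
      also have "\<dots> \<le> G * e" using e[of r] r G r' by (intro mult_left_mono) (auto simp: \<delta>_def v1_def v2_def)
      finally have "\<bar>c\<bar> * \<bar>f (u1 r) - f (u2 r)\<bar> * r powr (\<nu> - 1) \<le> \<bar>c\<bar> * (G * e) * r powr (\<nu> - 1)"
        by (intro mult_left_mono mult_right_mono) auto
      then show "\<bar>c * (f (u1 r) - f (u2 r)) * r powr (\<nu> - 1)\<bar> \<le> \<bar>c\<bar> * G * e * r powr (\<nu> - 1)"
        by (simp add: abs_mult mult.assoc)
      show "\<bar>\<delta> r\<bar> \<le> 2 * M" using bd\<delta> r' by auto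
    qed (use s \<nu> G e0 in auto)
    then have "\<bar>p1 s - p2 s\<bar> * s powr \<nu> \<le> (\<bar>c\<bar> * G * e) / \<nu> * s powr \<nu>"
      by (simp add: abs_mult mult_ac)
    then have "\<bar>p1 s - p2 s\<bar> \<le> (\<bar>c\<bar> * G * e) / \<nu>" using s by (subst (asm) mult_le_cancel_right) auto
    also have "\<dots> \<le> (\<bar>c\<bar> * G / \<nu> + 1) * e" using e0 by (simp add: algebra_simps)
    finally show "\<bar>p1 s - p2 s\<bar> \<le> (\<bar>c\<bar> * G / \<nu> + 1) * e" .
  qed (use t in auto)
  then show ?thesis using t by (simp add: \<delta>_def v1_def v2_def)
qed

text \<open>Integrating \<open>(t powr \<nu> * u')' = c * t powr (\<nu> - 1) * g u\<close> and rescaling the integral to the unit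
  interval gives \<open>u' t = c * integral {0..1} (\<lambda>\<theta>. \<theta> powr (\<nu> - 1) * g (u (\<theta> * t)))\<close>, where
  the singularity has disappeared. The global Lipschitz condition is met by truncating the power;
  an a priori bound then shows that the truncation is never felt.\<close>

lemma singular_ivp_exists:
  fixes g :: "real \<Rightarrow> real"
  assumes \<nu>: "\<nu> > 1" and G: "G \<ge> 0" and lip: "\<And>x y. \<bar>g x - g y\<bar> \<le> G * \<bar>x - y\<bar>"
  obtains u p where "u 0 = d" "continuous_on {0..} p"
    "\<And>t. t \<ge> 0 \<Longrightarrow> (u has_real_derivative p t) (at t within {0..})"
    "\<And>t. t > 0 \<Longrightarrow> (p has_real_derivative (c * g (u t) - \<nu> * p t) / t) (at t)"
proof -
  define \<Phi> where "\<Phi> = (\<lambda>u t. c * integral {0..1} (\<lambda>\<theta>. \<theta> powr (\<nu> - 1) * g (u (\<theta> * t))))"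
  have cg: "continuous_on S g" for S
  proof (rule lipschitz_on_continuous_on)
    show "G-lipschitz_on S g" using G lip by (auto simp: lipschitz_on_def dist_real_def)
  qed
  have cpow: "continuous_on {0..} (\<lambda>\<theta>::real. \<theta> powr (\<nu> - 1))"
    using \<nu> by (intro continuous_on_powr' continuous_intros) auto
  have c2: "continuous_on ({0..} \<times> cbox 0 1) (\<lambda>(t, \<theta>). \<theta> powr (\<nu> - 1) * g (u (\<theta> * t)))"
    if "continuous_on {0..} u" for u
    unfolding split_beta
    by (intro continuous_on_mult continuous_on_compose2[OF cpow] continuous_on_compose2[OF cg]
        continuous_on_compose2[OF that] continuous_intros) auto
  have c\<Phi>: "continuous_on {0..} (\<Phi> u)" if "continuous_on {0..} u" for u
    using integral_continuous_on_param[OF c2[OF that]] unfolding \<Phi>_def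
    by (intro continuous_on_mult_left) (simp add: cbox_interval)
  have ig: "(\<lambda>\<theta>. \<theta> powr (\<nu> - 1) * g (u (\<theta> * t))) integrable_on {0..1}" if "continuous_on {0..} u" "t \<ge> 0" for u t
    by (intro integrable_continuous_interval continuous_on_mult continuous_on_compose2[OF cpow]
        continuous_on_compose2[OF cg] continuous_on_compose2[OF that(1)] continuous_intros)
       (use that in auto)
  obtain u where u: "continuous_on {0..} u" "u 0 = d"
    "\<And>t. t \<ge> 0 \<Longrightarrow> (u has_real_derivative \<Phi> u t) (at t within {0..})"
  proof (rule volterra_exists[where \<Phi> = \<Phi> and d = d, OF c\<Phi>])
    fix T :: real
    have est: "\<bar>\<Phi> u t - \<Phi> v t\<bar> \<le> (\<bar>c\<bar> * G + 1) * e"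
      if uv: "continuous_on {0..} u" "continuous_on {0..} v" "t \<in> {0..T}" "\<forall>s\<in>{0..t}. \<bar>u s - v s\<bar> \<le> e" for u v t e
    proof -
      have e0: "e \<ge> 0" using uv(3) uv(4)[rule_format, of t] abs_ge_zero[of "u t - v t"] by force
      have i: "(\<lambda>\<theta>. \<theta> powr (\<nu> - 1) * g (u (\<theta> * t))) integrable_on {0..1}"
        "(\<lambda>\<theta>. \<theta> powr (\<nu> - 1) * g (v (\<theta> * t))) integrable_on {0..1}"
        using ig uv by auto
      have "norm (integral {0..1} (\<lambda>\<theta>. \<theta> powr (\<nu> - 1) * g (u (\<theta> * t)) - \<theta> powr (\<nu> - 1) * g (v (\<theta> * t))))
         \<le> integral {0..1} (\<lambda>\<theta>::real. G * e)"
      proof (rule integral_norm_bound_integral)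
        fix \<theta> :: real assume \<theta>: "\<theta> \<in> {0..1}"
        have "\<theta> * t \<le> 1 * t" using \<theta> uv(3) by (intro mult_right_mono) auto
        then have "\<theta> * t \<in> {0..t}" using \<theta> uv(3) by auto
        then have "\<bar>u (\<theta> * t) - v (\<theta> * t)\<bar> \<le> e" using uv(4) by blast
        then have "\<bar>g (u (\<theta> * t)) - g (v (\<theta> * t))\<bar> \<le> G * e"
          using lip[of "u (\<theta> * t)" "v (\<theta> * t)"] G by (meson mult_left_mono order_trans)
        moreover have "\<theta> powr (\<nu> - 1) \<le> 1" using \<theta> \<nu> by (intro powr_le1) auto
        ultimately have "\<theta> powr (\<nu> - 1) * \<bar>g (u (\<theta> * t)) - g (v (\<theta> * t))\<bar> \<le> 1 * (G * e)"
          by (intro mult_mono) auto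
        then show "norm (\<theta> powr (\<nu> - 1) * g (u (\<theta> * t)) - \<theta> powr (\<nu> - 1) * g (v (\<theta> * t))) \<le> G * e"
          by (simp add: right_diff_distrib[symmetric] abs_mult)
      qed (use i in \<open>auto intro: integrable_diff\<close>)
      then have "\<bar>integral {0..1} (\<lambda>\<theta>. \<theta> powr (\<nu> - 1) * g (u (\<theta> * t)))
          - integral {0..1} (\<lambda>\<theta>. \<theta> powr (\<nu> - 1) * g (v (\<theta> * t)))\<bar> \<le> G * e"
        unfolding integral_diff[OF i] by simp
      then have "\<bar>\<Phi> u t - \<Phi> v t\<bar> \<le> \<bar>c\<bar> * (G * e)"
        unfolding \<Phi>_def right_diff_distrib[symmetric] abs_mult by (intro mult_left_mono) auto
      also have "\<dots> \<le> (\<bar>c\<bar> * G + 1) * e" using e0 by (simp add: algebra_simps)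
      finally show ?thesis .
    qed
    show "\<exists>C>0. \<forall>u v t e. continuous_on {0..} u \<longrightarrow> continuous_on {0..} v \<longrightarrow>
        t \<in> {0..T} \<longrightarrow> (\<forall>s\<in>{0..t}. \<bar>u s - v s\<bar> \<le> e) \<longrightarrow> \<bar>\<Phi> u t - \<Phi> v t\<bar> \<le> C * e"
      using est G by (intro exI[of _ "\<bar>c\<bar> * G + 1"]) (auto simp: add_nonneg_pos)
  qed auto
  have flux: "\<Phi> u t = c * (t powr (- \<nu>) * integral {0..t} (\<lambda>s. s powr (\<nu> - 1) * g (u s)))" if t: "t > 0" for t
  proof -
    have "(\<lambda>s. s powr (\<nu> - 1) * g (u s)) integrable_on {0..t}"
      by (intro integrable_continuous_interval continuous_on_mult continuous_on_subset[OF cpow]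
          continuous_on_compose2[OF cg] continuous_on_subset[OF u(1)]) auto
    then have "((\<lambda>s. s powr (\<nu> - 1) * g (u s)) has_integral integral {0..t} (\<lambda>s. s powr (\<nu> - 1) * g (u s))) {0..t}"
      by (rule integrable_integral)
    from has_integral_stretch_real[OF this, of t]
    have "((\<lambda>\<theta>. (t * \<theta>) powr (\<nu> - 1) * g (u (t * \<theta>))) has_integral
        (1 / t) * integral {0..t} (\<lambda>s. s powr (\<nu> - 1) * g (u s))) ((\<lambda>x. x / t) ` {0..t})"
      using t by simp
    moreover have "(\<lambda>x. x / t) ` {0..t} = {0..1}"
      using t by (auto simp: image_iff intro!: bexI[of _ "_ * t"])
    ultimately have "((\<lambda>\<theta>. t powr (1 - \<nu>) * ((t * \<theta>) powr (\<nu> - 1) * g (u (t * \<theta>)))) has_integral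
        t powr (1 - \<nu>) * ((1 / t) * integral {0..t} (\<lambda>s. s powr (\<nu> - 1) * g (u s)))) {0..1}"
      by (intro has_integral_mult_right) auto
    moreover have "t powr (1 - \<nu>) * ((t * \<theta>) powr (\<nu> - 1) * g (u (t * \<theta>))) = \<theta> powr (\<nu> - 1) * g (u (\<theta> * t))"
      if "\<theta> \<in> {0..1}" for \<theta>
    proof -
      have "t powr (1 - \<nu>) * t powr (\<nu> - 1) = 1" using t by (simp flip: powr_add)
      then show ?thesis using t that by (simp add: powr_mult mult.commute[of t] mult.assoc[symmetric])
    qed
    ultimately have "((\<lambda>\<theta>. \<theta> powr (\<nu> - 1) * g (u (\<theta> * t))) has_integral
        t powr (1 - \<nu>) * ((1 / t) * integral {0..t} (\<lambda>s. s powr (\<nu> - 1) * g (u s)))) {0..1}"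
      using has_integral_cong[of "{0..1}"] by (metis (no_types, lifting))
    then have "integral {0..1} (\<lambda>\<theta>. \<theta> powr (\<nu> - 1) * g (u (\<theta> * t))) =
      t powr (1 - \<nu>) * ((1 / t) * integral {0..t} (\<lambda>s. s powr (\<nu> - 1) * g (u s)))"
      by (rule integral_unique)
    also have "t powr (1 - \<nu>) = t * t powr (- \<nu>)" using t by (simp add: powr_diff powr_minus field_simps)
    finally show ?thesis using t by (simp add: \<Phi>_def)
  qed
  have dp: "(\<Phi> u has_real_derivative (c * g (u t) - \<nu> * \<Phi> u t) / t) (at t)" if t: "t > 0" for t
  proof -
    define I where "I = (\<lambda>t. integral {0..t} (\<lambda>s. s powr (\<nu> - 1) * g (u s)))"
    have dI: "(I has_real_derivative t powr (\<nu> - 1) * g (u t)) (at t)"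
      unfolding I_def
      by (rule has_real_derivative_within_atLeast_at[OF integral_deriv_atLeast])
         (use t in \<open>auto intro!: continuous_on_mult continuous_on_subset[OF cpow]
          continuous_on_compose2[OF cg] continuous_on_subset[OF u(1)]\<close>)
    have "((\<lambda>t. c * (t powr (- \<nu>) * I t)) has_real_derivative
       c * ((- \<nu> * t powr (- \<nu> - 1)) * I t + t powr (\<nu> - 1) * g (u t) * t powr (- \<nu>))) (at t)"
      using t by (intro DERIV_cmult DERIV_mult dI has_real_derivative_powr)
    moreover have "c * ((- \<nu> * t powr (- \<nu> - 1)) * I t + t powr (\<nu> - 1) * g (u t) * t powr (- \<nu>))
       = (c * g (u t) - \<nu> * \<Phi> u t) / t"
    proof -
      define P where "P = t powr (- \<nu>)"
      have e1: "t powr (- \<nu> - 1) = P / t" using t by (simp add: P_def powr_diff)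
      have "t powr (\<nu> - 1) * P = t powr (-1)" unfolding P_def powr_add[symmetric] by simp
      then have e2: "t powr (\<nu> - 1) * g (u t) * P = g (u t) / t"
        using t by (simp add: powr_minus_divide mult.commute[of _ P] mult.assoc[symmetric])
      have e3: "\<Phi> u t = c * (P * I t)" using flux[OF t] by (simp add: I_def P_def)
      show ?thesis unfolding e1 P_def[symmetric] e2 e3 using t by (simp add: field_simps)
    qed
    ultimately have "((\<lambda>t. c * (t powr (- \<nu>) * I t)) has_real_derivative (c * g (u t) - \<nu> * \<Phi> u t) / t) (at t)"
      by simp
    moreover have "eventually (\<lambda>s. \<Phi> u s = c * (s powr (- \<nu>) * I s)) (nhds t)"
      by (rule eventually_nhds_openI[of "{0<..}"]) (use flux t in \<open>auto simp: I_def\<close>)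
    ultimately show ?thesis by (subst DERIV_cong_ev[OF refl _ refl]) auto
  qed
  show ?thesis by (rule that[OF u(2) c\<Phi>[OF u(1)] u(3) dp])
qed

section \<open>The power nonlinearity\<close>

definition nonlin :: "real \<Rightarrow> real \<Rightarrow> real" where
  "nonlin q x = x * \<bar>x\<bar> powr (q - 2)"

lemma nonlin_0 [simp]: "nonlin q 0 = 0"
  by (simp add: nonlin_def)

lemma nonlin_minus [simp]: "nonlin q (- x) = - nonlin q x"
  by (simp add: nonlin_def)

lemma nonlin_pos: "x > 0 \<Longrightarrow> nonlin q x = x powr (q - 1)"
  by (simp add: nonlin_def powr_diff power2_eq_square)

lemma nonlin_pos_iff: "nonlin q x > 0 \<longleftrightarrow> x > 0"
  by (auto simp: nonlin_def zero_less_mult_iff)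

lemma nonlin_mult: "a > 0 \<Longrightarrow> nonlin q (a * x) = a powr (q - 1) * nonlin q x"
  by (simp add: nonlin_def powr_mult abs_mult powr_diff power2_eq_square)

lemma tendsto_abs_powr_zero:
  assumes "p > 0"
  shows "((\<lambda>h::real. \<bar>h\<bar> powr p) \<longlongrightarrow> 0) (at 0)"
  using tendsto_powr'[OF tendsto_rabs_zero[OF tendsto_ident_at[of 0 UNIV]] tendsto_const[of p]] assms
  by simp

lemma powr_abs_deriv_ge2:
  fixes p :: real assumes p: "p > 1"
  shows "((\<lambda>x. \<bar>x\<bar> powr p / p) has_real_derivative x * \<bar>x\<bar> powr (p - 2)) (at x)"
proof -
  consider "x > 0" | "x < 0" | "x = 0" by linarith
  then show ?thesis
  proof cases
    case 1
    have "((\<lambda>x. x powr p / p) has_real_derivative x * \<bar>x\<bar> powr (p - 2)) (at x)"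
      using 1 p by (auto intro!: derivative_eq_intros simp: powr_diff power2_eq_square)
    moreover have "eventually (\<lambda>y. \<bar>y\<bar> powr p / p = y powr p / p) (nhds x)"
      by (rule eventually_nhds_openI[of "{0<..}"]) (use 1 in auto)
    ultimately show ?thesis by (subst DERIV_cong_ev[OF refl _ refl]) auto
  next
    case 2
    have "((\<lambda>x. (-x) powr p / p) has_real_derivative p * (-x) powr (p - 1) * (-1) / p) (at x)"
      by (intro DERIV_cdivide DERIV_chain2[OF has_real_derivative_powr DERIV_minus[OF DERIV_ident]])
         (use 2 in auto)
    moreover have "p * (-x) powr (p - 1) * (-1) / p = x * \<bar>x\<bar> powr (p - 2)"
      using 2 p by (simp add: powr_diff power2_eq_square)
    ultimately have "((\<lambda>x. (-x) powr p / p) has_real_derivative x * \<bar>x\<bar> powr (p - 2)) (at x)"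
      by simp
    moreover have "eventually (\<lambda>y. \<bar>y\<bar> powr p / p = (-y) powr p / p) (nhds x)"
      by (rule eventually_nhds_openI[of "{..<0}"]) (use 2 in auto)
    ultimately show ?thesis by (subst DERIV_cong_ev[OF refl _ refl]) auto
  next
    case 3
    have "((\<lambda>h. \<bar>h\<bar> powr (p - 1) / p) \<longlongrightarrow> 0) (at (0::real))"
      using tendsto_divide[OF tendsto_abs_powr_zero[of "p - 1"] tendsto_const[of p]] p by simp
    then have "((\<lambda>h. norm ((\<bar>h\<bar> powr p / p) / h)) \<longlongrightarrow> 0) (at (0::real))"
      by (rule Lim_transform_eventually)
         (use p in \<open>auto simp: eventually_at_filter powr_diff abs_mult\<close>)
    then have "((\<lambda>h. (\<bar>h\<bar> powr p / p) / h) \<longlongrightarrow> 0) (at (0::real))"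
      by (rule tendsto_norm_zero_cancel)
    then show ?thesis using 3 by (simp add: DERIV_def)
  qed
qed

lemma nonlin_deriv:
  assumes q: "q > 2"
  shows "(nonlin q has_real_derivative (q - 1) * \<bar>x\<bar> powr (q - 2)) (at x)"
proof -
  consider "x > 0" | "x < 0" | "x = 0" by linarith
  then show ?thesis
  proof cases
    case 1
    have "((\<lambda>x. x powr (q - 1)) has_real_derivative (q - 1) * \<bar>x\<bar> powr (q - 2)) (at x)"
      using 1 q by (auto intro!: derivative_eq_intros)
    moreover have "eventually (\<lambda>y. nonlin q y = y powr (q - 1)) (nhds x)"
      by (rule eventually_nhds_openI[of "{0<..}"]) (use 1 in \<open>auto simp: nonlin_pos\<close>)
    ultimately show ?thesis by (subst DERIV_cong_ev[OF refl _ refl]) auto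
  next
    case 2
    have "((\<lambda>x. - ((-x) powr (q - 1))) has_real_derivative (q - 1) * \<bar>x\<bar> powr (q - 2)) (at x)"
      using 2 q by (auto intro!: derivative_eq_intros)
    moreover have "eventually (\<lambda>y. nonlin q y = - ((-y) powr (q - 1))) (nhds x)"
      by (rule eventually_nhds_openI[of "{..<0}"])
         (use 2 in \<open>auto simp: nonlin_def abs_if powr_diff power2_eq_square\<close>)
    ultimately show ?thesis by (subst DERIV_cong_ev[OF refl _ refl]) auto
  next
    case 3
    have "((\<lambda>h. nonlin q h / h) \<longlongrightarrow> 0) (at (0::real))"
      by (rule Lim_transform_eventually[OF tendsto_abs_powr_zero[of "q - 2"]])
         (use q in \<open>auto simp: eventually_at_filter nonlin_def\<close>)
    then show ?thesis using 3 q by (simp add: DERIV_def)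
  qed
qed

lemma isCont_nonlin: "q > 2 \<Longrightarrow> isCont (nonlin q) x"
  by (rule DERIV_isCont[OF nonlin_deriv])

lemma continuous_on_nonlin [continuous_intros]:
  "q > 2 \<Longrightarrow> continuous_on S g \<Longrightarrow> continuous_on S (\<lambda>x. nonlin q (g x))"
  by (rule continuous_on_compose2[of UNIV "nonlin q" S g])
     (auto intro!: continuous_at_imp_continuous_on isCont_nonlin)

lemma nonlin_lipschitz:
  assumes q: "q > 2" and M: "M \<ge> 0" and x: "x \<in> {-M..M}" and y: "y \<in> {-M..M}"
  shows "\<bar>nonlin q x - nonlin q y\<bar> \<le> (q - 1) * M powr (q - 2) * \<bar>x - y\<bar>"
proof -
  have "norm (nonlin q y - nonlin q x) \<le> (q - 1) * M powr (q - 2) * norm (y - x)"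
  proof (rule field_differentiable_bound[where S = "{-M..M}" and f' = "\<lambda>x. (q - 1) * \<bar>x\<bar> powr (q - 2)"])
    fix z assume z: "z \<in> {-M..M}"
    show "(nonlin q has_field_derivative (q - 1) * \<bar>z\<bar> powr (q - 2)) (at z within {-M..M})"
      using nonlin_deriv[OF q] has_field_derivative_at_within by blast
    show "norm ((q - 1) * \<bar>z\<bar> powr (q - 2)) \<le> (q - 1) * M powr (q - 2)"
      using q z by (auto simp: abs_mult intro!: mult_left_mono powr_mono2)
  qed (use x y in auto)
  then show ?thesis by (simp add: abs_minus_commute)
qed

lemma nonlin_mono:
  assumes q: "q > 2" and "x \<le> y" shows "nonlin q x \<le> nonlin q y"
  by (rule DERIV_nonneg_imp_nondecreasing[OF assms(2)])
     (use nonlin_deriv[OF q] q in \<open>force intro!: mult_nonneg_nonneg\<close>)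

definition clamp_real :: "real \<Rightarrow> real \<Rightarrow> real \<Rightarrow> real" where
  "clamp_real a b x = max a (min b x)"

lemma clamp_nonlin_lipschitz:
  assumes q: "q > 2" and ab: "-M \<le> a" "a \<le> b" "b \<le> M"
  shows "\<bar>nonlin q (clamp_real a b x) - nonlin q (clamp_real a b y)\<bar> \<le> (q - 1) * M powr (q - 2) * \<bar>x - y\<bar>"
proof -
  have "\<bar>nonlin q (clamp_real a b x) - nonlin q (clamp_real a b y)\<bar>
      \<le> (q - 1) * M powr (q - 2) * \<bar>clamp_real a b x - clamp_real a b y\<bar>"
    by (rule nonlin_lipschitz[OF q]) (use ab in \<open>auto simp: clamp_real_def\<close>)
  also have "\<dots> \<le> (q - 1) * M powr (q - 2) * \<bar>x - y\<bar>"
    using q by (intro mult_left_mono) (auto simp: clamp_real_def)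
  finally show ?thesis .
qed

lemma clamp_real_id: "x \<in> {a..b} \<Longrightarrow> clamp_real a b x = x"
  by (auto simp: clamp_real_def)

section \<open>The inner system in Emden--Fowler coordinates\<close>

text \<open>The inner system. For \<open>n = \<alpha> + \<mu> + 2\<close> and constant weight \<open>K\<close> the radial equation for
  \<open>u r = r powr (- \<alpha>) * x (ln r)\<close> reads \<open>x' = y\<close>, \<open>y' = A * y + B * x - K * nonlin q x\<close>; the relation
  between \<open>\<alpha>\<close> and \<open>q\<close> makes the powers of \<open>r\<close> cancel. The sign of \<open>A\<close>, that is, \<open>q\<close> being subcritical,
  makes the energy increase.\<close>

locale emden =
  fixes q \<alpha> \<mu> K :: real
  assumes q2: "q > 2" and \<alpha>q: "\<alpha> * (q - 2) = 2" and \<mu>0: "0 < \<mu>" and \<mu>\<alpha>: "\<mu> < \<alpha>" and K0: "K > 0"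
begin

definition "A = \<alpha> - \<mu>"
definition "B = \<alpha> * \<mu>"

lemma \<alpha>0: "\<alpha> > 0" and A0: "A > 0" and B0: "B > 0"
  using \<mu>0 \<mu>\<alpha> by (auto simp: A_def B_def)

definition pot :: "real \<Rightarrow> real" where
  "pot x = K * \<bar>x\<bar> powr q / q - B * x\<^sup>2 / 2"

definition sol :: "(real \<Rightarrow> real) \<Rightarrow> (real \<Rightarrow> real) \<Rightarrow> real set \<Rightarrow> bool" where
  "sol x y I \<longleftrightarrow> (\<forall>t\<in>I. (x has_real_derivative y t) (at t within I) \<and>
     (y has_real_derivative A * y t + B * x t - K * nonlin q (x t)) (at t within I))"

definition energy :: "(real \<Rightarrow> real) \<Rightarrow> (real \<Rightarrow> real) \<Rightarrow> real \<Rightarrow> real" where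
  "energy x y t = (y t)\<^sup>2 / 2 + pot (x t)"

lemma pot_minus [simp]: "pot (- x) = pot x"
  by (simp add: pot_def)

lemma pot_0 [simp]: "pot 0 = 0"
  by (simp add: pot_def)

lemma pot_deriv: "(pot has_real_derivative K * nonlin q x - B * x) (at x)"
proof -
  have "((\<lambda>x. K * (\<bar>x\<bar> powr q / q) - B * x\<^sup>2 / 2) has_real_derivative K * (x * \<bar>x\<bar> powr (q - 2)) - B * x) (at x)"
    by (rule DERIV_diff DERIV_cmult powr_abs_deriv_ge2)+ (use q2 in \<open>auto intro!: derivative_eq_intros\<close>)
  then show ?thesis by (simp add: pot_def[abs_def] nonlin_def)
qed

lemma isCont_pot: "isCont pot x"
  by (rule DERIV_isCont[OF pot_deriv])

lemma continuous_on_pot [continuous_intros]: "continuous_on S g \<Longrightarrow> continuous_on S (\<lambda>x. pot (g x))"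
  by (rule continuous_on_compose2[of UNIV pot S g]) (auto intro!: continuous_at_imp_continuous_on isCont_pot)

lemma sol_subset: "sol x y I \<Longrightarrow> J \<subseteq> I \<Longrightarrow> sol x y J"
  unfolding sol_def by (meson has_field_derivative_subset subset_eq)

lemma sol_minus: "sol x y I \<Longrightarrow> sol (\<lambda>t. - x t) (\<lambda>t. - y t) I"
  unfolding sol_def by (auto intro!: derivative_eq_intros)

lemma energy_minus [simp]: "energy (\<lambda>t. - x t) (\<lambda>t. - y t) = energy x y"
  by (rule ext) (simp add: energy_def)

lemma sol_x: "sol x y I \<Longrightarrow> t \<in> I \<Longrightarrow> (x has_real_derivative y t) (at t within I)"
  and sol_y: "sol x y I \<Longrightarrow> t \<in> I \<Longrightarrow>
     (y has_real_derivative A * y t + B * x t - K * nonlin q (x t)) (at t within I)"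
  by (auto simp: sol_def)

lemma sol_cont: assumes "sol x y I" shows "continuous_on I x" "continuous_on I y"
  by (rule DERIV_continuous_on, erule sol_x[OF assms])
     (rule DERIV_continuous_on, erule sol_y[OF assms])

lemma sol_at:
  assumes "sol x y I" "t \<in> interior I"
  shows "(x has_real_derivative y t) (at t)"
    "(y has_real_derivative A * y t + B * x t - K * nonlin q (x t)) (at t)"
proof -
  have "t \<in> I" using assms(2) interior_subset by blast
  then show "(x has_real_derivative y t) (at t)"
    "(y has_real_derivative A * y t + B * x t - K * nonlin q (x t)) (at t)"
    using sol_x[OF assms(1), of t] sol_y[OF assms(1), of t] unfolding at_within_interior[OF assms(2)]
    by blast+
qed

lemma energy_deriv:
  assumes "sol x y I" "t \<in> I"
  shows "(energy x y has_real_derivative A * (y t)\<^sup>2) (at t within I)"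
proof -
  have "((\<lambda>t. (y t)\<^sup>2 / 2 + pot (x t)) has_real_derivative
     (2 * y t * (A * y t + B * x t - K * nonlin q (x t))) / 2 + (K * nonlin q (x t) - B * x t) * y t) (at t within I)"
    by (intro DERIV_add DERIV_cdivide DERIV_chain2[OF pot_deriv] sol_x[OF assms])
       (use sol_y[OF assms] in \<open>auto intro!: derivative_eq_intros\<close>)
  then show ?thesis unfolding energy_def[abs_def]
    by (rule DERIV_cong) (simp add: power2_eq_square field_simps)
qed

lemma energy_cont: "sol x y I \<Longrightarrow> continuous_on I (energy x y)"
  using energy_deriv by (rule DERIV_continuous_on)

lemma energy_mono:
  assumes s: "sol x y I" and ab: "{a..b} \<subseteq> I" "a \<le> b"
  shows "energy x y a \<le> energy x y b"
proof (rule DERIV_nonneg_imp_increasing_open[OF ab(2)])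
  have s': "sol x y {a..b}" using sol_subset s ab by blast
  show "continuous_on {a..b} (energy x y)" by (rule energy_cont[OF s'])
  fix t assume "a < t" "t < b"
  then have "(energy x y has_real_derivative A * (y t)\<^sup>2) (at t)"
    using energy_deriv[OF s', of t] by (simp add: at_within_Icc_at)
  then show "\<exists>z. DERIV (energy x y) t :> z \<and> z \<ge> 0" using A0 by force
qed

text \<open>The positive equilibrium \<open>xs\<close> and the positive zero \<open>x1\<close> of the potential.\<close>

definition "xs = (B / K) powr (\<alpha> / 2)"
definition "x1 = (B * q / (2 * K)) powr (\<alpha> / 2)"

lemma powr_q2: "a > 0 \<Longrightarrow> (a powr (\<alpha> / 2)) powr (q - 2) = a"
  using \<alpha>q by (simp add: powr_powr)

lemma xs0: "xs > 0" and x10: "x1 > 0" and xsx1: "xs < x1"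
proof -
  show "xs > 0" "x1 > 0" using B0 K0 q2 by (auto simp: xs_def x1_def)
  have "B / K < B * q / (2 * K)" using B0 K0 q2 by (simp add: field_simps)
  then show "xs < x1" using B0 K0 \<alpha>0 unfolding xs_def x1_def by (intro powr_less_mono2) auto
qed

lemma nonlin_factor: "x > 0 \<Longrightarrow> nonlin q x = x * x powr (q - 2)"
  by (simp add: nonlin_def)

lemma force_sign:
  assumes x: "x > 0"
  shows "B * x - K * nonlin q x < 0 \<longleftrightarrow> x > xs" "B * x - K * nonlin q x = 0 \<longleftrightarrow> x = xs"
proof -
  have xs: "B = K * xs powr (q - 2)" unfolding xs_def using powr_q2[of "B/K"] B0 K0 by simp
  have e: "B * x - K * nonlin q x = K * x * (xs powr (q - 2) - x powr (q - 2))"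
    using x by (simp add: nonlin_factor xs algebra_simps)
  have lt: "xs powr (q - 2) < x powr (q - 2) \<longleftrightarrow> xs < x" using x xs0 q2 by (metis powr_less_mono2 powr_mono2 linorder_not_le diff_gt_0_iff_gt less_imp_le)
  have gt: "x powr (q - 2) < xs powr (q - 2) \<longleftrightarrow> x < xs" using x xs0 q2 by (metis powr_less_mono2 powr_mono2 linorder_not_le diff_gt_0_iff_gt less_imp_le)
  show "B * x - K * nonlin q x < 0 \<longleftrightarrow> x > xs" unfolding e using lt K0 x by (auto simp: mult_less_0_iff)
  show "B * x - K * nonlin q x = 0 \<longleftrightarrow> x = xs" unfolding e using lt gt K0 x
    by (metis linorder_neqE_linordered_idom mult_eq_0_iff right_minus_eq order_less_irrefl)
qed

lemma pot_factor:
  assumes x: "x > 0"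
  shows "pot x = K / q * x\<^sup>2 * (x powr (q - 2) - x1 powr (q - 2))"
proof -
  have e1: "x1 powr (q - 2) = B * q / (2 * K)" unfolding x1_def using powr_q2[of "B * q / (2 * K)"] B0 K0 q2 by simp
  have e2: "x powr q = x\<^sup>2 * x powr (q - 2)" using x by (simp add: powr_diff powr_numeral)
  show ?thesis unfolding pot_def e1 using x K0 q2 by (simp add: e2 field_simps)
qed

lemma pot_sign:
  assumes x: "x > 0"
  shows "pot x < 0 \<longleftrightarrow> x < x1" "pot x > 0 \<longleftrightarrow> x > x1"
proof -
  have lt: "x1 powr (q - 2) < x powr (q - 2) \<longleftrightarrow> x1 < x" "x powr (q - 2) < x1 powr (q - 2) \<longleftrightarrow> x < x1"
    using x x10 q2 by (metis powr_less_mono2 powr_mono2 linorder_not_le diff_gt_0_iff_gt less_imp_le)+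
  have "K / q * x\<^sup>2 > 0" using x K0 q2 by auto
  then show "pot x < 0 \<longleftrightarrow> x < x1" "pot x > 0 \<longleftrightarrow> x > x1"
    unfolding pot_factor[OF x] mult_less_0_iff[of "K / q * x\<^sup>2"] zero_less_mult_iff[of "K / q * x\<^sup>2"]
    using lt by auto
qed

lemma pot_coercive: "\<exists>M>0. \<forall>x. \<bar>x\<bar> \<ge> M \<longrightarrow> pot x > c"
proof -
  define R where "R = x1 powr (q - 2) + 1"
  define M where "M = max (R powr (\<alpha>/2)) (max 1 (q * \<bar>c\<bar> / K + 1))"
  have "pot x > c" if x: "\<bar>x\<bar> \<ge> M" for x
  proof -
    have R: "R > 0" by (simp add: R_def add_nonneg_pos)
    have ax: "\<bar>x\<bar> > 0" "\<bar>x\<bar> \<ge> 1" "\<bar>x\<bar> \<ge> R powr (\<alpha>/2)" "\<bar>x\<bar> > q * \<bar>c\<bar> / K" using x by (auto simp: M_def)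
    have "(R powr (\<alpha>/2)) powr (q - 2) \<le> \<bar>x\<bar> powr (q - 2)" using ax q2 by (intro powr_mono2) auto
    then have "\<bar>x\<bar> powr (q - 2) - x1 powr (q - 2) \<ge> 1" using powr_q2[OF R] by (simp add: R_def)
    then have "K / q * \<bar>x\<bar>\<^sup>2 * (\<bar>x\<bar> powr (q - 2) - x1 powr (q - 2)) \<ge> K / q * \<bar>x\<bar>\<^sup>2 * 1"
      using K0 q2 by (intro mult_left_mono) auto
    moreover have "K / q * \<bar>x\<bar>\<^sup>2 \<ge> K / q * \<bar>x\<bar>"
      using K0 q2 ax self_le_power[of "\<bar>x\<bar>" 2] by (intro mult_left_mono) auto
    moreover have "K / q * \<bar>x\<bar> > \<bar>c\<bar>" using ax(4) K0 q2 by (simp add: field_simps)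
    moreover have "pot x = pot \<bar>x\<bar>" by (auto simp: abs_if)
    ultimately show ?thesis using pot_factor[OF ax(1)] by linarith
  qed
  moreover have "M > 0" by (simp add: M_def)
  ultimately show ?thesis by blast
qed

section \<open>Comparison of arcs in the phase plane\<close>

lemma x_less:
  assumes s: "sol x y {a..b}" and ab: "a < b" and y: "\<And>t. t \<in> {a<..<b} \<Longrightarrow> y t > 0"
  shows "x a < x b"
proof (rule DERIV_pos_imp_increasing_open[OF ab _ sol_cont(1)[OF s]])
  fix t assume "a < t" "t < b"
  then show "\<exists>z. DERIV x t :> z \<and> z > 0"
    using sol_at(1)[OF s, of t] y[of t] by auto
qed

lemma x_greater:
  assumes s: "sol x y {a..b}" and ab: "a < b" and y: "\<And>t. t \<in> {a<..<b} \<Longrightarrow> y t < 0"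
  shows "x b < x a"
  using x_less[OF sol_minus[OF s] ab] y by simp

lemma x_le:
  assumes s: "sol x y {a..b}" and ab: "a \<le> b" and y: "\<And>t. t \<in> {a<..<b} \<Longrightarrow> y t > 0"
  shows "x a \<le> x b"
  using x_less[OF s _ y] ab by (cases "a = b") auto

lemma x_ge:
  assumes s: "sol x y {a..b}" and ab: "a \<le> b" and y: "\<And>t. t \<in> {a<..<b} \<Longrightarrow> y t < 0"
  shows "x b \<le> x a"
  using x_greater[OF s _ y] ab by (cases "a = b") auto

text \<open>On an arc with \<open>y > 0\<close> the abscissa replaces time as parameter, and the energy \<open>F\<close> satisfies the
  scalar equation \<open>F' = A * Y\<close> with \<open>Y = sqrt (2 * (F - pot \<xi>))\<close>.\<close>

lemma arc_graph:
  assumes s: "sol x y {s..e}" and se: "s < e" and y: "\<And>t. t \<in> {s<..<e} \<Longrightarrow> y t > 0"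
  shows "\<exists>F Y. continuous_on {x s..x e} F \<and> F (x s) = energy x y s \<and> F (x e) = energy x y e \<and>
    (\<forall>\<xi>\<in>{x s<..<x e}. (F has_real_derivative A * Y \<xi>) (at \<xi>) \<and> Y \<xi> > 0 \<and> (Y \<xi>)\<^sup>2 / 2 = F \<xi> - pot \<xi>)"
proof -
  have mono: "x a < x b" if "s \<le> a" "a < b" "b \<le> e" for a b
    by (rule x_less[OF sol_subset[OF s]]) (use that y in auto)
  have inj: "inj_on x {s..e}"
    by (rule linorder_inj_onI) (use mono in \<open>force+\<close>)
  have cx: "continuous_on {s..e} x" by (rule sol_cont[OF s])
  have img: "x ` {s..e} = {x s..x e}"
  proof
    show "x ` {s..e} \<subseteq> {x s..x e}"
    proof
      fix z assume "z \<in> x ` {s..e}"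
      then obtain t where t: "t \<in> {s..e}" "z = x t" by auto
      then show "z \<in> {x s..x e}" using mono[of s t] mono[of t e]
        by (cases "t = s"; cases "t = e") auto
    qed
    show "{x s..x e} \<subseteq> x ` {s..e}"
    proof
      fix z assume "z \<in> {x s..x e}"
      then obtain t where "s \<le> t" "t \<le> e" "x t = z" using IVT'[of x s z e] cx se by auto
      then show "z \<in> x ` {s..e}" by auto
    qed
  qed
  define g where "g = the_inv_into {s..e} x"
  have gx: "g (x t) = t" if "t \<in> {s..e}" for t
    unfolding g_def by (rule the_inv_into_f_f[OF inj that])
  have xg: "x (g \<xi>) = \<xi>" "g \<xi> \<in> {s..e}" if "\<xi> \<in> {x s..x e}" for \<xi>
  proof -
    have "\<xi> \<in> x ` {s..e}" using that by (simp only: img)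
    then obtain t where "t \<in> {s..e}" "\<xi> = x t" by (rule imageE)
    then show "x (g \<xi>) = \<xi>" "g \<xi> \<in> {s..e}" using gx[of t] by auto
  qed
  have cg: "continuous_on {x s..x e} g"
    using continuous_on_inv[OF cx, of g] gx img by auto
  define F where "F = (\<lambda>\<xi>. energy x y (g \<xi>))"
  define Y where "Y = (\<lambda>\<xi>. y (g \<xi>))"
  have gin: "g \<xi> \<in> {s<..<e}" if "\<xi> \<in> {x s<..<x e}" for \<xi>
  proof -
    have "\<xi> \<in> {x s..x e}" using that by auto
    from xg[OF this] show ?thesis using that by (cases "g \<xi> = s"; cases "g \<xi> = e") auto
  qed
  show ?thesis
  proof (rule exI[of _ F], rule exI[of _ Y], intro conjI ballI)
    show "continuous_on {x s..x e} F" unfolding F_def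
      by (rule continuous_on_compose2[OF energy_cont[OF s] cg]) (use xg in auto)
    show "F (x s) = energy x y s" "F (x e) = energy x y e"
      unfolding F_def using gx[of s] gx[of e] se by auto
  next
    fix \<xi> assume xi: "\<xi> \<in> {x s<..<x e}"
    have gi: "g \<xi> \<in> interior {s..e}" using gin[OF xi] by simp
    show Y0: "Y \<xi> > 0" unfolding Y_def using y gin[OF xi] by auto
    show "(Y \<xi>)\<^sup>2 / 2 = F \<xi> - pot \<xi>"
      unfolding Y_def F_def energy_def using xg(1)[of \<xi>] xi by auto
    have "(g has_real_derivative inverse (y (g \<xi>))) (at \<xi>)"
    proof (rule DERIV_inverse_function[where f = x and a = "x s" and b = "x e"])
      show "(x has_real_derivative y (g \<xi>)) (at (g \<xi>))" using sol_at(1)[OF s gi] .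
      show "isCont g \<xi>" using cg xi by (intro continuous_on_interior[of "{x s..x e}"]) auto
    qed (use xi xg Y0 in \<open>auto simp: Y_def\<close>)
    moreover have "(energy x y has_real_derivative A * (y (g \<xi>))\<^sup>2) (at (g \<xi>))"
      using energy_deriv[OF s, of "g \<xi>"] gi by (auto simp: at_within_Icc_at)
    ultimately have "(F has_real_derivative A * (y (g \<xi>))\<^sup>2 * inverse (y (g \<xi>))) (at \<xi>)"
      unfolding F_def by (rule DERIV_chain2[rotated])
    then show "(F has_real_derivative A * Y \<xi>) (at \<xi>)"
      using Y0 by (simp add: Y_def power2_eq_square field_simps)
  qed
qed

text \<open>At equal abscissa more energy means larger \<open>y\<close>, hence a larger derivative of the energy with
  respect to the abscissa: the gap can only widen.\<close>

lemma arc_compare: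
  assumes s1: "sol xa ya {s1..e1}" "s1 < e1" "\<And>t. t \<in> {s1<..<e1} \<Longrightarrow> ya t > 0"
    and s2: "sol xb yb {s2..e2}" "s2 < e2" "\<And>t. t \<in> {s2<..<e2} \<Longrightarrow> yb t > 0"
    and st: "xa s1 = xb s2" "xa e1 = xb e2" and lt: "energy xa ya s1 < energy xb yb s2"
  shows "energy xb yb s2 - energy xa ya s1 \<le> energy xb yb e2 - energy xa ya e1"
proof -
  from arc_graph[OF s1] obtain F1 Y1 where 1: "continuous_on {xa s1..xa e1} F1"
    "F1 (xa s1) = energy xa ya s1" "F1 (xa e1) = energy xa ya e1"
    "\<forall>\<xi>\<in>{xa s1<..<xa e1}. (F1 has_real_derivative A * Y1 \<xi>) (at \<xi>) \<and> Y1 \<xi> > 0 \<and> (Y1 \<xi>)\<^sup>2 / 2 = F1 \<xi> - pot \<xi>"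
    by blast
  from arc_graph[OF s2] obtain F2 Y2 where 2: "continuous_on {xb s2..xb e2} F2"
    "F2 (xb s2) = energy xb yb s2" "F2 (xb e2) = energy xb yb e2"
    "\<forall>\<xi>\<in>{xb s2<..<xb e2}. (F2 has_real_derivative A * Y2 \<xi>) (at \<xi>) \<and> Y2 \<xi> > 0 \<and> (Y2 \<xi>)\<^sup>2 / 2 = F2 \<xi> - pot \<xi>"
    by blast
  define D where "D = (\<lambda>\<xi>. F2 \<xi> - F1 \<xi>)"
  have "D (xa s1) \<le> D (xa e1)"
  proof (rule increasing_while_positive[where D = D and D' = "\<lambda>\<xi>. A * Y2 \<xi> - A * Y1 \<xi>"])
    show "xa s1 \<le> xa e1" using x_less[OF s1] by simp
    show "continuous_on {xa s1..xa e1} D" unfolding D_def using 1(1) 2(1) st by (intro continuous_intros) auto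
    show "D (xa s1) > 0" unfolding D_def using 1(2) 2(2) st lt by simp
    fix \<xi> assume xi: "\<xi> \<in> {xa s1<..<xa e1}"
    then show "(D has_real_derivative A * Y2 \<xi> - A * Y1 \<xi>) (at \<xi>)"
      unfolding D_def using 1(4) 2(4) st by (intro DERIV_diff) auto
    assume "D \<xi> > 0"
    then have "(Y1 \<xi>)\<^sup>2 < (Y2 \<xi>)\<^sup>2" using 1(4) 2(4) xi st by (simp add: D_def)
    then have "Y1 \<xi> < Y2 \<xi>" by (rule power2_less_imp_less) (use 2(4) xi st in \<open>auto intro!: less_imp_le\<close>)
    then show "A * Y2 \<xi> - A * Y1 \<xi> \<ge> 0" using A0 by simp
  qed
  then show ?thesis unfolding D_def using 1(2,3) 2(2,3) st by simp
qed

lemma arc_compare_neg: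
  assumes s1: "sol xa ya {s1..e1}" "s1 < e1" "\<And>t. t \<in> {s1<..<e1} \<Longrightarrow> ya t < 0"
    and s2: "sol xb yb {s2..e2}" "s2 < e2" "\<And>t. t \<in> {s2<..<e2} \<Longrightarrow> yb t < 0"
    and st: "xa s1 = xb s2" "xa e1 = xb e2" and lt: "energy xa ya s1 < energy xb yb s2"
  shows "energy xb yb s2 - energy xa ya s1 \<le> energy xb yb e2 - energy xa ya e1"
  using arc_compare[OF sol_minus[OF s1(1)] s1(2) _ sol_minus[OF s2(1)] s2(2)] assms by simp

text \<open>At a tip \<open>y = 0\<close>, so the energy has the least value possible at that abscissa. The trajectory with
  less energy can therefore not pass the tip of the one with more energy.\<close>

lemma tip_compare:
  assumes S1: "sol xa ya {s1..m1}" and o1: "s1 \<le> m1"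
    and up1: "\<And>t. t \<in> {s1<..<m1} \<Longrightarrow> ya t > 0"
    and S2: "sol xb yb {s2..m2}" and o2: "s2 \<le> m2"
    and up2: "\<And>t. t \<in> {s2<..<m2} \<Longrightarrow> yb t > 0" and tip2: "yb m2 = 0"
    and st: "xa s1 = xb s2" and lt: "energy xa ya s1 < energy xb yb s2"
  shows "xa m1 \<le> xb m2"
proof -
  have sub1: "sol xa ya {a..b}" if "s1 \<le> a" "b \<le> m1" for a b using sol_subset[OF S1] that by auto
  have sub2: "sol xb yb {a..b}" if "s2 \<le> a" "b \<le> m2" for a b using sol_subset[OF S2] that by auto
  have up1le: "xa s1 \<le> xa m1" by (rule x_le[OF sub1]) (use o1 up1 in auto)
  have up2le: "xb s2 \<le> xb m2" by (rule x_le[OF sub2]) (use o2 up2 in auto)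
  show ?thesis
  proof (cases "s1 = m1")
    case True then show ?thesis using up2le st by simp
  next
    case False
    show ?thesis
    proof (rule ccontr)
      assume "\<not> xa m1 \<le> xb m2"
      then have gt: "xb m2 < xa m1" by simp
      have "continuous_on {s1..m1} xa" using sol_cont(1)[OF sub1[of s1 m1]] o1 by simp
      then obtain e where e: "s1 \<le> e" "e \<le> m1" "xa e = xb m2"
        using IVT'[of xa s1 "xb m2" m1] gt up2le st o1 by auto
      have E2: "energy xb yb m2 \<le> energy xa ya e" using tip2 e by (simp add: energy_def)
      show False
      proof (cases "s2 = m2 \<or> e = s1")
        case True
        have "s2 = m2"
        proof (rule ccontr)
          assume "s2 \<noteq> m2"
          have "xb s2 < xb m2" by (rule x_less[OF sub2]) (use \<open>s2 \<noteq> m2\<close> o2 up2 in auto)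
          then show False using True \<open>s2 \<noteq> m2\<close> e st by auto
        qed
        then have "energy xb yb s2 \<le> energy xa ya s1" using tip2 st by (simp add: energy_def)
        then show False using lt by simp
      next
        case F: False
        have "energy xb yb s2 - energy xa ya s1 \<le> energy xb yb m2 - energy xa ya e"
          by (rule arc_compare[of _ _ _ _ xb yb])
             (use F e o1 o2 up1 up2 st lt in \<open>auto intro!: sub1 sub2\<close>)
        then show False using E2 lt by simp
      qed
    qed
  qed
qed

text \<open>A half turn rises to its tip and falls afterwards. The trajectory with more energy passes the
  abscissa of the other tip twice; in between it only gains energy, so the order at the tip
  carries over to the falling arcs. The alternative \<open>s1 = m1\<close> admits trajectories that fall
  from the start.\<close>

lemma half_turn_compare:
  assumes S1: "sol xa ya {s1..e1}" and o1: "s1 \<le> m1" "m1 \<le> e1"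
    and up1: "\<And>t. t \<in> {s1<..<m1} \<Longrightarrow> ya t > 0" and dn1: "\<And>t. t \<in> {m1<..<e1} \<Longrightarrow> ya t < 0"
    and tip1: "ya m1 = 0 \<or> s1 = m1"
    and S2: "sol xb yb {s2..e2}" and o2: "s2 \<le> m2" "m2 \<le> e2"
    and up2: "\<And>t. t \<in> {s2<..<m2} \<Longrightarrow> yb t > 0" and dn2: "\<And>t. t \<in> {m2<..<e2} \<Longrightarrow> yb t < 0"
    and tip2: "yb m2 = 0"
    and st: "xa s1 = xb s2" "xa e1 = xb e2" and lt: "energy xa ya s1 < energy xb yb s2"
  shows "energy xa ya e1 < energy xb yb e2"
proof -
  have sub1: "sol xa ya {a..b}" if "s1 \<le> a" "b \<le> e1" for a b using sol_subset[OF S1] that by auto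
  have sub2: "sol xb yb {a..b}" if "s2 \<le> a" "b \<le> e2" for a b using sol_subset[OF S2] that by auto
  have up1le: "xa s1 \<le> xa m1" by (rule x_le[OF sub1]) (use o1 up1 in auto)
  have up2le: "xb s2 \<le> xb m2" by (rule x_le[OF sub2]) (use o2 up2 in auto)
  have C1: "xa m1 \<le> xb m2"
    by (rule tip_compare[OF sub1[of s1 m1] _ up1 sub2[of s2 m2] _ up2 tip2 st(1) lt]) (use o1 o2 in auto)
  have dn1le: "xa e1 \<le> xa m1" by (rule x_ge[OF sub1]) (use o1 dn1 in auto)
  have "continuous_on {m2..e2} xb" using sol_cont(1)[OF sub2[of m2 e2]] o2 by simp
  then obtain m where m: "m2 \<le> m" "m \<le> e2" "xb m = xa m1"
    using IVT2'[of xb e2 "xa m1" m2] C1 dn1le st o2 by auto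
  have E2: "energy xa ya m1 < energy xb yb m"
  proof (cases "s1 = m1")
    case True
    have "energy xb yb s2 \<le> energy xb yb m" by (rule energy_mono[OF S2]) (use m o2 in auto)
    then show ?thesis using True lt by simp
  next
    case False
    have "continuous_on {s2..m2} xb" using sol_cont(1)[OF sub2[of s2 m2]] o2 by simp
    then obtain k where k: "s2 \<le> k" "k \<le> m2" "xb k = xa m1"
      using IVT'[of xb s2 "xa m1" m2] C1 up1le st o2 by auto
    have "xa s1 < xa m1" by (rule x_less[OF sub1]) (use False o1 up1 in auto)
    then have "k \<noteq> s2" using k st by auto
    have "energy xb yb s2 - energy xa ya s1 \<le> energy xb yb k - energy xa ya m1"
      by (rule arc_compare[of _ _ _ _ xb yb])
         (use False \<open>k \<noteq> s2\<close> k o1 o2 up1 up2 st lt in \<open>auto intro!: sub1 sub2\<close>)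
    moreover have "energy xb yb k \<le> energy xb yb m" by (rule energy_mono[OF S2]) (use m k o2 in auto)
    ultimately show ?thesis using lt by simp
  qed
  show ?thesis
  proof (cases "m1 = e1")
    case True
    have "energy xb yb m \<le> energy xb yb e2" by (rule energy_mono[OF S2]) (use m o2 in auto)
    then show ?thesis using True E2 by simp
  next
    case False
    have "xa e1 < xa m1" by (rule x_greater[OF sub1]) (use False o1 dn1 in auto)
    then have "m \<noteq> e2" using m st by auto
    have "energy xb yb m - energy xa ya m1 \<le> energy xb yb e2 - energy xa ya e1"
      by (rule arc_compare_neg[of _ _ _ _ xb yb])
         (use False \<open>m \<noteq> e2\<close> m o1 o2 dn1 dn2 st E2 in \<open>auto intro!: sub1 sub2\<close>)
    then show ?thesis using E2 by simp
  qed
qed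

section \<open>Half turns\<close>

text \<open>Beyond the equilibrium the force is negative, so \<open>y\<close> passes 0 downwards only.\<close>

lemma y_after_zero:
  assumes S: "sol x y {s..e}" and se: "s < e" and ys: "y s \<le> 0"
    and Z: "\<And>t. t \<in> {s..e} \<Longrightarrow> y t = 0 \<Longrightarrow> x t > xs"
  shows "y e < 0"
proof (rule negative_after_zero[OF sol_y[OF S] _ se ys])
  fix t assume t: "t \<in> {s..e}" "y t = 0"
  have "x t > xs" using Z t by auto
  then have "B * x t - K * nonlin q (x t) < 0" using force_sign(1)[of "x t"] xs0 by simp
  then show "A * y t + B * x t - K * nonlin q (x t) < 0" using t by simp
qed

lemma tip_exists:
  assumes S: "sol x y {s..e}" and se: "s < e" and ys: "y s \<ge> 0" and ye: "y e < 0"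
    and Z: "\<And>t. t \<in> {s..e} \<Longrightarrow> y t = 0 \<Longrightarrow> x t > xs"
  shows "\<exists>m. s \<le> m \<and> m < e \<and> y m = 0 \<and> (\<forall>t\<in>{s<..<m}. y t > 0) \<and> (\<forall>t\<in>{m<..e}. y t < 0)"
proof -
  obtain m where m: "s \<le> m" "m \<le> e" "y m = 0"
    using IVT2'[of y e 0 s] sol_cont(2)[OF S] ys ye se by auto
  have sub: "sol x y {a..b}" if "s \<le> a" "b \<le> e" for a b using sol_subset[OF S] that by auto
  show ?thesis
  proof (intro exI[of _ m] conjI ballI)
    show "s \<le> m" "m < e" "y m = 0" using m ye by (auto simp: order.order_iff_strict)
    show "y t > 0" if t: "t \<in> {s<..<m}" for t
    proof (rule ccontr)
      assume nt: "\<not> y t > 0"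
      have "y m < 0" by (rule y_after_zero[OF sub[of t m]]) (use nt t m Z in auto)
      then show False using m by simp
    qed
    show "y t < 0" if t: "t \<in> {m<..e}" for t
      by (rule y_after_zero[OF sub[of m t]]) (use t m Z in auto)
  qed
qed

lemma pos_energy_x1:
  assumes "energy x y t > 0" "y t = 0" "x t > 0"
  shows "x t > x1"
  using assms pot_sign(2)[of "x t"] by (simp add: energy_def)

lemma y_sign_at_zero:
  assumes S: "sol x y {s..e}" and se: "s < e" and x: "\<And>t. t \<in> {s<..<e} \<Longrightarrow> x t > 0"
  shows "x s = 0 \<Longrightarrow> y s \<ge> 0" "x e = 0 \<Longrightarrow> y e \<le> 0"
proof -
  assume xs: "x s = 0"
  show "y s \<ge> 0"
  proof (rule ccontr)
    assume "\<not> y s \<ge> 0"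
    then obtain d where d: "d > 0" "\<And>h. h > 0 \<Longrightarrow> s + h \<in> {s..e} \<Longrightarrow> h < d \<Longrightarrow> x (s + h) < x s"
      using has_real_derivative_neg_dec_right[OF sol_x[OF S, of s]] se by auto
    define h where "h = min d (e - s) / 2"
    have "h > 0" "h < d" "h < e - s" using d se by (auto simp: h_def)
    then show False using d(2)[of h] x[of "s + h"] xs by auto
  qed
next
  assume xs: "x e = 0"
  show "y e \<le> 0"
  proof (rule ccontr)
    assume "\<not> y e \<le> 0"
    then obtain d where d: "d > 0" "\<And>h. h > 0 \<Longrightarrow> e - h \<in> {s..e} \<Longrightarrow> h < d \<Longrightarrow> x (e - h) < x e"
      using has_real_derivative_pos_inc_left[OF sol_x[OF S, of e]] se by auto
    define h where "h = min d (e - s) / 2"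
    have "h > 0" "h < d" "h < e - s" using d se by (auto simp: h_def)
    then show False using d(2)[of h] x[of "e - h"] xs by auto
  qed
qed

text \<open>A lower bound for the integral of \<open>A * y\<close> over the abscissas from \<open>xs / 2\<close> to \<open>xs\<close> on a rising arc
  with nonnegative energy; the square root bounds \<open>y\<close> from below there.\<close>

definition "gain = A * sqrt (2 * (K / q * (xs / 2)\<^sup>2 * (x1 powr (q - 2) - xs powr (q - 2)))) * (xs / 2)"

lemma gain_pos: "gain > 0"
proof -
  have "x1 powr (q - 2) > xs powr (q - 2)" using xs0 xsx1 q2 by (intro powr_less_mono2) auto
  then show ?thesis unfolding gain_def using A0 K0 q2 xs0 by (intro mult_pos_pos real_sqrt_gt_zero) auto
qed

lemma rise_gain:
  assumes S: "sol x y {s..e}" and se: "s \<le> e" and xs: "x s = 0" and xe: "x e \<ge> xs"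
    and y: "\<And>t. t \<in> {s<..<e} \<Longrightarrow> y t > 0" and E: "energy x y s \<ge> 0"
  shows "energy x y e \<ge> energy x y s + gain"
proof -
  define c where "c = sqrt (2 * (K / q * (xs / 2)\<^sup>2 * (x1 powr (q - 2) - xs powr (q - 2))))"
  have P: "x1 powr (q - 2) > xs powr (q - 2)" using xs0 xsx1 q2 by (intro powr_less_mono2) auto
  then have c2: "c\<^sup>2 = 2 * (K / q * (xs / 2)\<^sup>2 * (x1 powr (q - 2) - xs powr (q - 2)))"
    unfolding c_def using K0 q2 by (intro real_sqrt_pow2) auto
  have c0: "c \<ge> 0" unfolding c_def using K0 q2 P by auto
  have sub: "sol x y {a..b}" if "s \<le> a" "b \<le> e" for a b using sol_subset[OF S] that by auto
  obtain a where a: "s \<le> a" "a \<le> e" "x a = xs / 2"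
    using IVT'[of x s "xs/2" e] sol_cont(1)[OF S] xs xe xs0 se by auto
  obtain b where b: "a \<le> b" "b \<le> e" "x b = xs"
    using IVT'[of x a "xs" e] sol_cont(1)[OF sub[of a e]] a xe xs0 by auto
  have "energy x y a - A * c * x a \<le> energy x y b - A * c * x b"
  proof (rule DERIV_nonneg_imp_increasing_open[where f = "\<lambda>t. energy x y t - A * c * x t"])
    show "continuous_on {a..b} (\<lambda>t. energy x y t - A * c * x t)"
      using a b by (intro continuous_intros energy_cont[OF sub] sol_cont[OF sub]) auto
    fix t assume t: "a < t" "t < b"
    then have ti: "t \<in> interior {s..e}" "t \<in> {s..e}" using a b by auto
    have "((\<lambda>t. energy x y t - A * c * x t) has_real_derivative A * (y t)\<^sup>2 - A * c * y t) (at t)"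
      using energy_deriv[OF S ti(2)] sol_at(1)[OF S ti(1)] at_within_interior[OF ti(1)]
      by (intro DERIV_diff DERIV_cmult) auto
    moreover have "A * (y t)\<^sup>2 - A * c * y t \<ge> 0"
    proof -
      have yt: "y t > 0" using y t a b by auto
      have "x a \<le> x t" by (rule x_le[OF sub]) (use t a b y in auto)
      moreover have "x t \<le> x b" by (rule x_le[OF sub]) (use t a b y in auto)
      ultimately have xt: "xs / 2 \<le> x t" "x t \<le> xs" using a b by auto
      have "energy x y s \<le> energy x y t" by (rule energy_mono[OF S]) (use t a b in auto)
      then have "(y t)\<^sup>2 \<ge> 2 * (- pot (x t))" using E by (simp add: energy_def)
      also have "- pot (x t) = K / q * (x t)\<^sup>2 * (x1 powr (q - 2) - x t powr (q - 2))"
        using pot_factor[of "x t"] xt xs0 by (simp add: algebra_simps)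
      also have "2 * \<dots> \<ge> 2 * (K / q * (xs / 2)\<^sup>2 * (x1 powr (q - 2) - xs powr (q - 2)))"
      proof -
        have "x t powr (q - 2) \<le> xs powr (q - 2)" using xt xs0 q2 by (intro powr_mono2) auto
        moreover have "(xs / 2)\<^sup>2 \<le> (x t)\<^sup>2" using xt xs0 by (intro power_mono) auto
        ultimately show ?thesis using K0 q2 P by (intro mult_mono) auto
      qed
      finally have "c\<^sup>2 \<le> (y t)\<^sup>2" using c2 by simp
      then have "c \<le> y t" by (rule power2_le_imp_le) (use yt in auto)
      then have "0 \<le> A * y t * (y t - c)" using A0 yt by auto
      then show ?thesis by (simp add: power2_eq_square algebra_simps)
    qed
    ultimately show "\<exists>z. DERIV (\<lambda>t. energy x y t - A * c * x t) t :> z \<and> z \<ge> 0" by blast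
  qed (use b in auto)
  then have "energy x y b \<ge> energy x y a + gain"
    using a b by (simp add: gain_def c_def algebra_simps)
  moreover have "energy x y s \<le> energy x y a" "energy x y b \<le> energy x y e"
    using a b by (auto intro!: energy_mono[OF S])
  ultimately show ?thesis by simp
qed

text \<open>Every half turn gains at least a fixed amount of energy. This forces finitely many zeros
  backward in time and unbounded crossing times of \<open>U\<close> forward in time.\<close>

lemma half_turn_gain:
  assumes S: "sol x y {s..e}" and se: "s < e" and xs: "x s = 0" and ys: "y s > 0" and xe: "x e = 0"
    and x: "\<And>t. t \<in> {s<..<e} \<Longrightarrow> x t > 0"
  shows "energy x y e \<ge> energy x y s + gain"
proof -
  have Es: "energy x y s > 0" using xs ys by (simp add: energy_def)
  have Et: "energy x y t > 0" if "t \<in> {s..e}" for t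
    using energy_mono[OF S, of s t] Es that by auto
  have ye0: "y e \<noteq> 0" using Et[of e] xe se by (auto simp: energy_def)
  then have ye: "y e < 0" using y_sign_at_zero(2)[OF S se x xe] by simp
  have Z: "x t > xs" if "t \<in> {s..e}" "y t = 0" for t
  proof -
    have "t \<noteq> s" "t \<noteq> e" using that ys ye by auto
    then have "x t > x1" using that x[of t] Et[of t] by (intro pos_energy_x1[of x y t]) auto
    then show ?thesis using xsx1 by simp
  qed
  from tip_exists[OF S se less_imp_le[OF ys] ye Z]
  obtain m where m: "s \<le> m" "m < e" "y m = 0" "\<forall>t\<in>{s<..<m}. y t > 0" by blast
  have "energy x y m \<ge> energy x y s + gain"
    by (rule rise_gain[OF sol_subset[OF S]]) (use m less_imp_le[OF Z[of m]] Es xs in auto)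
  moreover have "energy x y m \<le> energy x y e" by (rule energy_mono[OF S]) (use m in auto)
  ultimately show ?thesis by simp
qed

end

section \<open>Limits and uniqueness for second-order equations\<close>

lemma mono_bounded_limit_at_top:
  fixes x :: "real \<Rightarrow> real"
  assumes mono: "\<And>s t. T \<le> s \<Longrightarrow> s \<le> t \<Longrightarrow> x s \<le> x t" and bd: "\<And>t. t \<ge> T \<Longrightarrow> x t \<le> M"
  shows "\<exists>l. (x \<longlongrightarrow> l) at_top \<and> (\<forall>t\<ge>T. x t \<le> l) \<and> l \<le> M"
proof -
  define l where "l = Sup (x ` {T..})"
  have bdd: "bdd_above (x ` {T..})" using bd by (auto intro!: bdd_aboveI[of _ M])
  have le: "x t \<le> l" if "t \<ge> T" for t unfolding l_def by (rule cSup_upper[OF _ bdd]) (use that in auto)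
  have "(x \<longlongrightarrow> l) at_top"
  proof (rule order_tendstoI)
    fix a assume "a < l"
    then obtain t where t: "t \<ge> T" "a < x t" using less_cSup_iff[OF _ bdd, of a] by (auto simp: l_def)
    show "eventually (\<lambda>s. a < x s) at_top"
      using eventually_ge_at_top[of t] by eventually_elim (use t mono[of t] in fastforce)
  next
    fix a assume "l < a"
    show "eventually (\<lambda>s. x s < a) at_top"
      using eventually_ge_at_top[of T] by eventually_elim (use le \<open>l < a\<close> in fastforce)
  qed
  moreover have "l \<le> M" unfolding l_def by (rule cSup_least) (use bd in auto)
  ultimately show ?thesis using le by blast
qed

lemma filterlim_add_const_at_top: "filterlim (\<lambda>r::real. r + c) at_top at_top"
  using filterlim_tendsto_add_at_top[OF tendsto_const[of c] filterlim_ident] by (simp add: add.commute)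

text \<open>The limit of a solution is an equilibrium. By the mean value theorem \<open>y\<close> is small at some \<open>\<xi> r\<close>
  between \<open>r\<close> and \<open>r + 1\<close>, so \<open>w = y - a * x\<close>, whose derivative is \<open>h (x t)\<close>, converges along \<open>\<xi>\<close>.\<close>

lemma limit_equilibrium:
  fixes x y :: "real \<Rightarrow> real"
  assumes dx: "\<And>t. t > T \<Longrightarrow> (x has_real_derivative y t) (at t)"
    and dy: "\<And>t. t > T \<Longrightarrow> (y has_real_derivative a * y t + h (x t)) (at t)"
    and lim: "(x \<longlongrightarrow> X) at_top" and h: "isCont h X"
  shows "h X = 0" "(y \<longlongrightarrow> 0) at_top"
proof -
  define w where "w = (\<lambda>t. y t - a * x t)"
  have dw: "(w has_real_derivative h (x t)) (at t)" if "t > T" for t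
    unfolding w_def using DERIV_diff[OF dy[OF that] DERIV_cmult[OF dx[OF that], of a]] by simp
  have hl: "((\<lambda>t. h (x t)) \<longlongrightarrow> h X) at_top" by (rule isCont_tendsto_compose[OF h lim])
  have mid: "\<exists>z. z \<in> {r<..<r+1} \<and> x (r + 1) - x r = y z" if "r > T" for r
    using MVT2[of r "r + 1" x y] dx that by auto
  define \<xi> where "\<xi> r = (SOME z. z \<in> {r<..<r+1} \<and> x (r + 1) - x r = y z)" for r
  have xi: "\<xi> r \<in> {r<..<r+1}" "x (r + 1) - x r = y (\<xi> r)" if "r > T" for r
    using someI_ex[OF mid[OF that]] unfolding \<xi>_def by auto
  have limr: "((\<lambda>r. x (r + 1) - x r) \<longlongrightarrow> 0) at_top"
  proof -
    have "((\<lambda>r. x (r + 1)) \<longlongrightarrow> X) at_top" by (rule filterlim_compose[OF lim filterlim_add_const_at_top])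
    then show ?thesis using tendsto_diff[OF _ lim] by fastforce
  qed
  have xitop: "filterlim \<xi> at_top at_top"
    by (rule filterlim_at_top_mono[OF filterlim_ident])
       (rule eventually_mono[OF eventually_gt_at_top[of T]], use xi(1) in force)
  have yxi: "((\<lambda>r. y (\<xi> r)) \<longlongrightarrow> 0) at_top"
    by (rule Lim_transform_eventually[OF limr])
       (rule eventually_mono[OF eventually_gt_at_top[of T]], use xi(2) in auto)
  have wxi: "((\<lambda>r. w (\<xi> r)) \<longlongrightarrow> - a * X) at_top"
    unfolding w_def using tendsto_diff[OF yxi tendsto_mult[OF tendsto_const[of a] filterlim_compose[OF lim xitop]]] by simp
  show hX: "h X = 0"
  proof (rule ccontr)
    assume h0: "h X \<noteq> 0"
    define e where "e = \<bar>h X\<bar> / 2"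
    have e: "e > 0" using h0 by (simp add: e_def)
    have "eventually (\<lambda>t. \<bar>h (x t) - h X\<bar> < e) at_top"
      using tendstoD[OF hl e] by (simp add: dist_real_def)
    then obtain T1 where T1: "\<And>t. t \<ge> T1 \<Longrightarrow> \<bar>h (x t) - h X\<bar> < e"
      unfolding eventually_at_top_linorder by blast
    \<comment> \<open>\<open>\<xi> r\<close> and \<open>\<xi> (r + 2)\<close> are more than 1 apart, so a nonzero limit of \<open>w'\<close> would show\<close>
    have "((\<lambda>r. w (\<xi> (r + 2)) - w (\<xi> r)) \<longlongrightarrow> - a * X - - a * X) at_top"
      by (intro tendsto_diff wxi filterlim_compose[OF wxi] filterlim_add_const_at_top)
    from tendstoD[OF this e] have "eventually (\<lambda>r. \<bar>w (\<xi> (r + 2)) - w (\<xi> r)\<bar> < e) at_top"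
      by (simp add: dist_real_def)
    then obtain r where r: "r > T" "r > T1" "\<bar>w (\<xi> (r + 2)) - w (\<xi> r)\<bar> < e"
      using eventually_conj[OF eventually_conj[OF eventually_gt_at_top[of T] eventually_gt_at_top[of T1]]]
      by (metis (mono_tags, lifting) eventually_happens' trivial_limit_at_top_linorder)
    have lt: "\<xi> r < \<xi> (r + 2)" "\<xi> (r + 2) - \<xi> r > 1" using xi(1)[of r] xi(1)[of "r + 2"] r by auto
    obtain z where z: "z > \<xi> r" "z < \<xi> (r + 2)" "w (\<xi> (r + 2)) - w (\<xi> r) = (\<xi> (r + 2) - \<xi> r) * h (x z)"
      using MVT2[OF lt(1), of w "\<lambda>t. h (x t)"] dw xi(1)[of r] r by force
    have "\<bar>h (x z)\<bar> > e" using T1[of z] z xi(1)[of r] r by (auto simp: e_def abs_if split: if_splits)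
    then have "(\<xi> (r + 2) - \<xi> r) * \<bar>h (x z)\<bar> > 1 * e" using lt e by (intro mult_strict_mono) auto
    then show False using r(3) z(3) lt by (simp add: abs_mult)
  qed
  have "((\<lambda>t. w t - w (\<xi> t)) \<longlongrightarrow> 0) at_top"
  proof (rule tendstoI)
    fix e :: real assume e: "e > 0"
    have "eventually (\<lambda>t. \<bar>h (x t)\<bar> < e) at_top"
      using tendstoD[OF hl e] hX by (simp add: dist_real_def)
    then obtain T1 where T1: "\<And>t. t \<ge> T1 \<Longrightarrow> \<bar>h (x t)\<bar> < e"
      unfolding eventually_at_top_linorder by blast
    show "eventually (\<lambda>t. dist (w t - w (\<xi> t)) 0 < e) at_top"
      using eventually_gt_at_top[of T] eventually_gt_at_top[of T1]
    proof eventually_elim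
      fix t assume t: "t > T" "t > T1"
      have lt: "t < \<xi> t" "\<xi> t - t < 1" using xi(1)[OF t(1)] by auto
      obtain z where z: "z > t" "z < \<xi> t" "w (\<xi> t) - w t = (\<xi> t - t) * h (x z)"
        using MVT2[OF lt(1), of w "\<lambda>t. h (x t)"] dw t by force
      have "\<bar>w (\<xi> t) - w t\<bar> = (\<xi> t - t) * \<bar>h (x z)\<bar>" using z(3) lt by (simp add: abs_mult)
      also have "\<dots> \<le> 1 * \<bar>h (x z)\<bar>" using lt by (intro mult_right_mono) auto
      also have "\<dots> < e" using T1[of z] z t by simp
      finally show "dist (w t - w (\<xi> t)) 0 < e" by (simp add: dist_real_def abs_minus_commute)
    qed
  qed
  from tendsto_add[OF tendsto_add[OF this wxi] tendsto_mult[OF tendsto_const[of a] lim]]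
  show "(y \<longlongrightarrow> 0) at_top" by (simp add: w_def)
qed

text \<open>Gronwall for the squared distance of the two trajectories.\<close>

lemma planar_unique:
  fixes x1 y1 x2 y2 h :: "real \<Rightarrow> real"
  assumes lip: "\<And>M. \<exists>G\<ge>0. \<forall>x\<in>{-M..M}. \<forall>y\<in>{-M..M}. \<bar>h x - h y\<bar> \<le> G * \<bar>x - y\<bar>"
    and c: "continuous_on {s..e} x1" "continuous_on {s..e} y1" "continuous_on {s..e} x2" "continuous_on {s..e} y2"
    and d1: "\<And>t. t \<in> {s<..<e} \<Longrightarrow> (x1 has_real_derivative y1 t) (at t)"
      "\<And>t. t \<in> {s<..<e} \<Longrightarrow> (y1 has_real_derivative a * y1 t + h (x1 t)) (at t)"
    and d2: "\<And>t. t \<in> {s<..<e} \<Longrightarrow> (x2 has_real_derivative y2 t) (at t)"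
      "\<And>t. t \<in> {s<..<e} \<Longrightarrow> (y2 has_real_derivative a * y2 t + h (x2 t)) (at t)"
    and eq: "x1 s = x2 s" "y1 s = y2 s" and t: "t \<in> {s..e}"
  shows "x1 t = x2 t" "y1 t = y2 t"
proof -
  have "bounded (x1 ` {s..e})" "bounded (x2 ` {s..e})"
    using c by (auto intro!: compact_imp_bounded compact_continuous_image)
  then obtain M1 M2 where M: "\<And>t. t \<in> {s..e} \<Longrightarrow> \<bar>x1 t\<bar> \<le> M1" "\<And>t. t \<in> {s..e} \<Longrightarrow> \<bar>x2 t\<bar> \<le> M2"
    unfolding bounded_iff by (metis image_eqI real_norm_def)
  define M where "M = max M1 M2"
  have xM: "x1 t \<in> {-M..M}" "x2 t \<in> {-M..M}" if "t \<in> {s..e}" for t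
    using M(1)[OF that] M(2)[OF that] by (auto simp: M_def abs_le_iff)
  obtain G where G: "G \<ge> 0" "\<forall>x\<in>{-M..M}. \<forall>y\<in>{-M..M}. \<bar>h x - h y\<bar> \<le> G * \<bar>x - y\<bar>"
    using lip by blast
  define D where "D = (\<lambda>r. (x1 (s + r) - x2 (s + r))\<^sup>2 + (y1 (s + r) - y2 (s + r))\<^sup>2)"
  define D' where "D' = (\<lambda>r. 2 * (x1 (s + r) - x2 (s + r)) * (y1 (s + r) - y2 (s + r)) +
    2 * (y1 (s + r) - y2 (s + r)) * (a * (y1 (s + r) - y2 (s + r)) + (h (x1 (s + r)) - h (x2 (s + r)))))"
  have D0: "D (t - s) = 0"
  proof (rule volterra_unique[where \<delta> = D and T = "e - s" and \<delta>' = D' and C = "1 + 2 * \<bar>a\<bar> + G"])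
    show "continuous_on {0..e - s} D" unfolding D_def
      by (intro continuous_intros continuous_on_compose2[OF c(1)] continuous_on_compose2[OF c(2)]
          continuous_on_compose2[OF c(3)] continuous_on_compose2[OF c(4)]) auto
    show "D 0 = 0" using eq by (simp add: D_def)
    show "0 < 1 + 2 * \<bar>a\<bar> + G" using G by linarith
    show "0 \<le> e - s" "t - s \<in> {0..e - s}" using t by auto
  next
    fix r assume r: "r \<in> {0<..<e - s}"
    then have sr: "s + r \<in> {s<..<e}" "s + r \<in> {s..e}" by auto
    have sh: "((\<lambda>r. g (s + r)) has_real_derivative g') (at r)" if "(g has_real_derivative g') (at (s + r))" for g g'
      using DERIV_shift[of g g' r s] that by (simp add: add.commute)
    show "(D has_real_derivative D' r) (at r)" unfolding D_def D'_def
      by (rule derivative_eq_intros sh[OF d1(1)] sh[OF d2(1)] sh[OF d1(2)] sh[OF d2(2)] sr(1) refl)+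
         (simp add: algebra_simps)
    fix b assume b: "\<And>u. u \<in> {0..r} \<Longrightarrow> \<bar>D u\<bar> \<le> b"
    define p where "p = x1 (s + r) - x2 (s + r)"
    define g where "g = y1 (s + r) - y2 (s + r)"
    define H where "H = h (x1 (s + r)) - h (x2 (s + r))"
    have H: "\<bar>H\<bar> \<le> G * \<bar>p\<bar>" using G xM[OF sr(2)] unfolding H_def p_def by blast
    have pg: "2 * (\<bar>p\<bar> * \<bar>g\<bar>) \<le> p\<^sup>2 + g\<^sup>2"
      using sum_squares_bound[of "\<bar>p\<bar>" "\<bar>g\<bar>"] by simp
    have "D' r = 2 * (p * g) + 2 * (a * g\<^sup>2) + 2 * (g * H)"
      unfolding D'_def p_def g_def H_def by (simp add: algebra_simps power2_eq_square)
    then have "\<bar>D' r\<bar> \<le> \<bar>2 * (p * g)\<bar> + \<bar>2 * (a * g\<^sup>2)\<bar> + \<bar>2 * (g * H)\<bar>" by linarith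
    also have "\<dots> = 2 * (\<bar>p\<bar> * \<bar>g\<bar>) + 2 * \<bar>a\<bar> * g\<^sup>2 + 2 * (\<bar>g\<bar> * \<bar>H\<bar>)" by (simp add: abs_mult)
    also have "\<dots> \<le> (p\<^sup>2 + g\<^sup>2) + 2 * \<bar>a\<bar> * (p\<^sup>2 + g\<^sup>2) + G * (p\<^sup>2 + g\<^sup>2)"
    proof (intro add_mono pg mult_left_mono)
      have "2 * (\<bar>g\<bar> * \<bar>H\<bar>) \<le> 2 * (\<bar>g\<bar> * (G * \<bar>p\<bar>))" using H by (intro mult_left_mono) auto
      also have "\<dots> = G * (2 * (\<bar>p\<bar> * \<bar>g\<bar>))" by simp
      also have "\<dots> \<le> G * (p\<^sup>2 + g\<^sup>2)" using pg G by (intro mult_left_mono) auto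
      finally show "2 * (\<bar>g\<bar> * \<bar>H\<bar>) \<le> G * (p\<^sup>2 + g\<^sup>2)" .
    qed auto
    also have "\<dots> = (1 + 2 * \<bar>a\<bar> + G) * D r" by (simp add: D_def p_def g_def algebra_simps)
    also have "\<dots> \<le> (1 + 2 * \<bar>a\<bar> + G) * b" using b[of r] r G by (intro mult_left_mono) auto
    finally show "\<bar>D' r\<bar> \<le> (1 + 2 * \<bar>a\<bar> + G) * b" .
  qed
  then show "x1 t = x2 t" "y1 t = y2 t" by (simp_all add: D_def sum_power2_eq_zero_iff)
qed

lemma nonlin_locally_lipschitz:
  assumes "q > 2"
  shows "\<exists>G\<ge>0. \<forall>x\<in>{-M..M}. \<forall>y\<in>{-M..M}. \<bar>nonlin q x - nonlin q y\<bar> \<le> G * \<bar>x - y\<bar>"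
proof (cases "M \<ge> 0")
  case True
  show ?thesis
  proof (intro exI conjI ballI)
    show "(q - 1) * M powr (q - 2) \<ge> 0" using assms by simp
  qed (rule nonlin_lipschitz[OF assms True])
next
  case False then show ?thesis by (intro exI[of _ 0]) auto
qed

lemma affine_nonlin_locally_lipschitz:
  fixes b k :: real
  assumes "q > 2"
  shows "\<exists>G\<ge>0. \<forall>x\<in>{-M..M}. \<forall>y\<in>{-M..M}. \<bar>(b * x - k * nonlin q x) - (b * y - k * nonlin q y)\<bar> \<le> G * \<bar>x - y\<bar>"
proof -
  obtain G where G: "G \<ge> 0" "\<forall>x\<in>{-M..M}. \<forall>y\<in>{-M..M}. \<bar>nonlin q x - nonlin q y\<bar> \<le> G * \<bar>x - y\<bar>"
    using nonlin_locally_lipschitz[OF assms] by blast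
  have "\<bar>(b * x - k * nonlin q x) - (b * y - k * nonlin q y)\<bar> \<le> (\<bar>b\<bar> + \<bar>k\<bar> * G) * \<bar>x - y\<bar>"
    if "x \<in> {-M..M}" "y \<in> {-M..M}" for x y
  proof -
    have "(b * x - k * nonlin q x) - (b * y - k * nonlin q y) = b * (x - y) - k * (nonlin q x - nonlin q y)"
      by (simp add: algebra_simps)
    then have "\<bar>(b * x - k * nonlin q x) - (b * y - k * nonlin q y)\<bar>
       \<le> \<bar>b * (x - y)\<bar> + \<bar>k * (nonlin q x - nonlin q y)\<bar>" by linarith
    also have "\<dots> = \<bar>b\<bar> * \<bar>x - y\<bar> + \<bar>k\<bar> * \<bar>nonlin q x - nonlin q y\<bar>" by (simp add: abs_mult)
    also have "\<dots> \<le> \<bar>b\<bar> * \<bar>x - y\<bar> + \<bar>k\<bar> * (G * \<bar>x - y\<bar>)"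
      using G(2) that by (intro add_left_mono mult_left_mono) auto
    finally show ?thesis by (simp add: algebra_simps)
  qed
  then show ?thesis using G(1) by (intro exI[of _ "\<bar>b\<bar> + \<bar>k\<bar> * G"]) auto
qed

context emden
begin

section \<open>Emden--Fowler coordinates and the singular initial value problem\<close>

text \<open>For either root \<open>\<sigma>\<close> of the characteristic equation, that is, \<open>\<sigma> = \<alpha>\<close> or \<open>\<sigma> = - \<mu>\<close>, the function
  \<open>w = exp (- \<sigma> * t) * x\<close> of \<open>z = exp (\<sigma> * (q - 2) * t)\<close> solves the equation with a regular singular
  point, and \<open>w\<close> at \<open>z = 0\<close> is the coefficient \<open>d\<close> of the asymptotics \<open>d * exp (\<sigma> * t)\<close>. For \<open>\<sigma> = \<alpha>\<close>
  the point \<open>z = 0\<close> is \<open>t = - \<infinity>\<close>, for \<open>\<sigma> = - \<mu>\<close> it is \<open>t = \<infinity>\<close>.\<close>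

text \<open>The coefficient \<open>k\<close> is free, as the outer system has \<open>k = - \<kappa>\<close>; derivatives are two-sided, in
  contrast to \<open>sol\<close>.\<close>

definition flow :: "real \<Rightarrow> (real \<Rightarrow> real) \<Rightarrow> (real \<Rightarrow> real) \<Rightarrow> real set \<Rightarrow> bool" where
  "flow k x y I \<longleftrightarrow> (\<forall>t\<in>I. (x has_real_derivative y t) (at t) \<and>
     (y has_real_derivative A * y t + B * x t - k * nonlin q (x t)) (at t))"

lemma sol_flow: "open I \<Longrightarrow> sol x y I \<longleftrightarrow> flow K x y I"
  unfolding sol_def flow_def by (auto simp: at_within_open_NO_MATCH)

lemma flow_sol: "flow K x y I \<Longrightarrow> sol x y I"
  unfolding sol_def flow_def by (auto intro: has_field_derivative_at_within)

lemma flow_subset: "flow k x y I \<Longrightarrow> J \<subseteq> I \<Longrightarrow> flow k x y J"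
  unfolding flow_def by auto

lemma ivp_flow:
  assumes \<sigma>: "\<sigma>\<^sup>2 = A * \<sigma> + B" "\<sigma> \<noteq> 0" and \<gamma>: "\<gamma> = \<sigma> * (q - 2)"
    and \<nu>: "\<nu> = 1 + (2 * \<sigma> - A) / \<gamma>" and c: "c = - k / \<gamma>\<^sup>2"
    and w: "\<And>t. t \<in> I \<Longrightarrow> (w has_real_derivative p (exp (\<gamma> * t))) (at (exp (\<gamma> * t)))"
    and p: "\<And>t. t \<in> I \<Longrightarrow> (p has_real_derivative (c * nonlin q (w (exp (\<gamma> * t))) - \<nu> * p (exp (\<gamma> * t))) / exp (\<gamma> * t)) (at (exp (\<gamma> * t)))"
  shows "flow k (\<lambda>t. exp (\<sigma> * t) * w (exp (\<gamma> * t)))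
    (\<lambda>t. exp (\<sigma> * t) * (\<sigma> * w (exp (\<gamma> * t)) + \<gamma> * exp (\<gamma> * t) * p (exp (\<gamma> * t)))) I"
  unfolding flow_def
proof
  fix t assume t: "t \<in> I"
  define z where "z = exp (\<gamma> * t)"
  have z: "z > 0" by (simp add: z_def)
  have \<gamma>0: "\<gamma> \<noteq> 0" using \<sigma> q2 \<gamma> by simp
  have de: "((\<lambda>t. exp (a * t)) has_real_derivative a * exp (a * t)) (at t)" for a
    by (auto intro!: derivative_eq_intros)
  have dw: "((\<lambda>t. w (exp (\<gamma> * t))) has_real_derivative p z * (\<gamma> * z)) (at t)"
    using DERIV_chain2[OF w[OF t] de] by (simp add: z_def)
  have dp: "((\<lambda>t. p (exp (\<gamma> * t))) has_real_derivative (c * nonlin q (w z) - \<nu> * p z) * \<gamma>) (at t)"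
    using DERIV_chain2[OF p[OF t] de] by (simp add: z_def)
  have D1: "((\<lambda>t. exp (\<sigma> * t) * w (exp (\<gamma> * t))) has_real_derivative
     \<sigma> * exp (\<sigma> * t) * w z + p z * (\<gamma> * z) * exp (\<sigma> * t)) (at t)"
    using DERIV_mult[OF de dw] by (simp add: z_def)
  have D2: "((\<lambda>t. exp (\<sigma> * t) * (\<sigma> * w (exp (\<gamma> * t)) + \<gamma> * exp (\<gamma> * t) * p (exp (\<gamma> * t)))) has_real_derivative
     \<sigma> * exp (\<sigma> * t) * (\<sigma> * w z + \<gamma> * z * p z) +
     (\<sigma> * (p z * (\<gamma> * z)) + (\<gamma> * (\<gamma> * z) * p z + (c * nonlin q (w z) - \<nu> * p z) * \<gamma> * (\<gamma> * z))) * exp (\<sigma> * t)) (at t)"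
    using DERIV_mult[OF de[of \<sigma>] DERIV_add[OF DERIV_cmult[OF dw, of \<sigma>] DERIV_mult[OF DERIV_cmult[OF de[of \<gamma>], of \<gamma>] dp]]]
    by (simp add: z_def)
  have EQ: "\<sigma> * exp (\<sigma> * t) * (\<sigma> * w z + \<gamma> * z * p z) +
     (\<sigma> * (p z * (\<gamma> * z)) + (\<gamma> * (\<gamma> * z) * p z + (c * nonlin q (w z) - \<nu> * p z) * \<gamma> * (\<gamma> * z))) * exp (\<sigma> * t)
   = A * (exp (\<sigma> * t) * (\<sigma> * w z + \<gamma> * z * p z)) + B * (exp (\<sigma> * t) * w z) - k * nonlin q (exp (\<sigma> * t) * w z)"
  proof -
    have e1: "nonlin q (exp (\<sigma> * t) * w z) = exp (\<sigma> * t) * z * nonlin q (w z)"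
    proof -
      have "exp (\<sigma> * t) powr (q - 1) = exp (\<sigma> * t) * z"
        unfolding z_def \<gamma> by (simp add: powr_def flip: exp_add) (simp add: algebra_simps)
      then show ?thesis using nonlin_mult[of "exp (\<sigma> * t)" q "w z"] by simp
    qed
    have e2: "c * \<gamma>\<^sup>2 = - k" using \<gamma>0 by (simp add: c)
    have e3: "\<nu> * \<gamma> = \<gamma> + 2 * \<sigma> - A" using \<gamma>0 by (simp add: \<nu> field_simps)
    have "\<sigma> * exp (\<sigma> * t) * (\<sigma> * w z + \<gamma> * z * p z) +
      (\<sigma> * (p z * (\<gamma> * z)) + (\<gamma> * (\<gamma> * z) * p z + (c * nonlin q (w z) - \<nu> * p z) * \<gamma> * (\<gamma> * z))) * exp (\<sigma> * t)
      = exp (\<sigma> * t) * (\<sigma>\<^sup>2 * w z + (2 * \<sigma> + \<gamma>) * (\<gamma> * z * p z) + (c * \<gamma>\<^sup>2) * z * nonlin q (w z) - (\<nu> * \<gamma>) * (\<gamma> * z * p z))"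
      by (simp add: algebra_simps power2_eq_square)
    also have "\<dots> = exp (\<sigma> * t) * ((A * \<sigma> + B) * w z + (2 * \<sigma> + \<gamma>) * (\<gamma> * z * p z) - k * z * nonlin q (w z) - (\<gamma> + 2 * \<sigma> - A) * (\<gamma> * z * p z))"
      unfolding e2 e3 \<sigma>(1) by simp
    finally show ?thesis unfolding e1 by (simp add: algebra_simps)
  qed
  show "((\<lambda>t. exp (\<sigma> * t) * w (exp (\<gamma> * t))) has_real_derivative
       exp (\<sigma> * t) * (\<sigma> * w (exp (\<gamma> * t)) + \<gamma> * exp (\<gamma> * t) * p (exp (\<gamma> * t)))) (at t) \<and>
     ((\<lambda>t. exp (\<sigma> * t) * (\<sigma> * w (exp (\<gamma> * t)) + \<gamma> * exp (\<gamma> * t) * p (exp (\<gamma> * t)))) has_real_derivative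
       A * (exp (\<sigma> * t) * (\<sigma> * w (exp (\<gamma> * t)) + \<gamma> * exp (\<gamma> * t) * p (exp (\<gamma> * t)))) +
       B * (exp (\<sigma> * t) * w (exp (\<gamma> * t))) - k * nonlin q (exp (\<sigma> * t) * w (exp (\<gamma> * t)))) (at t)"
    unfolding z_def[symmetric] using D2[unfolded EQ]
    by (intro conjI DERIV_cong[OF D1]) (simp_all add: algebra_simps)
qed

text \<open>The inverse of the substitution in \<open>ivp_flow\<close>.\<close>

lemma flow_ivp:
  assumes \<sigma>: "\<sigma>\<^sup>2 = A * \<sigma> + B" "\<sigma> \<noteq> 0" and \<gamma>: "\<gamma> = \<sigma> * (q - 2)"
    and \<nu>: "\<nu> = 1 + (2 * \<sigma> - A) / \<gamma>" and c: "c = - k / \<gamma>\<^sup>2"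
    and fl: "flow k x y I" and z: "z > 0" "ln z / \<gamma> \<in> I"
  defines "w \<equiv> \<lambda>z. exp (- \<sigma> * (ln z / \<gamma>)) * x (ln z / \<gamma>)"
    and "p \<equiv> \<lambda>z. exp (- \<sigma> * (ln z / \<gamma>)) * (y (ln z / \<gamma>) - \<sigma> * x (ln z / \<gamma>)) / (\<gamma> * z)"
  shows "(w has_real_derivative p z) (at z)"
    "(p has_real_derivative (c * nonlin q (w z) - \<nu> * p z) / z) (at z)"
proof -
  define t where "t = ln z / \<gamma>"
  have \<gamma>0: "\<gamma> \<noteq> 0" using \<sigma> q2 \<gamma> by simp
  have zt: "z = exp (\<gamma> * t)" using z(1) \<gamma>0 by (simp add: t_def)
  have dl: "((\<lambda>z. ln z / \<gamma>) has_real_derivative 1 / (\<gamma> * z)) (at z)"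
    using z(1) \<gamma>0 by (auto intro!: derivative_eq_intros)
  have dx: "((\<lambda>z. x (ln z / \<gamma>)) has_real_derivative y t * (1 / (\<gamma> * z))) (at z)"
    using fl z(2) unfolding flow_def t_def by (intro DERIV_chain2[OF _ dl]) auto
  have dy: "((\<lambda>z. y (ln z / \<gamma>)) has_real_derivative (A * y t + B * x t - k * nonlin q (x t)) * (1 / (\<gamma> * z))) (at z)"
    using fl z(2) unfolding flow_def t_def by (intro DERIV_chain2[OF _ dl]) auto
  define E where "E = exp (- \<sigma> * t)"
  have dE: "((\<lambda>z. exp (- \<sigma> * (ln z / \<gamma>))) has_real_derivative E * (- \<sigma> * (1 / (\<gamma> * z)))) (at z)"
    unfolding E_def t_def by (rule DERIV_chain2[OF DERIV_exp DERIV_cmult[OF dl]])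
  have wz: "w z = E * x t" and pz: "p z = E * (y t - \<sigma> * x t) / (\<gamma> * z)"
    by (simp_all add: w_def p_def E_def t_def)
  have "(w has_real_derivative E * (- \<sigma> * (1 / (\<gamma> * z))) * x t + y t * (1 / (\<gamma> * z)) * E) (at z)"
    unfolding w_def using DERIV_mult[OF dE dx] by (simp add: E_def t_def)
  moreover have "E * (- \<sigma> * (1 / (\<gamma> * z))) * x t + y t * (1 / (\<gamma> * z)) * E = p z"
    unfolding pz by (simp add: field_simps diff_divide_distrib)
  ultimately show "(w has_real_derivative p z) (at z)" by simp
  define g where "g = y t - \<sigma> * x t"
  define g' where "g' = (A * y t + B * x t - k * nonlin q (x t)) - \<sigma> * y t"
  have dg: "((\<lambda>z. y (ln z / \<gamma>) - \<sigma> * x (ln z / \<gamma>)) has_real_derivative g' * (1 / (\<gamma> * z))) (at z)"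
    using DERIV_diff[OF dy DERIV_cmult[OF dx, of \<sigma>]] by (simp add: g'_def algebra_simps diff_divide_distrib add_divide_distrib)
  have "(p has_real_derivative ((E * (- \<sigma> * (1 / (\<gamma> * z))) * g + g' * (1 / (\<gamma> * z)) * E) * (\<gamma> * z)
      - E * g * \<gamma>) / ((\<gamma> * z) * (\<gamma> * z))) (at z)"
    unfolding p_def
    using DERIV_quotient[OF DERIV_mult[OF dE dg] DERIV_cmult[OF DERIV_ident, of \<gamma> z UNIV]] \<gamma>0 z(1)
    by (simp add: E_def t_def g_def power2_eq_square mult_ac)
  moreover have "((E * (- \<sigma> * (1 / (\<gamma> * z))) * g + g' * (1 / (\<gamma> * z)) * E) * (\<gamma> * z)
      - E * g * \<gamma>) / ((\<gamma> * z) * (\<gamma> * z)) = (c * nonlin q (w z) - \<nu> * p z) / z"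
  proof -
    have e1: "nonlin q (w z) = E / z * nonlin q (x t)"
    proof -
      have "E powr (q - 1) = E / z"
        unfolding E_def zt \<gamma> by (simp add: powr_def flip: exp_diff) (simp add: algebra_simps)
      then show ?thesis unfolding wz using nonlin_mult[of E q "x t"] by (simp add: E_def)
    qed
    have e2: "c = - k / (\<gamma> * \<gamma>)" by (simp add: c power2_eq_square)
    have e3: "\<nu> = (\<gamma> + 2 * \<sigma> - A) / \<gamma>" using \<gamma>0 by (simp add: \<nu> field_simps)
    have e4: "- \<sigma> * g + g' - g * \<gamma> = - k * nonlin q (x t) - (\<gamma> + 2 * \<sigma> - A) * g"
    proof -
      have "g' = (A - \<sigma>) * y t + (\<sigma>\<^sup>2 - A * \<sigma>) * x t - k * nonlin q (x t)"
        using \<sigma>(1) by (simp add: g'_def algebra_simps)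
      then show ?thesis by (simp add: g_def algebra_simps power2_eq_square)
    qed
    have "((E * (- \<sigma> * (1 / (\<gamma> * z))) * g + g' * (1 / (\<gamma> * z)) * E) * (\<gamma> * z)
      - E * g * \<gamma>) / ((\<gamma> * z) * (\<gamma> * z)) = E * (- \<sigma> * g + g' - g * \<gamma>) / ((\<gamma> * z) * (\<gamma> * z))"
      using \<gamma>0 z(1) by (simp add: field_simps)
    also have "\<dots> = (c * nonlin q (w z) - \<nu> * p z) / z"
      unfolding e4 e1 e2 e3 pz g_def[symmetric] using \<gamma>0 z(1) by (simp add: field_simps)
    finally show ?thesis .
  qed
  ultimately show "(p has_real_derivative (c * nonlin q (w z) - \<nu> * p z) / z) (at z)" by simp
qed

text \<open>A trajectory is determined by its coefficient \<open>d\<close> at the end where \<open>exp (\<sigma> * t)\<close> tends to 0; this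
  is \<open>singular_ivp_unique\<close> in the variable \<open>z\<close>. The condition on \<open>t\<close> describes the half-line at that end
  for either sign of \<open>\<sigma>\<close>.\<close>

lemma flow_unique_asymptotic:
  assumes \<sigma>: "\<sigma>\<^sup>2 = A * \<sigma> + B" "\<sigma> \<noteq> 0" and \<nu>: "(2 * \<sigma> - A) / (\<sigma> * (q - 2)) \<ge> 0"
    and 1: "flow k xa ya {t. \<sigma> * t < \<sigma> * T}" and 2: "flow k xb yb {t. \<sigma> * t < \<sigma> * T}"
    and l1: "((\<lambda>t. exp (- \<sigma> * t) * xa t) \<longlongrightarrow> d) (if \<sigma> > 0 then at_bot else at_top)"
    and l2: "((\<lambda>t. exp (- \<sigma> * t) * xb t) \<longlongrightarrow> d) (if \<sigma> > 0 then at_bot else at_top)"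
    and t: "\<sigma> * t < \<sigma> * T"
  shows "xa t = xb t"
proof -
  define \<gamma> where "\<gamma> = \<sigma> * (q - 2)"
  define c where "c = - k / \<gamma>\<^sup>2"
  define n where "n = 1 + (2 * \<sigma> - A) / \<gamma>"
  have \<gamma>0: "\<gamma> \<noteq> 0" using \<sigma> q2 \<gamma>_def by simp
  have in_I: "\<sigma> * (ln z / \<gamma>) < \<sigma> * T" if "z \<in> {0<..<exp (\<gamma> * T)}" for z
  proof -
    have "ln z < ln (exp (\<gamma> * T))" using that by (subst ln_less_cancel_iff) auto
    then have "ln z < \<gamma> * T" by simp
    then have "ln z / (q - 2) < \<gamma> * T / (q - 2)" using q2 by (intro divide_strict_right_mono) auto
    moreover have "\<sigma> * (ln z / \<gamma>) = ln z / (q - 2)" "\<gamma> * T / (q - 2) = \<sigma> * T"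
      using \<sigma>(2) q2 by (simp_all add: \<gamma>_def)
    ultimately show ?thesis by simp
  qed
  have fl: "filterlim (\<lambda>z. ln z / \<gamma>) (if \<sigma> > 0 then at_bot else at_top) (at_right 0)"
  proof (cases "\<sigma> > 0")
    case True
    then have "1 / \<gamma> > 0" using q2 by (simp add: \<gamma>_def)
    then show ?thesis using True filterlim_tendsto_pos_mult_at_bot[OF tendsto_const[of "1/\<gamma>"] _ ln_at_0] by simp
  next
    case False
    then have "1 / \<gamma> < 0" using q2 \<sigma>(2) by (simp add: \<gamma>_def mult_neg_pos)
    then have "filterlim (\<lambda>z. - (1 / \<gamma>) * ln z) at_bot (at_right 0)"
      using filterlim_tendsto_pos_mult_at_bot[OF tendsto_const[of "-(1/\<gamma>)"] _ ln_at_0] by simp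
    then have "filterlim (\<lambda>z. ln z / \<gamma>) at_top (at_right 0)"
      by (subst filterlim_uminus_at_top) simp
    then show ?thesis using False by simp
  qed
  define W where "W x z = exp (- \<sigma> * (ln z / \<gamma>)) * x (ln z / \<gamma>)" for x z
  have "W xa (exp (\<gamma> * t)) = W xb (exp (\<gamma> * t))"
  proof (rule singular_ivp_unique[where ?u1.0 = "W xa" and ?u2.0 = "W xb" and t = "exp (\<gamma> * t)" and Z = "exp (\<gamma> * T)" and f = "nonlin q" and \<nu> = n and c = c and d = d])
    show "n \<ge> 1" using \<nu> by (simp add: n_def \<gamma>_def)
    show "\<exists>G\<ge>0. \<forall>x\<in>{-M..M}. \<forall>y\<in>{-M..M}. \<bar>nonlin q x - nonlin q y\<bar> \<le> G * \<bar>x - y\<bar>" for M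
      by (rule nonlin_locally_lipschitz[OF q2])
    have "(q - 2) * (\<sigma> * t) < (q - 2) * (\<sigma> * T)" using t q2 by (intro mult_strict_left_mono[OF t]) auto
    then have "\<gamma> * t < \<gamma> * T" by (simp add: \<gamma>_def mult_ac)
    then show "exp (\<gamma> * t) \<in> {0<..<exp (\<gamma> * T)}" by simp
    show "(W xa \<longlongrightarrow> d) (at_right 0)" "(W xb \<longlongrightarrow> d) (at_right 0)"
      unfolding W_def using filterlim_compose[OF l1 fl] filterlim_compose[OF l2 fl] by auto
  next
    fix z assume z: "z \<in> {0<..<exp (\<gamma> * T)}"
    have z': "z > 0" "ln z / \<gamma> \<in> {t. \<sigma> * t < \<sigma> * T}" using z in_I by auto
    from flow_ivp[OF \<sigma> \<gamma>_def n_def c_def 1 z'] flow_ivp[OF \<sigma> \<gamma>_def n_def c_def 2 z']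
    show "(W xa has_real_derivative exp (- \<sigma> * (ln z / \<gamma>)) * (ya (ln z / \<gamma>) - \<sigma> * xa (ln z / \<gamma>)) / (\<gamma> * z)) (at z)"
      "((\<lambda>z. exp (- \<sigma> * (ln z / \<gamma>)) * (ya (ln z / \<gamma>) - \<sigma> * xa (ln z / \<gamma>)) / (\<gamma> * z)) has_real_derivative
        (c * nonlin q (W xa z) - n * (exp (- \<sigma> * (ln z / \<gamma>)) * (ya (ln z / \<gamma>) - \<sigma> * xa (ln z / \<gamma>)) / (\<gamma> * z))) / z) (at z)"
      "(W xb has_real_derivative exp (- \<sigma> * (ln z / \<gamma>)) * (yb (ln z / \<gamma>) - \<sigma> * xb (ln z / \<gamma>)) / (\<gamma> * z)) (at z)"
      "((\<lambda>z. exp (- \<sigma> * (ln z / \<gamma>)) * (yb (ln z / \<gamma>) - \<sigma> * xb (ln z / \<gamma>)) / (\<gamma> * z)) has_real_derivative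
        (c * nonlin q (W xb z) - n * (exp (- \<sigma> * (ln z / \<gamma>)) * (yb (ln z / \<gamma>) - \<sigma> * xb (ln z / \<gamma>)) / (\<gamma> * z))) / z) (at z)"
      unfolding W_def by auto
  qed
  then show ?thesis using \<gamma>0 by (simp add: W_def)
qed

lemma \<alpha>_root: "\<alpha>\<^sup>2 = A * \<alpha> + B" and \<mu>_root: "(-\<mu>)\<^sup>2 = A * (-\<mu>) + B"
  by (simp_all add: A_def B_def power2_eq_square algebra_simps)

section \<open>Global solutions of the inner system\<close>

text \<open>The regular solution with value 1 at the origin, in the variable \<open>r\<^sup>2\<close>, and its Emden--Fowler
  form. It is global: while \<open>\<bar>u\<bar> < 2\<close> the truncated equation is the true one, whose energy \<open>H\<close> decreases
  and hence keeps \<open>\<bar>u\<bar> \<le> 1\<close>.\<close>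

lemma regular_sol_exists:
  "\<exists>u p x y. u 0 = 1 \<and> continuous_on {0..} p \<and>
     (\<forall>t\<ge>0. (u has_real_derivative p t) (at t within {0..})) \<and>
     sol x y UNIV \<and> (\<forall>t. x t = exp (\<alpha> * t) * u (exp (2 * t))) \<and>
     (\<forall>t. y t = exp (\<alpha> * t) * (\<alpha> * u (exp (2 * t)) + 2 * exp (2 * t) * p (exp (2 * t))))"
proof -
  define \<nu> where "\<nu> = 1 + (2 * \<alpha> - A) / 2"
  define c where "c = - K / 2\<^sup>2"
  define g where "g = (\<lambda>x. nonlin q (clamp_real (-2) 2 x))"
  have \<nu>1: "\<nu> > 1" using \<mu>0 \<mu>\<alpha> by (simp add: \<nu>_def A_def)
  have c0: "c < 0" using K0 by (simp add: c_def)
  have Gl: "\<bar>g x - g y\<bar> \<le> (q - 1) * 2 powr (q - 2) * \<bar>x - y\<bar>" for x y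
    unfolding g_def by (rule clamp_nonlin_lipschitz[OF q2]) auto
  have G0: "0 \<le> (q - 1) * 2 powr (q - 2)" using q2 by simp
  obtain u p where u: "u 0 = 1" "continuous_on {0..} p"
    "\<And>t. t \<ge> 0 \<Longrightarrow> (u has_real_derivative p t) (at t within {0..})"
    "\<And>t. t > 0 \<Longrightarrow> (p has_real_derivative (c * g (u t) - \<nu> * p t) / t) (at t)"
    using singular_ivp_exists[where g = g and d = 1 and c = c, OF \<nu>1 G0 Gl] by blast
  have cu: "continuous_on {0..} u" by (rule DERIV_continuous_on[of _ u p]) (use u(3) in auto)
  have du: "(u has_real_derivative p t) (at t)" if "t > 0" for t
    using has_real_derivative_within_atLeast_at[OF u(3)] that by auto
  have small: "\<bar>u t\<bar> < 2" if t: "t \<ge> 0" for t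
  proof (rule ccontr)
    assume big: "\<not> \<bar>u t\<bar> < 2"
    have "continuous_on {0..t} (\<lambda>s. 2 - \<bar>u s\<bar>)"
      by (intro continuous_intros continuous_on_subset[OF cu]) auto
    then obtain \<tau> where \<tau>: "0 < \<tau>" "\<bar>u \<tau>\<bar> = 2" "\<forall>s\<in>{0..<\<tau>}. \<bar>u s\<bar> < 2"
      using first_zero[of 0 t "\<lambda>s. 2 - \<bar>u s\<bar>"] big t u(1) by auto
    have \<tau>0: "0 \<le> \<tau>" using \<tau> by simp
    \<comment> \<open>an energy of the singular equation, dissipated because of \<open>\<nu> > 1/2\<close>\<close>
    define H where "H = (\<lambda>s. s * (p s)\<^sup>2 / 2 - c * (\<bar>u s\<bar> powr q / q))"
    have cabs: "continuous_on {0..\<tau>} (\<lambda>s. \<bar>u s\<bar> powr q / q)"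
    proof -
      have "continuous_on UNIV (\<lambda>x. \<bar>x\<bar> powr q / q)"
        using powr_abs_deriv_ge2[of q] q2 by (intro continuous_at_imp_continuous_on ballI DERIV_isCont) auto
      from continuous_on_compose2[OF this continuous_on_subset[OF cu, of "{0..\<tau>}"]] show ?thesis by auto
    qed
    have "H \<tau> \<le> H 0"
    proof (rule DERIV_nonpos_imp_decreasing_open[where f = H])
      show "continuous_on {0..\<tau>} H" unfolding H_def
        by (intro continuous_intros cabs continuous_on_subset[OF u(2)]) auto
      fix s assume s: "0 < s" "s < \<tau>"
      have gs: "g (u s) = nonlin q (u s)" using \<tau>(3)[rule_format, of s] s by (simp add: g_def clamp_real_id abs_less_iff)
      have d1: "((\<lambda>s. s * (p s)\<^sup>2 / 2) has_real_derivative
          (1 * (p s)\<^sup>2 + (2 * p s * ((c * g (u s) - \<nu> * p s) / s)) * s) / 2) (at s)"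
        using DERIV_cdivide[OF DERIV_mult[OF DERIV_ident DERIV_power[OF u(4)[OF s(1)], of 2]], of 2]
        by (simp add: mult_ac)
      have d2: "((\<lambda>s. \<bar>u s\<bar> powr q / q) has_real_derivative nonlin q (u s) * p s) (at s)"
        using DERIV_chain2[OF powr_abs_deriv_ge2 du[OF s(1)], of q] q2 by (simp add: nonlin_def)
      have "(H has_real_derivative (1 * (p s)\<^sup>2 + (2 * p s * ((c * g (u s) - \<nu> * p s) / s)) * s) / 2
          - c * (nonlin q (u s) * p s)) (at s)"
        unfolding H_def by (intro DERIV_diff d1 DERIV_cmult d2)
      moreover have "(1 * (p s)\<^sup>2 + (2 * p s * ((c * g (u s) - \<nu> * p s) / s)) * s) / 2
          - c * (nonlin q (u s) * p s) = (1/2 - \<nu>) * (p s)\<^sup>2"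
        using s gs by (simp add: field_simps power2_eq_square)
      moreover have "(1/2 - \<nu>) * (p s)\<^sup>2 \<le> 0" using \<nu>1 by (intro mult_nonpos_nonneg) auto
      ultimately show "\<exists>y. DERIV H s :> y \<and> y \<le> 0" by auto
    qed (rule \<tau>0)
    moreover have "\<tau> * (p \<tau>)\<^sup>2 / 2 \<ge> 0" using \<tau>0 by simp
    moreover have "H 0 = - c * (1 / q)" by (simp add: H_def u(1))
    ultimately have "- c * (\<bar>u \<tau>\<bar> powr q / q) \<le> - c * (1 / q)" unfolding H_def by linarith
    then have "\<bar>u \<tau>\<bar> powr q / q \<le> 1 / q" by (subst (asm) mult_le_cancel_left_pos) (use c0 in auto)
    then have "\<bar>u \<tau>\<bar> powr q \<le> 1" using q2 by (simp add: divide_le_cancel)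
    moreover have "\<bar>u \<tau>\<bar> powr q > 1 powr q" using \<tau>(2) q2 by (intro powr_less_mono2) auto
    ultimately show False by simp
  qed
  have gu: "g (u t) = nonlin q (u t)" if "t \<ge> 0" for t
    using small[OF that] by (simp add: g_def clamp_real_id abs_less_iff)
  have fl: "flow K (\<lambda>t. exp (\<alpha> * t) * u (exp (2 * t)))
    (\<lambda>t. exp (\<alpha> * t) * (\<alpha> * u (exp (2 * t)) + 2 * exp (2 * t) * p (exp (2 * t)))) UNIV"
  proof (rule ivp_flow[OF \<alpha>_root])
    show "\<alpha> \<noteq> 0" "2 = \<alpha> * (q - 2)" using \<alpha>0 \<alpha>q by auto
    show "\<nu> = 1 + (2 * \<alpha> - A) / 2" "c = - K / 2\<^sup>2" by (simp_all add: \<nu>_def c_def)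
    fix t :: real
    show "(u has_real_derivative p (exp (2 * t))) (at (exp (2 * t)))" by (rule du) simp
    show "(p has_real_derivative (c * nonlin q (u (exp (2 * t))) - \<nu> * p (exp (2 * t))) / exp (2 * t)) (at (exp (2 * t)))"
      using u(4)[of "exp (2 * t)"] gu[of "exp (2 * t)"] by simp
  qed
  show ?thesis
    by (rule exI[of _ u], rule exI[of _ p], rule exI[of _ "\<lambda>t. exp (\<alpha> * t) * u (exp (2 * t))"],
        rule exI[of _ "\<lambda>t. exp (\<alpha> * t) * (\<alpha> * u (exp (2 * t)) + 2 * exp (2 * t) * p (exp (2 * t)))"])
       (use u flow_sol[OF fl] in auto)
qed

text \<open>Backward in time the energy decreases and the potential is coercive, so trajectories stay
  bounded and the truncation at \<open>M\<close> is never felt. After time reversal the integrated second equation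
  turns the system into a single equation with memory for \<open>x\<close>.\<close>

lemma backward_sol_exists:
  "\<exists>x y. sol x y {..0} \<and> x 0 = X \<and> y 0 = Y"
proof -
  obtain M where M: "M > 0" "\<And>x. \<bar>x\<bar> \<ge> M \<Longrightarrow> pot x > Y\<^sup>2 / 2 + pot X"
    using pot_coercive by blast
  define g where "g = (\<lambda>x. nonlin q (clamp_real (-M) M x))"
  define G where "G = (q - 1) * M powr (q - 2)"
  have Gl: "\<bar>g x - g y\<bar> \<le> G * \<bar>x - y\<bar>" for x y
    unfolding g_def G_def by (rule clamp_nonlin_lipschitz[OF q2]) (use M in auto)
  have G0: "G \<ge> 0" using q2 by (simp add: G_def)
  have cg: "continuous_on S g" for S
    by (rule lipschitz_on_continuous_on[of G]) (use G0 Gl in \<open>auto simp: lipschitz_on_def dist_real_def\<close>)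
  define h where "h = (\<lambda>x. B * x - K * g x)"
  have hl: "\<bar>h x - h y\<bar> \<le> (B + K * G) * \<bar>x - y\<bar>" for x y
  proof -
    have "\<bar>h x - h y\<bar> \<le> \<bar>B * (x - y)\<bar> + \<bar>K * (g x - g y)\<bar>" unfolding h_def right_diff_distrib by linarith
    also have "\<dots> \<le> B * \<bar>x - y\<bar> + K * (G * \<bar>x - y\<bar>)"
      using B0 K0 Gl[of x y] by (simp add: abs_mult)
    finally show ?thesis by (simp add: algebra_simps)
  qed
  have ch: "continuous_on S (\<lambda>x. h (u x))" if "continuous_on S u" for S and u :: "real \<Rightarrow> real"
    unfolding h_def by (intro continuous_intros that continuous_on_compose2[OF cg that]) auto
  define \<Phi> where "\<Phi> u s = - (Y + A * (u s - X) - integral {0..s} (\<lambda>r. h (u r)))" for u :: "real \<Rightarrow> real" and s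
  have c\<Phi>: "continuous_on {0..} (\<Phi> u)" if "continuous_on {0..} u" for u
  proof -
    have "continuous_on {0..} (\<lambda>s. integral {0..s} (\<lambda>r. h (u r)))"
      by (rule DERIV_continuous_on, rule integral_deriv_atLeast[OF ch[OF that]]) auto
    then show ?thesis unfolding \<Phi>_def by (intro continuous_intros that)
  qed
  obtain u where u: "continuous_on {0..} u" "u 0 = X"
    "\<And>t. t \<ge> 0 \<Longrightarrow> (u has_real_derivative \<Phi> u t) (at t within {0..})"
  proof (rule volterra_exists[where \<Phi> = \<Phi> and d = X, OF c\<Phi>])
    fix T :: real assume T: "0 \<le> T"
    have est: "\<bar>\<Phi> u t - \<Phi> v t\<bar> \<le> (A + T * (B + K * G)) * e"
      if uv: "continuous_on {0..} u" "continuous_on {0..} v" "t \<in> {0..T}" "\<forall>s\<in>{0..t}. \<bar>u s - v s\<bar> \<le> e" for u v t e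
    proof -
      have e0: "e \<ge> 0" using uv(3) uv(4)[rule_format, of t] abs_ge_zero[of "u t - v t"] by force
      have i: "(\<lambda>r. h (u r)) integrable_on {0..t}" "(\<lambda>r. h (v r)) integrable_on {0..t}"
        using uv by (auto intro!: integrable_continuous_interval ch intro: continuous_on_subset)
      have "norm (integral {0..t} (\<lambda>r. h (u r) - h (v r))) \<le> integral {0..t} (\<lambda>r. (B + K * G) * e)"
      proof (rule integral_norm_bound_integral)
        fix r assume r: "r \<in> {0..t}"
        have "\<bar>h (u r) - h (v r)\<bar> \<le> (B + K * G) * \<bar>u r - v r\<bar>" by (rule hl)
        also have "\<dots> \<le> (B + K * G) * e" using uv(4) r B0 K0 G0 by (intro mult_left_mono) auto
        finally show "norm (h (u r) - h (v r)) \<le> (B + K * G) * e" by simp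
      qed (use i in \<open>auto intro: integrable_diff\<close>)
      then have I: "\<bar>integral {0..t} (\<lambda>r. h (u r)) - integral {0..t} (\<lambda>r. h (v r))\<bar> \<le> t * ((B + K * G) * e)"
        unfolding integral_diff[OF i] using uv(3) by (simp add: mult_ac)
      also have "\<dots> \<le> T * ((B + K * G) * e)" using uv(3) e0 B0 K0 G0 by (intro mult_right_mono) auto
      finally have I': "\<bar>integral {0..t} (\<lambda>r. h (u r)) - integral {0..t} (\<lambda>r. h (v r))\<bar> \<le> T * ((B + K * G) * e)" .
      have "\<bar>A * (u t - v t)\<bar> \<le> A * e" using uv(3,4) A0 by (auto simp: abs_mult)
      moreover have "\<Phi> u t - \<Phi> v t = - (A * (u t - v t)) + (integral {0..t} (\<lambda>r. h (u r)) - integral {0..t} (\<lambda>r. h (v r)))"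
        by (simp add: \<Phi>_def algebra_simps)
      ultimately have "\<bar>\<Phi> u t - \<Phi> v t\<bar> \<le> A * e + T * ((B + K * G) * e)" using I' by linarith
      then show ?thesis by (simp add: algebra_simps)
    qed
    have "A + T * (B + K * G) > 0" using A0 T B0 K0 G0 by (intro add_pos_nonneg mult_nonneg_nonneg) auto
    then show "\<exists>C>0. \<forall>u v t e. continuous_on {0..} u \<longrightarrow> continuous_on {0..} v \<longrightarrow>
        t \<in> {0..T} \<longrightarrow> (\<forall>s\<in>{0..t}. \<bar>u s - v s\<bar> \<le> e) \<longrightarrow> \<bar>\<Phi> u t - \<Phi> v t\<bar> \<le> C * e"
      using est by blast
  qed auto
  have dI: "((\<lambda>s. integral {0..s} (\<lambda>r. h (u r))) has_real_derivative h (u s)) (at s within {0..})" if "s \<ge> 0" for s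
    by (rule integral_deriv_atLeast[OF ch[OF u(1)] that])
  have d\<Phi>: "(\<Phi> u has_real_derivative - (A * \<Phi> u s - h (u s))) (at s within {0..})" if s: "s \<ge> 0" for s
  proof -
    have "((\<lambda>s. - (Y + A * (u s - X) - integral {0..s} (\<lambda>r. h (u r)))) has_real_derivative
       - (0 + A * (\<Phi> u s - 0) - h (u s))) (at s within {0..})"
      by (intro DERIV_minus DERIV_diff DERIV_add DERIV_const DERIV_cmult u(3)[OF s] dI[OF s])
    moreover have "(\<lambda>s. - (Y + A * (u s - X) - integral {0..s} (\<lambda>r. h (u r)))) = \<Phi> u"
      by (rule ext) (simp add: \<Phi>_def)
    ultimately show ?thesis by simp
  qed
  define x where "x = (\<lambda>t. u (- t))"
  define y where "y = (\<lambda>t. - \<Phi> u (- t))"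
  have refl: "((\<lambda>t. w (- t)) has_real_derivative - w') (at t within {..0})"
    if "(w has_real_derivative w') (at (- t) within {0..})" for w w' t
  proof -
    have "(uminus has_real_derivative -1) (at t within {..0})"
      by (rule DERIV_minus[OF DERIV_ident])
    then show ?thesis
      using DERIV_image_chain[of w w' uminus t "{..0}" "-1"] that by (simp add: o_def image_uminus_atMost)
  qed
  have dx: "(x has_real_derivative y t) (at t within {..0})" if "t \<le> 0" for t
    unfolding x_def y_def by (rule refl[OF u(3)]) (use that in auto)
  have dy: "(y has_real_derivative A * y t + h (x t)) (at t within {..0})" if "t \<le> 0" for t
  proof -
    have "(y has_real_derivative - (- (- (A * \<Phi> u (- t) - h (u (- t)))))) (at t within {..0})"
      unfolding y_def by (intro DERIV_minus refl[OF d\<Phi>]) (use that in auto)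
    then show ?thesis by (simp add: x_def y_def)
  qed
  have x0: "x 0 = X" "y 0 = Y" using u(2) by (simp_all add: x_def y_def \<Phi>_def)
  have cx: "continuous_on {..0} x" "continuous_on {..0} y"
    by (rule DERIV_continuous_on, rule dx, simp) (rule DERIV_continuous_on, rule dy, simp)
  have small: "\<bar>x t\<bar> < M" if t: "t \<le> 0" for t
  proof (rule ccontr)
    assume big: "\<not> \<bar>x t\<bar> < M"
    have "continuous_on {0..- t} (\<lambda>s. M - \<bar>x (- s)\<bar>)"
      by (intro continuous_intros continuous_on_compose2[OF cx(1)]) auto
    moreover have "\<bar>x 0\<bar> < M" using M(2)[of X] x0(1) zero_le_power2[of Y] by (cases "\<bar>X\<bar> \<ge> M") auto
    ultimately obtain e where e: "0 < e" "\<bar>x (- e)\<bar> = M" "\<forall>s\<in>{0..<e}. \<bar>x (- s)\<bar> < M"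
      using first_zero[of 0 "- t" "\<lambda>s. M - \<bar>x (- s)\<bar>"] big t by auto
    define \<tau> where "\<tau> = - e"
    have \<tau>0: "\<tau> \<le> 0" and \<tau>M: "\<bar>x \<tau>\<bar> = M" using e by (auto simp: \<tau>_def)
    have after: "\<bar>x s\<bar> < M" if "s \<le> 0" "\<tau> < s" for s
      using e(3)[rule_format, of "- s"] that by (auto simp: \<tau>_def)
    have "energy x y \<tau> \<le> energy x y 0"
    proof (rule DERIV_nonneg_imp_increasing_open[where f = "energy x y"])
      show "continuous_on {\<tau>..0} (energy x y)" unfolding energy_def[abs_def]
        by (intro continuous_intros continuous_on_subset[OF cx(1)] continuous_on_subset[OF cx(2)]) auto
      fix s assume s: "\<tau> < s" "s < 0"
      have gs: "g (x s) = nonlin q (x s)" using after[of s] s by (simp add: g_def clamp_real_id abs_less_iff)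
      have at: "at s within {..0} = at s" using s by (intro at_within_interior) auto
      have d: "(x has_real_derivative y s) (at s)" "(y has_real_derivative A * y s + h (x s)) (at s)"
        using dx[of s] dy[of s] s unfolding at by auto
      have "((\<lambda>t. (y t)\<^sup>2 / 2 + pot (x t)) has_real_derivative
         (2 * y s * (A * y s + h (x s))) / 2 + (K * nonlin q (x s) - B * x s) * y s) (at s)"
        by (intro DERIV_add DERIV_cdivide DERIV_chain2[OF pot_deriv] d)
           (use d in \<open>auto intro!: derivative_eq_intros\<close>)
      moreover have "(2 * y s * (A * y s + h (x s))) / 2 + (K * nonlin q (x s) - B * x s) * y s = A * (y s)\<^sup>2"
        unfolding h_def gs by (simp add: power2_eq_square field_simps)
      ultimately have "(energy x y has_real_derivative A * (y s)\<^sup>2) (at s)"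
        unfolding energy_def[abs_def] by simp
      then show "\<exists>z. DERIV (energy x y) s :> z \<and> z \<ge> 0" using A0 by force
    qed (rule \<tau>0)
    moreover have "pot (x \<tau>) > Y\<^sup>2 / 2 + pot X" using M(2) \<tau>M by auto
    moreover have "energy x y 0 = Y\<^sup>2 / 2 + pot X" "energy x y \<tau> \<ge> pot (x \<tau>)"
      using x0 by (simp_all add: energy_def)
    ultimately show False by linarith
  qed
  have hx: "h (x t) = B * x t - K * nonlin q (x t)" if "t \<le> 0" for t
    using small[OF that] by (simp add: h_def g_def clamp_real_id abs_less_iff)
  have "sol x y {..0}" unfolding sol_def
    using dx dy hx by (simp add: algebra_simps)
  then show ?thesis using x0 by blast
qed

section \<open>Oscillation forward in time\<close>

text \<open>The quantity \<open>y - \<alpha> * x\<close> is the coordinate along the stable eigenvector of the linear part; the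
  factor \<open>exp (\<mu> * t)\<close> absorbs the linear part.\<close>

lemma stable_component_deriv:
  assumes "(x has_real_derivative y t) (at t)"
    "(y has_real_derivative A * y t + B * x t - K * nonlin q (x t)) (at t)"
  shows "((\<lambda>t. exp (\<mu> * t) * (y t - \<alpha> * x t)) has_real_derivative - K * exp (\<mu> * t) * nonlin q (x t)) (at t)"
proof -
  have de: "((\<lambda>t. exp (\<mu> * t)) has_real_derivative \<mu> * exp (\<mu> * t)) (at t)"
    by (auto intro!: derivative_eq_intros)
  have "((\<lambda>t. exp (\<mu> * t) * (y t - \<alpha> * x t)) has_real_derivative
     \<mu> * exp (\<mu> * t) * (y t - \<alpha> * x t) + ((A * y t + B * x t - K * nonlin q (x t)) - \<alpha> * y t) * exp (\<mu> * t)) (at t)"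
    by (intro DERIV_mult de DERIV_diff DERIV_cmult assms)
  then show ?thesis by (rule DERIV_cong) (simp add: A_def B_def algebra_simps)
qed

text \<open>Suppose a trajectory with positive energy stays in \<open>x > 0\<close>. Its stable coordinate \<open>z\<close> decreases and
  cannot stay nonnegative, as \<open>x\<close> would then increase and \<open>z\<close> fall at a definite rate. Once \<open>z < 0\<close>,
  the function \<open>exp (- \<alpha> * t) * x t\<close> decreases; this bounds the values of \<open>x\<close> on the last unit of
  time from below by the present one, and integrating \<open>z'\<close> gives
  \<open>y \<le> \<alpha> * x - k * x powr (q - 1)\<close>, so \<open>x\<close> is bounded. As zeros of \<open>y\<close> are passed downwards
  only, \<open>x\<close> is eventually monotone and tends to an equilibrium. But the equilibria have
  nonpositive energy.\<close>

lemma no_escape: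
  assumes S: "sol x y {t0..}" and x: "\<And>t. t \<ge> t0 \<Longrightarrow> x t > 0" and E0: "energy x y t0 > 0"
  shows False
proof -
  have dx: "(x has_real_derivative y t) (at t)"
    and dy: "(y has_real_derivative A * y t + B * x t - K * nonlin q (x t)) (at t)" if "t > t0" for t
    using sol_at[OF S, of t] that by auto
  define z where "z = (\<lambda>t. exp (\<mu> * t) * (y t - \<alpha> * x t))"
  have dz: "(z has_real_derivative - K * exp (\<mu> * t) * nonlin q (x t)) (at t)" if "t > t0" for t
    unfolding z_def by (rule stable_component_deriv[of x y t, OF dx[OF that] dy[OF that]])
  have E: "energy x y t > 0" if "t \<ge> t0" for t
    using energy_mono[OF S, of t0 t] E0 that by auto
  have "\<exists>t1>t0. z t1 < 0"
  proof (rule ccontr)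
    assume "\<not> (\<exists>t1>t0. z t1 < 0)"
    then have z0: "z t \<ge> 0" if "t > t0" for t using that by force
    then have yx: "y t \<ge> \<alpha> * x t" if "t > t0" for t using that by (simp add: z_def zero_le_mult_iff)
    define a where "a = t0 + 1"
    have xge: "x a \<le> x t" if "t \<ge> a" for t
    proof (rule DERIV_nonneg_imp_nondecreasing[OF that])
      fix s assume s: "a \<le> s" "s \<le> t"
      have "y s \<ge> \<alpha> * x s" using s by (intro yx) (auto simp: a_def)
      moreover have "\<alpha> * x s \<ge> 0" using \<alpha>0 x[of s] s by (simp add: a_def)
      ultimately show "\<exists>v. DERIV x s :> v \<and> v \<ge> 0" using dx[of s] s by (auto simp: a_def)
    qed
    define k where "k = K * exp (\<mu> * a) * nonlin q (x a)"
    have k: "k > 0" using K0 x[of a] by (simp add: k_def nonlin_pos_iff a_def)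
    define t where "t = a + (z a + 1) / k"
    have za: "z a \<ge> 0" using z0 by (simp add: a_def)
    have t: "t \<ge> a" using za k by (simp add: t_def)
    have "z a + k * a \<ge> z t + k * t"
    proof (rule DERIV_nonpos_imp_nonincreasing[OF t, of "\<lambda>t. z t + k * t"])
      fix s assume s: "a \<le> s" "s \<le> t"
      have "((\<lambda>t. z t + k * t) has_real_derivative - K * exp (\<mu> * s) * nonlin q (x s) + k * 1) (at s)"
        using s by (intro DERIV_add dz DERIV_cmult DERIV_ident) (auto simp: a_def)
      moreover have "k \<le> K * exp (\<mu> * s) * nonlin q (x s)"
        unfolding k_def
        using K0 s xge[of s] \<mu>0 nonlin_mono[OF q2, of "x a" "x s"] x[of a]
        by (intro mult_mono) (auto simp: nonlin_pos_iff a_def less_imp_le)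
      ultimately show "\<exists>v. DERIV (\<lambda>t. z t + k * t) s :> v \<and> v \<le> 0" by force
    qed
    then have "z t \<le> z a - k * (t - a)" by (simp add: algebra_simps)
    also have "k * (t - a) = z a + 1" using k by (simp add: t_def)
    finally have "z t < 0" by simp
    then show False using z0[of t] t by (simp add: a_def)
  qed
  then obtain t1 where t1: "t1 > t0" "z t1 < 0" by blast
  have zneg: "z t < 0" if "t \<ge> t1" for t
  proof -
    have "z t1 \<ge> z t"
    proof (rule DERIV_nonpos_imp_nonincreasing[OF that])
      fix s assume s: "t1 \<le> s" "s \<le> t"
      have "- K * exp (\<mu> * s) * nonlin q (x s) \<le> 0"
        using K0 x[of s] s t1 by (simp add: nonlin_pos_iff less_imp_le)
      then show "\<exists>v. DERIV z s :> v \<and> v \<le> 0" using dz[of s] s t1 by force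
    qed
    then show ?thesis using t1 by simp
  qed
  define w where "w = (\<lambda>t. exp (- \<alpha> * t) * x t)"
  have wdec: "w t \<le> w s" if "t1 \<le> s" "s \<le> t" for s t
  proof (rule DERIV_nonpos_imp_nonincreasing[OF that(2)])
    fix r assume r: "s \<le> r" "r \<le> t"
    have "(w has_real_derivative - \<alpha> * exp (- \<alpha> * r) * x r + y r * exp (- \<alpha> * r)) (at r)"
      unfolding w_def using r that t1
      by (intro DERIV_mult dx) (auto intro!: derivative_eq_intros)
    moreover have "y r - \<alpha> * x r \<le> 0" using zneg[of r] r that by (simp add: z_def mult_less_0_iff)
    then have "exp (- \<alpha> * r) * (y r - \<alpha> * x r) \<le> 0" by (intro mult_nonneg_nonpos) auto
    then have "- \<alpha> * exp (- \<alpha> * r) * x r + y r * exp (- \<alpha> * r) \<le> 0" by (simp add: algebra_simps)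
    ultimately show "\<exists>v. DERIV w r :> v \<and> v \<le> 0" by blast
  qed
  \<comment> \<open>the exponent of \<open>exp (\<mu> * s) * exp (\<alpha> * (q - 1) * s)\<close>, which bounds \<open>- z'\<close> from below\<close>
  define m where "m = \<alpha> + \<mu> + 2"
  have m: "m > 0" using \<alpha>0 \<mu>0 by (simp add: m_def)
  define k where "k = K * (1 - exp (- m)) / m"
  have k: "k > 0" using K0 m by (simp add: k_def)
  have \<alpha>q1: "\<alpha> * (q - 1) = \<alpha> + 2" using \<alpha>q by (simp add: algebra_simps)
  have upper: "y t \<le> \<alpha> * x t - k * x t powr (q - 1)" if t: "t \<ge> t1 + 1" for t
  proof -
    define P where "P = K * x t powr (q - 1) * exp (- (\<alpha> + 2) * t)"
    have P: "P > 0" using K0 x[of t] t t1 by (simp add: P_def)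
    have "z t1 + P / m * exp (m * t1) \<ge> z t + P / m * exp (m * t)"
    proof (rule DERIV_nonpos_imp_nonincreasing[where f = "\<lambda>s. z s + P / m * exp (m * s)"])
      show "t1 \<le> t" using t by simp
      fix s assume s: "t1 \<le> s" "s \<le> t"
      have "((\<lambda>s. z s + P / m * exp (m * s)) has_real_derivative - K * exp (\<mu> * s) * nonlin q (x s) + P / m * (m * exp (m * s))) (at s)"
        using s t1 by (intro DERIV_add dz DERIV_cmult) (auto intro!: derivative_eq_intros)
      moreover have "P * exp (m * s) \<le> K * exp (\<mu> * s) * nonlin q (x s)"
      proof -
        have "w t \<le> w s" by (rule wdec) (use s in auto)
        then have "exp (\<alpha> * s) * w t \<le> exp (\<alpha> * s) * w s" by (intro mult_left_mono) auto
        then have "exp (\<alpha> * s - \<alpha> * t) * x t \<le> x s"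
          by (simp add: w_def mult.assoc[symmetric] flip: exp_add)
        then have "nonlin q (exp (\<alpha> * s - \<alpha> * t) * x t) \<le> nonlin q (x s)" by (rule nonlin_mono[OF q2])
        moreover have "nonlin q (exp (\<alpha> * s - \<alpha> * t) * x t) = exp ((\<alpha> + 2) * s - (\<alpha> + 2) * t) * x t powr (q - 1)"
        proof -
          have "exp (\<alpha> * s - \<alpha> * t) powr (q - 1) = exp ((\<alpha> * (q - 1)) * s - (\<alpha> * (q - 1)) * t)"
            by (simp add: powr_def algebra_simps)
          then show ?thesis unfolding \<alpha>q1
            using nonlin_mult[of "exp (\<alpha> * s - \<alpha> * t)" q "x t"] nonlin_pos[of "x t" q] x[of t] t t1 by simp
        qed
        ultimately have "K * exp (\<mu> * s) * (exp ((\<alpha> + 2) * s - (\<alpha> + 2) * t) * x t powr (q - 1)) \<le> K * exp (\<mu> * s) * nonlin q (x s)"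
          using K0 by (intro mult_left_mono) auto
        moreover have "K * exp (\<mu> * s) * (exp ((\<alpha> + 2) * s - (\<alpha> + 2) * t) * x t powr (q - 1)) = P * exp (m * s)"
        proof -
          have "exp (\<mu> * s) * exp ((\<alpha> + 2) * s - (\<alpha> + 2) * t) = exp (- (\<alpha> + 2) * t) * exp (m * s)"
            unfolding exp_add[symmetric] by (simp add: m_def algebra_simps)
          then show ?thesis by (simp add: P_def mult_ac)
        qed
        ultimately show ?thesis by simp
      qed
      ultimately show "\<exists>v. DERIV (\<lambda>s. z s + P / m * exp (m * s)) s :> v \<and> v \<le> 0" using m by force
    qed
    then have "z t \<le> z t1 - P / m * (exp (m * t) - exp (m * t1))" by (simp add: algebra_simps)
    also have "\<dots> \<le> - (P / m * (exp (m * t) - exp (m * (t - 1))))"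
    proof -
      have "exp (m * t1) \<le> exp (m * (t - 1))" using m t by simp
      then have "P / m * (exp (m * t) - exp (m * (t - 1))) \<le> P / m * (exp (m * t) - exp (m * t1))"
        using P m by (intro mult_left_mono) auto
      then show ?thesis using t1(2) by simp
    qed
    also have "P / m * (exp (m * t) - exp (m * (t - 1))) = exp (\<mu> * t) * (k * x t powr (q - 1))"
    proof -
      have "exp (m * (t - 1)) = exp (m * t) * exp (- m)" by (simp add: algebra_simps flip: exp_add)
      moreover have "exp (- (\<alpha> + 2) * t) * exp (m * t) = exp (\<mu> * t)"
        unfolding exp_add[symmetric] by (simp add: m_def algebra_simps)
      ultimately show ?thesis by (simp add: P_def k_def algebra_simps add_divide_distrib diff_divide_distrib)
    qed
    finally have "exp (\<mu> * t) * (y t - \<alpha> * x t) \<le> exp (\<mu> * t) * (- (k * x t powr (q - 1)))" by (simp add: z_def)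
    then show ?thesis by (subst (asm) mult_le_cancel_left_pos) auto
  qed
  define t2 where "t2 = t1 + 1"
  define R where "R = max (x t2) ((\<alpha> / k) powr (\<alpha> / 2) + 1)"
  have R0: "R > (\<alpha> / k) powr (\<alpha> / 2)" "R > 0" "x t2 \<le> R" using x[of t2] t1 by (auto simp: R_def t2_def less_max_iff_disj)
  have bounded: "x t \<le> R" if "t \<ge> t2" for t
  proof (cases "t = t2")
    case True then show ?thesis using R0 by simp
  next
    case False
    have "x t - R < 0"
    proof (rule negative_after_zero[of t2 t "\<lambda>t. x t - R" y])
      fix s assume s: "s \<in> {t2..t}"
      then have s': "s > t0" "s \<ge> t1 + 1" using t1 by (auto simp: t2_def)
      show "((\<lambda>t. x t - R) has_real_derivative y s) (at s within {t2..t})"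
        using DERIV_diff[OF dx[OF s'(1)] DERIV_const[of R]] has_field_derivative_at_within by fastforce
      assume "x s - R = 0"
      then have xs: "x s = R" by simp
      have "((\<alpha> / k) powr (\<alpha> / 2)) powr (q - 2) < R powr (q - 2)"
        using R0 q2 by (intro powr_less_mono2) auto
      then have "\<alpha> < k * R powr (q - 2)" using powr_q2[of "\<alpha>/k"] \<alpha>0 k by (simp add: field_simps)
      then have "\<alpha> * R < k * R powr (q - 2) * R" using R0 by simp
      also have "\<dots> = k * R powr (q - 1)" using R0 by (simp add: powr_diff power2_eq_square)
      finally show "y s < 0" using upper[OF s'(2)] xs by simp
    qed (use that False R0 in auto)
    then show ?thesis by simp
  qed
  have "\<exists>X\<ge>0. (x \<longlongrightarrow> X) at_top"
  proof (cases "\<exists>t3\<ge>t2. y t3 \<le> 0")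
    case True
    then obtain t3 where t3: "t3 \<ge> t2" "y t3 \<le> 0" by blast
    have yneg: "y t \<le> 0" if "t \<ge> t3" for t
    proof (cases "t = t3")
      case True then show ?thesis using t3 by simp
    next
      case False
      have "y t < 0"
      proof (rule y_after_zero[OF sol_subset[OF S]])
        fix s assume s: "s \<in> {t3..t}" "y s = 0"
        have "s \<ge> t0" using s t3 t1 by (auto simp: t2_def)
        then have "x s > x1" using pos_energy_x1[of x y s] E[of s] x[of s] s by simp
        then show "x s > xs" using xsx1 by simp
      qed (use that False t3 t1 in \<open>auto simp: t2_def\<close>)
      then show ?thesis by simp
    qed
    have "\<exists>l. ((\<lambda>t. - x t) \<longlongrightarrow> l) at_top \<and> (\<forall>t\<ge>t3. - x t \<le> l) \<and> l \<le> 0"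
    proof (rule mono_bounded_limit_at_top)
      fix s t assume st: "t3 \<le> s" "s \<le> t"
      have "x t \<le> x s"
        by (rule antimono_if_deriv_nonpos[OF st(2), of x y])
           (use dx yneg st t3 t1 in \<open>auto simp: t2_def\<close>)
      then show "- x s \<le> - x t" by simp
    next
      fix t assume "t \<ge> t3" then show "- x t \<le> 0" using x[of t] t3 t1 by (simp add: t2_def)
    qed
    then obtain l where l: "((\<lambda>t. - x t) \<longlongrightarrow> l) at_top" "l \<le> 0" by blast
    have "(x \<longlongrightarrow> - l) at_top" using tendsto_minus[OF l(1)] by simp
    then show ?thesis using l(2) by (intro exI[of _ "- l"]) auto
  next
    case False
    then have ypos: "y t > 0" if "t \<ge> t2" for t using that by force
    have "\<exists>l. (x \<longlongrightarrow> l) at_top \<and> (\<forall>t\<ge>t2. x t \<le> l) \<and> l \<le> R"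
    proof (rule mono_bounded_limit_at_top)
      fix s t assume st: "t2 \<le> s" "s \<le> t"
      show "x s \<le> x t"
        by (rule mono_if_deriv_nonneg[OF st(2), of x y])
           (use dx ypos st t1 in \<open>auto simp: t2_def intro: less_imp_le\<close>)
    qed (rule bounded)
    then obtain l where l: "(x \<longlongrightarrow> l) at_top" "\<forall>t\<ge>t2. x t \<le> l" by blast
    moreover have "l \<ge> 0" using l(2)[rule_format, of t2] x[of t2] t1 by (simp add: t2_def)
    ultimately show ?thesis by blast
  qed
  then obtain X where X: "X \<ge> 0" "(x \<longlongrightarrow> X) at_top" by blast
  have dy': "(y has_real_derivative A * y t + (B * x t - K * nonlin q (x t))) (at t)" if "t > t0" for t
    using dy[OF that] by (simp add: algebra_simps)
  have ch: "isCont (\<lambda>x. B * x - K * nonlin q x) X" by (intro continuous_intros isCont_nonlin q2)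
  have eq: "B * X - K * nonlin q X = 0" "(y \<longlongrightarrow> 0) at_top"
    using limit_equilibrium[OF dx dy' X(2) ch] by auto
  have "(energy x y \<longlongrightarrow> 0\<^sup>2 / 2 + pot X) at_top"
    unfolding energy_def[abs_def]
    by (intro tendsto_add tendsto_divide tendsto_power eq tendsto_const isCont_tendsto_compose[OF isCont_pot X(2)]) auto
  then have "energy x y t0 \<le> 0\<^sup>2 / 2 + pot X"
    by (rule tendsto_lowerbound)
       (auto intro!: eventually_mono[OF eventually_ge_at_top[of t0]] energy_mono[OF S])
  then have "pot X > 0" using E0 by simp
  then show False using force_sign(2)[of X] eq(1) X(1) pot_sign(1)[of X] xsx1 xs0
    by (cases "X = 0") auto
qed

lemma next_zero:
  assumes S: "sol x y {s..}" and xs: "x s = 0" and ys: "y s > 0"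
  shows "\<exists>e>s. x e = 0 \<and> (\<forall>t\<in>{s<..<e}. x t > 0)"
proof -
  obtain d where d: "d > 0" "\<And>h. h > 0 \<Longrightarrow> s + h \<in> {s..} \<Longrightarrow> h < d \<Longrightarrow> x s < x (s + h)"
    using has_real_derivative_pos_inc_right[OF sol_x[OF S, of s]] ys by auto
  define t0 where "t0 = s + d / 2"
  have t0: "s < t0" using d by (simp add: t0_def)
  have pos: "x t > 0" if "s < t" "t \<le> t0" for t
    using d(2)[of "t - s"] d(1) that xs by (auto simp: t0_def)
  have "energy x y s > 0" using xs ys by (simp add: energy_def)
  moreover have "energy x y s \<le> energy x y t0" using t0 by (intro energy_mono[OF S]) auto
  ultimately have E0: "energy x y t0 > 0" by simp
  have "\<exists>b\<ge>t0. x b \<le> 0"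
  proof (rule ccontr)
    assume "\<not> ?thesis"
    then have "x t > 0" if "t \<ge> t0" for t using that by force
    then show False using no_escape[OF sol_subset[OF S, of "{t0..}"] _ E0] t0 by auto
  qed
  then obtain b where b: "b \<ge> t0" "x b \<le> 0" by blast
  have "continuous_on {t0..b} x" by (rule continuous_on_subset[OF sol_cont(1)[OF S]]) (use t0 in auto)
  from first_zero[OF this b(1) pos[of t0] b(2)] t0
  obtain e where e: "t0 < e" "x e = 0" "\<forall>t\<in>{t0..<e}. x t > 0" by auto
  then show ?thesis using pos t0 by (intro exI[of _ e]) force
qed

section \<open>Behaviour at the origin\<close>

lemma limit_equilibrium_at_bot:
  assumes S: "sol x y {..T}" and lim: "(x \<longlongrightarrow> X) at_bot"
  shows "B * X = K * nonlin q X" "(y \<longlongrightarrow> 0) at_bot" "(energy x y \<longlongrightarrow> pot X) at_bot"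
proof -
  have refl: "((\<lambda>t. w (- t)) has_real_derivative - w') (at t)"
    if "(w has_real_derivative w') (at (- t))" for w w' t
    using that by (simp add: DERIV_mirror)
  have d: "((\<lambda>s. x (- s)) has_real_derivative - y (- s)) (at s)"
    "((\<lambda>s. - y (- s)) has_real_derivative (- A) * (- y (- s)) * (-1) * (-1) + (B * x (- s) - K * nonlin q (x (- s)))) (at s)"
    if "s > - T" for s
  proof -
    have i: "- s \<in> interior {..T}" using that by simp
    show "((\<lambda>s. x (- s)) has_real_derivative - y (- s)) (at s)" by (rule refl[OF sol_at(1)[OF S i]])
    have "((\<lambda>s. - y (- s)) has_real_derivative - (- (A * y (- s) + B * x (- s) - K * nonlin q (x (- s))))) (at s)"
      by (intro DERIV_minus refl[OF sol_at(2)[OF S i]])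
    then show "((\<lambda>s. - y (- s)) has_real_derivative (- A) * (- y (- s)) * (-1) * (-1) + (B * x (- s) - K * nonlin q (x (- s)))) (at s)"
      by (simp add: algebra_simps)
  qed
  have d2: "((\<lambda>s. - y (- s)) has_real_derivative (- A) * (- y (- s)) + (B * x (- s) - K * nonlin q (x (- s)))) (at s)"
    if "s > - T" for s using d(2)[OF that] by simp
  have ch: "isCont (\<lambda>x. B * x - K * nonlin q x) X" by (intro continuous_intros isCont_nonlin q2)
  have lim': "((\<lambda>s. x (- s)) \<longlongrightarrow> X) at_top"
    using lim by (simp add: filterlim_at_bot_mirror)
  from limit_equilibrium[OF d(1) d2 lim' ch] have
    1: "B * X - K * nonlin q X = 0" and 2: "((\<lambda>s. - y (- s)) \<longlongrightarrow> 0) at_top" by auto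
  show "B * X = K * nonlin q X" using 1 by simp
  show y0: "(y \<longlongrightarrow> 0) at_bot"
    using tendsto_minus[OF 2] by (simp add: filterlim_at_bot_mirror)
  have "(energy x y \<longlongrightarrow> 0\<^sup>2 / 2 + pot X) at_bot"
    unfolding energy_def[abs_def]
    by (intro tendsto_add tendsto_divide tendsto_power y0 tendsto_const isCont_tendsto_compose[OF isCont_pot lim]) auto
  then show "(energy x y \<longlongrightarrow> pot X) at_bot" by simp
qed

lemma mono_bounded_limit_at_bot:
  fixes x :: "real \<Rightarrow> real"
  assumes mono: "\<And>s t. s \<le> t \<Longrightarrow> t \<le> T \<Longrightarrow> x t \<le> x s" and bd: "\<And>t. t \<le> T \<Longrightarrow> x t \<le> M"
  shows "\<exists>l. (x \<longlongrightarrow> l) at_bot \<and> (\<forall>t\<le>T. x t \<le> l) \<and> l \<le> M"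
proof -
  have "\<exists>l. ((\<lambda>s. x (- s)) \<longlongrightarrow> l) at_top \<and> (\<forall>t\<ge>-T. x (- t) \<le> l) \<and> l \<le> M"
    by (rule mono_bounded_limit_at_top) (auto intro!: mono bd)
  then obtain l where l: "((\<lambda>s. x (- s)) \<longlongrightarrow> l) at_top" "\<forall>t\<ge>-T. x (- t) \<le> l" "l \<le> M" by blast
  have "x t \<le> l" if "t \<le> T" for t using l(2)[rule_format, of "- t"] that by simp
  then show ?thesis using l(1,3) by (auto simp: filterlim_at_bot_mirror)
qed

text \<open>With nonnegative energy \<open>y\<close> can vanish only beyond \<open>xs\<close>, where it passes from positive to negative.
  So \<open>x\<close> is monotone near \<open>- \<infinity>\<close>, and its limit is an equilibrium with nonnegative energy: the origin.\<close>

lemma backward_tends_to_origin: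
  assumes S: "sol x y {..T}" and x: "\<And>t. t \<le> T \<Longrightarrow> x t > 0" and E: "\<And>t. t \<le> T \<Longrightarrow> energy x y t \<ge> 0"
  shows "(x \<longlongrightarrow> 0) at_bot" "(y \<longlongrightarrow> 0) at_bot" "\<exists>T'\<le>T. \<forall>t<T'. y t > 0"
proof -
  have sub: "sol x y {a..b}" if "b \<le> T" for a b by (rule sol_subset[OF S]) (use that in auto)
  have Z: "x t > xs" if "t \<le> T" "y t = 0" for t
  proof -
    have "pot (x t) \<ge> 0" using E[OF that(1)] that(2) by (simp add: energy_def)
    then show ?thesis using pot_sign(1)[OF x[OF that(1)]] xsx1 by linarith
  qed
  have neg_after: "y t' < 0" if "y t \<le> 0" "t < t'" "t' \<le> T" for t t'
    by (rule y_after_zero[OF sub]) (use that Z in auto)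
  obtain M where M: "\<And>z. \<bar>z\<bar> \<ge> M \<Longrightarrow> pot z > energy x y T" using pot_coercive by blast
  have xM: "x t \<le> M" if "t \<le> T" for t
  proof (rule ccontr)
    assume "\<not> x t \<le> M"
    then have "pot (x t) > energy x y T" using M[of "x t"] by auto
    moreover have "energy x y t \<le> energy x y T" by (rule energy_mono[OF S]) (use that in auto)
    moreover have "energy x y t \<ge> pot (x t)" by (simp add: energy_def)
    ultimately show False by simp
  qed
  have dx: "(x has_real_derivative y t) (at t)" if "t < T" for t
    using sol_at(1)[OF S, of t] that by simp
  have key: "X = 0" if lim: "(x \<longlongrightarrow> X) at_bot" and X: "X \<ge> 0" for X
  proof (rule ccontr)
    assume X0: "X \<noteq> 0"
    have e: "B * X = K * nonlin q X" "(energy x y \<longlongrightarrow> pot X) at_bot"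
      using limit_equilibrium_at_bot[OF S lim] by auto
    have "0 \<le> pot X"
      by (rule tendsto_lowerbound[OF e(2)])
         (auto intro!: eventually_mono[OF eventually_le_at_bot[of T]] E)
    moreover have "X = xs" using force_sign(2)[of X] e(1) X X0 by simp
    ultimately show False using pot_sign(1)[of X] xsx1 xs0 by simp
  qed
  have ex: "\<exists>t\<le>T. y t > 0"
  proof (rule ccontr)
    assume "\<not> (\<exists>t\<le>T. y t > 0)"
    then have yn: "y t \<le> 0" if "t \<le> T" for t using that by force
    have "\<exists>l. (x \<longlongrightarrow> l) at_bot \<and> (\<forall>t\<le>T-1. x t \<le> l) \<and> l \<le> M"
    proof (rule mono_bounded_limit_at_bot)
      fix s t assume st: "s \<le> t" "t \<le> T - 1"
      show "x t \<le> x s"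
        by (rule antimono_if_deriv_nonpos[OF st(1), of x y]) (use dx yn st in auto)
    next
      fix t assume "t \<le> T - 1" then show "x t \<le> M" by (intro xM) simp
    qed
    then obtain l where l: "(x \<longlongrightarrow> l) at_bot" "\<forall>t\<le>T-1. x t \<le> l" by blast
    have "l > 0" using l(2)[rule_format, of "T - 1"] x[of "T - 1"] by simp
    then show False using key[OF l(1)] by simp
  qed
  then obtain t0 where t0: "t0 \<le> T" "y t0 > 0" by blast
  have yp: "y t > 0" if "t < t0" for t
    using neg_after[of t t0] that t0 by force
  show "\<exists>T'\<le>T. \<forall>t<T'. y t > 0" using t0 yp by blast
  have "\<exists>l. ((\<lambda>t. - x t) \<longlongrightarrow> l) at_bot \<and> (\<forall>t\<le>t0-1. - x t \<le> l) \<and> l \<le> 0"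
  proof (rule mono_bounded_limit_at_bot)
    fix s t assume st: "s \<le> t" "t \<le> t0 - 1"
    have "x s \<le> x t"
      by (rule mono_if_deriv_nonneg[OF st(1), of x y]) (use dx yp st t0 in \<open>auto intro: less_imp_le\<close>)
    then show "- x t \<le> - x s" by simp
  next
    fix t assume "t \<le> t0 - 1" then show "- x t \<le> 0" using x[of t] t0 by simp
  qed
  then obtain l where l: "((\<lambda>t. - x t) \<longlongrightarrow> l) at_bot" "l \<le> 0" by blast
  have "(x \<longlongrightarrow> - l) at_bot" using tendsto_minus[OF l(1)] by simp
  moreover have "- l = 0" using key[OF calculation] l(2) by simp
  ultimately show x0: "(x \<longlongrightarrow> 0) at_bot" by simp
  show "(y \<longlongrightarrow> 0) at_bot" by (rule limit_equilibrium_at_bot(2)[OF S x0])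
qed

text \<open>Nonnegative energy first gives \<open>y \<ge> c * x\<close>, a crude exponential decay of \<open>x\<close> backward in time. The
  stable coordinate \<open>z\<close>, which tends to 0, then lies between \<open>- (K / \<mu>) * nonlin q (x t) * exp (\<mu> * t)\<close>
  and 0. Hence the logarithm of \<open>exp (- \<alpha> * t) * x t\<close> is monotone with an integrable derivative, and
  converges.\<close>

lemma backward_regular:
  assumes S: "sol x y {..T}" and x: "\<And>t. t \<le> T \<Longrightarrow> x t > 0" and E: "\<And>t. t \<le> T \<Longrightarrow> energy x y t \<ge> 0"
  shows "\<exists>d>0. ((\<lambda>t. exp (- \<alpha> * t) * x t) \<longlongrightarrow> d) at_bot"
proof -
  note lims = backward_tends_to_origin[OF assms]
  obtain T1 where T1: "T1 \<le> T" "\<And>t. t < T1 \<Longrightarrow> y t > 0" using lims(3) by blast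
  have "eventually (\<lambda>t. x t < xs) at_bot" by (rule order_tendstoD(2)[OF lims(1) xs0])
  then obtain T2 where T2: "\<And>t. t \<le> T2 \<Longrightarrow> x t < xs" unfolding eventually_at_bot_linorder by blast
  define b where "b = min T1 T2 - 1"
  have b: "b < T1" "b \<le> T2" "b < T" using T1 by (auto simp: b_def)
  have dx: "(x has_real_derivative y t) (at t)"
    and dy: "(y has_real_derivative A * y t + B * x t - K * nonlin q (x t)) (at t)" if "t \<le> b" for t
    using sol_at[OF S, of t] that b by auto
  define k where "k = K / q * (x1 powr (q - 2) - xs powr (q - 2))"
  have k: "k > 0"
  proof -
    have "xs powr (q - 2) < x1 powr (q - 2)" using xs0 xsx1 q2 by (intro powr_less_mono2) auto
    then show ?thesis using K0 q2 by (simp add: k_def)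
  qed
  define c where "c = sqrt (2 * k)"
  have c: "c > 0" "c\<^sup>2 = 2 * k" using k by (simp_all add: c_def)
  have yc: "y t \<ge> c * x t" if t: "t \<le> b" for t
  proof -
    have xt: "x t > 0" "x t < xs" "t \<le> T" using x[of t] T2[of t] b t by auto
    have "k * (x t)\<^sup>2 \<le> - pot (x t)"
    proof -
      have "x t powr (q - 2) \<le> xs powr (q - 2)" using xt q2 by (intro powr_mono2) auto
      then have "K / q * (x t)\<^sup>2 * (x1 powr (q - 2) - xs powr (q - 2)) \<le> K / q * (x t)\<^sup>2 * (x1 powr (q - 2) - x t powr (q - 2))"
        using K0 q2 by (intro mult_left_mono) auto
      moreover have "K / q * (x t)\<^sup>2 * (x1 powr (q - 2) - xs powr (q - 2)) = k * (x t)\<^sup>2" by (simp add: k_def)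
      moreover have "- pot (x t) = K / q * (x t)\<^sup>2 * (x1 powr (q - 2) - x t powr (q - 2))"
        unfolding pot_factor[OF xt(1)] by (simp add: right_diff_distrib)
      ultimately show ?thesis by linarith
    qed
    then have "(c * x t)\<^sup>2 \<le> (y t)\<^sup>2" using E[OF xt(3)] c(2) by (simp add: energy_def power_mult_distrib)
    then show ?thesis by (rule power2_le_imp_le) (use T1(2)[of t] t b in auto)
  qed
  define C where "C = (exp (- c * b) * x b) powr (q - 2)"
  have C0: "C > 0" using x[of b] b by (simp add: C_def)
  define c' where "c' = c * (q - 2)"
  have c': "c' > 0" using c q2 by (simp add: c'_def)
  have xq: "x t powr (q - 2) \<le> C * exp (c' * t)" if t: "t \<le> b" for t
  proof -
    have "exp (- c * t) * x t \<le> exp (- c * b) * x b"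
    proof (rule DERIV_nonneg_imp_nondecreasing[OF t])
      fix s assume s: "t \<le> s" "s \<le> b"
      have "((\<lambda>t. exp (- c * t) * x t) has_real_derivative - c * exp (- c * s) * x s + y s * exp (- c * s)) (at s)"
        using s by (intro DERIV_mult dx) (auto intro!: derivative_eq_intros)
      moreover have "- c * exp (- c * s) * x s + y s * exp (- c * s) = exp (- c * s) * (y s - c * x s)"
        by (simp add: algebra_simps)
      moreover have "\<dots> \<ge> 0" using yc[OF s(2)] by simp
      ultimately show "\<exists>v. DERIV (\<lambda>t. exp (- c * t) * x t) s :> v \<and> v \<ge> 0" by auto
    qed
    then have "(exp (- c * t) * x t) powr (q - 2) \<le> C" unfolding C_def
      using q2 x[of t] t b by (intro powr_mono2) auto
    also have "(exp (- c * t) * x t) powr (q - 2) = exp (- (c' * t)) * x t powr (q - 2)"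
      using x[of t] t b by (simp add: powr_mult c'_def powr_def[of "exp _"] mult_ac)
    finally have "exp (c' * t) * (exp (- (c' * t)) * x t powr (q - 2)) \<le> exp (c' * t) * C"
      by (intro mult_left_mono) auto
    then show ?thesis by (simp add: mult.assoc[symmetric] mult.commute flip: exp_add)
  qed
  have xmono: "x s \<le> x t" if "s \<le> t" "t \<le> b" for s t
    by (rule mono_if_deriv_nonneg[OF that(1), of x y])
       (use dx T1(2) that b in \<open>auto intro: less_imp_le\<close>)
  define z where "z = (\<lambda>t. exp (\<mu> * t) * (y t - \<alpha> * x t))"
  have dz: "(z has_real_derivative - K * exp (\<mu> * t) * nonlin q (x t)) (at t)" if "t \<le> b" for t
    unfolding z_def by (rule stable_component_deriv[of x y t, OF dx[OF that] dy[OF that]])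
  have emu: "((\<lambda>t. exp (\<mu> * t)) \<longlongrightarrow> 0) at_bot"
    by (rule filterlim_compose[OF exp_at_bot])
       (use filterlim_tendsto_pos_mult_at_bot[OF tendsto_const[of \<mu>] \<mu>0 filterlim_ident] in simp)
  have zlim: "(z \<longlongrightarrow> 0) at_bot"
    unfolding z_def using tendsto_mult[OF emu tendsto_diff[OF lims(2) tendsto_mult[OF tendsto_const[of \<alpha>] lims(1)]]] by simp
  have z_le: "z t \<le> 0" if t: "t \<le> b" for t
  proof (rule tendsto_lowerbound[OF zlim])
    show "eventually (\<lambda>s. z t \<le> z s) at_bot"
    proof (rule eventually_mono[OF eventually_le_at_bot[of t]])
      fix s assume s: "s \<le> t"
      show "z t \<le> z s"
      proof (rule DERIV_nonpos_imp_nonincreasing[OF s])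
        fix r assume r: "s \<le> r" "r \<le> t"
        have "- K * exp (\<mu> * r) * nonlin q (x r) \<le> 0"
          using K0 x[of r] r t b by (simp add: nonlin_pos_iff less_imp_le)
        then show "\<exists>v. DERIV z r :> v \<and> v \<le> 0" using dz[of r] r t by force
      qed
    qed
  qed simp
  have z_ge: "z t \<ge> - (K / \<mu> * nonlin q (x t) * exp (\<mu> * t))" if t: "t \<le> b" for t
  proof -
    define Q where "Q = K / \<mu> * nonlin q (x t)"
    have "((\<lambda>s. z s + Q * exp (\<mu> * s)) \<longlongrightarrow> 0 + Q * 0) at_bot"
      by (intro tendsto_intros zlim emu)
    moreover have "eventually (\<lambda>s. z s + Q * exp (\<mu> * s) \<le> z t + Q * exp (\<mu> * t)) at_bot"
    proof (rule eventually_mono[OF eventually_le_at_bot[of t]])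
      fix s assume s: "s \<le> t"
      show "z s + Q * exp (\<mu> * s) \<le> z t + Q * exp (\<mu> * t)"
      proof (rule DERIV_nonneg_imp_nondecreasing[OF s, of "\<lambda>s. z s + Q * exp (\<mu> * s)"])
        fix r assume r: "s \<le> r" "r \<le> t"
        have "((\<lambda>s. z s + Q * exp (\<mu> * s)) has_real_derivative - K * exp (\<mu> * r) * nonlin q (x r) + Q * (\<mu> * exp (\<mu> * r))) (at r)"
          using r t by (intro DERIV_add dz DERIV_cmult) (auto intro!: derivative_eq_intros)
        moreover have "- K * exp (\<mu> * r) * nonlin q (x r) + Q * (\<mu> * exp (\<mu> * r)) = K * exp (\<mu> * r) * (nonlin q (x t) - nonlin q (x r))"
          using \<mu>0 by (simp add: Q_def algebra_simps)
        moreover have "\<dots> \<ge> 0"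
          using K0 nonlin_mono[OF q2 xmono[OF r(2) t]] by simp
        ultimately show "\<exists>v. DERIV (\<lambda>s. z s + Q * exp (\<mu> * s)) r :> v \<and> v \<ge> 0" by metis
      qed
    qed
    ultimately have "0 + Q * 0 \<le> z t + Q * exp (\<mu> * t)" by (rule tendsto_upperbound) simp
    then show ?thesis by (simp add: Q_def)
  qed
  define l where "l = (\<lambda>t. ln (x t) - \<alpha> * t)"
  have dl: "(l has_real_derivative (y t - \<alpha> * x t) / x t) (at t)" if t: "t \<le> b" for t
  proof -
    have "x t > 0" using x t b by simp
    then have "(l has_real_derivative 1 / x t * y t - \<alpha> * 1) (at t)"
      unfolding l_def using DERIV_chain2[OF DERIV_ln_divide dx[OF t]]
      by (intro DERIV_diff DERIV_cmult DERIV_ident) auto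
    then show ?thesis by (rule DERIV_cong) (use \<open>x t > 0\<close> in \<open>simp add: field_simps\<close>)
  qed
  have yx: "y t - \<alpha> * x t \<le> 0" "y t - \<alpha> * x t \<ge> - (K / \<mu> * nonlin q (x t))" if t: "t \<le> b" for t
  proof -
    show "y t - \<alpha> * x t \<le> 0" using z_le[OF t] by (simp add: z_def mult_le_0_iff)
    have "exp (\<mu> * t) * (- (K / \<mu> * nonlin q (x t))) \<le> exp (\<mu> * t) * (y t - \<alpha> * x t)"
      using z_ge[OF t] by (simp add: z_def mult_ac)
    then show "y t - \<alpha> * x t \<ge> - (K / \<mu> * nonlin q (x t))"
      by (subst (asm) mult_le_cancel_left_pos) auto
  qed
  define J where "J = K / \<mu> * C / c'"
  have J: "J > 0" using K0 \<mu>0 C0 c' by (simp add: J_def)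
  have lup: "l t \<le> l b + J * exp (c' * b)" if t: "t \<le> b" for t
  proof -
    have "l t + J * exp (c' * t) \<le> l b + J * exp (c' * b)"
    proof (rule DERIV_nonneg_imp_nondecreasing[OF t, of "\<lambda>s. l s + J * exp (c' * s)"])
      fix s assume s: "t \<le> s" "s \<le> b"
      have "((\<lambda>s. l s + J * exp (c' * s)) has_real_derivative (y s - \<alpha> * x s) / x s + J * (c' * exp (c' * s))) (at s)"
        using s by (intro DERIV_add dl DERIV_cmult) (auto intro!: derivative_eq_intros)
      moreover have "(y s - \<alpha> * x s) / x s \<ge> - (J * (c' * exp (c' * s)))"
      proof -
        have xs: "x s > 0" using x s b by simp
        have "- (K / \<mu> * x s powr (q - 2)) = - (K / \<mu> * nonlin q (x s)) / x s"
          using xs by (simp add: nonlin_factor)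
        also have "\<dots> \<le> (y s - \<alpha> * x s) / x s" using yx(2)[OF s(2)] xs by (intro divide_right_mono) auto
        finally have "- (K / \<mu> * x s powr (q - 2)) \<le> (y s - \<alpha> * x s) / x s" .
        moreover have "K / \<mu> * x s powr (q - 2) \<le> K / \<mu> * (C * exp (c' * s))"
          using xq[OF s(2)] K0 \<mu>0 by (intro mult_left_mono) auto
        moreover have "J * (c' * exp (c' * s)) = K / \<mu> * (C * exp (c' * s))" using c' by (simp add: J_def)
        ultimately show ?thesis by linarith
      qed
      ultimately show "\<exists>v. DERIV (\<lambda>s. l s + J * exp (c' * s)) s :> v \<and> v \<ge> 0" by force
    qed
    moreover have "J * exp (c' * t) \<ge> 0" using J by simp
    ultimately show ?thesis by linarith
  qed
  have "\<exists>v. (l \<longlongrightarrow> v) at_bot \<and> (\<forall>t\<le>b. l t \<le> v) \<and> v \<le> l b + J * exp (c' * b)"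
  proof (rule mono_bounded_limit_at_bot)
    fix s t assume st: "s \<le> t" "t \<le> b"
    show "l t \<le> l s"
    proof (rule DERIV_nonpos_imp_nonincreasing[OF st(1)])
      fix r assume r: "s \<le> r" "r \<le> t"
      have "(y r - \<alpha> * x r) / x r \<le> 0" using yx(1)[of r] x[of r] r st b by (simp add: divide_nonpos_pos)
      then show "\<exists>v. DERIV l r :> v \<and> v \<le> 0" using dl[of r] r st by force
    qed
  qed (rule lup)
  then obtain v where v: "(l \<longlongrightarrow> v) at_bot" by blast
  have "((\<lambda>t. exp (l t)) \<longlongrightarrow> exp v) at_bot" by (intro tendsto_exp v)
  then have "((\<lambda>t. exp (- \<alpha> * t) * x t) \<longlongrightarrow> exp v) at_bot"
  proof (rule Lim_transform_eventually)
    show "eventually (\<lambda>t. exp (l t) = exp (- \<alpha> * t) * x t) at_bot"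
    proof (rule eventually_mono[OF eventually_le_at_bot[of T]])
      fix t assume "t \<le> T"
      then show "exp (l t) = exp (- \<alpha> * t) * x t" using x[of t]
        by (simp add: l_def exp_diff exp_minus field_simps)
    qed
  qed
  then show ?thesis by (intro exI[of _ "exp v"]) auto
qed

section \<open>Ordering of half turns\<close>

text \<open>A half turn rises from \<open>s\<close> to its tip \<open>m\<close> and falls until \<open>e\<close>; for \<open>s = m\<close> it only falls, and \<open>y\<close> need
  not vanish at \<open>m\<close>.\<close>

definition turn :: "(real \<Rightarrow> real) \<Rightarrow> (real \<Rightarrow> real) \<Rightarrow> real \<Rightarrow> real \<Rightarrow> real \<Rightarrow> bool" where
  "turn x y s m e \<longleftrightarrow> sol x y {s..e} \<and> s \<le> m \<and> m \<le> e \<and> (\<forall>t\<in>{s<..<m}. y t > 0) \<and>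
     (\<forall>t\<in>{m<..<e}. y t < 0) \<and> (y m = 0 \<or> s = m)"

text \<open>The second half turn starts at the same abscissa with more energy. The predicate hides where
  the half turns start, since only their ends are compared.\<close>

definition below :: "(real \<Rightarrow> real) \<Rightarrow> (real \<Rightarrow> real) \<Rightarrow> real \<Rightarrow> (real \<Rightarrow> real) \<Rightarrow> (real \<Rightarrow> real) \<Rightarrow> real \<Rightarrow> bool" where
  "below xa ya e1 xb yb e2 \<longleftrightarrow> (\<exists>s1 m1 s2 m2. turn xa ya s1 m1 e1 \<and> turn xb yb s2 m2 e2 \<and> yb m2 = 0 \<and>
     xa s1 = xb s2 \<and> energy xa ya s1 < energy xb yb s2)"

lemma below_energy:
  assumes b: "below xa ya e1 xb yb e2" and e: "xa e1 = xb e2"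
  shows "energy xa ya e1 < energy xb yb e2"
proof -
  obtain s1 m1 s2 m2 where t: "turn xa ya s1 m1 e1" "turn xb yb s2 m2 e2" "yb m2 = 0"
     "xa s1 = xb s2" "energy xa ya s1 < energy xb yb s2" using b unfolding below_def by blast
  show ?thesis
    by (rule half_turn_compare[of xa ya s1 e1 m1 xb yb s2 e2 m2]) (use t e in \<open>auto simp: turn_def\<close>)
qed

lemma zero_at_turn_end:
  assumes S: "sol x y {s..e}" and se: "s < e" and x: "\<And>t. t \<in> {s<..<e} \<Longrightarrow> x t > 0"
    and xe: "x e = 0" and E: "energy x y s > 0"
  shows "y e < 0"
proof -
  have "energy x y s \<le> energy x y e" by (rule energy_mono[OF S]) (use se in auto)
  then have "y e \<noteq> 0" using E xe by (auto simp: energy_def)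
  then show ?thesis using y_sign_at_zero(2)[OF S se x xe] by simp
qed

lemma turn_from_zero:
  assumes S: "sol x y {s..e}" and se: "s < e" and xs: "x s = 0" and ys: "y s > 0" and ye: "y e < 0"
    and x: "\<And>t. t \<in> {s<..<e} \<Longrightarrow> x t > 0"
  shows "\<exists>m. turn x y s m e \<and> y m = 0 \<and> x m > x1 \<and> s < m \<and> m < e"
proof -
  have Es: "energy x y s > 0" using xs ys by (simp add: energy_def)
  have Et: "energy x y t > 0" if "t \<in> {s..e}" for t
    using energy_mono[OF S, of s t] Es that by auto
  have Z: "x t > x1" if "t \<in> {s..e}" "y t = 0" for t
  proof -
    have "t \<noteq> s" "t \<noteq> e" using that ys ye by auto
    then show ?thesis using that x[of t] Et[of t] by (intro pos_energy_x1[of x y t]) auto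
  qed
  then have Z': "x t > xs" if "t \<in> {s..e}" "y t = 0" for t using that xsx1 by fastforce
  from tip_exists[OF S se less_imp_le[OF ys] ye Z']
  obtain m where m: "s \<le> m" "m < e" "y m = 0" "\<forall>t\<in>{s<..<m}. y t > 0" "\<forall>t\<in>{m<..e}. y t < 0"
    by blast
  have "s < m" using m ys by (auto simp: order.order_iff_strict)
  then show ?thesis using m Z[of m] S by (intro exI[of _ m]) (auto simp: turn_def)
qed

lemma turn_suffix:
  assumes "turn x y s m e" "s \<le> s'" "s' \<le> m" "y m = 0"
  shows "turn x y s' m e"
  using assms sol_subset[of x y "{s..e}" "{s'..e}"] unfolding turn_def by auto

lemma turn_prefix:
  assumes "turn x y s m e" "m \<le> e'" "e' \<le> e"
  shows "turn x y s m e'"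
  using assms sol_subset[of x y "{s..e}" "{s..e'}"] unfolding turn_def by auto

lemma below_from_zeros:
  assumes "sol xa ya {s1..e1}" "s1 < e1" "xa s1 = 0" "ya s1 > 0" "ya e1 < 0" "\<And>t. t \<in> {s1<..<e1} \<Longrightarrow> xa t > 0"
    and "sol xb yb {s2..e2}" "s2 < e2" "xb s2 = 0" "yb s2 > 0" "yb e2 < 0" "\<And>t. t \<in> {s2<..<e2} \<Longrightarrow> xb t > 0"
    and "energy xa ya s1 < energy xb yb s2"
  shows "below xa ya e1 xb yb e2"
  using turn_from_zero[OF assms(1-6)] turn_from_zero[OF assms(7-12)] assms(3,9,13)
  unfolding below_def by metis

lemma zero_gap_gain:
  assumes S: "sol x y {a..b}" and ab: "a < b" and xa: "x a = 0" and xb: "x b = 0" and ya: "y a \<noteq> 0"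
  shows "energy x y b \<ge> energy x y a + gain"
proof -
  have main: "energy x y b \<ge> energy x y a + gain"
    if S: "sol x y {a..b}" and xa: "x a = 0" and xb: "x b = 0" and ya: "y a > 0" for x y
  proof -
    obtain d where d: "d > 0" "\<And>h. h > 0 \<Longrightarrow> a + h \<in> {a..b} \<Longrightarrow> h < d \<Longrightarrow> x a < x (a + h)"
      using has_real_derivative_pos_inc_right[OF sol_x[OF S, of a]] ya ab by auto
    define t0 where "t0 = a + min d (b - a) / 2"
    have t0: "a < t0" "t0 < b" using d ab by (auto simp: t0_def min_def field_simps)
    have pos: "x t > 0" if "a < t" "t \<le> t0" for t
      using d(2)[of "t - a"] d(1) that xa t0 by (auto simp: t0_def)
    have "continuous_on {t0..b} x" by (rule continuous_on_subset[OF sol_cont(1)[OF S]]) (use t0 in auto)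
    from first_zero[OF this _ pos[of t0]] t0 xb
    obtain e where e: "t0 < e" "e \<le> b" "x e = 0" "\<forall>t\<in>{t0..<e}. x t > 0" by auto
    have "energy x y e \<ge> energy x y a + gain"
    proof (rule half_turn_gain[OF sol_subset[OF S]])
      fix t assume "t \<in> {a<..<e}"
      then show "x t > 0" using pos[of t] e(4) by (cases "t \<le> t0") auto
    qed (use e t0 xa ya in auto)
    moreover have "energy x y e \<le> energy x y b" by (rule energy_mono[OF S]) (use e t0 in auto)
    ultimately show ?thesis by simp
  qed
  show ?thesis
  proof (cases "y a > 0")
    case True then show ?thesis using main[OF S xa xb] by simp
  next
    case False
    then show ?thesis using main[OF sol_minus[OF S]] xa xb ya by simp
  qed
qed

lemma zeros_gain:
  assumes S: "sol x y {..T}" and nd: "\<And>t. t \<le> T \<Longrightarrow> x t = 0 \<Longrightarrow> y t \<noteq> 0"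
    and F: "finite F" "F \<noteq> {}" "F \<subseteq> {t. t \<le> T \<and> x t = 0}"
  shows "energy x y (Max F) \<ge> (real (card F) - 1) * gain"
  using F
proof (induction F rule: finite_linorder_max_induct)
  case empty then show ?case by simp
next
  case (insert b F)
  show ?case
  proof (cases "F = {}")
    case True
    then show ?thesis using insert.prems by (simp add: energy_def)
  next
    case False
    have M: "Max F \<in> F" using False insert.hyps by simp
    then have lt: "Max F < b" using insert.hyps by blast
    have mb: "Max (Set.insert b F) = b"
      using lt False insert.hyps by (simp add: Max_insert)
    have "b \<notin> F" using insert.hyps by blast
    then have card: "card (Set.insert b F) = Suc (card F)" using insert.hyps by simp
    have "energy x y b \<ge> energy x y (Max F) + gain"
      by (rule zero_gap_gain[OF sol_subset[OF S] lt]) (use insert.prems M nd in auto)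
    moreover have "energy x y (Max F) \<ge> (real (card F) - 1) * gain" using insert False by simp
    ultimately show ?thesis unfolding mb card by (simp add: algebra_simps)
  qed
qed

text \<open>Each gap between zeros costs at least \<open>gain\<close>, and the energy at zeros is nonnegative while the
  energy at \<open>T\<close> is finite.\<close>

lemma zeros_finite:
  assumes S: "sol x y {..T}" and nd: "\<And>t. t \<le> T \<Longrightarrow> x t = 0 \<Longrightarrow> y t \<noteq> 0"
  shows "finite {t. t \<le> T \<and> x t = 0}"
proof (rule ccontr)
  assume inf: "infinite {t. t \<le> T \<and> x t = 0}"
  obtain N :: nat where N: "energy x y T / gain < real N" using reals_Archimedean2 by blast
  obtain F where F: "finite F" "card F = Suc N" "F \<subseteq> {t. t \<le> T \<and> x t = 0}"
    using infinite_arbitrarily_large[OF inf] by blast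
  have ne: "F \<noteq> {}" using F by auto
  have "energy x y (Max F) \<ge> (real (card F) - 1) * gain" by (rule zeros_gain[OF S nd F(1) ne F(3)])
  moreover have "Max F \<le> T" using F ne Max_in[OF F(1) ne] by auto
  then have "energy x y (Max F) \<le> energy x y T" by (intro energy_mono[OF S]) auto
  ultimately have "real N * gain \<le> energy x y T" using F by simp
  then show False using N gain_pos by (simp add: field_simps)
qed

lemma stays_at_origin:
  assumes S: "sol x y {s..e}" and se: "s \<le> e" and xs: "x s = 0" "y s = 0"
  shows "x e = 0" "y e = 0"
proof -
  have lip: "\<exists>G\<ge>0. \<forall>u\<in>{-M..M}. \<forall>v\<in>{-M..M}. \<bar>(B * u - K * nonlin q u) - (B * v - K * nonlin q v)\<bar> \<le> G * \<bar>u - v\<bar>" for M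
    by (rule affine_nonlin_locally_lipschitz[OF q2])
  have d: "(x has_real_derivative y t) (at t)" "(y has_real_derivative A * y t + (B * x t - K * nonlin q (x t))) (at t)"
    if "t \<in> {s<..<e}" for t
    using sol_at[OF S, of t] that by (auto simp: algebra_simps)
  have z: "((\<lambda>_. 0::real) has_real_derivative 0) (at t)"
    "((\<lambda>_. 0::real) has_real_derivative A * 0 + (B * 0 - K * nonlin q 0)) (at t)" for t
    by auto
  have c0: "continuous_on {s..e} (\<lambda>_. 0::real)" by (rule continuous_on_const)
  note pu = planar_unique[where h = "\<lambda>u. B * u - K * nonlin q u" and a = A and ?x1.0 = x and ?y1.0 = y
        and ?x2.0 = "\<lambda>_. 0" and ?y2.0 = "\<lambda>_. 0" and s = s and e = e and t = e,
        OF lip sol_cont[OF S] c0 c0 d z xs]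
  show "x e = 0" "y e = 0" using pu se by simp_all
qed

lemma const_sign:
  fixes x :: "real \<Rightarrow> real"
  assumes c: "continuous_on I x" and I: "is_interval I" and nz: "\<And>t. t \<in> I \<Longrightarrow> x t \<noteq> 0"
    and a: "a \<in> I" "x a > 0" and b: "b \<in> I"
  shows "x b > 0"
proof (rule ccontr)
  assume nb: "\<not> x b > 0"
  have sub: "{min a b..max a b} \<subseteq> I"
  proof
    fix t assume t: "t \<in> {min a b..max a b}"
    show "t \<in> I"
    proof (cases "a \<le> b")
      case True then show ?thesis using mem_is_interval_1_I[OF I a(1) b, of t] t by simp
    next
      case False then show ?thesis using mem_is_interval_1_I[OF I b a(1), of t] t by simp
    qed
  qed
  have c': "continuous_on {min a b..max a b} x" by (rule continuous_on_subset[OF c sub])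
  have "\<exists>t\<in>{min a b..max a b}. x t = 0"
  proof (cases "a \<le> b")
    case True
    then show ?thesis using IVT2'[of x b 0 a] c' nb a by (auto simp: min_def max_def)
  next
    case False
    then show ?thesis using IVT'[of x b 0 a] c' nb a by (auto simp: min_def max_def)
  qed
  then show False using nz sub by blast
qed

lemma last_nonpos_energy:
  assumes S: "sol x y {a..b}" and ab: "a \<le> b" and Ea: "energy x y a \<le> 0" and Eb: "energy x y b > 0"
  shows "\<exists>c. a \<le> c \<and> c < b \<and> energy x y c = 0 \<and> (\<forall>t\<in>{c<..b}. energy x y t > 0)"
proof -
  have "continuous_on {-b..-a} (\<lambda>s. energy x y (- s))"
    by (rule continuous_on_compose2[OF energy_cont[OF S]]) (auto intro!: continuous_intros)
  from first_zero[OF this] ab Ea Eb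
  obtain e where e: "- b < e" "e \<le> - a" "energy x y (- e) = 0" "\<forall>t\<in>{-b..<e}. energy x y (- t) > 0" by auto
  have "energy x y t > 0" if "t \<in> {- e<..b}" for t
    using e(4)[rule_format, of "- t"] that by auto
  then show ?thesis using e by (intro exI[of _ "- e"]) auto
qed

lemma sign_between:
  fixes x :: "real \<Rightarrow> real"
  assumes c: "continuous_on I x" and I: "is_interval I" and nz: "\<And>t. t \<in> I \<Longrightarrow> x t \<noteq> 0"
  shows "\<exists>c\<in>{1, -1::real}. \<forall>t\<in>I. c * x t > 0"
proof (cases "\<exists>a\<in>I. x a > 0")
  case True
  then obtain a where a: "a \<in> I" "x a > 0" by blast
  have "x t > 0" if "t \<in> I" for t by (rule const_sign[OF c I nz a that])
  then show ?thesis by (intro bexI[of _ 1]) auto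
next
  case False
  have "- x t > 0" if "t \<in> I" for t using False nz[OF that] that by force
  then show ?thesis by (intro bexI[of _ "-1"]) auto
qed

text \<open>Before \<open>t0\<close> the energy, and so the potential, stays below a negative number, whereas the potential is
  close to 0 near \<open>x = 0\<close>.\<close>

lemma negative_energy_singular:
  assumes S: "sol x y {..T}" and neg: "t0 \<le> T" "energy x y t0 < 0"
  shows "\<exists>\<delta>>0. (\<forall>t\<le>t0. x t \<ge> \<delta>) \<or> (\<forall>t\<le>t0. x t \<le> - \<delta>)"
proof -
  define e where "e = energy x y t0"
  have "(pot \<longlongrightarrow> pot 0) (nhds 0)"
    using isCont_pot[of 0] unfolding isCont_def tendsto_at_iff_tendsto_nhds .
  then have "eventually (\<lambda>r. pot r > e) (nhds 0)"
    by (rule order_tendstoD(1)) (use neg(2) in \<open>simp add: e_def\<close>)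
  then obtain \<delta> where \<delta>: "\<delta> > 0" "\<And>r. \<bar>r\<bar> < \<delta> \<Longrightarrow> pot r > e"
    unfolding eventually_nhds_metric by (auto simp: dist_real_def)
  have big: "\<bar>x t\<bar> \<ge> \<delta>" if "t \<le> t0" for t
  proof (rule ccontr)
    assume "\<not> \<bar>x t\<bar> \<ge> \<delta>"
    then have "pot (x t) > e" by (intro \<delta>(2)) simp
    moreover have "energy x y t \<le> e" unfolding e_def by (rule energy_mono[OF S]) (use that neg in auto)
    moreover have "pot (x t) \<le> energy x y t" by (simp add: energy_def)
    ultimately show False by simp
  qed
  have nz: "x t \<noteq> 0" if "t \<in> {..t0}" for t using big[of t] that \<delta>(1) by auto
  have cI: "continuous_on {..t0} x" by (rule continuous_on_subset[OF sol_cont(1)[OF S]]) (use neg(1) in auto)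
  from sign_between[OF cI is_interval_ic nz]
  obtain c where c: "c \<in> {1, -1::real}" "\<forall>t\<in>{..t0}. c * x t > 0" by blast
  show ?thesis
  proof (intro exI[of _ \<delta>] conjI \<delta>(1))
    show "(\<forall>t\<le>t0. x t \<ge> \<delta>) \<or> (\<forall>t\<le>t0. x t \<le> - \<delta>)"
    proof (cases "c = 1")
      case True then show ?thesis using big c(2) by force
    next
      case False
      then have "c = -1" using c(1) by simp
      then show ?thesis using big c(2) by force
    qed
  qed
qed

end

section \<open>The regular trajectory and the stable curve\<close>

text \<open>The graph of \<open>h\<close> stands for the stable curve of the outer system; \<open>h_cross\<close> says that inner
  trajectories cross it downwards.
  The trajectory \<open>U = (ux, uy)\<close> is the regular one with coefficient 1.\<close>

locale emden_graph = emden +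
  fixes h ux uy :: "real \<Rightarrow> real"
  assumes h_neg: "\<And>x. x > 0 \<Longrightarrow> h x < 0"
    and h_cont: "continuous_on {0<..} h"
    and h_0: "(h \<longlongrightarrow> 0) (at_right 0)"
    and h_cross: "\<And>x y a b. sol x y {a..b} \<Longrightarrow> a < b \<Longrightarrow> (\<And>t. t \<in> {a..b} \<Longrightarrow> x t > 0) \<Longrightarrow>
        y a \<le> h (x a) \<Longrightarrow> y b < h (x b)"
    and U: "sol ux uy UNIV"
    and ux_lim: "((\<lambda>t. exp (- \<alpha> * t) * ux t) \<longlongrightarrow> 1) at_bot"
    and uy_lim: "((\<lambda>t. exp (- \<alpha> * t) * uy t) \<longlongrightarrow> \<alpha>) at_bot"
begin

text \<open>Otherwise the half turn with more energy would pass the abscissa \<open>xa e1\<close> on its falling arc before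
  it reaches the graph. There it has more energy than the other one, which is on the graph, so it is
  already below the graph and cannot come back.\<close>

lemma below_graph:
  assumes b: "below xa ya e1 xb yb e2" and xe: "xa e1 > 0"
    and ha: "ya e1 = h (xa e1)" and hb: "yb e2 = h (xb e2)" and xb: "xb e2 > 0"
  shows "xa e1 < xb e2"
proof (rule ccontr)
  assume "\<not> xa e1 < xb e2"
  then have le: "xb e2 \<le> xa e1" by simp
  obtain s1 m1 s2 m2 where 1: "turn xa ya s1 m1 e1" and 2: "turn xb yb s2 m2 e2" "yb m2 = 0"
     and st: "xa s1 = xb s2" "energy xa ya s1 < energy xb yb s2" using b unfolding below_def by blast
  have S1: "sol xa ya {s1..e1}" "s1 \<le> m1" "m1 \<le> e1" and S2: "sol xb yb {s2..e2}" "s2 \<le> m2" "m2 \<le> e2"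
    using 1 2 by (auto simp: turn_def)
  have "xa m1 \<le> xb m2"
    by (rule tip_compare[of xa ya s1 m1 xb yb s2 m2])
       (use 1 2 st sol_subset[OF S1(1)] sol_subset[OF S2(1)] in \<open>auto simp: turn_def\<close>)
  moreover have "xa e1 \<le> xa m1"
    by (rule x_ge[OF sol_subset[OF S1(1)]]) (use 1 in \<open>auto simp: turn_def\<close>)
  ultimately have "xa e1 \<le> xb m2" by simp
  moreover have "continuous_on {m2..e2} xb" by (rule continuous_on_subset[OF sol_cont(1)[OF S2(1)]]) (use S2 in auto)
  ultimately obtain m where m: "m2 \<le> m" "m \<le> e2" "xb m = xa e1"
    using IVT2'[of xb e2 "xa e1" m2] le S2 by auto
  have P2: "turn xb yb s2 m2 m" by (rule turn_prefix[OF 2(1) m(1,2)])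
  have "energy xa ya e1 < energy xb yb m"
    by (rule below_energy) (use 1 2 P2 st m in \<open>auto simp: below_def\<close>)
  then have sq: "(ya e1)\<^sup>2 < (yb m)\<^sup>2" using m by (simp add: energy_def)
  have yn: "yb t \<le> 0" if tm: "t \<in> {m2..e2}" for t
  proof -
    consider "t = m2" | "t = e2" | "m2 < t \<and> t < e2" using tm by fastforce
    then show ?thesis
    proof cases
      case 3 then have "yb t < 0" using 2 unfolding turn_def by simp
      then show ?thesis by simp
    qed (use 2 hb h_neg[OF xb] in auto)
  qed
  have "yb m < ya e1"
  proof (rule ccontr)
    assume "\<not> yb m < ya e1"
    then have "- yb m \<le> - ya e1" by simp
    moreover have "0 \<le> - yb m" using yn m by auto
    ultimately have "(- yb m)\<^sup>2 \<le> (- ya e1)\<^sup>2" by (rule power_mono)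
    then show False using sq by simp
  qed
  then have g: "yb m < h (xb m)" using ha m by simp
  then have "m \<noteq> e2" using hb by auto
  then have me: "m < e2" using m by simp
  have "yb e2 < h (xb e2)"
  proof (rule h_cross[OF sol_subset[OF S2(1)] me])
    show "{m..e2} \<subseteq> {s2..e2}" using m S2 by auto
    fix t assume t: "t \<in> {m..e2}"
    have "xb e2 \<le> xb t"
      by (rule x_ge[OF sol_subset[OF S2(1)]]) (use t m S2 2 in \<open>auto simp: turn_def\<close>)
    then show "xb t > 0" using xb by simp
  qed (use g in simp)
  then show False using hb by simp
qed

lemma ux_0: "(ux \<longlongrightarrow> 0) at_bot" and uy_0: "(uy \<longlongrightarrow> 0) at_bot" and energy_U_0: "(energy ux uy \<longlongrightarrow> 0) at_bot"
proof -
  have e: "((\<lambda>t. exp (\<alpha> * t)) \<longlongrightarrow> 0) at_bot"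
    by (rule filterlim_compose[OF exp_at_bot])
       (use filterlim_tendsto_pos_mult_at_bot[OF tendsto_const[of \<alpha>] \<alpha>0 filterlim_ident] in simp)
  have i: "exp (\<alpha> * t) * (exp (- \<alpha> * t) * c) = c" for t c
    by (simp add: mult.assoc[symmetric] flip: exp_add)
  show x: "(ux \<longlongrightarrow> 0) at_bot" using tendsto_mult[OF e ux_lim, unfolded i] by simp
  show y: "(uy \<longlongrightarrow> 0) at_bot" using tendsto_mult[OF e uy_lim, unfolded i] by simp
  have "(energy ux uy \<longlongrightarrow> 0\<^sup>2 / 2 + pot 0) at_bot"
    unfolding energy_def[abs_def]
    by (intro tendsto_add tendsto_divide tendsto_power y tendsto_const isCont_tendsto_compose[OF isCont_pot x]) auto
  then show "(energy ux uy \<longlongrightarrow> 0) at_bot" by simp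
qed

lemma U_early: "eventually (\<lambda>t. ux t > 0 \<and> uy t > 0) at_bot"
proof -
  have "eventually (\<lambda>t. exp (- \<alpha> * t) * ux t > 0) at_bot" by (rule order_tendstoD(1)[OF ux_lim]) simp
  moreover have "eventually (\<lambda>t. exp (- \<alpha> * t) * uy t > 0) at_bot" by (rule order_tendstoD(1)[OF uy_lim \<alpha>0])
  ultimately show ?thesis by eventually_elim (auto simp: zero_less_mult_iff)
qed

lemma energy_U_mono: "s \<le> t \<Longrightarrow> energy ux uy s \<le> energy ux uy t"
  by (rule energy_mono[OF U]) auto

text \<open>The energy tends to 0 at \<open>- \<infinity>\<close> and increases strictly as long as \<open>uy > 0\<close>.\<close>

lemma energy_U_pos: "energy ux uy t > 0"
proof -
  have nonneg: "energy ux uy t \<ge> 0" for t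
    by (rule tendsto_upperbound[OF energy_U_0])
       (auto intro!: eventually_mono[OF eventually_le_at_bot[of t]] energy_U_mono)
  obtain T where T: "\<And>t. t \<le> T \<Longrightarrow> uy t > 0" using U_early unfolding eventually_at_bot_linorder by blast
  define s where "s = min t T"
  have "energy ux uy (s - 1) < energy ux uy s"
  proof (rule DERIV_pos_imp_increasing_open[where f = "energy ux uy"])
    show "continuous_on {s - 1..s} (energy ux uy)" by (rule continuous_on_subset[OF energy_cont[OF U]]) auto
    fix r assume r: "s - 1 < r" "r < s"
    have "(energy ux uy has_real_derivative A * (uy r)\<^sup>2) (at r)" using energy_deriv[OF U, of r] by simp
    moreover have "A * (uy r)\<^sup>2 > 0" using A0 T[of r] r by (auto simp: s_def)
    ultimately show "\<exists>v. DERIV (energy ux uy) r :> v \<and> v > 0" by blast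
  qed simp
  then have "energy ux uy s > 0" using nonneg[of "s - 1"] by simp
  then show ?thesis using energy_U_mono[of s t] by (simp add: s_def)
qed

lemma U_nondegenerate: "ux t = 0 \<Longrightarrow> uy t \<noteq> 0"
  using energy_U_pos[of t] by (auto simp: energy_def)

lemma zeros_of_U_exist:
  "\<exists>tz :: nat \<Rightarrow> real. (\<forall>k. ux (tz k) = 0) \<and> (\<forall>k. tz k < tz (Suc k)) \<and> (\<forall>t<tz 0. ux t > 0) \<and>
     (\<forall>k. \<forall>t\<in>{tz k<..<tz (Suc k)}. (-1) ^ Suc k * ux t > 0)"
proof -
  define P where "P k t \<longleftrightarrow> ux t = 0 \<and> (-1) ^ k * uy t < 0 \<and> (k = 0 \<longrightarrow> (\<forall>r<t. ux r > 0))" for k :: nat and t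
  define Q where "Q k s t \<longleftrightarrow> s < t \<and> (\<forall>r\<in>{s<..<t}. (-1) ^ Suc k * ux r > 0)" for k :: nat and s t
  have "\<exists>tz. \<forall>k. P k (tz k) \<and> Q k (tz k) (tz (Suc k))"
  proof (rule dependent_nat_choice)
    obtain T where T: "\<And>t. t \<le> T \<Longrightarrow> ux t > 0 \<and> uy t > 0" using U_early unfolding eventually_at_bot_linorder by blast
    have "\<exists>b\<ge>T. ux b \<le> 0"
    proof (rule ccontr)
      assume "\<not> ?thesis"
      then have "ux t > 0" if "t \<ge> T" for t using that by force
      then show False using no_escape[OF sol_subset[OF U, of "{T..}"] _ energy_U_pos] by auto
    qed
    then obtain b where b: "b \<ge> T" "ux b \<le> 0" by blast
    have "continuous_on {T..b} ux" by (rule continuous_on_subset[OF sol_cont(1)[OF U]]) auto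
    from first_zero[OF this b(1) _ b(2)] T
    obtain e where e: "T < e" "ux e = 0" "\<forall>t\<in>{T..<e}. ux t > 0" by auto
    have pos: "ux r > 0" if "r < e" for r using e T[of r] that by (cases "r \<le> T") auto
    have "uy e < 0"
      by (rule zero_at_turn_end[OF sol_subset[OF U], of T]) (use e pos energy_U_pos in auto)
    then show "\<exists>t. P 0 t" using e pos by (auto simp: P_def)
  next
    fix s :: real and k :: nat assume P: "P k s"
    have main: "\<exists>e>s. ux e = 0 \<and> (\<forall>t\<in>{s<..<e}. c * ux t > 0) \<and> c * uy e < 0"
      if c: "c = 1 \<or> c = (-1::real)" and cy: "c * uy s > 0" for c
    proof -
      have S: "sol (\<lambda>t. c * ux t) (\<lambda>t. c * uy t) UNIV" using c U sol_minus[OF U] by auto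
      have "c * ux s = 0" using P by (simp add: P_def)
      from next_zero[OF sol_subset[OF S subset_UNIV] this cy]
      obtain e where e: "e > s" "c * ux e = 0" "\<forall>t\<in>{s<..<e}. c * ux t > 0" by blast
      have "c * uy e < 0"
      proof (rule zero_at_turn_end[OF sol_subset[OF S], of s e])
        show "energy (\<lambda>t. c * ux t) (\<lambda>t. c * uy t) s > 0"
          using c energy_U_pos[of s] energy_minus[of ux uy] by auto
      qed (use e in auto)
      then show ?thesis using e c by auto
    qed
    have "\<exists>e>s. ux e = 0 \<and> (\<forall>t\<in>{s<..<e}. (-1) ^ Suc k * ux t > 0) \<and> (-1) ^ Suc k * uy e < 0"
    proof (rule main)
      show "(-1) ^ Suc k = (1::real) \<or> (-1) ^ Suc k = (-1::real)" by (cases "even k") auto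
      show "(-1) ^ Suc k * uy s > 0" using P by (simp add: P_def)
    qed
    then show "\<exists>t. P (Suc k) t \<and> Q k s t" unfolding P_def Q_def by blast
  qed
  then show ?thesis unfolding P_def Q_def by auto
qed

end

text \<open>The sequence \<open>tz\<close> enumerates the zeros of \<open>ux\<close>. The reflected trajectory \<open>V k\<close> has its \<open>k\<close>-th half turn in
  \<open>x > 0\<close>, at the times in \<open>bump k\<close>; \<open>bump 0\<close> extends to \<open>- \<infinity>\<close>.\<close>

locale emden_bumps = emden_graph +
  fixes tz :: "nat \<Rightarrow> real"
  assumes tz_zero: "ux (tz k) = 0" and tz_Suc: "tz k < tz (Suc k)"
    and tz_first: "t < tz 0 \<Longrightarrow> ux t > 0"
    and tz_sign: "t \<in> {tz k<..<tz (Suc k)} \<Longrightarrow> (-1) ^ Suc k * ux t > 0"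
begin

definition V :: "nat \<Rightarrow> real \<Rightarrow> real" where "V k t = (-1) ^ k * ux t"
definition Vy :: "nat \<Rightarrow> real \<Rightarrow> real" where "Vy k t = (-1) ^ k * uy t"

lemma V_cases: "(V k = ux \<and> Vy k = uy) \<or> (V k = (\<lambda>t. - ux t) \<and> Vy k = (\<lambda>t. - uy t))"
  unfolding V_def[abs_def] Vy_def[abs_def] by (cases "even k") auto

lemma V_sol: "sol (V k) (Vy k) I"
  using V_cases[of k] sol_subset[OF U, of I] sol_minus[OF sol_subset[OF U, of I]] by auto

lemma V_energy: "energy (V k) (Vy k) = energy ux uy"
  using V_cases[of k] by auto

lemma V_Suc: "V (Suc k) t = - V k t" "Vy (Suc k) t = - Vy k t"
  by (simp_all add: V_def Vy_def)

lemma V_tz: "V k (tz j) = 0"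
  by (simp add: V_def tz_zero)

definition bump :: "nat \<Rightarrow> real set" where
  "bump k = {t. t < tz k \<and> (k > 0 \<longrightarrow> tz (k - 1) < t)}"

lemma V_pos: "t \<in> bump k \<Longrightarrow> V k t > 0"
proof (cases k)
  case 0 then show "t \<in> bump k \<Longrightarrow> V k t > 0" by (simp add: bump_def V_def tz_first)
next
  case (Suc j) then show "t \<in> bump k \<Longrightarrow> V k t > 0" using tz_sign[of t j] by (simp add: bump_def V_def)
qed

lemma Vy_end: "Vy k (tz k) < 0"
proof -
  define s where "s = (if k = 0 then tz k - 1 else (tz (k - 1) + tz k) / 2)"
  have lt: "k > 0 \<Longrightarrow> tz (k - 1) < tz k" using tz_Suc[of "k - 1"] by simp
  have s: "s < tz k" "\<And>t. t \<in> {s<..<tz k} \<Longrightarrow> t \<in> bump k"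
    using lt by (auto simp: s_def bump_def field_simps split: if_splits)
  show ?thesis
    by (rule zero_at_turn_end[OF V_sol s(1) V_pos[OF s(2)] V_tz]) (auto simp: V_energy energy_U_pos)
qed

lemma Vy_start: "Vy (Suc k) (tz k) > 0"
  using Vy_end[of k] by (simp add: V_Suc)

abbreviation "EZ k \<equiv> energy ux uy (tz k)"

lemma EZ_Suc: "EZ (Suc k) \<ge> EZ k + gain"
  by (rule zero_gap_gain[OF sol_subset[OF U] tz_Suc tz_zero tz_zero U_nondegenerate[OF tz_zero]]) auto

lemma EZ_less: "EZ k < EZ (Suc k)"
  using EZ_Suc[of k] gain_pos by linarith

lemma tz_unbounded: "\<exists>k. tz k > T"
proof (rule ccontr)
  assume "\<not> ?thesis"
  then have le: "tz k \<le> T" for k by (meson linorder_not_le)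
  have EZ: "EZ k \<ge> real k * gain" for k
  proof (induction k)
    case 0 then show ?case using energy_U_pos[of "tz 0"] by simp
  next
    case (Suc k) then show ?case using EZ_Suc[of k] by (simp add: algebra_simps)
  qed
  obtain N :: nat where N: "energy ux uy T / gain < real N" using reals_Archimedean2 by blast
  have "real N * gain \<le> energy ux uy T" using EZ[of N] energy_U_mono[OF le[of N]] by simp
  then show False using N gain_pos by (simp add: field_simps)
qed

subsection \<open>Crossings of the stable curve\<close>

text \<open>At the tip of a bump \<open>V k\<close> lies above the graph of \<open>h\<close>. At its end \<open>x\<close> tends to 0 with \<open>y\<close> negative,
  whereas \<open>h x\<close> tends to 0, so there it lies below the graph.\<close>

lemma crossing_exists: "\<exists>s\<in>bump k. Vy k s = h (V k s)"
proof -
  have "\<exists>T\<in>bump k \<union> {t. k > 0 \<and> t = tz (k - 1)}. Vy k T > 0 \<and> T < tz k"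
  proof (cases k)
    case 0
    obtain T where T: "\<And>t. t \<le> T \<Longrightarrow> ux t > 0 \<and> uy t > 0" using U_early unfolding eventually_at_bot_linorder by blast
    define r where "r = min T (tz 0 - 1)"
    have "r \<in> bump k" "r < tz k" "Vy k r > 0" using T[of r] 0 by (auto simp: r_def bump_def Vy_def)
    then show ?thesis by blast
  next
    case (Suc j)
    then show ?thesis using Vy_start[of j] tz_Suc[of j] by auto
  qed
  then obtain T where T: "T \<in> bump k \<union> {t. k > 0 \<and> t = tz (k - 1)}" "Vy k T > 0" "T < tz k" by blast
  have inb: "t \<in> bump k" if "T < t" "t < tz k" for t using T(1) that by (auto simp: bump_def)
  obtain m where m: "T \<le> m" "m \<le> tz k" "Vy k m = 0"
    using IVT2'[of "Vy k" "tz k" 0 T] Vy_end[of k] T sol_cont(2)[OF V_sol] by auto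
  have "m \<noteq> T" "m \<noteq> tz k" using m T Vy_end[of k] by auto
  then have m': "T < m" "m < tz k" using m by auto
  have cV: "isCont (V k) t" "isCont (Vy k) t" for t
    using sol_cont[OF V_sol[of k UNIV]] by (auto simp: continuous_on_eq_continuous_at)
  have lim: "((\<lambda>t. Vy k t - h (V k t)) \<longlongrightarrow> Vy k (tz k) - 0) (at_left (tz k))"
  proof (intro tendsto_diff)
    show "(Vy k \<longlongrightarrow> Vy k (tz k)) (at_left (tz k))"
      using cV(2)[of "tz k"] by (simp add: isCont_def filterlim_at_split)
    have "(V k \<longlongrightarrow> 0) (at_left (tz k))"
      using cV(1)[of "tz k"] by (simp add: isCont_def filterlim_at_split V_tz)
    moreover have "eventually (\<lambda>t. V k t > 0) (at_left (tz k))"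
      using eventually_at_left_real[OF m'(2)] by eventually_elim (use inb m' V_pos in auto)
    ultimately have "filterlim (V k) (at_right 0) (at_left (tz k))"
      by (auto simp: filterlim_at elim: eventually_mono)
    then show "((\<lambda>t. h (V k t)) \<longlongrightarrow> 0) (at_left (tz k))" by (rule filterlim_compose[OF h_0])
  qed
  have "eventually (\<lambda>t. Vy k t - h (V k t) < 0) (at_left (tz k))"
    by (rule order_tendstoD(2)[OF lim]) (use Vy_end in auto)
  moreover have "eventually (\<lambda>t. t \<in> {m<..<tz k}) (at_left (tz k))"
    by (rule eventually_at_left_real[OF m'(2)])
  ultimately have "eventually (\<lambda>t. Vy k t - h (V k t) < 0 \<and> t \<in> {m<..<tz k}) (at_left (tz k))"
    by (rule eventually_conj)
  then obtain e where e: "Vy k e - h (V k e) < 0" "m < e" "e < tz k"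
    using eventually_happens'[of "at_left (tz k)"] by (auto simp: trivial_limit_at_left_real)
  have gm: "Vy k m - h (V k m) > 0"
    using m h_neg[OF V_pos[OF inb[OF m']]] by simp
  have "continuous_on {m..e} (\<lambda>t. Vy k t - h (V k t))"
  proof (intro continuous_on_diff sol_cont(2)[OF V_sol] continuous_on_compose2[OF h_cont sol_cont(1)[OF V_sol]])
    show "V k ` {m..e} \<subseteq> {0<..}" using V_pos inb m' e by auto
  qed
  then obtain s where s: "m \<le> s" "s \<le> e" "Vy k s - h (V k s) = 0"
    using IVT2'[of "\<lambda>t. Vy k t - h (V k t)" e 0 m] gm e by auto
  then show ?thesis using inb[of s] m' e by (intro bexI[of _ s]) auto
qed

lemma bump_convex: "a \<in> bump k \<Longrightarrow> b \<in> bump k \<Longrightarrow> a \<le> t \<Longrightarrow> t \<le> b \<Longrightarrow> t \<in> bump k"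
  by (auto simp: bump_def)

lemma crossing_unique:
  assumes "s \<in> bump k" "Vy k s = h (V k s)" "t \<in> bump k" "Vy k t = h (V k t)"
  shows "s = t"
proof -
  have no: False if "a \<in> bump k" "Vy k a = h (V k a)" "b \<in> bump k" "Vy k b = h (V k b)" "a < b" for a b
    using h_cross[OF V_sol that(5), of k] V_pos bump_convex[OF that(1,3)] that by force
  then show ?thesis using assms by (metis linorder_neqE_linordered_idom)
qed

definition crossing :: "nat \<Rightarrow> real" where
  "crossing k = (THE s. s \<in> bump k \<and> Vy k s = h (V k s))"

lemma crossing: "crossing k \<in> bump k" "Vy k (crossing k) = h (V k (crossing k))"
proof -
  have "crossing k \<in> bump k \<and> Vy k (crossing k) = h (V k (crossing k))"
    unfolding crossing_def by (rule theI') (use crossing_exists crossing_unique in blast)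
  then show "crossing k \<in> bump k" "Vy k (crossing k) = h (V k (crossing k))" by auto
qed

definition X :: "nat \<Rightarrow> real" where "X k = V k (crossing k)"

lemma X_pos: "X k > 0"
  unfolding X_def by (rule V_pos[OF crossing(1)])

lemma Vy_crossing: "Vy k (crossing k) < 0"
  using crossing(2)[of k] h_neg[OF X_pos[of k]] by (simp add: X_def)

lemma crossing_bounds: "crossing k < tz k" "tz k < crossing (Suc k)"
  using crossing(1)[of k] crossing(1)[of "Suc k"] by (auto simp: bump_def)

lemma crossing_mono: "strict_mono crossing"
  unfolding strict_mono_Suc_iff using crossing_bounds by (meson less_trans)

lemma crossing_unbounded: "filterlim crossing at_top sequentially"
proof (rule filterlim_at_top[THEN iffD2], intro allI)
  fix Z
  obtain k where k: "tz k > Z" using tz_unbounded by blast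
  have "crossing n \<ge> Z" if "n \<ge> Suc k" for n
    using crossing_bounds(2)[of k] k that strict_mono_less_eq[OF crossing_mono, of "Suc k" n] by simp
  then show "eventually (\<lambda>n. Z \<le> crossing n) sequentially" unfolding eventually_sequentially by blast
qed

lemma zeros_before_crossing: "{t. t < crossing k \<and> ux t = 0} = tz ` {..<k}"
proof
  show "tz ` {..<k} \<subseteq> {t. t < crossing k \<and> ux t = 0}"
  proof
    fix t assume "t \<in> tz ` {..<k}"
    then obtain j where j: "j < k" "t = tz j" by auto
    have "crossing (Suc j) \<le> crossing k" using j strict_mono_less_eq[OF crossing_mono] by simp
    then show "t \<in> {t. t < crossing k \<and> ux t = 0}" using crossing_bounds(2)[of j] j tz_zero by simp
  qed
  show "{t. t < crossing k \<and> ux t = 0} \<subseteq> tz ` {..<k}"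
  proof
    fix t assume "t \<in> {t. t < crossing k \<and> ux t = 0}"
    then have t: "t < crossing k" "ux t = 0" by auto
    have "t < tz k" using t crossing_bounds(1)[of k] by simp
    define j where "j = (LEAST j. t < tz j)"
    have j: "t < tz j" unfolding j_def by (rule LeastI[of _ k]) fact
    have jk: "j \<le> k" unfolding j_def by (rule Least_le) fact
    have "j \<noteq> 0" using tz_first[of t] j t by (cases "j = 0") auto
    then obtain i where i: "j = Suc i" by (cases j) auto
    have ti: "tz i \<le> t" using not_less_Least[of i "\<lambda>j. t < tz j"] i by (simp add: j_def[symmetric])
    have "t = tz i"
    proof (rule ccontr)
      assume "t \<noteq> tz i"
      then have "(-1) ^ Suc i * ux t > 0" using tz_sign[of t i] ti j i by auto
      then show False using t by simp
    qed
    then show "t \<in> tz ` {..<k}" using i jk by auto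
  qed
qed

section \<open>Counting the zeros\<close>

text \<open>The first half turn of \<open>U\<close> has no first zero to start from. Instead it may be taken to start at an
  arbitrarily small abscissa with arbitrarily small energy, inside any half turn of
  positive energy that starts on the axis \<open>x = 0\<close>.\<close>

lemma bump0_turn:
  assumes "\<delta> > 0" "\<eta> > 0" and e: "e \<le> tz 0" "uy e < 0"
  shows "\<exists>s m. turn ux uy s m e \<and> uy m = 0 \<and> ux m > x1 \<and> 0 < ux s \<and> ux s < \<delta> \<and> energy ux uy s < \<eta>"
proof -
  have "eventually (\<lambda>t. (ux t > 0 \<and> uy t > 0) \<and> ux t < \<delta> \<and> energy ux uy t < \<eta>) at_bot"
    by (intro eventually_conj U_early order_tendstoD(2)[OF ux_0] order_tendstoD(2)[OF energy_U_0] assms)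
  then obtain T where T: "\<And>t. t \<le> T \<Longrightarrow> (ux t > 0 \<and> uy t > 0) \<and> ux t < \<delta> \<and> energy ux uy t < \<eta>"
    unfolding eventually_at_bot_linorder by blast
  define s where "s = min T (e - 1)"
  have s: "s \<le> T" "s < e" by (auto simp: s_def)
  have Z: "ux t > x1" if "t \<in> {s..e}" "uy t = 0" for t
  proof -
    have "t < tz 0" using that e by (cases "t = e") auto
    then show ?thesis using tz_first[of t] energy_U_pos[of t] that by (intro pos_energy_x1[of ux uy t]) auto
  qed
  then have Z': "ux t > xs" if "t \<in> {s..e}" "uy t = 0" for t using that xsx1 by fastforce
  have "uy s \<ge> 0" using T[OF s(1)] by simp
  from tip_exists[OF sol_subset[OF U subset_UNIV] s(2) this e(2) Z']
  obtain m where m: "s \<le> m" "m < e" "uy m = 0" "\<forall>t\<in>{s<..<m}. uy t > 0" "\<forall>t\<in>{m<..e}. uy t < 0" by blast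
  then have "turn ux uy s m e" using sol_subset[OF U subset_UNIV] by (simp add: turn_def)
  then show ?thesis using m Z[of m] T[OF s(1)] by (intro exI[of _ s] exI[of _ m]) auto
qed

lemma below_bump0_from_zero:
  assumes b: "sol x y {s..e}" "s < e" "x s = 0" "y s > 0" "y e < 0" "\<And>t. t \<in> {s<..<e} \<Longrightarrow> x t > 0"
    and e1: "e1 \<le> tz 0" "uy e1 < 0"
  shows "below ux uy e1 x y e"
proof -
  obtain m where m: "turn x y s m e" "y m = 0" "x m > x1" "s < m" "m < e"
    using turn_from_zero[OF b] by blast
  have "energy x y s > 0" using b by (simp add: energy_def)
  then obtain s1 m1 where 1: "turn ux uy s1 m1 e1" "uy m1 = 0" "ux m1 > x1" "0 < ux s1" "ux s1 < x1"
      "energy ux uy s1 < energy x y s"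
    using bump0_turn[OF x10 _ e1] by blast
  have "continuous_on {s..m} x" by (rule continuous_on_subset[OF sol_cont(1)[OF b(1)]]) (use m in auto)
  then obtain s2 where s2: "s \<le> s2" "s2 \<le> m" "x s2 = ux s1"
    using IVT'[of x s "ux s1" m] 1 m b(3) by auto
  have "energy x y s \<le> energy x y s2" by (rule energy_mono[OF b(1)]) (use s2 m in auto)
  then have "energy ux uy s1 < energy x y s2" using 1(6) by simp
  then show ?thesis unfolding below_def
    using 1(1) turn_suffix[OF m(1) s2(1,2) m(2)] m(2) s2(3)[symmetric] by blast
qed

text \<open>A trajectory that comes from negative energies starts, at the last time of nonpositive energy, inside
  the first half turn of \<open>U\<close>, whose energy is positive throughout.\<close>

lemma below_singular_bump0:
  assumes S: "sol x y {..e}" and x: "\<And>t. t < e \<Longrightarrow> x t > 0" and ye: "y e < 0" and xe: "x e \<ge> 0"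
    and neg: "\<exists>t\<le>e. energy x y t < 0" and e2: "e2 \<le> tz 0" "uy e2 < 0"
  shows "below x y e ux uy e2"
proof -
  have sub: "sol x y {a..e}" for a by (rule sol_subset[OF S]) auto
  have "\<exists>c m. turn x y c m e \<and> energy x y c \<le> 0 \<and> x c > 0"
  proof (cases "energy x y e \<le> 0")
    case True
    have "x e \<noteq> 0" using True ye by (auto simp: energy_def)
    then show ?thesis using True xe sub[of e] by (intro exI[of _ e]) (auto simp: turn_def)
  next
    case False
    obtain a where a: "a \<le> e" "energy x y a < 0" using neg by blast
    obtain c where c: "a \<le> c" "c < e" "energy x y c = 0" "\<forall>t\<in>{c<..e}. energy x y t > 0"
      using last_nonpos_energy[OF sub a(1)] a False by auto
    have Z: "x t > xs" if "t \<in> {c..e}" "y t = 0" for t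
    proof -
      have "t < e" using that ye by (cases "t = e") auto
      then have "x t > 0" by (rule x)
      have "energy x y t \<ge> 0" using c(3,4) that by (cases "t = c") (auto intro: less_imp_le)
      then have "pot (x t) \<ge> 0" using that by (simp add: energy_def)
      then show ?thesis using pot_sign(1)[OF \<open>x t > 0\<close>] xsx1 by linarith
    qed
    show ?thesis
    proof (cases "y c \<ge> 0")
      case True
      obtain m where m: "c \<le> m" "m < e" "y m = 0" "\<forall>t\<in>{c<..<m}. y t > 0" "\<forall>t\<in>{m<..e}. y t < 0"
        using tip_exists[OF sub c(2) True ye Z] by blast
      then have "turn x y c m e" using sub by (simp add: turn_def)
      then show ?thesis using c x[of c] by auto
    next
      case False
      have "y t < 0" if "t \<in> {c<..<e}" for t
        by (rule y_after_zero[of x y c t, OF sol_subset[OF S]]) (use False that Z in auto)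
      then have "turn x y c c e" using sub c by (simp add: turn_def)
      then show ?thesis using c x[of c] by auto
    qed
  qed
  then obtain c m where c: "turn x y c m e" "energy x y c \<le> 0" "x c > 0" by blast
  have "pot (x c) \<le> 0" using c(2) zero_le_power2[of "y c"] unfolding energy_def by linarith
  then have xc: "x c \<le> x1" using pot_sign(2)[OF c(3)] by linarith
  obtain s2 m2 where 2: "turn ux uy s2 m2 e2" "uy m2 = 0" "ux m2 > x1" "0 < ux s2" "ux s2 < x c"
    using bump0_turn[OF c(3) zero_less_one e2] by blast
  have "continuous_on {s2..m2} ux" by (rule continuous_on_subset[OF sol_cont(1)[OF U]]) auto
  then obtain s where s: "s2 \<le> s" "s \<le> m2" "ux s = x c"
    using IVT'[of ux s2 "x c" m2] 2 xc by (auto simp: turn_def)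
  have "energy x y c < energy ux uy s" using c(2) energy_U_pos[of s] by simp
  then show ?thesis unfolding below_def
    using c(1) turn_suffix[OF 2(1) s(1,2) 2(2)] 2(2) s(3)[symmetric] by blast
qed

lemma V_bump_facts:
  assumes "tz k < e" "e \<le> tz (Suc k)"
  shows "sol (V (Suc k)) (Vy (Suc k)) {tz k..e}" "tz k < e" "V (Suc k) (tz k) = 0" "Vy (Suc k) (tz k) > 0"
    "\<And>t. t \<in> {tz k<..<e} \<Longrightarrow> V (Suc k) t > 0"
  using assms by (auto simp: V_sol V_tz Vy_start bump_def intro!: V_pos)

lemma V0: "V 0 = ux" "Vy 0 = uy"
  by (rule ext, simp add: V_def) (rule ext, simp add: Vy_def)

text \<open>One half turn from zero to zero advances the position relative to the energies of \<open>U\<close> at its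
  zeros by one index.\<close>

lemma half_turn_order:
  assumes S: "sol x y {s..e}" and se: "s < e" and xs: "x s = 0" and ys: "y s > 0" and xe: "x e = 0"
    and x: "\<And>t. t \<in> {s<..<e} \<Longrightarrow> x t > 0"
  shows "energy x y s < EZ k \<Longrightarrow> energy x y e < EZ (Suc k)"
    "EZ k < energy x y s \<Longrightarrow> EZ (Suc k) < energy x y e"
    "EZ 0 < energy x y e"
proof -
  have ye: "y e < 0" by (rule zero_at_turn_end[OF S se x xe]) (use xs ys in \<open>auto simp: energy_def\<close>)
  note fk = V_bump_facts[where k = k, OF tz_Suc order_refl] and f = S se xs ys
  show "energy x y e < EZ (Suc k)" if "energy x y s < EZ k"
    using below_energy[OF below_from_zeros[OF f ye x fk(1-4) Vy_end fk(5)]] that xe V_tz by (simp add: V_energy)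
  show "EZ (Suc k) < energy x y e" if "EZ k < energy x y s"
    using below_energy[OF below_from_zeros[OF fk(1-4) Vy_end fk(5) f ye x]] that xe V_tz by (simp add: V_energy)
  have "below ux uy (tz 0) x y e"
    by (rule below_bump0_from_zero[OF f ye x]) (use Vy_end[of 0] V0 in auto)
  from below_energy[OF this] show "EZ 0 < energy x y e" using xe tz_zero by simp
qed

text \<open>The same for the last half turn, which ends on the graph.\<close>

lemma half_turn_graph_order:
  assumes S: "sol x y {s..e}" and se: "s < e" and xs: "x s = 0" and ys: "y s > 0"
    and ye: "y e = h (x e)" and x: "\<And>t. t \<in> {s<..e} \<Longrightarrow> x t > 0"
  shows "energy x y s < EZ k \<Longrightarrow> x e < X (Suc k)"
    "EZ k < energy x y s \<Longrightarrow> X (Suc k) < x e"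
    "X 0 < x e"
proof -
  have xe: "x e > 0" using x se by auto
  have ye': "y e < 0" using ye h_neg[OF xe] by simp
  have x': "\<And>t. t \<in> {s<..<e} \<Longrightarrow> x t > 0" using x by auto
  note fk = V_bump_facts[where k = k, OF crossing_bounds(2) less_imp_le[OF crossing_bounds(1)]] and f = S se xs ys
  note gk = X_pos[unfolded X_def] crossing(2)
  show "x e < X (Suc k)" if "energy x y s < EZ k" unfolding X_def
    by (rule below_graph[OF below_from_zeros[OF f ye' x' fk(1-4) Vy_crossing fk(5)] xe ye gk(2) gk(1)])
       (use that in \<open>auto simp: V_energy\<close>)
  show "X (Suc k) < x e" if "EZ k < energy x y s" unfolding X_def
    by (rule below_graph[OF below_from_zeros[OF fk(1-4) Vy_crossing fk(5) f ye' x'] gk(1) gk(2) ye xe])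
       (use that in \<open>auto simp: V_energy\<close>)
  have "below (V 0) (Vy 0) (crossing 0) x y e" unfolding V0
    by (rule below_bump0_from_zero[OF f ye' x'])
       (use Vy_crossing[of 0] V0 crossing_bounds(1)[of 0] in auto)
  then show "X 0 < x e" unfolding X_def
    by (rule below_graph) (use gk(1)[of 0] gk(2)[of 0] ye xe in auto)
qed

lemma X_mono: "strict_mono X"
  unfolding strict_mono_Suc_iff
proof
  fix k
  note fk = V_bump_facts[where k = k, OF crossing_bounds(2) less_imp_le[OF crossing_bounds(1)]]
  have pos: "V (Suc k) t > 0" if "t \<in> {tz k<..crossing (Suc k)}" for t
    using fk(5)[of t] X_pos[of "Suc k"] that by (cases "t = crossing (Suc k)") (auto simp: X_def)
  note g = half_turn_graph_order[OF fk(1-4) crossing(2) pos, folded X_def]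
  show "X k < X (Suc k)"
  proof (cases k)
    case 0 then show ?thesis using g(3) by simp
  next
    case (Suc j)
    then show ?thesis using g(2)[of j] EZ_less[of j] by (simp add: V_energy)
  qed
qed

lemma sol_sign: "c \<in> {1, -1} \<Longrightarrow> sol x y I \<Longrightarrow> sol (\<lambda>t. c * x t) (\<lambda>t. c * y t) I"
  using sol_minus[of x y I] by auto

lemma energy_sign: "c \<in> {1, -1} \<Longrightarrow> energy (\<lambda>t. c * x t) (\<lambda>t. c * y t) = energy x y"
  by auto

text \<open>A trajectory that comes from negative energies interlaces with \<open>U\<close>: at its zero number \<open>j\<close>
  (counting from 0) its energy lies strictly between the energies of \<open>U\<close> at \<open>tz (j - 1)\<close> and \<open>tz j\<close>.
  The induction runs over the half turns; \<open>below_singular_bump0\<close> starts it.\<close>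

lemma energy_order:
  assumes "sol x y {..e}" "x e = 0" "y e \<noteq> 0" "\<exists>t\<le>e. energy x y t < 0"
    and "finite {t. t < e \<and> x t = 0}" "card {t. t < e \<and> x t = 0} = j"
  shows "energy x y e < EZ j \<and> (\<forall>i. j = Suc i \<longrightarrow> EZ i < energy x y e)"
  using assms
proof (induction j arbitrary: e)
  case 0
  note S = 0(1)
  have nz: "x t \<noteq> 0" if "t \<in> {..<e}" for t using 0(5,6) that by auto
  have cI: "continuous_on {..<e} x" by (rule continuous_on_subset[OF sol_cont(1)[OF S]]) auto
  from sign_between[OF cI is_interval_io nz]
  obtain c where c: "c \<in> {1, -1::real}" "\<forall>t\<in>{..<e}. c * x t > 0" by blast
  note Sc = sol_sign[OF c(1) S]
  have "c * y e \<le> 0"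
    by (rule y_sign_at_zero(2)[OF sol_subset[OF Sc], of "e - 1" e]) (use c 0 in auto)
  then have "c * y e < 0" using c(1) 0(3) by auto
  have "below (\<lambda>t. c * x t) (\<lambda>t. c * y t) e ux uy (tz 0)"
    by (rule below_singular_bump0[OF Sc])
       (use c(2) \<open>c * y e < 0\<close> 0(2,4) Vy_end[of 0] V0 energy_sign[OF c(1)] in auto)
  from below_energy[OF this] have "energy x y e < EZ 0" using 0(2) tz_zero energy_sign[OF c(1)] by simp
  then show ?case by simp
next
  case (Suc j)
  note S = Suc.prems(1)
  define Z where "Z = {t. t < e \<and> x t = 0}"
  have Z: "finite Z" "card Z = Suc j" using Suc.prems by (auto simp: Z_def)
  have ne: "Z \<noteq> {}" using Z by auto
  define s where "s = Max Z"
  have sZ: "s \<in> Z" unfolding s_def by (rule Max_in[OF Z(1) ne])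
  then have s: "s < e" "x s = 0" by (auto simp: Z_def)
  have nz: "x t \<noteq> 0" if "t \<in> {s<..<e}" for t
  proof
    assume "x t = 0"
    then have "t \<in> Z" using that by (auto simp: Z_def)
    then have "t \<le> s" unfolding s_def using Z(1) by simp
    then show False using that by simp
  qed
  have ys: "y s \<noteq> 0"
  proof
    assume "y s = 0"
    then have "y e = 0" using stays_at_origin[OF sol_subset[OF S], of s e] s by auto
    then show False using Suc.prems by simp
  qed
  have Zs: "{t. t < s \<and> x t = 0} = Z - {s}"
  proof
    show "{t. t < s \<and> x t = 0} \<subseteq> Z - {s}" using s by (auto simp: Z_def)
    show "Z - {s} \<subseteq> {t. t < s \<and> x t = 0}"
    proof
      fix t assume t: "t \<in> Z - {s}"
      then have "t \<le> s" unfolding s_def using Max_ge[OF Z(1), of t] by simp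
      then show "t \<in> {t. t < s \<and> x t = 0}" using t by (auto simp: Z_def)
    qed
  qed
  have Es: "energy x y s > 0" using s ys by (simp add: energy_def)
  have negs: "\<exists>t\<le>s. energy x y t < 0"
  proof -
    obtain t where t: "t \<le> e" "energy x y t < 0" using Suc.prems(4) by blast
    have "t \<le> s"
    proof (rule ccontr)
      assume "\<not> t \<le> s"
      then have "energy x y s \<le> energy x y t" using t by (intro energy_mono[OF S]) auto
      then show False using Es t by simp
    qed
    then show ?thesis using t by blast
  qed
  have IH: "energy x y s < EZ j \<and> (\<forall>i. j = Suc i \<longrightarrow> EZ i < energy x y s)"
    by (rule Suc.IH[OF sol_subset[OF S] s(2) ys negs]) (use s Z sZ Zs in auto)
  have cI: "continuous_on {s<..<e} x" by (rule continuous_on_subset[OF sol_cont(1)[OF S]]) auto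
  from sign_between[OF cI is_interval_oo nz]
  obtain c where c: "c \<in> {1, -1::real}" "\<forall>t\<in>{s<..<e}. c * x t > 0" by blast
  note Sc = sol_subset[OF sol_sign[OF c(1) S], of "{s..e}"]
  have "c * y s \<ge> 0"
    by (rule y_sign_at_zero(1)[OF Sc s(1)]) (use c s in auto)
  then have cy: "c * y s > 0" using c(1) ys by auto
  have H: "energy x y s < EZ k \<Longrightarrow> energy x y e < EZ (Suc k)" "EZ k < energy x y s \<Longrightarrow> EZ (Suc k) < energy x y e"
    "EZ 0 < energy x y e" for k
    using half_turn_order(1)[where k = k, OF Sc s(1) _ cy] half_turn_order(2)[where k = k, OF Sc s(1) _ cy]
      half_turn_order(3)[OF Sc s(1) _ cy] c s Suc.prems(2) unfolding energy_sign[OF c(1)] by auto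
  show ?case
  proof (intro conjI allI impI)
    show "energy x y e < EZ (Suc j)" using H(1) IH by blast
    fix i assume "Suc j = Suc i"
    then show "EZ i < energy x y e" using H(2,3) IH by (cases j) auto
  qed
qed

lemma graph_order:
  assumes S: "sol x y {..T}" and xT: "x T > 0" and yT: "y T = h (x T)" and neg: "\<exists>t\<le>T. energy x y t < 0"
  shows "finite {t. t \<le> T \<and> x t = 0}"
    "x T < X (card {t. t \<le> T \<and> x t = 0})"
    "card {t. t \<le> T \<and> x t = 0} = Suc i \<Longrightarrow> X i < x T"
proof -
  have nd: "y t \<noteq> 0" if "t \<le> T" "x t = 0" for t
    using stays_at_origin(1)[OF sol_subset[OF S], of t T] that xT by auto
  define Z where "Z = {t. t \<le> T \<and> x t = 0}"
  show fin: "finite {t. t \<le> T \<and> x t = 0}" by (rule zeros_finite[OF S nd])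
  then have Z: "finite Z" by (simp add: Z_def)
  have "x T < X (card Z) \<and> (\<forall>i. card Z = Suc i \<longrightarrow> X i < x T)"
  proof (cases "Z = {}")
    case True
    have pos: "x t > 0" if "t \<le> T" for t
      by (rule const_sign[OF sol_cont(1)[OF S] _ _ _ xT]) (use True that in \<open>auto simp: Z_def is_interval_1\<close>)
    have "below x y T (V 0) (Vy 0) (crossing 0)" unfolding V0
      by (rule below_singular_bump0[OF S])
         (use pos yT h_neg[OF xT] neg Vy_crossing[of 0] V0 crossing_bounds(1)[of 0] xT in \<open>auto intro: less_imp_le\<close>)
    then have "x T < X 0" unfolding X_def
      by (rule below_graph) (use xT yT crossing(2)[of 0] X_pos[of 0] in \<open>auto simp: X_def\<close>)
    then show ?thesis using True by simp
  next
    case False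
    define s where "s = Max Z"
    have sZ: "s \<in> Z" unfolding s_def by (rule Max_in[OF Z False])
    then have s: "s \<le> T" "x s = 0" by (auto simp: Z_def)
    then have sT: "s < T" using xT by (cases "s = T") auto
    have nz: "x t \<noteq> 0" if "t \<in> {s<..T}" for t
    proof
      assume "x t = 0"
      then have "t \<in> Z" using that by (auto simp: Z_def)
      then have "t \<le> s" unfolding s_def using Z by simp
      then show False using that by simp
    qed
    have pos: "x t > 0" if "t \<in> {s<..T}" for t
      by (rule const_sign[OF continuous_on_subset[OF sol_cont(1)[OF S]] _ nz _ xT that])
         (use sT in \<open>auto simp: is_interval_1\<close>)
    have "y s \<ge> 0" by (rule y_sign_at_zero(1)[OF sol_subset[OF S] sT]) (use pos s in auto)
    then have ys: "y s > 0" using nd[OF s] by simp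
    have Es: "energy x y s > 0" using s ys by (simp add: energy_def)
    have negs: "\<exists>t\<le>s. energy x y t < 0"
    proof -
      obtain t where t: "t \<le> T" "energy x y t < 0" using neg by blast
      have "t \<le> s"
      proof (rule ccontr)
        assume "\<not> t \<le> s"
        then have "energy x y s \<le> energy x y t" using t by (intro energy_mono[OF S]) auto
        then show False using Es t by simp
      qed
      then show ?thesis using t by blast
    qed
    have Zs: "{t. t < s \<and> x t = 0} = Z - {s}"
    proof
      show "{t. t < s \<and> x t = 0} \<subseteq> Z - {s}" using s by (auto simp: Z_def)
      show "Z - {s} \<subseteq> {t. t < s \<and> x t = 0}"
      proof
        fix t assume t: "t \<in> Z - {s}"
        then have "t \<le> s" unfolding s_def using Max_ge[OF Z, of t] by simp
        then show "t \<in> {t. t < s \<and> x t = 0}" using t by (auto simp: Z_def)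
      qed
    qed
    define j where "j = card (Z - {s})"
    have cZ: "card Z = Suc j" using Z sZ unfolding j_def by (metis card_Suc_Diff1)
    have O: "energy x y s < EZ j \<and> (\<forall>i. j = Suc i \<longrightarrow> EZ i < energy x y s)"
      by (rule energy_order[OF sol_subset[OF S] s(2) _ negs]) (use s nd Z Zs j_def in auto)
    note H = half_turn_graph_order[OF sol_subset[OF S] sT s(2) ys yT pos]
    show ?thesis unfolding cZ
    proof (intro conjI allI impI)
      show "x T < X (Suc j)" by (rule H(1)) (use O in auto)
      fix i assume "Suc j = Suc i"
      then show "X i < x T" using H(2)[where k = "i - 1"] H(3) O by (cases i) auto
    qed
  qed
  then show "x T < X (card {t. t \<le> T \<and> x t = 0})"
    "card {t. t \<le> T \<and> x t = 0} = Suc i \<Longrightarrow> X i < x T" by (auto simp: Z_def)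
qed

lemma in_some_bump: "ux t \<noteq> 0 \<Longrightarrow> \<exists>k. t \<in> bump k"
proof -
  assume nz: "ux t \<noteq> 0"
  define k where "k = (LEAST k. t < tz k)"
  have k: "t < tz k" unfolding k_def using tz_unbounded by (rule LeastI_ex)
  have "tz (k - 1) < t" if "k > 0"
  proof -
    have "\<not> t < tz (k - 1)" using not_less_Least[of "k - 1" "\<lambda>k. t < tz k"] that by (simp add: k_def[symmetric])
    moreover have "t \<noteq> tz (k - 1)" using nz tz_zero by auto
    ultimately show ?thesis by simp
  qed
  then show ?thesis using k by (auto simp: bump_def)
qed

text \<open>By \<open>backward_regular\<close> and uniqueness such a trajectory is, up to sign, a translate of \<open>U\<close>, and \<open>U\<close>
  meets the graph at its crossings only.\<close>

lemma regular_on_graph: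
  assumes S: "sol x y {..T}" and xT: "x T > 0" and yT: "y T = h (x T)" and nonneg: "\<And>t. t \<le> T \<Longrightarrow> energy x y t \<ge> 0"
  shows "x T \<in> range X"
proof -
  have nd: "y t \<noteq> 0" if "t \<le> T" "x t = 0" for t
    using stays_at_origin(1)[OF sol_subset[OF S], of t T] that xT by auto
  have fin: "finite {t. t \<le> T \<and> x t = 0}" by (rule zeros_finite[OF S nd])
  define R where "R = Min (Set.insert T {t. t \<le> T \<and> x t = 0}) - 1"
  have R: "R < T" "\<And>t. t \<le> T \<Longrightarrow> x t = 0 \<Longrightarrow> R < t"
  proof -
    have "Min (Set.insert T {t. t \<le> T \<and> x t = 0}) \<le> T" using fin by (intro Min_le) auto
    then show "R < T" by (simp add: R_def)
    fix t assume "t \<le> T" "x t = 0"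
    then have "Min (Set.insert T {t. t \<le> T \<and> x t = 0}) \<le> t" using fin by (intro Min_le) auto
    then show "R < t" by (simp add: R_def)
  qed
  have nz: "x t \<noteq> 0" if "t \<in> {..R}" for t using R(1) R(2)[of t] that by auto
  have cI: "continuous_on {..R} x" by (rule continuous_on_subset[OF sol_cont(1)[OF S]]) (use R(1) in auto)
  from sign_between[OF cI is_interval_ic nz]
  obtain c where c: "c \<in> {1, -1::real}" "\<forall>t\<in>{..R}. c * x t > 0" by blast
  note Sc = sol_sign[OF c(1) S]
  have "\<exists>d>0. ((\<lambda>t. exp (- \<alpha> * t) * (c * x t)) \<longlongrightarrow> d) at_bot"
    by (rule backward_regular[OF sol_subset[OF Sc], of R])
       (use c(2) R(1) nonneg in \<open>auto simp: energy_sign[OF c(1)]\<close>)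
  then obtain d where d: "d > 0" "((\<lambda>t. exp (- \<alpha> * t) * (c * x t)) \<longlongrightarrow> d) at_bot" by blast
  define \<tau> where "\<tau> = ln d / \<alpha>"
  have fU: "flow K ux uy UNIV" using sol_flow[of UNIV ux uy] U by simp
  have fl: "flow K (\<lambda>t. ux (t + \<tau>)) (\<lambda>t. uy (t + \<tau>)) I" for I
    using fU unfolding flow_def by (auto intro!: DERIV_shift[THEN iffD1])
  have fx: "flow K (\<lambda>t. c * x t) (\<lambda>t. c * y t) {..<T}"
  proof -
    have "sol (\<lambda>t. c * x t) (\<lambda>t. c * y t) {..<T}" by (rule sol_subset[OF Sc]) auto
    then show ?thesis by (simp add: sol_flow)
  qed
  have eqR: "c * x t = ux (t + \<tau>)" if "t < T" for t
  proof (rule flow_unique_asymptotic[where xa = "\<lambda>t. c * x t" and xb = "\<lambda>t. ux (t + \<tau>)" and t = t and \<sigma> = \<alpha> and T = T and k = K and d = d])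
    show "\<alpha>\<^sup>2 = A * \<alpha> + B" by (rule \<alpha>_root)
    show "\<alpha> \<noteq> 0" "0 \<le> (2 * \<alpha> - A) / (\<alpha> * (q - 2))" using \<alpha>0 \<mu>0 q2 by (auto simp: A_def)
    show "flow K (\<lambda>t. c * x t) (\<lambda>t. c * y t) {t. \<alpha> * t < \<alpha> * T}"
      by (rule flow_subset[OF fx]) (use \<alpha>0 in auto)
    show "((\<lambda>t. exp (- \<alpha> * t) * (c * x t)) \<longlongrightarrow> d) (if \<alpha> > 0 then at_bot else at_top)" using d \<alpha>0 by simp
    show "\<alpha> * t < \<alpha> * T" using that \<alpha>0 by simp
    have "filterlim (\<lambda>t. t + \<tau>) at_bot at_bot"
      unfolding filterlim_at_bot_mirror filterlim_uminus_at_bot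
      using filterlim_add_const_at_top[of "- \<tau>"] by simp
    from filterlim_compose[OF ux_lim this]
    have "((\<lambda>t. exp (\<alpha> * \<tau>) * (exp (- \<alpha> * (t + \<tau>)) * ux (t + \<tau>))) \<longlongrightarrow> exp (\<alpha> * \<tau>) * 1) at_bot"
      by (intro tendsto_mult tendsto_const)
    moreover have e: "exp (\<alpha> * \<tau>) * (exp (- \<alpha> * (t + \<tau>)) * z) = exp (- \<alpha> * t) * z" for t z
      by (simp add: mult.assoc[symmetric] algebra_simps flip: exp_add)
    moreover have "exp (\<alpha> * \<tau>) = d" using d \<alpha>0 by (simp add: \<tau>_def)
    ultimately have "((\<lambda>t. exp (- \<alpha> * t) * ux (t + \<tau>)) \<longlongrightarrow> d * 1) at_bot" by (simp only: e)
    then show "((\<lambda>t. exp (- \<alpha> * t) * ux (t + \<tau>)) \<longlongrightarrow> d) (if \<alpha> > 0 then at_bot else at_top)"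
      using \<alpha>0 by simp
  qed (rule fl)
  have eqy: "c * y t = uy (t + \<tau>)" if t: "t < T" for t
  proof (rule DERIV_unique[of "\<lambda>t. ux (t + \<tau>)"])
    show "((\<lambda>t. ux (t + \<tau>)) has_real_derivative uy (t + \<tau>)) (at t)" using fl[of UNIV] by (simp add: flow_def)
    have "((\<lambda>t. c * x t) has_real_derivative c * y t) (at t)" using fx t by (simp add: flow_def)
    moreover have "eventually (\<lambda>t. c * x t = ux (t + \<tau>)) (nhds t)"
      by (rule eventually_nhds_openI[of "{..<T}"]) (use t eqR in auto)
    ultimately show "((\<lambda>t. ux (t + \<tau>)) has_real_derivative c * y t) (at t)"
      by (subst (asm) DERIV_cong_ev[OF refl _ refl]) auto
  qed
  have contU: "isCont ux t" "isCont uy t" for t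
    using sol_cont[OF U] by (auto simp: continuous_on_eq_continuous_at)
  have lim: "c * g T = gu (T + \<tau>)"
    if cg: "continuous_on {..T} g" and cu: "\<And>t. isCont gu t" and eq: "\<And>t. t < T \<Longrightarrow> c * g t = gu (t + \<tau>)"
    for g gu :: "real \<Rightarrow> real"
  proof (rule tendsto_unique)
    have "(g \<longlongrightarrow> g T) (at T within {..T})" using cg by (simp add: continuous_on)
    then have "(g \<longlongrightarrow> g T) (at_left T)" by (rule tendsto_within_subset) auto
    then show "((\<lambda>t. c * g t) \<longlongrightarrow> c * g T) (at_left T)" by (intro tendsto_intros)
    have "isCont (\<lambda>t. gu (t + \<tau>)) T" by (intro isCont_o2[OF _ cu] continuous_intros)
    then have "((\<lambda>t. gu (t + \<tau>)) \<longlongrightarrow> gu (T + \<tau>)) (at_left T)" by (simp add: isCont_def filterlim_at_split)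
    then show "((\<lambda>t. c * g t) \<longlongrightarrow> gu (T + \<tau>)) (at_left T)"
      by (rule Lim_transform_eventually) (auto simp: eventually_at_filter eq)
  qed (rule trivial_limit_at_left_real)
  have xt: "c * x T = ux (T + \<tau>)" by (rule lim[OF sol_cont(1)[OF S] contU(1) eqR])
  have yt: "c * y T = uy (T + \<tau>)" by (rule lim[OF sol_cont(2)[OF S] contU(2) eqy])
  obtain k where k: "T + \<tau> \<in> bump k" using in_some_bump[of "T + \<tau>"] xt xT c(1) by auto
  have "V k (T + \<tau>) > 0" by (rule V_pos[OF k])
  then have "(-1) ^ k * c * x T > 0" using xt by (simp add: V_def mult.assoc)
  then have "(-1) ^ k * c = 1" using xT c(1) by (cases "even k") (auto simp: zero_less_mult_iff)
  then have VT: "V k (T + \<tau>) = x T" "Vy k (T + \<tau>) = y T"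
    unfolding V_def Vy_def xt[symmetric] yt[symmetric] by (simp_all flip: mult.assoc)
  then have "T + \<tau> = crossing k" by (intro crossing_unique[OF k _ crossing]) (simp add: yT)
  then have "x T = X k" using VT by (simp add: X_def)
  then show ?thesis by blast
qed

text \<open>The abscissa differs from all \<open>X j\<close>, so the energy was negative at some time by \<open>regular_on_graph\<close>.
  The number of zeros \<open>j\<close> satisfies \<open>X (j - 1) < x T < X j\<close>, which leaves only \<open>j = k\<close>.\<close>

lemma singular_zero_count:
  assumes S: "sol x y {..T}" and yT: "y T = h (x T)" and x0: "0 < x T" and lo: "\<And>i. k = Suc i \<Longrightarrow> X i < x T" and up: "x T < X k"
  shows "finite {t. t \<le> T \<and> x t = 0}" "card {t. t \<le> T \<and> x t = 0} = k" "\<exists>t\<le>T. energy x y t < 0"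
proof -
  have "x T \<notin> range X"
  proof
    assume "x T \<in> range X"
    then obtain j where j: "x T = X j" by blast
    then have "j < k" using up strict_mono_less[OF X_mono] by simp
    then obtain i where i: "k = Suc i" by (cases k) auto
    have "X j \<le> X i" using \<open>j < k\<close> i strict_mono_less_eq[OF X_mono] by simp
    then show False using lo[OF i] j by simp
  qed
  then show neg: "\<exists>t\<le>T. energy x y t < 0"
    using regular_on_graph[OF S x0 yT] by force
  note g = graph_order[OF S x0 yT neg]
  show "finite {t. t \<le> T \<and> x t = 0}" by (rule g(1))
  define j where "j = card {t. t \<le> T \<and> x t = 0}"
  have "\<not> j < k"
  proof
    assume "j < k"
    then obtain i where i: "k = Suc i" "j \<le> i" by (cases k) auto
    have "X j \<le> X i" using i strict_mono_less_eq[OF X_mono] by simp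
    then show False using lo[OF i(1)] g(2) by (simp add: j_def[symmetric])
  qed
  moreover have "\<not> k < j"
  proof
    assume "k < j"
    then obtain i where i: "j = Suc i" "k \<le> i" by (cases j) auto
    have "X k \<le> X i" using i strict_mono_less_eq[OF X_mono] by simp
    then show False using up g(3)[of i] i by (simp add: j_def[symmetric])
  qed
  ultimately show "card {t. t \<le> T \<and> x t = 0} = k" by (simp add: j_def)
qed

end

text \<open>The outer system shares \<open>A\<close> and \<open>B\<close> with the inner one and has the coefficient \<open>- \<kappa>\<close> instead of \<open>K\<close>.\<close>

locale emden_outer = emden +
  fixes \<kappa> :: real
  assumes \<kappa>0: "\<kappa> > 0"
begin

section \<open>The stable trajectory of the outer system\<close>

text \<open>Pieces \<open>{T<..}\<close> of the trajectory that enters the origin in \<open>x > 0\<close>, with time normalised by the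
  decay constant 1. The inequality for \<open>y\<close> says that \<open>exp (\<mu> * t) * x t\<close> decreases; it makes
  the trajectory a graph over the abscissa.\<close>

definition stab :: "real \<Rightarrow> (real \<Rightarrow> real) \<Rightarrow> (real \<Rightarrow> real) \<Rightarrow> bool" where
  "stab T x y \<longleftrightarrow> flow (- \<kappa>) x y {T<..} \<and> ((\<lambda>t. exp (\<mu> * t) * x t) \<longlongrightarrow> 1) at_top \<and>
     (\<forall>t>T. x t > 0 \<and> y t < - \<mu> * x t)"

text \<open>In the variable \<open>z = exp (- \<mu> * (q - 2) * t)\<close> the function \<open>w = exp (\<mu> * t) * x\<close> starts at 1 and, the sign
  of the nonlinearity being defocusing, grows at least linearly even if the power is truncated to
  \<open>{1..M}\<close>. Until it reaches \<open>M\<close> the truncation is not felt. Since \<open>M\<close> is arbitrary, the maximal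
  trajectory is unbounded.\<close>

lemma stab_exists:
  assumes M: "M > 1"
  shows "\<exists>T x y t. stab T x y \<and> t > T \<and> exp (\<mu> * t) * x t > M - 1"
proof -
  define \<beta> where "\<beta> = \<mu> * (q - 2)"
  have \<beta>0: "\<beta> > 0" using \<mu>0 q2 by (simp add: \<beta>_def)
  define \<nu> where "\<nu> = 1 + (2 * (-\<mu>) - A) / (-\<beta>)"
  define c where "c = - (-\<kappa>) / (-\<beta>)\<^sup>2"
  have \<nu>1: "\<nu> > 1" using \<beta>0 \<mu>0 A0 by (simp add: \<nu>_def divide_neg_pos)
  have c0: "c > 0" using \<kappa>0 \<beta>0 by (simp add: c_def)
  define g where "g = (\<lambda>x. nonlin q (clamp_real 1 M x))"
  have Gl: "\<bar>g x - g y\<bar> \<le> (q - 1) * M powr (q - 2) * \<bar>x - y\<bar>" for x y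
    unfolding g_def by (rule clamp_nonlin_lipschitz[OF q2]) (use M in auto)
  have G0: "0 \<le> (q - 1) * M powr (q - 2)" using q2 by simp
  have g1: "g x \<ge> 1" for x
  proof -
    have "nonlin q 1 \<le> g x" unfolding g_def by (rule nonlin_mono[OF q2]) (use M in \<open>auto simp: clamp_real_def\<close>)
    then show ?thesis by (simp add: nonlin_def)
  qed
  obtain w p where w: "w 0 = 1" "continuous_on {0..} p"
    "\<And>t. t \<ge> 0 \<Longrightarrow> (w has_real_derivative p t) (at t within {0..})"
    "\<And>t. t > 0 \<Longrightarrow> (p has_real_derivative (c * g (w t) - \<nu> * p t) / t) (at t)"
    using singular_ivp_exists[where g = g and d = 1 and c = c, OF \<nu>1 G0 Gl] by blast
  have cw: "continuous_on {0..} w" by (rule DERIV_continuous_on[of _ w p]) (use w(3) in auto)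
  have dw: "(w has_real_derivative p t) (at t)" if "t > 0" for t
    using has_real_derivative_within_atLeast_at[OF w(3)] that by auto
  have p_ge: "p t \<ge> c / \<nu>" if t: "t > 0" for t
  proof -
    have cpow: "continuous_on {0..t} (\<lambda>s::real. s powr \<nu>)"
      using \<nu>1 by (intro continuous_on_powr' continuous_intros) auto
    have "0 powr \<nu> * p 0 - c / \<nu> * 0 powr \<nu> \<le> t powr \<nu> * p t - c / \<nu> * t powr \<nu>"
    proof (rule DERIV_nonneg_imp_increasing_open[where f = "\<lambda>s. s powr \<nu> * p s - c / \<nu> * s powr \<nu>"])
      show "continuous_on {0..t} (\<lambda>s. s powr \<nu> * p s - c / \<nu> * s powr \<nu>)"
        by (intro continuous_on_diff continuous_on_mult cpow continuous_on_subset[OF w(2)] continuous_on_const) auto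
      fix s assume s: "0 < s" "s < t"
      have "((\<lambda>s. s powr \<nu> * p s - c / \<nu> * s powr \<nu>) has_real_derivative
        (\<nu> * s powr (\<nu> - 1) * p s + (c * g (w s) - \<nu> * p s) / s * s powr \<nu>) - c / \<nu> * (\<nu> * s powr (\<nu> - 1))) (at s)"
        using s by (intro DERIV_diff DERIV_mult DERIV_cmult has_real_derivative_powr w(4)) auto
      moreover have "(\<nu> * s powr (\<nu> - 1) * p s + (c * g (w s) - \<nu> * p s) / s * s powr \<nu>) - c / \<nu> * (\<nu> * s powr (\<nu> - 1))
         = c * s powr (\<nu> - 1) * (g (w s) - 1)"
      proof -
        have e: "s powr \<nu> = s * s powr (\<nu> - 1)" using s by (simp add: powr_diff)
        show ?thesis unfolding e using s \<nu>1 by (simp add: field_simps)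
      qed
      moreover have "\<dots> \<ge> 0" using c0 g1[of "w s"] by (intro mult_nonneg_nonneg) auto
      ultimately show "\<exists>v. DERIV (\<lambda>s. s powr \<nu> * p s - c / \<nu> * s powr \<nu>) s :> v \<and> v \<ge> 0" by auto
    qed (use t in simp)
    then have "c / \<nu> * t powr \<nu> \<le> p t * t powr \<nu>" by (simp add: mult.commute)
    then show ?thesis by (subst (asm) mult_le_cancel_right_pos) (use t in auto)
  qed
  have cn: "c / \<nu> > 0" using c0 \<nu>1 by simp
  have p0: "p t > 0" if "t > 0" for t using p_ge[OF that] cn by linarith
  have winc: "w s < w t" if "0 \<le> s" "s < t" for s t
  proof (rule DERIV_pos_imp_increasing_open[OF that(2)])
    show "continuous_on {s..t} w" by (rule continuous_on_subset[OF cw]) (use that in auto)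
    fix r assume "s < r" "r < t"
    then show "\<exists>v. DERIV w r :> v \<and> v > 0" using dw[of r] p0[of r] that by auto
  qed
  define b where "b = M / (c / \<nu>)"
  have b0: "b > 0" unfolding b_def by (rule divide_pos_pos[OF _ cn]) (use M in simp)
  have cb: "c / \<nu> * b = M"
  proof -
    have "k * (M / k) = M" if "k > 0" for k :: real using that by simp
    from this[OF cn] show ?thesis unfolding b_def .
  qed
  have "w 0 - c / \<nu> * 0 \<le> w b - c / \<nu> * b"
  proof (rule DERIV_nonneg_imp_increasing_open[where f = "\<lambda>s. w s - c / \<nu> * s"])
    show "continuous_on {0..b} (\<lambda>s. w s - c / \<nu> * s)" by (intro continuous_intros continuous_on_subset[OF cw]) auto
    fix r assume r: "0 < r" "r < b"
    have "((\<lambda>s. w s - c / \<nu> * s) has_real_derivative p r - c / \<nu> * 1) (at r)"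
      by (intro DERIV_diff dw DERIV_cmult DERIV_ident r)
    then show "\<exists>v. DERIV (\<lambda>s. w s - c / \<nu> * s) r :> v \<and> v \<ge> 0" using p_ge[OF r(1)] by force
  qed (use b0 in simp)
  then have "w b \<ge> M" using w(1) unfolding cb by simp
  then obtain Z where Z: "0 \<le> Z" "Z \<le> b" "w Z = M"
    using IVT'[of w 0 M b] w(1) M b0 continuous_on_subset[OF cw, of "{0..b}"] by auto
  have Z0: "Z > 0" using Z w(1) M by (cases "Z = 0") auto
  have gw: "g (w t) = nonlin q (w t)" if "0 < t" "t < Z" for t
    unfolding g_def using winc[of 0 t] winc[of t Z] that Z w(1) by (simp add: clamp_real_id)
  define T where "T = - ln Z / \<beta>"
  have inZ: "0 < exp (- \<beta> * t)" "exp (- \<beta> * t) < Z" if "t > T" for t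
  proof -
    have "- \<beta> * t < ln Z" using that \<beta>0 by (simp add: T_def field_simps)
    then have "exp (- \<beta> * t) < exp (ln Z)" by (subst exp_less_cancel_iff)
    then show "0 < exp (- \<beta> * t)" "exp (- \<beta> * t) < Z" using Z0 by auto
  qed
  define x where "x = (\<lambda>t. exp (- \<mu> * t) * w (exp (- \<beta> * t)))"
  define y where "y = (\<lambda>t. exp (- \<mu> * t) * (- \<mu> * w (exp (- \<beta> * t)) + (- \<beta>) * exp (- \<beta> * t) * p (exp (- \<beta> * t))))"
  have fl: "flow (- \<kappa>) x y {T<..}" unfolding x_def y_def
  proof (rule ivp_flow[OF \<mu>_root])
    show "- \<mu> \<noteq> 0" "- \<beta> = - \<mu> * (q - 2)" using \<mu>0 by (auto simp: \<beta>_def)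
    show "\<nu> = 1 + (2 * - \<mu> - A) / - \<beta>" "c = - (- \<kappa>) / (- \<beta>)\<^sup>2" by (simp_all add: \<nu>_def c_def)
    fix t assume t: "t \<in> {T<..}"
    show "(w has_real_derivative p (exp (- \<beta> * t))) (at (exp (- \<beta> * t)))" by (rule dw) simp
    show "(p has_real_derivative (c * nonlin q (w (exp (- \<beta> * t))) - \<nu> * p (exp (- \<beta> * t))) / exp (- \<beta> * t)) (at (exp (- \<beta> * t)))"
      using w(4)[of "exp (- \<beta> * t)"] gw[OF inZ, of t] t by simp
  qed
  have em: "exp (\<mu> * t) * x t = w (exp (- \<beta> * t))" for t
    by (simp add: x_def mult.assoc[symmetric] flip: exp_add)
  have lim0: "(w \<longlongrightarrow> 1) (at_right 0)"
  proof -
    have "(w \<longlongrightarrow> w 0) (at 0 within {0..})" using cw by (simp add: continuous_on)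
    then have "(w \<longlongrightarrow> w 0) (at_right 0)" by (rule tendsto_within_subset) auto
    then show ?thesis by (simp add: w(1))
  qed
  have fe: "filterlim (\<lambda>t. exp (- \<beta> * t)) (at_right 0) at_top"
  proof -
    have "filterlim (\<lambda>t. - \<beta> * t) at_bot at_top"
      using filterlim_tendsto_neg_mult_at_bot[OF tendsto_const[of "- \<beta>"] _ filterlim_ident] \<beta>0 by simp
    then have "((\<lambda>t. exp (- \<beta> * t)) \<longlongrightarrow> 0) at_top" by (rule filterlim_compose[OF exp_at_bot])
    then show ?thesis by (auto simp: filterlim_at)
  qed
  have st: "stab T x y" unfolding stab_def
  proof (intro conjI allI impI fl)
    show "((\<lambda>t. exp (\<mu> * t) * x t) \<longlongrightarrow> 1) at_top" unfolding em by (rule filterlim_compose[OF lim0 fe])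
    fix t assume t: "t > T"
    have "w (exp (- \<beta> * t)) > 1" using winc[of 0 "exp (- \<beta> * t)"] w(1) by simp
    then show "x t > 0" by (simp add: x_def)
    have "0 < exp (- \<mu> * t) * (\<beta> * exp (- \<beta> * t) * p (exp (- \<beta> * t)))"
      using \<beta>0 p0[of "exp (- \<beta> * t)"] by (intro mult_pos_pos) auto
    then show "y t < - \<mu> * x t" by (simp add: x_def y_def algebra_simps)
  qed
  have "isCont w Z" using DERIV_isCont[OF dw[OF Z0]] .
  then have "(w \<longlongrightarrow> M) (at_left Z)" using Z(3) by (simp add: isCont_def filterlim_at_split)
  then have "eventually (\<lambda>z. w z > M - 1) (at_left Z)" by (rule order_tendstoD(1)) simp
  then have "eventually (\<lambda>z. w z > M - 1 \<and> z \<in> {0<..<Z}) (at_left Z)"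
    using eventually_at_left_real[OF Z0] by (rule eventually_conj)
  then obtain z where z: "w z > M - 1" "0 < z" "z < Z"
    using eventually_happens'[of "at_left Z"] by (auto simp: trivial_limit_at_left_real)
  define t where "t = - ln z / \<beta>"
  have "exp (- \<beta> * t) = z" using z \<beta>0 by (simp add: t_def)
  moreover have "t > T" using z \<beta>0 by (simp add: t_def T_def divide_strict_right_mono)
  ultimately show ?thesis using st em[of t] z by metis
qed

lemma stab_unique:
  assumes 1: "stab T x y" and 2: "stab T' x' y'" and t: "t > T" "t > T'"
  shows "x t = x' t" "y t = y' t"
proof -
  define S where "S = max T T'"
  have eq: "x s = x' s" if s: "s > S" for s
  proof (rule flow_unique_asymptotic[where xa = x and xb = x' and \<sigma> = "- \<mu>" and T = S and k = "- \<kappa>" and d = 1])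
    show "(- \<mu>)\<^sup>2 = A * - \<mu> + B" by (rule \<mu>_root)
    show "- \<mu> \<noteq> 0" "0 \<le> (2 * - \<mu> - A) / (- \<mu> * (q - 2))" using \<mu>0 A0 q2
      by (auto simp: divide_nonpos_pos)
    show "flow (- \<kappa>) x y {t. - \<mu> * t < - \<mu> * S}" "flow (- \<kappa>) x' y' {t. - \<mu> * t < - \<mu> * S}"
      using 1 2 \<mu>0 by (auto simp: stab_def S_def elim!: flow_subset)
    show "((\<lambda>t. exp (- (- \<mu>) * t) * x t) \<longlongrightarrow> 1) (if - \<mu> > 0 then at_bot else at_top)"
      "((\<lambda>t. exp (- (- \<mu>) * t) * x' t) \<longlongrightarrow> 1) (if - \<mu> > 0 then at_bot else at_top)"
      using 1 2 \<mu>0 by (auto simp: stab_def)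
    show "- \<mu> * s < - \<mu> * S" using s \<mu>0 by simp
  qed
  have tS: "t > S" using t by (simp add: S_def)
  show "x t = x' t" by (rule eq[OF tS])
  have "(x has_real_derivative y t) (at t)" using 1 t by (simp add: stab_def flow_def)
  moreover have "eventually (\<lambda>s. x s = x' s) (nhds t)"
    by (rule eventually_nhds_openI[of "{S<..}"]) (use tS eq in auto)
  ultimately have "(x' has_real_derivative y t) (at t)" by (subst (asm) DERIV_cong_ev[OF refl _ refl]) auto
  moreover have "(x' has_real_derivative y' t) (at t)" using 2 t by (simp add: stab_def flow_def)
  ultimately show "y t = y' t" by (rule DERIV_unique)
qed

text \<open>The maximal stable trajectory, glued from all pieces; \<open>stab_unique\<close> makes the values well defined.\<close>

definition tdom :: "real set" where "tdom = {t. \<exists>T x y. stab T x y \<and> T < t}"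
definition Xs :: "real \<Rightarrow> real" where "Xs t = (THE v. \<exists>T x y. stab T x y \<and> T < t \<and> v = x t)"
definition Ys :: "real \<Rightarrow> real" where "Ys t = (THE v. \<exists>T x y. stab T x y \<and> T < t \<and> v = y t)"

lemma Xs_eq: assumes "stab T x y" "T < t" shows "Xs t = x t" "Ys t = y t"
proof -
  show "Xs t = x t" unfolding Xs_def
    by (rule the_equality) (use assms stab_unique(1) in blast)+
  show "Ys t = y t" unfolding Ys_def
    by (rule the_equality) (use assms stab_unique(2) in blast)+
qed

lemma dom_up: "t \<in> tdom \<Longrightarrow> t \<le> s \<Longrightarrow> s \<in> tdom"
  unfolding tdom_def by force

lemma dom_nonempty: "\<exists>t. t \<in> tdom"
  using stab_exists[of 2] unfolding tdom_def by force

lemma dom_open_below: "t \<in> tdom \<Longrightarrow> \<exists>s\<in>tdom. s < t"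
proof -
  assume "t \<in> tdom"
  then obtain T x y where s: "stab T x y" "T < t" unfolding tdom_def by blast
  obtain r where "T < r" "r < t" using dense[OF s(2)] by blast
  then show ?thesis using s(1) unfolding tdom_def by blast
qed

lemma Xs_flow: "flow (- \<kappa>) Xs Ys tdom"
  unfolding flow_def
proof
  fix t assume "t \<in> tdom"
  then obtain T x y where s: "stab T x y" "T < t" unfolding tdom_def by blast
  have ev: "eventually (\<lambda>s. x s = Xs s) (nhds t)" "eventually (\<lambda>s. y s = Ys s) (nhds t)"
    by (rule eventually_nhds_openI[of "{T<..}"]; use s Xs_eq[OF s(1)] in auto)+
  have "(x has_real_derivative y t) (at t)" "(y has_real_derivative A * y t + B * x t - (- \<kappa>) * nonlin q (x t)) (at t)"
    using s by (auto simp: stab_def flow_def)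
  then show "(Xs has_real_derivative Ys t) (at t) \<and>
     (Ys has_real_derivative A * Ys t + B * Xs t - - \<kappa> * nonlin q (Xs t)) (at t)"
    using Xs_eq[OF s] DERIV_cong_ev[OF refl ev(1) refl] DERIV_cong_ev[OF refl ev(2) refl] by metis
qed

lemma Xs_deriv: "t \<in> tdom \<Longrightarrow> (Xs has_real_derivative Ys t) (at t)"
  and Ys_deriv: "t \<in> tdom \<Longrightarrow> (Ys has_real_derivative A * Ys t + B * Xs t + \<kappa> * nonlin q (Xs t)) (at t)"
  using Xs_flow unfolding flow_def by auto

lemma Xs_pos: "t \<in> tdom \<Longrightarrow> Xs t > 0" and Ys_less: "t \<in> tdom \<Longrightarrow> Ys t < - \<mu> * Xs t"
  unfolding tdom_def using Xs_eq by (auto simp: stab_def)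

lemma Ys_neg: "t \<in> tdom \<Longrightarrow> Ys t < 0"
  using Ys_less[of t] Xs_pos[of t] \<mu>0 mult_pos_pos[of \<mu> "Xs t"] by linarith

lemma Xs_lim: "((\<lambda>t. exp (\<mu> * t) * Xs t) \<longlongrightarrow> 1) at_top"
proof -
  obtain T x y where s: "stab T x y" using stab_exists[of 2] by auto
  then have "((\<lambda>t. exp (\<mu> * t) * x t) \<longlongrightarrow> 1) at_top" by (simp add: stab_def)
  then show ?thesis
    by (rule Lim_transform_eventually)
       (rule eventually_mono[OF eventually_gt_at_top[of T]], use Xs_eq[OF s] in auto)
qed

lemma Xs_less:
  assumes "s \<in> tdom" "s < t"
  shows "Xs t < Xs s"
proof (rule DERIV_neg_imp_decreasing[OF assms(2)])
  fix r assume "s \<le> r" "r \<le> t"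
  then have "r \<in> tdom" using dom_up assms(1) by blast
  then show "\<exists>v. DERIV Xs r :> v \<and> v < 0" using Xs_deriv Ys_neg by blast
qed

lemma Xs_less_iff: "s \<in> tdom \<Longrightarrow> t \<in> tdom \<Longrightarrow> Xs t < Xs s \<longleftrightarrow> s < t"
  using Xs_less[of s t] Xs_less[of t s] by (cases s t rule: linorder_cases) auto

lemma Xs_inj: "s \<in> tdom \<Longrightarrow> t \<in> tdom \<Longrightarrow> Xs s = Xs t \<Longrightarrow> s = t"
  using Xs_less_iff[of s t] Xs_less_iff[of t s] by auto

lemma Xs_0: "(Xs \<longlongrightarrow> 0) at_top"
proof -
  have "filterlim (\<lambda>t. - \<mu> * t) at_bot at_top"
    using filterlim_tendsto_neg_mult_at_bot[OF tendsto_const[of "- \<mu>"] _ filterlim_ident] \<mu>0 by simp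
  then have "((\<lambda>t. exp (- \<mu> * t)) \<longlongrightarrow> 0) at_top" by (rule filterlim_compose[OF exp_at_bot])
  from tendsto_mult[OF this Xs_lim] show ?thesis
    by (simp add: mult.assoc[symmetric] flip: exp_add)
qed

lemma Ys_0: "(Ys \<longlongrightarrow> 0) at_top"
proof -
  obtain T where T: "T \<in> tdom" using dom_nonempty by blast
  have d: "(Ys has_real_derivative A * Ys t + (B * Xs t + \<kappa> * nonlin q (Xs t))) (at t)" if "t > T" for t
    using Ys_deriv[of t] dom_up[OF T, of t] that by (simp add: algebra_simps)
  have d1: "(Xs has_real_derivative Ys t) (at t)" if "t > T" for t
    using Xs_deriv dom_up[OF T, of t] that by simp
  show ?thesis
    by (rule limit_equilibrium(2)[where h = "\<lambda>x. B * x + \<kappa> * nonlin q x", OF d1 d Xs_0])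
       (auto intro!: continuous_intros isCont_nonlin q2)
qed

text \<open>A piece on which \<open>exp (\<mu> * t) * Xs t\<close> is large must lie to the left of a fixed time \<open>t1\<close>, as this
  quantity decreases; there \<open>exp (\<mu> * t)\<close> is bounded, so \<open>Xs\<close> itself is large.\<close>

lemma Xs_unbounded: "\<exists>t\<in>tdom. Xs t \<ge> R"
proof -
  obtain t1 where t1: "t1 \<in> tdom" using dom_nonempty by blast
  define M where "M = max 1 (max (exp (\<mu> * t1) * Xs t1) (exp (\<mu> * t1) * R)) + 1"
  have M: "M > 1" "M - 1 \<ge> exp (\<mu> * t1) * Xs t1" "M - 1 \<ge> exp (\<mu> * t1) * R" by (auto simp: M_def)
  obtain T x y t where s: "stab T x y" "t > T" "exp (\<mu> * t) * x t > M - 1" using stab_exists[OF M(1)] by blast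
  have td: "t \<in> tdom" using s unfolding tdom_def by blast
  have big: "exp (\<mu> * t) * Xs t > M - 1" using s Xs_eq[OF s(1,2)] by simp
  have "t < t1"
  proof (rule ccontr)
    assume "\<not> t < t1"
    then have le: "t1 \<le> t" by simp
    have "exp (\<mu> * t) * Xs t \<le> exp (\<mu> * t1) * Xs t1"
    proof (rule antimono_if_deriv_nonpos[OF le, of "\<lambda>t. exp (\<mu> * t) * Xs t" "\<lambda>r. \<mu> * exp (\<mu> * r) * Xs r + Ys r * exp (\<mu> * r)"])
      fix r assume r: "t1 \<le> r" "r \<le> t"
      have rd: "r \<in> tdom" by (rule dom_up[OF t1 r(1)])
      show "((\<lambda>t. exp (\<mu> * t) * Xs t) has_real_derivative \<mu> * exp (\<mu> * r) * Xs r + Ys r * exp (\<mu> * r)) (at r)"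
        by (intro DERIV_mult Xs_deriv rd) (auto intro!: derivative_eq_intros)
      have "exp (\<mu> * r) * (\<mu> * Xs r + Ys r) \<le> 0" using Ys_less[OF rd] by (intro mult_nonneg_nonpos) auto
      then show "\<mu> * exp (\<mu> * r) * Xs r + Ys r * exp (\<mu> * r) \<le> 0" by (simp add: algebra_simps)
    qed
    then show False using big M by simp
  qed
  then have "exp (\<mu> * t) * Xs t \<le> exp (\<mu> * t1) * Xs t"
    using \<mu>0 Xs_pos[OF td] by (intro mult_right_mono) auto
  then have "exp (\<mu> * t1) * R \<le> exp (\<mu> * t1) * Xs t" using big M by linarith
  then have "R \<le> Xs t" by (subst (asm) mult_le_cancel_left_pos) auto
  then show ?thesis using td by blast
qed

lemma Xs_cont: "{a..b} \<subseteq> tdom \<Longrightarrow> continuous_on {a..b} Xs"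
  by (intro continuous_at_imp_continuous_on ballI DERIV_isCont[OF Xs_deriv]) auto

lemma Xs_surj:
  assumes x: "x > 0" shows "\<exists>t\<in>tdom. Xs t = x"
proof -
  obtain a where a: "a \<in> tdom" "Xs a \<ge> x" using Xs_unbounded by blast
  have "eventually (\<lambda>t. Xs t < x) at_top" by (rule order_tendstoD(2)[OF Xs_0 x])
  then have "eventually (\<lambda>t. Xs t < x \<and> t \<ge> a) at_top" using eventually_ge_at_top[of a] by (rule eventually_conj)
  from eventually_happens'[OF trivial_limit_at_top_linorder this]
  obtain b where b: "Xs b < x" "b \<ge> a" by blast
  have "{a..b} \<subseteq> tdom" using dom_up[OF a(1)] by auto
  then obtain t where "a \<le> t" "t \<le> b" "Xs t = x" using IVT2'[of Xs b x a] Xs_cont[of a b] a b by auto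
  then show ?thesis using dom_up[OF a(1), of t] by blast
qed

text \<open>Along the stable trajectory \<open>- y \<ge> \<epsilon> * x powr (q / 2)\<close>: the difference \<open>N\<close> of the two sides is positive
  for large times and passes its zeros downwards only. As \<open>q / 2 > 1\<close>, \<open>x\<close> blows up in finite
  time backward: \<open>x powr (- (q - 2) / 2)\<close> has derivative at least \<open>c\<close> but must stay positive.
  This is why the constants \<open>L\<^sub>k\<close> are bounded.\<close>

lemma dom_bounded_below: "\<exists>T. \<forall>t\<in>tdom. T \<le> t"
proof -
  \<comment> \<open>small enough for \<open>N' < 0\<close> wherever \<open>N = 0\<close>, after \<open>2 * a powr (q / 2) \<le> a + a powr (q - 1)\<close>\<close>
  define \<epsilon> where "\<epsilon> = min 1 (min (B / A) (\<kappa> / (A + q)))"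
  have \<epsilon>: "\<epsilon> > 0" "\<epsilon> \<le> 1" "A * \<epsilon> \<le> B" "(A + q) * \<epsilon> \<le> \<kappa>"
  proof -
    show "\<epsilon> > 0" using A0 B0 \<kappa>0 q2 by (simp add: \<epsilon>_def)
    show "\<epsilon> \<le> 1" by (simp add: \<epsilon>_def)
    have "\<epsilon> \<le> B / A" "\<epsilon> \<le> \<kappa> / (A + q)" by (simp_all add: \<epsilon>_def)
    then show "A * \<epsilon> \<le> B" "(A + q) * \<epsilon> \<le> \<kappa>" using A0 q2 by (simp_all add: field_simps)
  qed
  define N where "N t = - Ys t - \<epsilon> * Xs t powr (q / 2)" for t
  define N' where "N' t = - (A * Ys t + B * Xs t + \<kappa> * nonlin q (Xs t)) - \<epsilon> * (q / 2 * Xs t powr (q / 2 - 1) * Ys t)" for t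
  have dN: "(N has_real_derivative N' t) (at t)" if t: "t \<in> tdom" for t
  proof -
    have "((\<lambda>t. Xs t powr (q / 2)) has_real_derivative q / 2 * Xs t powr (q / 2 - 1) * Ys t) (at t)"
      by (rule DERIV_chain2[OF has_real_derivative_powr[OF Xs_pos[OF t]] Xs_deriv[OF t]])
    then show ?thesis unfolding N_def[abs_def] N'_def
      by (intro DERIV_diff DERIV_minus DERIV_cmult Ys_deriv t)
  qed
  have N'neg: "N' t < 0" if t: "t \<in> tdom" and Nt: "N t = 0" for t
  proof -
    define a where "a = Xs t"
    have a: "a > 0" using Xs_pos[OF t] by (simp add: a_def)
    have Y: "Ys t = - (\<epsilon> * a powr (q / 2))" using Nt by (simp add: N_def a_def)
    have e1: "a powr (q / 2 - 1) * a powr (q / 2) = a powr (q - 1)" using a by (simp flip: powr_add)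
    have amgm: "2 * a powr (q / 2) \<le> a + a powr (q - 1)"
    proof -
      have "0 \<le> (a powr (1/2) - a powr ((q - 1) / 2))\<^sup>2" by simp
      also have "\<dots> = a powr (1/2) * a powr (1/2) + a powr ((q - 1) / 2) * a powr ((q - 1) / 2)
          - 2 * (a powr (1/2) * a powr ((q - 1) / 2))" by (simp add: power2_eq_square algebra_simps)
      also have "\<dots> = a + a powr (q - 1) - 2 * a powr (q / 2)"
      proof -
        have e1: "a powr (1/2 + (q - 1) / 2) = a powr (q / 2)"
          "a powr ((q - 1) / 2 + (q - 1) / 2) = a powr (q - 1)"
          by (rule arg_cong[where f = "(powr) a"], simp add: field_simps)+
        have e3: "a powr (1/2 + 1/2) = a" using a by simp
        show ?thesis unfolding powr_add[symmetric] e1 e3 ..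
      qed
      finally show ?thesis by simp
    qed
    have "N' t = A * \<epsilon> * a powr (q / 2) - B * a - \<kappa> * a powr (q - 1) + \<epsilon> * \<epsilon> * (q / 2) * a powr (q - 1)"
      unfolding N'_def Y a_def[symmetric] nonlin_pos[OF a] e1[symmetric] by (simp add: algebra_simps)
    also have "A * \<epsilon> * a powr (q / 2) \<le> A * \<epsilon> * ((a + a powr (q - 1)) / 2)"
      using amgm A0 \<epsilon> by (intro mult_left_mono) auto
    also have "A * \<epsilon> * ((a + a powr (q - 1)) / 2) - B * a - \<kappa> * a powr (q - 1) + \<epsilon> * \<epsilon> * (q / 2) * a powr (q - 1)
      = (A * \<epsilon> / 2 - B) * a + (A * \<epsilon> / 2 + \<epsilon> * \<epsilon> * (q / 2) - \<kappa>) * a powr (q - 1)" by (simp add: algebra_simps)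
    also have "\<dots> < 0"
    proof -
      have "A * \<epsilon> / 2 - B < 0" using \<epsilon>(3) B0 by simp
      then have 1: "(A * \<epsilon> / 2 - B) * a < 0" using a by (rule mult_neg_pos)
      have "\<epsilon> * \<epsilon> * (q / 2) \<le> 1 * \<epsilon> * (q / 2)" using \<epsilon> q2 by (intro mult_right_mono) auto
      moreover have "A * \<epsilon> / 2 + 1 * \<epsilon> * (q / 2) = (A + q) * \<epsilon> / 2" by (simp add: algebra_simps)
      ultimately have "A * \<epsilon> / 2 + \<epsilon> * \<epsilon> * (q / 2) - \<kappa> \<le> 0" using \<epsilon>(4) \<kappa>0 by linarith
      then have "(A * \<epsilon> / 2 + \<epsilon> * \<epsilon> * (q / 2) - \<kappa>) * a powr (q - 1) \<le> 0" by (intro mult_nonpos_nonneg) auto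
      then show ?thesis using 1 by linarith
    qed
    finally show ?thesis by linarith
  qed
  have Npos: "N t > 0" if t: "t \<in> tdom" for t
  proof (rule ccontr)
    assume "\<not> N t > 0"
    have pw: "((\<lambda>t. Xs t powr (q / 2 - 1)) \<longlongrightarrow> 0) at_top"
    proof -
      have "((\<lambda>t. Xs t powr (q / 2 - 1)) \<longlongrightarrow> 0 powr (q / 2 - 1)) at_top"
        by (rule tendsto_powr'[OF Xs_0 tendsto_const])
           (use q2 in \<open>auto intro!: eventually_mono[OF eventually_ge_at_top[of t]] less_imp_le[OF Xs_pos] dom_up[OF t]\<close>)
      then show ?thesis by simp
    qed
    have "eventually (\<lambda>s. Xs s powr (q / 2 - 1) < \<mu> / \<epsilon>) at_top"
      by (rule order_tendstoD(2)[OF pw]) (use \<mu>0 \<epsilon> in auto)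
    then have "eventually (\<lambda>s. Xs s powr (q / 2 - 1) < \<mu> / \<epsilon> \<and> s > t) at_top"
      using eventually_gt_at_top[of t] by (rule eventually_conj)
    from eventually_happens'[OF trivial_limit_at_top_linorder this]
    obtain s where s: "Xs s powr (q / 2 - 1) < \<mu> / \<epsilon>" "s > t" by blast
    have sd: "s \<in> tdom" using dom_up[OF t, of s] s by simp
    have "N s < 0"
    proof (rule negative_after_zero[where g = N and g' = N' and a = t and b = s])
      fix r assume r: "r \<in> {t..s}"
      then have rd: "r \<in> tdom" using dom_up[OF t, of r] by simp
      show "(N has_real_derivative N' r) (at r within {t..s})" using dN[OF rd] by (rule has_field_derivative_at_within)
      show "N r = 0 \<Longrightarrow> N' r < 0" by (rule N'neg[OF rd])
    qed (use s \<open>\<not> N t > 0\<close> in auto)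
    moreover have "N s > 0"
    proof -
      have "\<epsilon> * Xs s powr (q / 2 - 1) < \<mu>" using s \<epsilon> by (simp add: field_simps)
      then have "\<epsilon> * Xs s powr (q / 2 - 1) * Xs s < \<mu> * Xs s" using Xs_pos[OF sd] by (rule mult_strict_right_mono)
      moreover have "Xs s powr (q / 2 - 1) * Xs s = Xs s powr (q / 2)" using Xs_pos[OF sd] by (simp add: powr_diff)
      ultimately show ?thesis using Ys_less[OF sd] by (simp add: N_def mult.assoc)
    qed
    ultimately show False by simp
  qed
  obtain t1 where t1: "t1 \<in> tdom" using dom_nonempty by blast
  define c where "c = (q - 2) / 2 * \<epsilon>"
  have c: "c > 0" using q2 \<epsilon> by (simp add: c_def)
  define P where "P t = Xs t powr (- ((q - 2) / 2))" for t
  have "t1 - P t1 / c \<le> t" if t: "t \<in> tdom" for t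
  proof (cases "t1 \<le> t")
    case True
    have "P t1 / c \<ge> 0" using c by (simp add: P_def)
    then show ?thesis using True by simp
  next
    case False
    then have le: "t \<le> t1" by simp
    have "P t - c * t \<le> P t1 - c * t1"
    proof (rule mono_if_deriv_nonneg[OF le, of "\<lambda>t. P t - c * t"
         "\<lambda>r. (- ((q - 2) / 2)) * Xs r powr (- ((q - 2) / 2) - 1) * Ys r - c * 1"])
      fix r assume r: "t \<le> r" "r \<le> t1"
      have rd: "r \<in> tdom" by (rule dom_up[OF t r(1)])
      show "((\<lambda>t. P t - c * t) has_real_derivative (- ((q - 2) / 2)) * Xs r powr (- ((q - 2) / 2) - 1) * Ys r - c * 1) (at r)"
        unfolding P_def[abs_def]
        by (intro DERIV_diff DERIV_cmult DERIV_ident DERIV_chain2[OF has_real_derivative_powr[OF Xs_pos[OF rd]] Xs_deriv[OF rd]])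
      have "\<epsilon> * Xs r powr (q / 2) \<le> - Ys r" using Npos[OF rd] by (simp add: N_def)
      then have "(q - 2) / 2 * Xs r powr (- (q / 2)) * (\<epsilon> * Xs r powr (q / 2)) \<le> (q - 2) / 2 * Xs r powr (- (q / 2)) * (- Ys r)"
        using q2 by (intro mult_left_mono) auto
      moreover have "(q - 2) / 2 * Xs r powr (- (q / 2)) * (\<epsilon> * Xs r powr (q / 2)) = c"
        using Xs_pos[OF rd] by (simp add: c_def powr_minus field_simps)
      moreover have "- ((q - 2) / 2) - 1 = - (q / 2)" by (simp add: field_simps)
      ultimately show "0 \<le> (- ((q - 2) / 2)) * Xs r powr (- ((q - 2) / 2) - 1) * Ys r - c * 1" by simp
    qed
    moreover have "P t > 0" using Xs_pos[OF t] by (simp add: P_def)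
    ultimately have "c * (t1 - t) \<le> P t1" by (simp add: algebra_simps)
    then have "t1 - t \<le> P t1 / c" using c by (simp add: field_simps)
    then show ?thesis by simp
  qed
  then show ?thesis by blast
qed

text \<open>The stable trajectory as a graph over the abscissa.\<close>

definition Tinv :: "real \<Rightarrow> real" where "Tinv x = (THE t. t \<in> tdom \<and> Xs t = x)"
definition hs :: "real \<Rightarrow> real" where "hs x = Ys (Tinv x)"

lemma Tinv: "x > 0 \<Longrightarrow> Tinv x \<in> tdom" "x > 0 \<Longrightarrow> Xs (Tinv x) = x"
proof -
  assume "x > 0"
  then have "\<exists>!t. t \<in> tdom \<and> Xs t = x" using Xs_surj Xs_inj by blast
  then have "Tinv x \<in> tdom \<and> Xs (Tinv x) = x"
    unfolding Tinv_def by (rule theI')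
  then show "Tinv x \<in> tdom" "Xs (Tinv x) = x" by auto
qed

lemma Tinv_Xs: "t \<in> tdom \<Longrightarrow> Tinv (Xs t) = t"
  using Tinv[OF Xs_pos] Xs_inj by blast

lemma hs_Xs: "t \<in> tdom \<Longrightarrow> hs (Xs t) = Ys t"
  by (simp add: hs_def Tinv_Xs)

lemma Tinv_deriv:
  assumes x: "x > 0"
  shows "(Tinv has_real_derivative inverse (Ys (Tinv x))) (at x)"
proof -
  define t where "t = Tinv x"
  have t: "t \<in> tdom" "Xs t = x" using Tinv[OF x] by (auto simp: t_def)
  obtain s where s: "s \<in> tdom" "s < t" using dom_open_below[OF t(1)] by blast
  have cT: "isCont Tinv (Xs t)"
  proof (rule isCont_inverse_function[where d = "t - s" and f = Xs and g = Tinv and x = t])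
    show "0 < t - s" using s by simp
    fix z assume z: "\<bar>z - t\<bar> \<le> t - s"
    then have "z \<in> tdom" using dom_up[OF s(1), of z] by auto
    then show "Tinv (Xs z) = z" "isCont Xs z" by (auto intro: Tinv_Xs DERIV_isCont[OF Xs_deriv])
  qed
  show ?thesis
  proof (rule DERIV_inverse_function[where f = Xs and a = 0 and b = "x + 1"])
    show "(Xs has_real_derivative Ys (Tinv x)) (at (Tinv x))" by (rule Xs_deriv[OF Tinv(1)[OF x]])
    show "Ys (Tinv x) \<noteq> 0" using Ys_neg[OF Tinv(1)[OF x]] by simp
    show "isCont Tinv x" using cT t by simp
  qed (use x Tinv in auto)
qed

lemma hs_deriv:
  assumes x: "x > 0"
  shows "(hs has_real_derivative (A * hs x + B * x + \<kappa> * nonlin q x) / hs x) (at x)"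
proof -
  have "((\<lambda>x. Ys (Tinv x)) has_real_derivative
     (A * Ys (Tinv x) + B * Xs (Tinv x) + \<kappa> * nonlin q (Xs (Tinv x))) * inverse (Ys (Tinv x))) (at x)"
    by (rule DERIV_chain2[OF Ys_deriv[OF Tinv(1)[OF x]] Tinv_deriv[OF x]])
  then show ?thesis unfolding hs_def[abs_def] by (simp add: Tinv(2)[OF x] divide_inverse)
qed

lemma hs_neg: "x > 0 \<Longrightarrow> hs x < 0"
  unfolding hs_def by (rule Ys_neg[OF Tinv(1)])

lemma hs_cont: "continuous_on {0<..} hs"
  by (intro continuous_at_imp_continuous_on ballI DERIV_isCont[OF hs_deriv]) auto

lemma hs_0: "(hs \<longlongrightarrow> 0) (at_right 0)"
proof (rule tendstoI)
  fix e :: real assume e: "e > 0"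
  obtain T where T: "T \<in> tdom" using dom_nonempty by blast
  have "eventually (\<lambda>t. \<bar>Ys t\<bar> < e) at_top" using tendstoD[OF Ys_0 e] by (simp add: dist_real_def)
  then obtain t0 where t0: "\<And>t. t \<ge> t0 \<Longrightarrow> \<bar>Ys t\<bar> < e" unfolding eventually_at_top_linorder by blast
  define t1 where "t1 = max t0 T"
  have t1: "t1 \<in> tdom" "t1 \<ge> t0" using dom_up[OF T] by (auto simp: t1_def)
  have "eventually (\<lambda>x. x \<in> {0<..<Xs t1}) (at_right 0)" by (rule eventually_at_right_real[OF Xs_pos[OF t1(1)]])
  then show "eventually (\<lambda>x. dist (hs x) 0 < e) (at_right 0)"
  proof eventually_elim
    fix x assume x: "x \<in> {0<..<Xs t1}"
    then have "Xs (Tinv x) < Xs t1" "Tinv x \<in> tdom" using Tinv by auto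
    then have "t1 < Tinv x" using Xs_less_iff t1 by blast
    then show "dist (hs x) 0 < e" using t0[of "Tinv x"] t1 by (simp add: hs_def)
  qed
qed

text \<open>On the graph both fields have the same \<open>x'\<close>. The outer field is tangent, and \<open>y'\<close> of the inner
  field is smaller by \<open>(K + \<kappa>) * nonlin q x > 0\<close>.\<close>

lemma hs_cross:
  assumes S: "sol x y {a..b}" and ab: "a < b" and x: "\<And>t. t \<in> {a..b} \<Longrightarrow> x t > 0" and ya: "y a \<le> hs (x a)"
  shows "y b < hs (x b)"
proof -
  have "y b - hs (x b) < 0"
  proof (rule negative_after_zero[where g = "\<lambda>t. y t - hs (x t)" and a = a and b = b and
      g' = "\<lambda>t. (A * y t + B * x t - K * nonlin q (x t)) - (A * hs (x t) + B * x t + \<kappa> * nonlin q (x t)) / hs (x t) * y t"])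
    fix t assume t: "t \<in> {a..b}"
    show "((\<lambda>t. y t - hs (x t)) has_real_derivative (A * y t + B * x t - K * nonlin q (x t))
        - (A * hs (x t) + B * x t + \<kappa> * nonlin q (x t)) / hs (x t) * y t) (at t within {a..b})"
      by (intro DERIV_diff sol_y[OF S t] DERIV_chain2[OF hs_deriv[OF x[OF t]] sol_x[OF S t]])
    assume "y t - hs (x t) = 0"
    then have y: "y t = hs (x t)" by simp
    have "(K + \<kappa>) * nonlin q (x t) > 0" using K0 \<kappa>0 x[OF t] by (simp add: nonlin_pos_iff)
    then show "(A * y t + B * x t - K * nonlin q (x t)) - (A * hs (x t) + B * x t + \<kappa> * nonlin q (x t)) / hs (x t) * y t < 0"
    proof -
      have "(A * hs (x t) + B * x t + \<kappa> * nonlin q (x t)) / hs (x t) * hs (x t) = A * hs (x t) + B * x t + \<kappa> * nonlin q (x t)"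
        using hs_neg[OF x[OF t]] by (intro nonzero_eq_divide_eq[THEN iffD1]) auto
      moreover have "(K + \<kappa>) * nonlin q (x t) = K * nonlin q (x t) + \<kappa> * nonlin q (x t)" by (simp add: algebra_simps)
      ultimately show ?thesis unfolding y using \<open>(K + \<kappa>) * nonlin q (x t) > 0\<close> by linarith
    qed
  qed (use ab ya in auto)
  then show ?thesis by simp
qed

end

section \<open>Back to the radial variable\<close>

lemma solves_on_subset:
  assumes "solves_on n q K1 K2 I u" "J \<subseteq> I"
  shows "solves_on n q K1 K2 J u"
proof -
  obtain u' u'' where u: "\<forall>r\<in>I. (u has_real_derivative u' r) (at r within I)" "continuous_on I u'"
    "\<forall>r\<in>I - {0, 1}. (u' has_real_derivative u'' r) (at r within I) \<and>
       u'' r + (real n - 1) / r * u' r + weight K1 K2 r * (u r * \<bar>u r\<bar> powr (q - 2)) = 0"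
    using assms(1) unfolding solves_on_def by blast
  have "\<forall>r\<in>J. (u has_real_derivative u' r) (at r within J)"
    using u(1) assms(2) has_field_derivative_subset by blast
  moreover have "continuous_on J u'" using u(2) assms(2) continuous_on_subset by blast
  moreover have "\<forall>r\<in>J - {0, 1}. (u' has_real_derivative u'' r) (at r within J) \<and>
       u'' r + (real n - 1) / r * u' r + weight K1 K2 r * (u r * \<bar>u r\<bar> powr (q - 2)) = 0"
    using u(3) assms(2) has_field_derivative_subset by blast
  ultimately show ?thesis unfolding solves_on_def by blast
qed

lemma has_derivative_cong_on:
  assumes "(u has_real_derivative D) (at r within I)" "r \<in> I" "\<And>s. s \<in> I \<Longrightarrow> u s = v s"
  shows "(v has_real_derivative D) (at r within I)"
  by (rule has_field_derivative_transform_within[OF assms(1) zero_less_one assms(2)]) (use assms(3) in auto)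

lemma solves_on_cong:
  assumes s: "solves_on n q K1 K2 I u" and eq: "\<And>r. r \<in> I \<Longrightarrow> u r = v r"
  shows "solves_on n q K1 K2 I v"
proof -
  obtain u' u'' where u: "\<forall>r\<in>I. (u has_real_derivative u' r) (at r within I)" "continuous_on I u'"
    "\<forall>r\<in>I - {0, 1}. (u' has_real_derivative u'' r) (at r within I) \<and>
       u'' r + (real n - 1) / r * u' r + weight K1 K2 r * (u r * \<bar>u r\<bar> powr (q - 2)) = 0"
    using s unfolding solves_on_def by blast
  show ?thesis unfolding solves_on_def
  proof (rule exI[of _ u'], rule exI[of _ u''], intro conjI ballI)
    show "continuous_on I u'" by (rule u(2))
    fix r assume r: "r \<in> I"
    show "(v has_real_derivative u' r) (at r within I)"
      by (rule has_derivative_cong_on[OF bspec[OF u(1) r] r eq])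
  next
    fix r assume r: "r \<in> I - {0, 1}"
    then show "(u' has_real_derivative u'' r) (at r within I)" using u(3) by blast
    show "u'' r + (real n - 1) / r * u' r + weight K1 K2 r * (v r * \<bar>v r\<bar> powr (q - 2)) = 0"
    proof -
      have e: "u r = v r" using eq r by blast
      show ?thesis using bspec[OF u(3) r] unfolding e by blast
    qed
  qed
qed

lemma solves_on_minus:
  assumes "solves_on n q K1 K2 I u"
  shows "solves_on n q K1 K2 I (\<lambda>r. - u r)"
proof -
  obtain u' u'' where u: "\<forall>r\<in>I. (u has_real_derivative u' r) (at r within I)" "continuous_on I u'"
    "\<forall>r\<in>I - {0, 1}. (u' has_real_derivative u'' r) (at r within I) \<and>
       u'' r + (real n - 1) / r * u' r + weight K1 K2 r * (u r * \<bar>u r\<bar> powr (q - 2)) = 0"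
    using assms unfolding solves_on_def by blast
  show ?thesis unfolding solves_on_def
  proof (rule exI[of _ "\<lambda>r. - u' r"], rule exI[of _ "\<lambda>r. - u'' r"], intro conjI ballI)
    show "continuous_on I (\<lambda>r. - u' r)" by (intro continuous_intros u(2))
    fix r assume r: "r \<in> I"
    then show "((\<lambda>r. - u r) has_real_derivative - u' r) (at r within I)" using u(1) by (intro DERIV_minus) auto
  next
    fix r assume r: "r \<in> I - {0, 1}"
    then show "((\<lambda>r. - u' r) has_real_derivative - u'' r) (at r within I)" using u(3) by (intro DERIV_minus) auto
    have "u'' r + (real n - 1) / r * u' r + weight K1 K2 r * (u r * \<bar>u r\<bar> powr (q - 2)) = 0"
      using u(3) r by blast
    then show "- u'' r + (real n - 1) / r * - u' r + weight K1 K2 r * (- u r * \<bar>- u r\<bar> powr (q - 2)) = 0"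
      unfolding mult_minus_right mult_minus_left abs_minus_cancel by linarith
  qed
qed

lemma regular_on_cong:
  assumes "regular_on n q K1 K2 I d u" "0 \<in> I" "\<And>r. r \<in> I \<Longrightarrow> u r = v r"
  shows "regular_on n q K1 K2 I d v"
  using assms solves_on_cong[of n q K1 K2 I u v] has_derivative_cong_on[of u 0 0 I v]
  unfolding regular_on_def by auto

lemma nondegenerate_zeroes_cong:
  assumes "nondegenerate_zeroes k u" and eq: "\<And>r. r > 0 \<Longrightarrow> u r = v r"
  shows "nondegenerate_zeroes k v"
proof -
  have Z: "{r. r > 0 \<and> v r = 0} = {r. r > 0 \<and> u r = 0}" using eq by auto
  have "deriv v r = deriv u r" if "r > 0" for r
    by (rule deriv_cong_ev[OF _ refl], rule eventually_nhds_openI[of "{0<..}"]) (use that eq in auto)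
  then show ?thesis using assms unfolding nondegenerate_zeroes_def Z by auto
qed

lemma nondegenerate_zeroes_minus:
  assumes "nondegenerate_zeroes k u" and d: "\<And>r. r > 0 \<Longrightarrow> u differentiable (at r)"
  shows "nondegenerate_zeroes k (\<lambda>r. - u r)"
proof -
  have "deriv (\<lambda>r. - u r) r = - deriv u r" if "r > 0" for r
    using d[OF that] by (intro DERIV_imp_deriv DERIV_minus) (simp add: DERIV_deriv_iff_real_differentiable)
  then show ?thesis using assms unfolding nondegenerate_zeroes_def by auto
qed

lemma DERIV_left_right:
  fixes f :: "real \<Rightarrow> real"
  assumes "(f has_real_derivative D) (at t within {..t})" "(f has_real_derivative D) (at t within {t..})"
  shows "(f has_real_derivative D) (at t)"
proof -
  have "((\<lambda>y. (f y - f t) / (y - t)) \<longlongrightarrow> D) (at_left t)"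
    using assms(1) unfolding has_field_derivative_iff by (rule tendsto_within_subset) auto
  moreover have "((\<lambda>y. (f y - f t) / (y - t)) \<longlongrightarrow> D) (at_right t)"
    using assms(2) unfolding has_field_derivative_iff by (rule tendsto_within_subset) auto
  ultimately show ?thesis unfolding has_field_derivative_iff filterlim_at_split by blast
qed

locale emden_radial = emden_outer +
  fixes n :: nat
  assumes n_eq: "real n = \<alpha> + \<mu> + 2"
begin

text \<open>Trajectories that pass from the inner to the outer system at \<open>t = 0\<close>: \<open>C\<^sup>1\<close> for \<open>x\<close> means that \<open>y\<close> is
  continuous at 0, where its derivative jumps.\<close>

definition tsol :: "(real \<Rightarrow> real) \<Rightarrow> (real \<Rightarrow> real) \<Rightarrow> real set \<Rightarrow> bool" where
  "tsol x y I \<longleftrightarrow> (\<forall>t\<in>I. (x has_real_derivative y t) (at t)) \<and> continuous_on I y \<and>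
     (\<forall>t\<in>I - {0}. (y has_real_derivative A * y t + B * x t - weight K (- \<kappa>) (exp t) * nonlin q (x t)) (at t))"

lemma tsol_flow:
  assumes "tsol x y I" "J \<subseteq> I"
  shows "J \<subseteq> {..<0} \<Longrightarrow> flow K x y J" "J \<subseteq> {0<..} \<Longrightarrow> flow (- \<kappa>) x y J"
proof -
  have d: "(x has_real_derivative y t) (at t)" if "t \<in> J" for t using assms that by (auto simp: tsol_def)
  have e: "(y has_real_derivative A * y t + B * x t - weight K (- \<kappa>) (exp t) * nonlin q (x t)) (at t)"
    if "t \<in> J" "t \<noteq> 0" for t using assms that by (auto simp: tsol_def)
  show "flow K x y J" if "J \<subseteq> {..<0}" unfolding flow_def
  proof (intro ballI conjI d)
    fix t assume "t \<in> J"
    then show "(y has_real_derivative A * y t + B * x t - K * nonlin q (x t)) (at t)"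
      using e[of t] that by (auto simp: weight_def)
  qed
  show "flow (- \<kappa>) x y J" if "J \<subseteq> {0<..}" unfolding flow_def
  proof (intro ballI conjI d)
    fix t assume "t \<in> J"
    then show "(y has_real_derivative A * y t + B * x t - (- \<kappa>) * nonlin q (x t)) (at t)"
      using e[of t] that by (auto simp: weight_def)
  qed
qed

lemma tsol_y_eq:
  assumes 1: "tsol x y I" and 2: "tsol x' y' I" and S: "open S" "S \<subseteq> I" and eq: "\<And>t. t \<in> S \<Longrightarrow> x t = x' t" and t: "t \<in> S"
  shows "y t = y' t"
proof (rule DERIV_unique[of x'])
  have "(x has_real_derivative y t) (at t)" using 1 S t by (auto simp: tsol_def)
  moreover have "eventually (\<lambda>s. x s = x' s) (nhds t)"
    by (rule eventually_nhds_openI[OF S(1) t]) (use eq in auto)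
  ultimately show "(x' has_real_derivative y t) (at t)" by (subst (asm) DERIV_cong_ev[OF refl _ refl]) auto
  show "(x' has_real_derivative y' t) (at t)" using 2 S t by (auto simp: tsol_def)
qed

lemma tsol_cont: "tsol x y I \<Longrightarrow> continuous_on I x" "tsol x y I \<Longrightarrow> continuous_on I y"
  unfolding tsol_def by (auto intro!: continuous_at_imp_continuous_on DERIV_isCont)

text \<open>On \<open>t < 0\<close> this is \<open>flow_unique_asymptotic\<close>; continuity transports equality to \<open>t = 0\<close>, and
  from there the initial value problem of the outer system takes over.\<close>

lemma tsol_unique_regular:
  assumes 1: "tsol xa ya {..<b}" and 2: "tsol xb yb {..<b}"
    and l: "((\<lambda>t. exp (- \<alpha> * t) * xa t) \<longlongrightarrow> d) at_bot" "((\<lambda>t. exp (- \<alpha> * t) * xb t) \<longlongrightarrow> d) at_bot"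
    and t: "t < b"
  shows "xa t = xb t"
proof -
  define T where "T = min 0 b"
  have T: "{..<T} \<subseteq> {..<b}" "{..<T} \<subseteq> {..<0}" by (auto simp: T_def)
  have eq: "xa s = xb s" if s: "s < T" for s
  proof (rule flow_unique_asymptotic[where xa = xa and xb = xb and \<sigma> = \<alpha> and T = T and k = K and d = d])
    show "\<alpha>\<^sup>2 = A * \<alpha> + B" by (rule \<alpha>_root)
    show "\<alpha> \<noteq> 0" "0 \<le> (2 * \<alpha> - A) / (\<alpha> * (q - 2))" using \<alpha>0 \<mu>0 q2 by (auto simp: A_def)
    have "{t. \<alpha> * t < \<alpha> * T} = {..<T}" using \<alpha>0 by auto
    then show "flow K xa ya {t. \<alpha> * t < \<alpha> * T}" "flow K xb yb {t. \<alpha> * t < \<alpha> * T}"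
      using tsol_flow(1)[OF 1 T] tsol_flow(1)[OF 2 T] by simp_all
    show "\<alpha> * s < \<alpha> * T" using s \<alpha>0 by simp
  qed (use l \<alpha>0 in auto)
  show ?thesis
  proof (cases "t < T")
    case True then show ?thesis by (rule eq)
  next
    case False
    then have t0: "0 \<le> t" "T = 0" "0 < b" using t by (auto simp: T_def min_def split: if_splits)
    have yeq: "ya s = yb s" if "s < 0" for s
      by (rule tsol_y_eq[OF 1 2 open_lessThan T(1)]) (use eq that t0 in auto)
    have lim: "g 0 = g' 0" if c: "continuous_on {..<b} g" "continuous_on {..<b} g'" and e: "\<And>s. s < 0 \<Longrightarrow> g s = g' s"
      for g g' :: "real \<Rightarrow> real"
    proof (rule tendsto_unique[OF trivial_limit_at_left_real])
      have "isCont g 0" "isCont g' 0" using c t0 by (auto simp: continuous_on_eq_continuous_at)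
      then have "(g \<longlongrightarrow> g 0) (at_left 0)" and g': "(g' \<longlongrightarrow> g' 0) (at_left 0)" by (auto simp: isCont_def filterlim_at_split)
      then show "(g \<longlongrightarrow> g 0) (at_left 0)" by simp
      show "(g \<longlongrightarrow> g' 0) (at_left 0)"
        by (rule Lim_transform_eventually[OF g']) (auto simp: eventually_at_filter e)
    qed
    have x0: "xa 0 = xb 0" by (rule lim[OF tsol_cont(1)[OF 1] tsol_cont(1)[OF 2]]) (use eq t0 in auto)
    have y0: "ya 0 = yb 0" by (rule lim[OF tsol_cont(2)[OF 1] tsol_cont(2)[OF 2]]) (use yeq in auto)
    have J: "{0<..<b} \<subseteq> {..<b}" "{0<..<b} \<subseteq> {0<..}" by auto
    have f: "flow (- \<kappa>) xa ya {0<..<b}" "flow (- \<kappa>) xb yb {0<..<b}"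
      using tsol_flow(2)[OF 1 J] tsol_flow(2)[OF 2 J] by auto
    have sub: "{0..t} \<subseteq> {..<b}" using t by auto
    show ?thesis
      by (rule planar_unique(1)[where h = "\<lambda>u. B * u - (- \<kappa>) * nonlin q u" and a = A and s = 0 and e = t
          and ?x1.0 = xa and ?x2.0 = xb and ?y1.0 = ya and ?y2.0 = yb, OF affine_nonlin_locally_lipschitz[OF q2]])
         (use f x0 y0 t0 t continuous_on_subset[OF tsol_cont(1)[OF 1] sub] continuous_on_subset[OF tsol_cont(2)[OF 1] sub]
            continuous_on_subset[OF tsol_cont(1)[OF 2] sub] continuous_on_subset[OF tsol_cont(2)[OF 2] sub]
          in \<open>auto simp: flow_def algebra_simps\<close>)
  qed
qed

lemma tsol_unique_fast:
  assumes 1: "tsol xa ya {a<..}" and 2: "tsol xb yb {a<..}"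
    and l: "((\<lambda>t. exp (\<mu> * t) * xa t) \<longlongrightarrow> L) at_top" "((\<lambda>t. exp (\<mu> * t) * xb t) \<longlongrightarrow> L) at_top"
    and t: "t > a"
  shows "xa t = xb t"
proof -
  define T where "T = max 0 a"
  have T: "{T<..} \<subseteq> {a<..}" "{T<..} \<subseteq> {0<..}" by (auto simp: T_def)
  have eq: "xa s = xb s" if s: "s > T" for s
  proof (rule flow_unique_asymptotic[where xa = xa and xb = xb and \<sigma> = "- \<mu>" and T = T and k = "- \<kappa>" and d = L])
    show "(- \<mu>)\<^sup>2 = A * - \<mu> + B" by (rule \<mu>_root)
    show "- \<mu> \<noteq> 0" "0 \<le> (2 * - \<mu> - A) / (- \<mu> * (q - 2))" using \<mu>0 A0 q2
      by (auto simp: divide_nonpos_pos)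
    have "{t. - \<mu> * t < - \<mu> * T} = {T<..}" using \<mu>0 by auto
    then show "flow (- \<kappa>) xa ya {t. - \<mu> * t < - \<mu> * T}" "flow (- \<kappa>) xb yb {t. - \<mu> * t < - \<mu> * T}"
      using tsol_flow(2)[OF 1 T] tsol_flow(2)[OF 2 T] by simp_all
    show "- \<mu> * s < - \<mu> * T" using s \<mu>0 by simp
  qed (use l \<mu>0 in auto)
  show ?thesis
  proof (cases "t > T")
    case True then show ?thesis by (rule eq)
  next
    case False
    then have t0: "t \<le> 0" "T = 0" "a < 0" using t by (auto simp: T_def max_def split: if_splits)
    have yeq: "ya s = yb s" if "s > 0" for s
      by (rule tsol_y_eq[OF 1 2 open_greaterThan T(1)]) (use eq that t0 in auto)
    have lim: "g 0 = g' 0" if c: "continuous_on {a<..} g" "continuous_on {a<..} g'" and e: "\<And>s. s > 0 \<Longrightarrow> g s = g' s"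
      for g g' :: "real \<Rightarrow> real"
    proof (rule tendsto_unique[OF trivial_limit_at_right_real])
      have "isCont g 0" "isCont g' 0" using c t0 by (auto simp: continuous_on_eq_continuous_at)
      then have "(g \<longlongrightarrow> g 0) (at_right 0)" and g': "(g' \<longlongrightarrow> g' 0) (at_right 0)" by (auto simp: isCont_def filterlim_at_split)
      then show "(g \<longlongrightarrow> g 0) (at_right 0)" by simp
      show "(g \<longlongrightarrow> g' 0) (at_right 0)"
        by (rule Lim_transform_eventually[OF g']) (auto simp: eventually_at_filter e)
    qed
    have x0: "xa 0 = xb 0" by (rule lim[OF tsol_cont(1)[OF 1] tsol_cont(1)[OF 2]]) (use eq t0 in auto)
    have y0: "ya 0 = yb 0" by (rule lim[OF tsol_cont(2)[OF 1] tsol_cont(2)[OF 2]]) (use yeq in auto)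
    have J: "{a<..<0} \<subseteq> {a<..}" "{a<..<0} \<subseteq> {..<0}" by auto
    have f: "flow K xa ya {a<..<0}" "flow K xb yb {a<..<0}"
      using tsol_flow(1)[OF 1 J] tsol_flow(1)[OF 2 J] by auto
    \<comment> \<open>time reversal turns the backward problem into a forward one\<close>
    have rev: "((\<lambda>t. x (- t)) has_real_derivative - y (- s)) (at s)"
      "((\<lambda>t. - y (- t)) has_real_derivative (- A) * (- y (- s)) + (B * x (- s) - K * nonlin q (x (- s)))) (at s)"
      if fl: "flow K x y {a<..<0}" and s: "s \<in> {0<..<- t}" for x y s
    proof -
      have "- s \<in> {a<..<0}" using s t by auto
      then have d: "(x has_real_derivative y (- s)) (at (- s))"
        "(y has_real_derivative A * y (- s) + B * x (- s) - K * nonlin q (x (- s))) (at (- s))"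
        using fl by (auto simp: flow_def)
      show "((\<lambda>t. x (- t)) has_real_derivative - y (- s)) (at s)" using d(1) by (simp add: DERIV_mirror)
      have "((\<lambda>t. y (- t)) has_real_derivative - (A * y (- s) + B * x (- s) - K * nonlin q (x (- s)))) (at s)"
        using d(2) by (simp add: DERIV_mirror)
      from DERIV_minus[OF this]
      show "((\<lambda>t. - y (- t)) has_real_derivative (- A) * (- y (- s)) + (B * x (- s) - K * nonlin q (x (- s)))) (at s)"
        by (simp add: algebra_simps)
    qed
    have cont: "continuous_on {0..- t} (\<lambda>s. g (- s))" if "continuous_on {a<..} g" for g :: "real \<Rightarrow> real"
      by (rule continuous_on_compose2[OF that]) (use t in \<open>auto intro!: continuous_intros\<close>)
    have "xa (- (- t)) = xb (- (- t))"
      by (rule planar_unique(1)[where h = "\<lambda>u. B * u - K * nonlin q u" and a = "- A" and s = 0 and e = "- t" and t = "- t"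
          and ?x1.0 = "\<lambda>s. xa (- s)" and ?x2.0 = "\<lambda>s. xb (- s)" and ?y1.0 = "\<lambda>s. - ya (- s)" and ?y2.0 = "\<lambda>s. - yb (- s)",
          OF affine_nonlin_locally_lipschitz[OF q2] cont[OF tsol_cont(1)[OF 1]] continuous_on_minus[OF cont[OF tsol_cont(2)[OF 1]]]
          cont[OF tsol_cont(1)[OF 2]] continuous_on_minus[OF cont[OF tsol_cont(2)[OF 2]]] rev(1)[OF f(1)] rev(2)[OF f(1)]
          rev(1)[OF f(2)] rev(2)[OF f(2)]])
         (use x0 y0 t0 in auto)
    then show ?thesis by simp
  qed
qed

lemma tsol_solves:
  assumes s: "tsol x y I" and J: "open J" "J \<subseteq> {0<..}" "\<And>r. r \<in> J \<Longrightarrow> ln r \<in> I"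
    and u: "\<And>r. r \<in> J \<Longrightarrow> u r = r powr (- \<alpha>) * x (ln r)"
  shows "solves_on n q K (- \<kappa>) J u"
    "\<And>r. r \<in> J \<Longrightarrow> (u has_real_derivative r powr (- \<alpha> - 1) * (y (ln r) - \<alpha> * x (ln r))) (at r)"
proof -
  define u' where "u' r = r powr (- \<alpha> - 1) * (y (ln r) - \<alpha> * x (ln r))" for r
  define k where "k r = weight K (- \<kappa>) r" for r
  define u'' where "u'' r = r powr (- \<alpha> - 2) * ((A * y (ln r) + B * x (ln r) - k r * nonlin q (x (ln r))) - \<alpha> * y (ln r) - (\<alpha> + 1) * (y (ln r) - \<alpha> * x (ln r)))" for r
  have pos: "r > 0" if "r \<in> J" for r using that J by auto
  have dln: "(ln has_real_derivative 1 / r) (at r)" if "r \<in> J" for r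
    using pos[OF that] by (rule DERIV_ln_divide)
  have pd: "((\<lambda>r. r powr a) has_real_derivative a * r powr (a - 1)) (at r)" if "r \<in> J" for a r
    by (rule has_real_derivative_powr[OF pos[OF that]])
  have dx: "((\<lambda>r. x (ln r)) has_real_derivative y (ln r) * (1 / r)) (at r)" if "r \<in> J" for r
    using s J(3)[OF that] by (intro DERIV_chain2[OF _ dln[OF that]]) (auto simp: tsol_def)
  have du: "(u has_real_derivative u' r) (at r)" if r: "r \<in> J" for r
  proof -
    have "((\<lambda>r. r powr (- \<alpha>) * x (ln r)) has_real_derivative (- \<alpha> * r powr (- \<alpha> - 1)) * x (ln r) + y (ln r) * (1 / r) * r powr (- \<alpha>)) (at r)"
      by (intro DERIV_mult pd dx r)
    moreover have "r powr (- \<alpha>) = r * r powr (- \<alpha> - 1)" using pos[OF r] by (simp add: powr_diff)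
    ultimately have "((\<lambda>r. r powr (- \<alpha>) * x (ln r)) has_real_derivative u' r) (at r)"
      using pos[OF r] by (simp add: u'_def algebra_simps)
    moreover have "eventually (\<lambda>s. s powr (- \<alpha>) * x (ln s) = u s) (nhds r)"
      by (rule eventually_nhds_openI[OF J(1) r]) (simp add: u)
    ultimately show ?thesis by (subst (asm) DERIV_cong_ev[OF refl _ refl]) auto
  qed
  then show "\<And>r. r \<in> J \<Longrightarrow> (u has_real_derivative r powr (- \<alpha> - 1) * (y (ln r) - \<alpha> * x (ln r))) (at r)"
    by (simp add: u'_def)
  have cln: "continuous_on J ln" using pos by (intro continuous_on_ln continuous_on_id) force
  have cx: "continuous_on J (\<lambda>r. x (ln r))" "continuous_on J (\<lambda>r. y (ln r))"
    using J(3) by (auto intro!: continuous_on_compose2[OF tsol_cont(1)[OF s] cln] continuous_on_compose2[OF tsol_cont(2)[OF s] cln])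
  have cu': "continuous_on J u'" unfolding u'_def
    using pos by (intro continuous_intros cx) force+
  have du': "(u' has_real_derivative u'' r) (at r) \<and>
       u'' r + (real n - 1) / r * u' r + weight K (- \<kappa>) r * (u r * \<bar>u r\<bar> powr (q - 2)) = 0"
    if r: "r \<in> J - {0, 1}" for r
  proof
    have rJ: "r \<in> J" and r0: "r > 0" "ln r \<noteq> 0" using r pos by auto
    have w: "weight K (- \<kappa>) (exp (ln r)) = k r" using r0 by (simp add: k_def)
    have dy: "((\<lambda>r. y (ln r)) has_real_derivative (A * y (ln r) + B * x (ln r) - k r * nonlin q (x (ln r))) * (1 / r)) (at r)"
      using s J(3)[OF rJ] r0(2) unfolding w[symmetric] by (intro DERIV_chain2[OF _ dln[OF rJ]]) (auto simp: tsol_def)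
    have "(u' has_real_derivative (- \<alpha> - 1) * r powr (- \<alpha> - 1 - 1) * (y (ln r) - \<alpha> * x (ln r)) +
       ((A * y (ln r) + B * x (ln r) - k r * nonlin q (x (ln r))) * (1 / r) - \<alpha> * (y (ln r) * (1 / r))) * r powr (- \<alpha> - 1)) (at r)"
      unfolding u'_def[abs_def] by (intro DERIV_mult pd rJ DERIV_diff dy DERIV_cmult dx)
    moreover have e: "r powr (- \<alpha> - 1) = r * r powr (- \<alpha> - 2)"
    proof -
      have "r powr (- \<alpha> - 1) = r powr (1 + (- \<alpha> - 2))" by (rule arg_cong[where f = "(powr) r"]) simp
      also have "\<dots> = r powr 1 * r powr (- \<alpha> - 2)" by (rule powr_add)
      finally show ?thesis using r0 by simp
    qed
    moreover have "r powr (- \<alpha> - 1 - 1) = r powr (- \<alpha> - 2)" by (simp add: algebra_simps)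
    ultimately show "(u' has_real_derivative u'' r) (at r)"
      using r0(1) by (simp add: u''_def algebra_simps)
    have nu: "u r * \<bar>u r\<bar> powr (q - 2) = r powr (- \<alpha> - 2) * nonlin q (x (ln r))"
    proof -
      have "u r * \<bar>u r\<bar> powr (q - 2) = nonlin q (r powr (- \<alpha>) * x (ln r))" by (simp add: nonlin_def u[OF rJ])
      also have "\<dots> = (r powr (- \<alpha>)) powr (q - 1) * nonlin q (x (ln r))" using r0 by (intro nonlin_mult) simp
      also have "(r powr (- \<alpha>)) powr (q - 1) = r powr (- \<alpha> - 2)"
      proof -
        have "- \<alpha> * (q - 1) = - \<alpha> - 2" using \<alpha>q by (simp add: algebra_simps)
        then show ?thesis by (simp add: powr_powr)
      qed
      finally show ?thesis .
    qed
    have u'r: "(real n - 1) / r * u' r = r powr (- \<alpha> - 2) * ((\<alpha> + \<mu> + 1) * (y (ln r) - \<alpha> * x (ln r)))"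
      unfolding u'_def e n_eq using r0(1) by simp
    show "u'' r + (real n - 1) / r * u' r + weight K (- \<kappa>) r * (u r * \<bar>u r\<bar> powr (q - 2)) = 0"
      unfolding nu u'r u''_def k_def[symmetric] by (simp add: A_def B_def algebra_simps)
  qed
  show "solves_on n q K (- \<kappa>) J u" unfolding solves_on_def
  proof (rule exI[of _ u'], rule exI[of _ u''], intro conjI ballI cu')
    fix r assume "r \<in> J"
    then show "(u has_real_derivative u' r) (at r within J)" by (rule has_field_derivative_at_within[OF du])
  next
    fix r assume r: "r \<in> J - {0, 1}"
    show "(u' has_real_derivative u'' r) (at r within J)"
      by (rule has_field_derivative_at_within[OF conjunct1[OF du'[OF r]]])
    show "u'' r + (real n - 1) / r * u' r + weight K (- \<kappa>) r * (u r * \<bar>u r\<bar> powr (q - 2)) = 0"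
      by (rule conjunct2[OF du'[OF r]])
  qed
qed

lemma solves_tsol:
  assumes s: "solves_on n q K (- \<kappa>) J u" and J: "open J" "J \<subseteq> {0<..}"
  shows "\<exists>y. tsol (\<lambda>t. exp (\<alpha> * t) * u (exp t)) y {t. exp t \<in> J}"
proof -
  obtain u' u'' where u: "\<forall>r\<in>J. (u has_real_derivative u' r) (at r within J)" "continuous_on J u'"
    "\<forall>r\<in>J - {0, 1}. (u' has_real_derivative u'' r) (at r within J) \<and>
       u'' r + (real n - 1) / r * u' r + weight K (- \<kappa>) r * (u r * \<bar>u r\<bar> powr (q - 2)) = 0"
    using s unfolding solves_on_def by blast
  have at: "at r within J = at r" if "r \<in> J" for r using that J(1) by (rule at_within_open)
  define x where "x = (\<lambda>t. exp (\<alpha> * t) * u (exp t))"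
  define y where "y = (\<lambda>t. \<alpha> * x t + exp ((\<alpha> + 1) * t) * u' (exp t))"
  have de: "((\<lambda>t. exp (a * t)) has_real_derivative a * exp (a * t)) (at t)" for a t :: real
    by (auto intro!: derivative_eq_intros)
  have dx: "(x has_real_derivative y t) (at t)" if t: "exp t \<in> J" for t
  proof -
    have du: "((\<lambda>t. u (exp t)) has_real_derivative u' (exp t) * exp t) (at t)"
      using u(1) t at[OF t] by (intro DERIV_chain2[OF _ DERIV_exp]) auto
    have "(x has_real_derivative \<alpha> * exp (\<alpha> * t) * u (exp t) + u' (exp t) * exp t * exp (\<alpha> * t)) (at t)"
      unfolding x_def by (intro DERIV_mult de du)
    moreover have "exp ((\<alpha> + 1) * t) = exp t * exp (\<alpha> * t)" by (simp add: algebra_simps flip: exp_add)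
    ultimately show ?thesis by (simp add: y_def x_def algebra_simps)
  qed
  have "tsol x y {t. exp t \<in> J}" unfolding tsol_def
  proof (intro conjI ballI)
    fix t assume "t \<in> {t. exp t \<in> J}" then show "(x has_real_derivative y t) (at t)" using dx by simp
  next
    have "continuous_on {t. exp t \<in> J} x" by (rule DERIV_continuous_on[of _ x y])
      (use dx has_field_derivative_at_within in blast)
    then show "continuous_on {t. exp t \<in> J} y" unfolding y_def
      by (intro continuous_intros continuous_on_compose2[OF u(2)]) auto
  next
    fix t assume t: "t \<in> {t. exp t \<in> J} - {0}"
    define r where "r = exp t"
    have r: "r \<in> J - {0, 1}" using t J(2) by (auto simp: r_def)
    then have rJ: "r \<in> J" by simp
    have du': "((\<lambda>t. u' (exp t)) has_real_derivative u'' r * exp t) (at t)"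
    proof -
      have "(u' has_real_derivative u'' r) (at r)" using bspec[OF u(3) r] unfolding at[OF rJ] by blast
      then show ?thesis unfolding r_def by (rule DERIV_chain2[OF _ DERIV_exp])
    qed
    have d: "(y has_real_derivative \<alpha> * y t + ((\<alpha> + 1) * exp ((\<alpha> + 1) * t) * u' (exp t) + u'' r * exp t * exp ((\<alpha> + 1) * t))) (at t)"
      unfolding y_def[abs_def] by (intro DERIV_add DERIV_cmult DERIV_mult de du' dx[unfolded y_def]) (use t in auto)
    define z where "z = exp ((\<alpha> + 1) * t) * u' r"
    define k where "k = weight K (- \<kappa>) (exp t)"
    have zy: "z = y t - \<alpha> * x t" by (simp add: z_def y_def r_def)
    have eq: "u'' r = - ((\<alpha> + \<mu> + 1) / r * u' r) - k * nonlin q (u r)"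
    proof -
      have n1: "real n - 1 = \<alpha> + \<mu> + 1" using n_eq by simp
      show ?thesis using bspec[OF u(3) r] unfolding n1 k_def nonlin_def r_def by linarith
    qed
    have nx: "nonlin q (x t) = exp ((\<alpha> + 2) * t) * nonlin q (u r)"
    proof -
      have "exp (\<alpha> * t) powr (q - 1) = exp ((\<alpha> * (q - 1)) * t)" by (simp add: powr_def algebra_simps)
      moreover have "\<alpha> * (q - 1) = \<alpha> + 2" using \<alpha>q by (simp add: algebra_simps)
      ultimately show ?thesis unfolding x_def r_def using nonlin_mult[of "exp (\<alpha> * t)" q "u (exp t)"] by simp
    qed
    have e: "exp t * exp ((\<alpha> + 1) * t) = exp ((\<alpha> + 2) * t)" by (simp add: algebra_simps flip: exp_add)
    have "u'' r * exp t * exp ((\<alpha> + 1) * t) = - ((\<alpha> + \<mu> + 1) * z) - k * nonlin q (x t)"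
    proof -
      have "u'' r * exp t * exp ((\<alpha> + 1) * t) = - ((\<alpha> + \<mu> + 1) * (exp ((\<alpha> + 1) * t) * u' r) * (exp t / r)) - k * (exp t * exp ((\<alpha> + 1) * t) * nonlin q (u r))"
        unfolding eq by (simp add: algebra_simps add_divide_distrib)
      then show ?thesis unfolding e nx z_def by (simp add: r_def)
    qed
    then have "\<alpha> * y t + ((\<alpha> + 1) * exp ((\<alpha> + 1) * t) * u' (exp t) + u'' r * exp t * exp ((\<alpha> + 1) * t))
       = \<alpha> * y t + (\<alpha> + 1) * z - (\<alpha> + \<mu> + 1) * z - k * nonlin q (x t)" by (simp add: z_def r_def)
    also have "\<dots> = A * y t + B * x t - k * nonlin q (x t)" unfolding zy by (simp add: A_def B_def algebra_simps)
    finally show "(y has_real_derivative A * y t + B * x t - weight K (- \<kappa>) (exp t) * nonlin q (x t)) (at t)"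
      using d by (simp add: k_def)
  qed
  then show ?thesis unfolding x_def by blast
qed

lemma power_eq_exp: "r > 0 \<Longrightarrow> r ^ (n - 2) = exp ((\<alpha> + \<mu>) * ln r)"
proof -
  assume r: "r > 0"
  have "real (n - 2) = \<alpha> + \<mu>" using n_eq \<alpha>0 \<mu>0 by (simp add: of_nat_diff)
  then show ?thesis using r by (metis exp_ln powr_realpow powr_def less_irrefl)
qed

lemma decays_iff:
  "decays_with n L u \<longleftrightarrow> ((\<lambda>t. exp (\<mu> * t) * (exp (\<alpha> * t) * u (exp t))) \<longlongrightarrow> L) at_top"
proof -
  have e: "u (exp t) * exp t ^ (n - 2) = exp (\<mu> * t) * (exp (\<alpha> * t) * u (exp t))" for t
    by (subst power_eq_exp) (simp_all add: algebra_simps flip: exp_add)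
  show ?thesis
  proof
    assume "decays_with n L u"
    then have "((\<lambda>t. u (exp t) * exp t ^ (n - 2)) \<longlongrightarrow> L) at_top"
      unfolding decays_with_def by (rule filterlim_compose[OF _ exp_at_top])
    then show "((\<lambda>t. exp (\<mu> * t) * (exp (\<alpha> * t) * u (exp t))) \<longlongrightarrow> L) at_top" unfolding e .
  next
    assume "((\<lambda>t. exp (\<mu> * t) * (exp (\<alpha> * t) * u (exp t))) \<longlongrightarrow> L) at_top"
    then have "((\<lambda>t. u (exp t) * exp t ^ (n - 2)) \<longlongrightarrow> L) at_top" unfolding e .
    from filterlim_compose[OF this ln_at_top]
    show "decays_with n L u" unfolding decays_with_def
      by (rule Lim_transform_eventually) (auto intro!: eventually_mono[OF eventually_gt_at_top[of 0]])
  qed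
qed

lemma fast_decay_unique:
  assumes 1: "solves_on n q K (- \<kappa>) {a<..} u" "decays_with n L u"
    and 2: "solves_on n q K (- \<kappa>) {a<..} w" "decays_with n L w" and a: "0 \<le> a" "a < r"
  shows "u r = w r"
proof -
  have sub: "{a<..} \<subseteq> {0<..}" using a by auto
  define b where "b = (if a = 0 then ln r - 1 else ln a)"
  have b: "exp t > a" if "t > b" for t
  proof (cases "a = 0")
    case False
    then have "exp (ln a) < exp t" using that by (simp add: b_def del: exp_ln)
    then show ?thesis using False a by simp
  qed simp
  have br: "ln r > b" using a by (auto simp: b_def)
  obtain y1 y2 where t: "tsol (\<lambda>t. exp (\<alpha> * t) * u (exp t)) y1 {t. exp t \<in> {a<..}}"
      "tsol (\<lambda>t. exp (\<alpha> * t) * w (exp t)) y2 {t. exp t \<in> {a<..}}"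
    using solves_tsol[OF 1(1) open_greaterThan sub] solves_tsol[OF 2(1) open_greaterThan sub] by blast
  have sb: "tsol x y {b<..}" if "tsol x y {t. exp t \<in> {a<..}}" for x y
    using that b continuous_on_subset[of "{t. exp t \<in> {a<..}}" y "{b<..}"] unfolding tsol_def by auto
  have "exp (\<alpha> * ln r) * u (exp (ln r)) = exp (\<alpha> * ln r) * w (exp (ln r))"
    by (rule tsol_unique_fast[OF sb[OF t(1)] sb[OF t(2)] _ _ br]) (use 1(2) 2(2) in \<open>simp_all add: decays_iff\<close>)
  then show ?thesis using a by simp
qed

text \<open>By uniqueness every competing solution, on however small a half-line, agrees with the global one.\<close>

lemma fast_decay_sol_eq:
  assumes u: "solves_on n q K (- \<kappa>) {0<..} u" "decays_with n L u" and r: "r > 0"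
  shows "fast_decay_sol n q K (- \<kappa>) L r = u r"
  unfolding fast_decay_sol_def
proof (rule the_equality)
  show "\<exists>a w. 0 \<le> a \<and> a < r \<and> solves_on n q K (- \<kappa>) {a<..} w \<and> decays_with n L w \<and> u r = w r"
    using u r by (intro exI[of _ 0] exI[of _ u]) auto
next
  fix v assume "\<exists>a w. 0 \<le> a \<and> a < r \<and> solves_on n q K (- \<kappa>) {a<..} w \<and> decays_with n L w \<and> v = w r"
  then obtain a w where w: "0 \<le> a" "a < r" "solves_on n q K (- \<kappa>) {a<..} w" "decays_with n L w" "v = w r" by blast
  have "solves_on n q K (- \<kappa>) {a<..} u" by (rule solves_on_subset[OF u(1)]) (use w in auto)
  from fast_decay_unique[OF w(3,4) this u(2) w(1,2)] show "v = u r" using w by simp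
qed

lemma regular_unique:
  assumes 1: "regular_on n q K (- \<kappa>) {0..<b} d u" and 2: "regular_on n q K (- \<kappa>) {0..<b} d w" and r: "0 \<le> r" "r < b"
  shows "u r = w r"
proof (cases "r = 0")
  case True then show ?thesis using 1 2 by (simp add: regular_on_def)
next
  case False
  then have r0: "r > 0" "b > 0" using r by auto
  have conv: "\<exists>y. tsol (\<lambda>t. exp (\<alpha> * t) * v (exp t)) y {..<ln b} \<and>
      ((\<lambda>t. exp (- \<alpha> * t) * (exp (\<alpha> * t) * v (exp t))) \<longlongrightarrow> d) at_bot"
    if v: "regular_on n q K (- \<kappa>) {0..<b} d v" for v
  proof -
    have s: "solves_on n q K (- \<kappa>) {0<..<b} v"
      by (rule solves_on_subset[of _ _ _ _ "{0..<b}"]) (use v in \<open>auto simp: regular_on_def\<close>)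
    have I: "{t. exp t \<in> {0<..<b}} = {..<ln b}"
    proof -
      have "exp t < b \<longleftrightarrow> t < ln b" for t using r0 by (metis exp_less_cancel_iff exp_ln)
      then show ?thesis by auto
    qed
    obtain y where y: "tsol (\<lambda>t. exp (\<alpha> * t) * v (exp t)) y {..<ln b}"
      using solves_tsol[OF s open_greaterThanLessThan] unfolding I by fastforce
    have "(v has_real_derivative 0) (at 0 within {0..<b})" using v by (simp add: regular_on_def)
    then have "continuous (at 0 within {0..<b}) v" by (rule DERIV_continuous)
    then have "(v \<longlongrightarrow> v 0) (at 0 within {0..<b})" by (simp add: continuous_within)
    then have "(v \<longlongrightarrow> v 0) (at 0 within {0<..<b})" by (rule tendsto_within_subset) auto
    moreover have "at 0 within {0<..<b} = at_right (0::real)"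
      by (rule at_within_nhd[of 0 "{..<b}"]) (use r0 in auto)
    ultimately have "(v \<longlongrightarrow> d) (at_right 0)" using v by (simp add: regular_on_def)
    moreover have "filterlim exp (at_right (0::real)) at_bot"
      using exp_at_bot by (auto simp: filterlim_at)
    ultimately have "((\<lambda>t. v (exp t)) \<longlongrightarrow> d) at_bot" by (rule filterlim_compose)
    moreover have e: "exp (- \<alpha> * t) * (exp (\<alpha> * t) * c) = c" for t c
      by (simp add: mult.assoc[symmetric] flip: exp_add)
    ultimately have "((\<lambda>t. exp (- \<alpha> * t) * (exp (\<alpha> * t) * v (exp t))) \<longlongrightarrow> d) at_bot" unfolding e by simp
    then show ?thesis using y by blast
  qed
  obtain y1 y2 where t: "tsol (\<lambda>t. exp (\<alpha> * t) * u (exp t)) y1 {..<ln b}" "tsol (\<lambda>t. exp (\<alpha> * t) * w (exp t)) y2 {..<ln b}"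
     and l: "((\<lambda>t. exp (- \<alpha> * t) * (exp (\<alpha> * t) * u (exp t))) \<longlongrightarrow> d) at_bot"
       "((\<lambda>t. exp (- \<alpha> * t) * (exp (\<alpha> * t) * w (exp t))) \<longlongrightarrow> d) at_bot"
    using conv[OF 1] conv[OF 2] by blast
  have "exp (\<alpha> * ln r) * u (exp (ln r)) = exp (\<alpha> * ln r) * w (exp (ln r))"
    by (rule tsol_unique_regular[OF t l]) (use r r0 in simp)
  then show ?thesis using r0 by simp
qed

lemma regular_on_subset:
  assumes "regular_on n q K1 K2 I d u" "J \<subseteq> I"
  shows "regular_on n q K1 K2 J d u"
  using assms solves_on_subset has_field_derivative_subset unfolding regular_on_def by blast

lemma regular_sol_eq:
  assumes u: "regular_on n q K (- \<kappa>) {0..} d u" and r: "r \<ge> 0"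
  shows "regular_sol n q K (- \<kappa>) d r = u r"
  unfolding regular_sol_def
proof (rule the_equality)
  have "regular_on n q K (- \<kappa>) {0..<r+1} d u" by (rule regular_on_subset[OF u]) auto
  then show "\<exists>b w. 0 \<le> r \<and> r < b \<and> regular_on n q K (- \<kappa>) {0..<b} d w \<and> u r = w r"
    using r by (intro exI[of _ "r + 1"] exI[of _ u]) auto
next
  fix v assume "\<exists>b w. 0 \<le> r \<and> r < b \<and> regular_on n q K (- \<kappa>) {0..<b} d w \<and> v = w r"
  then obtain b w where w: "r < b" "regular_on n q K (- \<kappa>) {0..<b} d w" "v = w r" by blast
  have "regular_on n q K (- \<kappa>) {0..<b} d u" by (rule regular_on_subset[OF u]) auto
  from regular_unique[OF w(2) this r w(1)] show "v = u r" using w by simp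
qed

end

text \<open>The regular solution \<open>w\<close> with \<open>w 0 = 1\<close> as a function of \<open>r\<^sup>2 = exp (2 * t)\<close>, with derivative \<open>p\<close>, and its
  Emden--Fowler form \<open>(ux, uy)\<close>.\<close>

locale emden_regular = emden_radial +
  fixes w p ux uy :: "real \<Rightarrow> real"
  assumes w0: "w 0 = 1" and p_cont: "continuous_on {0..} p"
    and w_deriv: "\<And>t. t \<ge> 0 \<Longrightarrow> (w has_real_derivative p t) (at t within {0..})"
    and U_sol: "sol ux uy UNIV"
    and ux_eq: "\<And>t. ux t = exp (\<alpha> * t) * w (exp (2 * t))"
    and uy_eq: "\<And>t. uy t = exp (\<alpha> * t) * (\<alpha> * w (exp (2 * t)) + 2 * exp (2 * t) * p (exp (2 * t)))"
begin

lemma w_lim: "((\<lambda>t. w (exp (2 * t))) \<longlongrightarrow> 1) at_bot" "((\<lambda>t. p (exp (2 * t))) \<longlongrightarrow> p 0) at_bot"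
  "((\<lambda>t::real. exp (2 * t)) \<longlongrightarrow> 0) at_bot"
proof -
  have "filterlim (\<lambda>t::real. 2 * t) at_bot at_bot"
    using filterlim_tendsto_pos_mult_at_bot[OF tendsto_const[of "2::real"] _ filterlim_ident] by simp
  then show e: "((\<lambda>t::real. exp (2 * t)) \<longlongrightarrow> 0) at_bot" by (rule filterlim_compose[OF exp_at_bot])
  then have f: "filterlim (\<lambda>t::real. exp (2 * t)) (at_right 0) at_bot" by (auto simp: filterlim_at)
  have cw: "continuous_on {0..} w" by (rule DERIV_continuous_on[of _ w p]) (use w_deriv in auto)
  have lim: "((\<lambda>t. g (exp (2 * t))) \<longlongrightarrow> g 0) at_bot" if "continuous_on {0..} g" for g :: "real \<Rightarrow> real"
  proof -
    have "(g \<longlongrightarrow> g 0) (at 0 within {0..})" using that by (simp add: continuous_on)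
    then have "(g \<longlongrightarrow> g 0) (at_right 0)" by (rule tendsto_within_subset) auto
    then show ?thesis using f by (rule filterlim_compose)
  qed
  show "((\<lambda>t. w (exp (2 * t))) \<longlongrightarrow> 1) at_bot" using lim[OF cw] w0 by simp
  show "((\<lambda>t. p (exp (2 * t))) \<longlongrightarrow> p 0) at_bot" by (rule lim[OF p_cont])
qed

sublocale emden_graph q \<alpha> \<mu> K hs ux uy
proof unfold_locales
  have i: "exp (- \<alpha> * t) * (exp (\<alpha> * t) * c) = c" for t c
    by (simp add: mult.assoc[symmetric] flip: exp_add)
  show "((\<lambda>t. exp (- \<alpha> * t) * ux t) \<longlongrightarrow> 1) at_bot" unfolding ux_eq i by (rule w_lim)
  have "((\<lambda>t. \<alpha> * w (exp (2 * t)) + 2 * exp (2 * t) * p (exp (2 * t))) \<longlongrightarrow> \<alpha> * 1 + 2 * 0 * p 0) at_bot"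
    by (intro tendsto_intros w_lim)
  then show "((\<lambda>t. exp (- \<alpha> * t) * uy t) \<longlongrightarrow> \<alpha>) at_bot" unfolding uy_eq i by simp
  show "sol ux uy UNIV" by (rule U_sol)
  show "continuous_on {0<..} hs" by (rule hs_cont)
  show "(hs \<longlongrightarrow> 0) (at_right 0)" by (rule hs_0)
  show "\<And>x. 0 < x \<Longrightarrow> hs x < 0" by (rule hs_neg)
  show "\<And>x y a b. sol x y {a..b} \<Longrightarrow> a < b \<Longrightarrow> (\<And>t. t \<in> {a..b} \<Longrightarrow> 0 < x t) \<Longrightarrow> y a \<le> hs (x a) \<Longrightarrow> y b < hs (x b)"
    by (rule hs_cross)
qed

section \<open>Matching the inner and the outer solution\<close>

text \<open>An inner trajectory that reaches the stable curve at the point with time \<open>t0\<close> is continued along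
  this curve; every \<open>v(r,L)\<close> considered here arises in this way.\<close>

definition joined :: "real \<Rightarrow> (real \<Rightarrow> real) \<Rightarrow> real \<Rightarrow> real" where
  "joined t0 x r = r powr (- \<alpha>) * (if ln r \<le> 0 then x (ln r) else Xs (t0 + ln r))"

context
  fixes t0 x y
  assumes t0: "t0 \<in> tdom" and S: "sol x y {..0}" and x0: "x 0 = Xs t0" and y0: "y 0 = Ys t0"
begin

definition "jx t = (if t \<le> 0 then x t else Xs (t0 + t))"
definition "jy t = (if t \<le> 0 then y t else Ys (t0 + t))"

lemma shifted_outer:
  assumes "t \<ge> 0"
  shows "((\<lambda>t. Xs (t0 + t)) has_real_derivative Ys (t0 + t)) (at t)"
    "((\<lambda>t. Ys (t0 + t)) has_real_derivative A * Ys (t0 + t) + B * Xs (t0 + t) + \<kappa> * nonlin q (Xs (t0 + t))) (at t)"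
proof -
  have d: "t + t0 \<in> tdom" using dom_up[OF t0, of "t + t0"] assms by simp
  show "((\<lambda>t. Xs (t0 + t)) has_real_derivative Ys (t0 + t)) (at t)"
    using DERIV_shift[THEN iffD1, OF Xs_deriv[OF d]] by (simp add: add.commute)
  show "((\<lambda>t. Ys (t0 + t)) has_real_derivative A * Ys (t0 + t) + B * Xs (t0 + t) + \<kappa> * nonlin q (Xs (t0 + t))) (at t)"
    using DERIV_shift[THEN iffD1, OF Ys_deriv[OF d]] by (simp add: add.commute)
qed

lemma jx_deriv: "(jx has_real_derivative jy t) (at t)"
proof -
  consider "t < 0" | "t > 0" | "t = 0" by linarith
  then show ?thesis
  proof cases
    case 1
    have "(x has_real_derivative y t) (at t)" using sol_at(1)[OF S, of t] 1 by simp
    moreover have "eventually (\<lambda>s. x s = jx s) (nhds t)"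
      by (rule eventually_nhds_openI[of "{..<0}"]) (use 1 in \<open>auto simp: jx_def\<close>)
    ultimately show ?thesis using 1 by (subst (asm) DERIV_cong_ev[OF refl _ refl]) (auto simp: jy_def)
  next
    case 2
    have "((\<lambda>t. Xs (t0 + t)) has_real_derivative Ys (t0 + t)) (at t)" by (rule shifted_outer) (use 2 in simp)
    moreover have "eventually (\<lambda>s. Xs (t0 + s) = jx s) (nhds t)"
      by (rule eventually_nhds_openI[of "{0<..}"]) (use 2 in \<open>auto simp: jx_def\<close>)
    ultimately show ?thesis using 2 by (subst (asm) DERIV_cong_ev[OF refl _ refl]) (auto simp: jy_def)
  next
    case 3
    have "(jx has_real_derivative jy 0) (at 0)"
    proof (rule DERIV_left_right)
      show "(jx has_real_derivative jy 0) (at 0 within {..0})"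
        by (rule has_derivative_cong_on[of x]) (use sol_x[OF S, of 0] in \<open>auto simp: jx_def jy_def\<close>)
      show "(jx has_real_derivative jy 0) (at 0 within {0..})"
        by (rule has_derivative_cong_on[of "\<lambda>t. Xs (t0 + t)"])
           (use has_field_derivative_at_within[OF shifted_outer(1)[of 0]] x0 y0 in \<open>auto simp: jx_def jy_def\<close>)
    qed
    then show ?thesis using 3 by simp
  qed
qed

lemma jy_cont: "isCont jy t"
proof -
  consider "t < 0" | "t > 0" | "t = 0" by linarith
  then show ?thesis
  proof cases
    case 1
    have "isCont y t" using sol_at(2)[OF S, of t] 1 by (intro DERIV_isCont) simp
    moreover have "eventually (\<lambda>s. y s = jy s) (nhds t)"
      by (rule eventually_nhds_openI[of "{..<0}"]) (use 1 in \<open>auto simp: jy_def\<close>)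
    ultimately show ?thesis using isCont_cong[of y jy t] by blast
  next
    case 2
    have "isCont (\<lambda>t. Ys (t0 + t)) t" using shifted_outer(2)[of t] 2 by (intro DERIV_isCont) simp
    moreover have "eventually (\<lambda>s. Ys (t0 + s) = jy s) (nhds t)"
      by (rule eventually_nhds_openI[of "{0<..}"]) (use 2 in \<open>auto simp: jy_def\<close>)
    ultimately show ?thesis using isCont_cong[of "\<lambda>t. Ys (t0 + t)" jy t] by blast
  next
    case 3
    have j0: "jy 0 = y 0" "jy 0 = Ys t0" using y0 by (auto simp: jy_def)
    have "(y \<longlongrightarrow> y 0) (at 0 within {..0})" using sol_cont(2)[OF S] by (simp add: continuous_on)
    then have "(y \<longlongrightarrow> jy 0) (at_left 0)" unfolding j0(1) by (rule tendsto_within_subset) auto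
    then have l: "(jy \<longlongrightarrow> jy 0) (at_left 0)"
      by (rule Lim_transform_eventually) (auto simp: eventually_at_filter jy_def)
    have "isCont (\<lambda>t. Ys (t0 + t)) 0" using shifted_outer(2)[of 0] by (intro DERIV_isCont) simp
    then have "((\<lambda>t. Ys (t0 + t)) \<longlongrightarrow> jy 0) (at_right 0)" by (simp add: isCont_def filterlim_at_split j0(2))
    then have r: "(jy \<longlongrightarrow> jy 0) (at_right 0)"
      by (rule Lim_transform_eventually) (auto simp: eventually_at_filter jy_def)
    show ?thesis using l r 3 by (simp add: isCont_def filterlim_at_split)
  qed
qed

lemma jy_deriv: "t \<noteq> 0 \<Longrightarrow> (jy has_real_derivative A * jy t + B * jx t - weight K (- \<kappa>) (exp t) * nonlin q (jx t)) (at t)"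
proof -
  assume "t \<noteq> 0"
  then consider "t < 0" | "t > 0" by linarith
  then show ?thesis
  proof cases
    case 1
    have "(y has_real_derivative A * y t + B * x t - K * nonlin q (x t)) (at t)" using sol_at(2)[OF S, of t] 1 by simp
    moreover have "eventually (\<lambda>s. y s = jy s) (nhds t)"
      by (rule eventually_nhds_openI[of "{..<0}"]) (use 1 in \<open>auto simp: jy_def\<close>)
    ultimately have "(jy has_real_derivative A * y t + B * x t - K * nonlin q (x t)) (at t)"
      by (subst (asm) DERIV_cong_ev[OF refl _ refl]) auto
    then show ?thesis using 1 by (simp add: jx_def jy_def weight_def)
  next
    case 2
    have "((\<lambda>t. Ys (t0 + t)) has_real_derivative A * Ys (t0 + t) + B * Xs (t0 + t) + \<kappa> * nonlin q (Xs (t0 + t))) (at t)"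
      by (rule shifted_outer) (use 2 in simp)
    moreover have "eventually (\<lambda>s. Ys (t0 + s) = jy s) (nhds t)"
      by (rule eventually_nhds_openI[of "{0<..}"]) (use 2 in \<open>auto simp: jy_def\<close>)
    ultimately have "(jy has_real_derivative A * Ys (t0 + t) + B * Xs (t0 + t) + \<kappa> * nonlin q (Xs (t0 + t))) (at t)"
      by (subst (asm) DERIV_cong_ev[OF refl _ refl]) auto
    then show ?thesis using 2 by (simp add: jx_def jy_def weight_def)
  qed
qed

lemma joined_tsol: "tsol jx jy UNIV"
  unfolding tsol_def using jx_deriv jy_deriv jy_cont by (auto intro!: continuous_at_imp_continuous_on)

lemma joined_jx: "joined t0 x r = r powr (- \<alpha>) * jx (ln r)"
  by (simp add: joined_def jx_def)

lemma joined_solves: "solves_on n q K (- \<kappa>) {0<..} (joined t0 x)"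
  and joined_deriv: "\<And>r. r > 0 \<Longrightarrow>
    (joined t0 x has_real_derivative r powr (- \<alpha> - 1) * (jy (ln r) - \<alpha> * jx (ln r))) (at r)"
  using tsol_solves[OF joined_tsol open_greaterThan subset_refl _ joined_jx] by auto

text \<open>A time shift by \<open>t0\<close> multiplies the decay constant by \<open>exp (- \<mu> * t0)\<close>.\<close>

lemma joined_decays: "decays_with n (exp (- \<mu> * t0)) (joined t0 x)"
  unfolding decays_iff
proof -
  have "filterlim (\<lambda>t. t + t0) at_top at_top" by (rule filterlim_add_const_at_top)
  from filterlim_compose[OF Xs_lim this]
  have "((\<lambda>t. exp (- \<mu> * t0) * (exp (\<mu> * (t + t0)) * Xs (t + t0))) \<longlongrightarrow> exp (- \<mu> * t0) * 1) at_top"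
    by (intro tendsto_mult tendsto_const)
  then have "((\<lambda>t. exp (- \<mu> * t0) * (exp (\<mu> * (t + t0)) * Xs (t + t0))) \<longlongrightarrow> exp (- \<mu> * t0)) at_top" by simp
  then show "((\<lambda>t. exp (\<mu> * t) * (exp (\<alpha> * t) * joined t0 x (exp t))) \<longlongrightarrow> exp (- \<mu> * t0)) at_top"
  proof (rule Lim_transform_eventually)
    show "eventually (\<lambda>t. exp (- \<mu> * t0) * (exp (\<mu> * (t + t0)) * Xs (t + t0)) = exp (\<mu> * t) * (exp (\<alpha> * t) * joined t0 x (exp t))) at_top"
    proof (rule eventually_mono[OF eventually_gt_at_top[of 0]])
      fix t :: real assume t: "t > 0"
      have "exp (\<alpha> * t) * joined t0 x (exp t) = Xs (t0 + t)"
        using t by (simp add: joined_def powr_def mult.assoc[symmetric] flip: exp_add)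
      moreover have "exp (- \<mu> * t0) * exp (\<mu> * (t + t0)) = exp (\<mu> * t)"
        by (simp add: algebra_simps flip: exp_add)
      ultimately show "exp (- \<mu> * t0) * (exp (\<mu> * (t + t0)) * Xs (t + t0)) = exp (\<mu> * t) * (exp (\<alpha> * t) * joined t0 x (exp t))"
        by (simp add: mult.assoc[symmetric] add.commute)
    qed
  qed
qed

lemma joined_eq: "r > 0 \<Longrightarrow> fast_decay_sol n q K (- \<kappa>) (exp (- \<mu> * t0)) r = joined t0 x r"
  by (rule fast_decay_sol_eq[OF joined_solves joined_decays])

lemma joined_outer_pos: "r > 1 \<Longrightarrow> joined t0 x r > 0"
  using Xs_pos[OF dom_up[OF t0, of "t0 + ln r"]] by (simp add: joined_def)

lemma joined_zeros: "{r. r > 0 \<and> joined t0 x r = 0} = exp ` {t. t \<le> 0 \<and> x t = 0}"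
proof
  show "{r. r > 0 \<and> joined t0 x r = 0} \<subseteq> exp ` {t. t \<le> 0 \<and> x t = 0}"
  proof
    fix r assume "r \<in> {r. r > 0 \<and> joined t0 x r = 0}"
    then have r: "r > 0" "joined t0 x r = 0" by auto
    then have "r \<le> 1" using joined_outer_pos[of r] by (cases "r > 1") auto
    then have "x (ln r) = 0" "ln r \<le> 0" using r by (auto simp: joined_def)
    then show "r \<in> exp ` {t. t \<le> 0 \<and> x t = 0}" using r by (intro image_eqI[of _ _ "ln r"]) auto
  qed
  show "exp ` {t. t \<le> 0 \<and> x t = 0} \<subseteq> {r. r > 0 \<and> joined t0 x r = 0}" by (auto simp: joined_def)
qed

lemma joined_nondegenerate:
  assumes fin: "finite {t. t \<le> 0 \<and> x t = 0}" and card: "card {t. t \<le> 0 \<and> x t = 0} = k"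
  shows "nondegenerate_zeroes k (joined t0 x)"
  unfolding nondegenerate_zeroes_def joined_zeros
proof (intro conjI allI impI)
  show "finite (exp ` {t. t \<le> 0 \<and> x t = 0})" using fin by simp
  show "card (exp ` {t. t \<le> 0 \<and> x t = 0}) = k" using card by (subst card_image) (auto simp: inj_on_def)
  fix r assume r: "r > 0" "joined t0 x r = 0"
  then have "r \<in> exp ` {t. t \<le> 0 \<and> x t = 0}" using joined_zeros by blast
  then obtain t where t: "r = exp t" "t \<le> 0" "x t = 0" by auto
  have "y t \<noteq> 0" using stays_at_origin(1)[OF sol_subset[OF S], of t 0] t x0 Xs_pos[OF t0] by auto
  have "deriv (joined t0 x) r = r powr (- \<alpha> - 1) * (jy (ln r) - \<alpha> * jx (ln r))"
    by (rule DERIV_imp_deriv[OF joined_deriv[OF r(1)]])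
  also have "\<dots> \<noteq> 0" using t \<open>y t \<noteq> 0\<close> by (simp add: jx_def jy_def)
  finally show "deriv (joined t0 x) r \<noteq> 0" .
qed

lemma joined_tendsto_0: "(joined t0 x \<longlongrightarrow> 0) at_top"
proof -
  have "filterlim (\<lambda>t. t0 + t) at_top at_top" using filterlim_add_const_at_top[of t0] by (simp add: add.commute)
  from filterlim_compose[OF Xs_0 this] have "((\<lambda>t. Xs (t0 + t)) \<longlongrightarrow> 0) at_top" .
  from filterlim_compose[OF this ln_at_top] have 1: "((\<lambda>r. Xs (t0 + ln r)) \<longlongrightarrow> 0) at_top" .
  have 2: "((\<lambda>r::real. r powr (- \<alpha>)) \<longlongrightarrow> 0) at_top" by (rule tendsto_neg_powr[OF _ filterlim_ident]) (use \<alpha>0 in simp)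
  have "((\<lambda>r. r powr (- \<alpha>) * Xs (t0 + ln r)) \<longlongrightarrow> 0) at_top" using tendsto_mult[OF 2 1] by simp
  then show ?thesis
    by (rule Lim_transform_eventually)
       (rule eventually_mono[OF eventually_gt_at_top[of 1]], auto simp: joined_def)
qed

lemma joined_fast_decay: "fast_decay n q K (- \<kappa>) (joined t0 x)"
  unfolding fast_decay_def using joined_solves joined_decays by blast

text \<open>By \<open>negative_energy_singular\<close>, \<open>\<bar>u r\<bar>\<close> is at least \<open>\<delta> * r powr (- \<alpha>)\<close> near 0.\<close>

lemma joined_singular:
  assumes neg: "\<exists>t\<le>0. energy x y t < 0"
  shows "singular n q K (- \<kappa>) (joined t0 x)"
proof -
  obtain t1 where t1: "t1 \<le> 0" "energy x y t1 < 0" using neg by blast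
  obtain \<delta> where \<delta>: "\<delta> > 0" "(\<forall>t\<le>t1. x t \<ge> \<delta>) \<or> (\<forall>t\<le>t1. x t \<le> - \<delta>)"
    using negative_energy_singular[OF S t1] by blast
  have pw: "filterlim (\<lambda>r::real. r powr (- \<alpha>)) at_top (at_right 0)"
  proof -
    have "filterlim (\<lambda>r. - \<alpha> * ln r) at_top (at_right 0)"
    proof -
      have "filterlim (\<lambda>r. \<alpha> * ln r) at_bot (at_right 0)"
        by (rule filterlim_tendsto_pos_mult_at_bot[OF tendsto_const \<alpha>0 ln_at_0])
      then show ?thesis by (simp add: filterlim_uminus_at_top)
    qed
    then have "filterlim (\<lambda>r. exp (- \<alpha> * ln r)) at_top (at_right 0)" by (rule filterlim_compose[OF exp_at_top])
    moreover have "eventually (\<lambda>r. exp (- \<alpha> * ln r) = r powr (- \<alpha>)) (at_right 0)"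
      by (auto simp: eventually_at_filter powr_def)
    ultimately show ?thesis using filterlim_cong[OF refl refl] by fast
  qed
  have small: "eventually (\<lambda>r. r \<in> {0<..<exp t1}) (at_right (0::real))" by (rule eventually_at_right_real) simp
  have ln_le: "ln r \<le> t1" if "r \<in> {0<..<exp t1}" for r
  proof -
    have "ln r < ln (exp t1)" using that by (subst ln_less_cancel_iff) auto
    then show ?thesis by simp
  qed
  have "filterlim (joined t0 x) at_top (at_right 0) \<or> filterlim (joined t0 x) at_bot (at_right 0)"
    using \<delta>(2)
  proof
    assume x: "\<forall>t\<le>t1. x t \<ge> \<delta>"
    have "filterlim (\<lambda>r. \<delta> * r powr (- \<alpha>)) at_top (at_right 0)"
      by (rule filterlim_tendsto_pos_mult_at_top[OF tendsto_const \<delta>(1) pw])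
    moreover have "eventually (\<lambda>r. \<delta> * r powr (- \<alpha>) \<le> joined t0 x r) (at_right 0)"
    proof (rule eventually_mono[OF small])
      fix r assume r: "r \<in> {0<..<exp t1}"
      then have "x (ln r) \<ge> \<delta>" using x by (metis ln_le)
      moreover have "ln r \<le> 0" using ln_le[OF r] t1(1) by linarith
      ultimately show "\<delta> * r powr (- \<alpha>) \<le> joined t0 x r" by (simp add: joined_def mult.commute[of _ "r powr (- \<alpha>)"] mult_left_mono)
    qed
    ultimately show ?thesis using filterlim_at_top_mono by blast
  next
    assume x: "\<forall>t\<le>t1. x t \<le> - \<delta>"
    have "filterlim (\<lambda>r. \<delta> * r powr (- \<alpha>)) at_top (at_right 0)"
      by (rule filterlim_tendsto_pos_mult_at_top[OF tendsto_const \<delta>(1) pw])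
    moreover have "eventually (\<lambda>r. \<delta> * r powr (- \<alpha>) \<le> - joined t0 x r) (at_right 0)"
    proof (rule eventually_mono[OF small])
      fix r assume r: "r \<in> {0<..<exp t1}"
      then have a: "x (ln r) \<le> - \<delta>" using x by (metis ln_le)
      have a': "ln r \<le> 0" using ln_le[OF r] t1(1) by linarith
      have "r powr (- \<alpha>) * \<delta> \<le> r powr (- \<alpha>) * (- x (ln r))" by (intro mult_left_mono) (use a in auto)
      then show "\<delta> * r powr (- \<alpha>) \<le> - joined t0 x r" using a' by (simp add: joined_def mult.commute)
    qed
    ultimately have "filterlim (\<lambda>r. - joined t0 x r) at_top (at_right 0)" by (rule filterlim_at_top_mono)
    then show ?thesis by (simp add: filterlim_uminus_at_top)
  qed
  then show ?thesis unfolding singular_def using joined_solves by blast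
qed

text \<open>If the inner part is a multiple of a translate of \<open>U\<close>, the joined solution is \<open>d * w (E * r\<^sup>2)\<close> for
  \<open>r \<le> 1\<close>, which is \<open>C\<^sup>1\<close> up to \<open>r = 0\<close> with vanishing derivative there.\<close>

lemma joined_regular:
  assumes c: "\<And>t. t \<le> 0 \<Longrightarrow> x t = c * ux (s + t)"
  shows "regular_on n q K (- \<kappa>) {0..} (c * exp (\<alpha> * s)) ((joined t0 x)(0 := c * exp (\<alpha> * s)))"
proof -
  define d where "d = c * exp (\<alpha> * s)"
  define g where "g = (joined t0 x)(0 := d)"
  define E where "E = exp (2 * s)"
  have E0: "E > 0" by (simp add: E_def)
  have gw: "g r = d * w (E * r\<^sup>2)" if r: "r \<in> {0..1}" for r
  proof (cases "r = 0")
    case True then show ?thesis by (simp add: g_def w0)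
  next
    case False
    then have r0: "r > 0" "ln r \<le> 0" using r by auto
    have "exp (2 * (s + ln r)) = E * r\<^sup>2"
    proof -
      have "exp (2 * ln r) = r\<^sup>2" using r0 by (simp add: exp_double)
      then show ?thesis by (simp add: E_def distrib_left exp_add)
    qed
    moreover have "r powr (- \<alpha>) * exp (\<alpha> * (s + ln r)) = exp (\<alpha> * s)"
      using r0 by (simp add: powr_def algebra_simps flip: exp_add)
    ultimately show ?thesis using r0 False c[of "ln r"]
      by (simp add: g_def joined_def ux_eq d_def mult.assoc[symmetric])
  qed
  obtain u' u'' where u: "\<forall>r\<in>{0<..}. (joined t0 x has_real_derivative u' r) (at r within {0<..})" "continuous_on {0<..} u'"
    "\<forall>r\<in>{0<..} - {0, 1}. (u' has_real_derivative u'' r) (at r within {0<..}) \<and>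
       u'' r + (real n - 1) / r * u' r + weight K (- \<kappa>) r * (joined t0 x r * \<bar>joined t0 x r\<bar> powr (q - 2)) = 0"
    using joined_solves unfolding solves_on_def by blast
  have at: "at r within {0<..} = at r" "at r within {0..} = at r" if "r > 0" for r :: real
    using that by (auto intro!: at_within_open at_within_interior simp: interior_open)
  have ev: "eventually (\<lambda>s. joined t0 x s = g s) (nhds r)" if "r > 0" for r
    by (rule eventually_nhds_openI[of "{0<..}"]) (use that in \<open>auto simp: g_def\<close>)
  have dg: "(g has_real_derivative u' r) (at r)" if r: "r > 0" for r
    using bspec[OF u(1), of r] r DERIV_cong_ev[OF refl ev[OF r] refl] by (simp add: at)
  define P where "P r = d * (p (E * r\<^sup>2) * (E * (2 * r)))" for r
  have dP: "((\<lambda>r. d * w (E * r\<^sup>2)) has_real_derivative P r) (at r within {0..})" if r: "r \<ge> 0" for r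
  proof -
    have sq: "((\<lambda>r. E * r\<^sup>2) has_real_derivative E * (2 * r)) (at r within {0..})"
      by (auto intro!: derivative_eq_intros)
    have "(w has_real_derivative p (E * r\<^sup>2)) (at (E * r\<^sup>2) within {0..})" by (rule w_deriv) (use E0 in simp)
    then have "(w has_real_derivative p (E * r\<^sup>2)) (at (E * r\<^sup>2) within (\<lambda>r. E * r\<^sup>2) ` {0..})"
      by (rule has_field_derivative_subset) (use E0 in auto)
    from DERIV_image_chain[OF this sq] have "((\<lambda>r. w (E * r\<^sup>2)) has_real_derivative p (E * r\<^sup>2) * (E * (2 * r))) (at r within {0..})"
      by (simp add: o_def)
    then show ?thesis unfolding P_def by (rule DERIV_cmult)
  qed
  have dg0: "(g has_real_derivative 0) (at 0 within {0..})"
  proof -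
    have "((\<lambda>r. d * w (E * r\<^sup>2)) has_real_derivative 0) (at 0 within {0..1})"
      using has_field_derivative_subset[OF dP[of 0], of "{0..1}"] by (simp add: P_def)
    then have "(g has_real_derivative 0) (at 0 within {0..1})"
      by (rule has_derivative_cong_on) (auto simp: gw)
    moreover have "at (0::real) within {0..1} = at 0 within {0..}" by (rule at_within_atLeast_eq) simp
    ultimately show ?thesis by simp
  qed
  have u'P: "u' r = P r" if r: "0 < r" "r < 1" for r
  proof (rule DERIV_unique[OF dg[OF r(1)]])
    have "((\<lambda>r. d * w (E * r\<^sup>2)) has_real_derivative P r) (at r)" using dP[of r] r by (simp add: at)
    moreover have "eventually (\<lambda>s. d * w (E * s\<^sup>2) = g s) (nhds r)"
      by (rule eventually_nhds_openI[of "{0<..<1}"]) (use r gw in auto)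
    ultimately show "(g has_real_derivative P r) (at r)" by (subst (asm) DERIV_cong_ev[OF refl _ refl]) auto
  qed
  define v where "v r = (if r = 0 then 0 else u' r)" for r
  have "solves_on n q K (- \<kappa>) {0..} g" unfolding solves_on_def
  proof (rule exI[of _ v], rule exI[of _ u''], intro conjI ballI)
    fix r :: real assume r: "r \<in> {0..}"
    show "(g has_real_derivative v r) (at r within {0..})"
      using dg0 dg[of r] r at[of r] by (cases "r = 0") (auto simp: v_def)
  next
    show "continuous_on {0..} v" unfolding continuous_on_eq_continuous_within
    proof
      fix r :: real assume r: "r \<in> {0..}"
      show "continuous (at r within {0..}) v"
      proof (cases "r = 0")
        case True
        have cP: "continuous_on {0..} P" unfolding P_def[abs_def]
          by (intro continuous_intros continuous_on_compose2[OF p_cont]) (use E0 in auto)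
        then have "(P \<longlongrightarrow> P 0) (at 0 within {0..})" by (simp add: continuous_on)
        moreover have "eventually (\<lambda>s. P s = v s) (at 0 within {0..})"
        proof -
          have "eventually (\<lambda>s. s < (1::real)) (nhds 0)" by (rule eventually_nhds_openI[of "{..<1}"]) auto
          then show ?thesis unfolding eventually_at_filter
            by (rule eventually_mono) (auto simp: v_def u'P)
        qed
        ultimately have "(v \<longlongrightarrow> P 0) (at 0 within {0..})" by (rule Lim_transform_eventually)
        then show ?thesis using True by (simp add: continuous_within v_def P_def)
      next
        case False
        then have r0: "r > 0" using r by simp
        then have "isCont u' r" using u(2) by (simp add: continuous_on_eq_continuous_at)
        moreover have "eventually (\<lambda>s. u' s = v s) (nhds r)"
          by (rule eventually_nhds_openI[of "{0<..}"]) (use r0 in \<open>auto simp: v_def\<close>)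
        ultimately have "isCont v r" using isCont_cong by blast
        then show ?thesis by (rule continuous_at_imp_continuous_within)
      qed
    qed
  next
    fix r :: real assume r: "r \<in> {0..} - {0, 1}"
    then have r0: "r > 0" "r \<in> {0<..} - {0, 1}" by auto
    have "(u' has_real_derivative u'' r) (at r)" using bspec[OF u(3) r0(2)] at[OF r0(1)] by simp
    moreover have "eventually (\<lambda>s. u' s = v s) (nhds r)"
      by (rule eventually_nhds_openI[of "{0<..}"]) (use r0 in \<open>auto simp: v_def\<close>)
    ultimately have "(v has_real_derivative u'' r) (at r)" by (subst (asm) DERIV_cong_ev[OF refl _ refl]) auto
    then show "(v has_real_derivative u'' r) (at r within {0..})" by (rule has_field_derivative_at_within)
    have e: "v r = u' r" "g r = joined t0 x r" using r0 by (auto simp: v_def g_def)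
    show "u'' r + (real n - 1) / r * v r + weight K (- \<kappa>) r * (g r * \<bar>g r\<bar> powr (q - 2)) = 0"
      unfolding e using bspec[OF u(3) r0(2)] by blast
  qed
  then have "regular_on n q K (- \<kappa>) {0..} d g" unfolding regular_on_def using dg0 by (simp add: g_def)
  then show ?thesis by (simp add: g_def d_def)
qed

end

end

section \<open>The critical decay constants\<close>

lemma fast_decay_cong:
  assumes "fast_decay n q K1 K2 u" "\<And>r. r > 0 \<Longrightarrow> u r = v r"
  shows "fast_decay n q K1 K2 v"
proof -
  have "decays_with n L v" if "decays_with n L u" for L
    using that unfolding decays_with_def
    by (rule Lim_transform_eventually) (use assms(2) in \<open>auto intro!: eventually_mono[OF eventually_gt_at_top[of 0]]\<close>)
  moreover have "solves_on n q K1 K2 {0<..} v"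
    by (rule solves_on_cong[of n q K1 K2 "{0<..}" u v]) (use assms in \<open>auto simp: fast_decay_def\<close>)
  ultimately show ?thesis using assms(1) unfolding fast_decay_def by blast
qed

lemma singular_cong:
  assumes "singular n q K1 K2 u" "\<And>r. r > 0 \<Longrightarrow> u r = v r"
  shows "singular n q K1 K2 v"
proof -
  have "eventually (\<lambda>r. u r = v r) (at_right 0)" using assms(2) by (auto simp: eventually_at_filter)
  from filterlim_cong[OF refl refl this]
  have "filterlim u F (at_right 0) \<longleftrightarrow> filterlim v F (at_right 0)" for F .
  moreover have "solves_on n q K1 K2 {0<..} v"
    by (rule solves_on_cong[of n q K1 K2 "{0<..}" u v]) (use assms in \<open>auto simp: singular_def\<close>)
  ultimately show ?thesis using assms(1) unfolding singular_def by blast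
qed

lemma regular_cong:
  assumes "regular_on n q K1 K2 {0..} d u" "\<And>r. r > 0 \<Longrightarrow> u r = v r"
  shows "regular n q K1 K2 v"
proof -
  have "u 0 = d" using assms(1) by (simp add: regular_on_def)
  then have "regular_on n q K1 K2 {0..} d (v(0 := d))"
    by (intro regular_on_cong[OF assms(1)]) (use assms(2) in auto)
  then show ?thesis unfolding regular_def by blast
qed

lemma tendsto_at_top_cong_pos:
  fixes u v :: "real \<Rightarrow> real"
  assumes "(u \<longlongrightarrow> l) at_top" "\<And>r. r > 0 \<Longrightarrow> u r = v r"
  shows "(v \<longlongrightarrow> l) at_top"
  using assms(1)
  by (rule Lim_transform_eventually) (use assms(2) in \<open>auto intro!: eventually_mono[OF eventually_gt_at_top[of 0]]\<close>)

lemma regular_on_sign: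
  assumes "c \<in> {1, -1}" "regular_on n q K1 K2 I d u"
  shows "regular_on n q K1 K2 I (c * d) (\<lambda>r. c * u r)"
  using assms solves_on_minus[of n q K1 K2 I u] DERIV_minus[of u 0 0 I] unfolding regular_on_def by auto

lemma fast_decay_sign:
  assumes "c \<in> {1, -1}" "fast_decay n q K1 K2 u"
  shows "fast_decay n q K1 K2 (\<lambda>r. c * u r)"
proof -
  obtain L where "decays_with n L u" using assms(2) by (auto simp: fast_decay_def)
  then have "decays_with n (c * L) (\<lambda>r. c * u r)"
    unfolding decays_with_def using tendsto_mult[OF tendsto_const[of c]] by (fastforce simp: mult.assoc)
  then show ?thesis using assms solves_on_minus[of n q K1 K2 "{0<..}" u] unfolding fast_decay_def by auto
qed

lemma nondegenerate_zeroes_sign: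
  assumes "c \<in> {1, -1}" "nondegenerate_zeroes k u" "\<And>r. r > 0 \<Longrightarrow> u differentiable (at r)"
  shows "nondegenerate_zeroes k (\<lambda>r. c * u r)"
  using assms nondegenerate_zeroes_minus[OF assms(2,3)] by auto

locale emden_full = emden_regular +
  fixes tz :: "nat \<Rightarrow> real"
  assumes tz0: "\<And>k. ux (tz k) = 0" and tz1: "\<And>k. tz k < tz (Suc k)"
    and tz2: "\<And>t. t < tz 0 \<Longrightarrow> ux t > 0"
    and tz3: "\<And>k t. t \<in> {tz k<..<tz (Suc k)} \<Longrightarrow> (-1) ^ Suc k * ux t > 0"
begin

sublocale emden_bumps q \<alpha> \<mu> K hs ux uy tz
  by unfold_locales (use tz0 tz1 tz2 tz3 in auto)

text \<open>The stable trajectory passes the \<open>k\<close>-th crossing at time \<open>tk k\<close>.\<close>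

definition tk :: "nat \<Rightarrow> real" where "tk k = Tinv (X k)"
definition Lk :: "nat \<Rightarrow> real" where "Lk k = exp (- \<mu> * tk k)"

lemma tk: "tk k \<in> tdom" "Xs (tk k) = X k"
  unfolding tk_def using Tinv[OF X_pos] by auto

lemma Lk_pos: "Lk k > 0"
  by (simp add: Lk_def)

lemma Lk_mono: "strict_mono Lk"
  unfolding strict_mono_Suc_iff
proof
  fix k
  have "Xs (tk k) < Xs (tk (Suc k))" using strict_monoD[OF X_mono, of k "Suc k"] tk(2) by simp
  then have "tk (Suc k) < tk k" using Xs_less_iff[OF tk(1) tk(1)] by blast
  then show "Lk k < Lk (Suc k)" using \<mu>0 by (simp add: Lk_def)
qed

lemma Lk_converges: "\<exists>l. Lk \<longlonglongrightarrow> l"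
proof -
  obtain T where T: "\<forall>t\<in>tdom. T \<le> t" using dom_bounded_below by blast
  have "Lk k \<le> exp (- \<mu> * T)" for k using bspec[OF T tk(1)[of k]] \<mu>0 by (simp add: Lk_def)
  then show ?thesis using incseq_convergent[OF strict_mono_mono[OF Lk_mono]] by blast
qed

text \<open>The trajectory \<open>V k\<close>, shifted such that the crossing takes place at \<open>t = 0\<close>.\<close>

definition xk :: "nat \<Rightarrow> real \<Rightarrow> real" where "xk k t = V k (crossing k + t)"
definition yk :: "nat \<Rightarrow> real \<Rightarrow> real" where "yk k t = Vy k (crossing k + t)"

lemma xk_sol: "sol (xk k) (yk k) {..0}" "xk k 0 = Xs (tk k)" "yk k 0 = Ys (tk k)"
proof -
  have "(xk k has_real_derivative yk k t) (at t)"
    "(yk k has_real_derivative A * yk k t + B * xk k t - K * nonlin q (xk k t)) (at t)" for t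
    using DERIV_shift[THEN iffD1, OF sol_at(1)[OF V_sol[of k UNIV], of "t + crossing k"]]
      DERIV_shift[THEN iffD1, OF sol_at(2)[OF V_sol[of k UNIV], of "t + crossing k"]]
    unfolding xk_def[abs_def] yk_def[abs_def] by (simp_all add: add.commute)
  then show "sol (xk k) (yk k) {..0}" unfolding sol_def using has_field_derivative_at_within by blast
  show "xk k 0 = Xs (tk k)" by (simp add: xk_def tk X_def)
  have "Ys (tk k) = hs (X k)" using hs_Xs[OF tk(1)[of k]] tk(2) by simp
  then show "yk k 0 = Ys (tk k)" by (simp add: yk_def X_def crossing)
qed

abbreviation "J k \<equiv> joined (tk k) (xk k)"
abbreviation "sg k \<equiv> (-1::real) ^ k"

lemma sg: "sg k \<in> {1, -1}"
  by (cases "even k") auto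

lemma J_eq: "r > 0 \<Longrightarrow> J k r = fast_decay_sol n q K (- \<kappa>) (Lk k) r"
  unfolding Lk_def by (rule joined_eq[OF tk(1) xk_sol, symmetric])

lemma J_fast_decay: "fast_decay n q K (- \<kappa>) (J k)"
  by (rule joined_fast_decay[OF tk(1) xk_sol])

lemma J_regular: "regular_on n q K (- \<kappa>) {0..} (sg k * exp (\<alpha> * crossing k)) ((J k)(0 := sg k * exp (\<alpha> * crossing k)))"
  by (rule joined_regular[OF tk(1) xk_sol]) (simp add: xk_def V_def)

lemma J_zeroes: "nondegenerate_zeroes k (J k)"
proof -
  have "{t. t \<le> 0 \<and> xk k t = 0} = (\<lambda>t. t - crossing k) ` {t. t < crossing k \<and> ux t = 0}"
  proof
    show "{t. t \<le> 0 \<and> xk k t = 0} \<subseteq> (\<lambda>t. t - crossing k) ` {t. t < crossing k \<and> ux t = 0}"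
    proof
      fix t assume "t \<in> {t. t \<le> 0 \<and> xk k t = 0}"
      then have t: "t \<le> 0" "ux (crossing k + t) = 0" by (auto simp: xk_def V_def)
      have "ux (crossing k) \<noteq> 0" using X_pos[of k] by (auto simp: X_def V_def)
      then have "t \<noteq> 0" using t by auto
      then show "t \<in> (\<lambda>t. t - crossing k) ` {t. t < crossing k \<and> ux t = 0}"
        using t by (intro image_eqI[of _ _ "crossing k + t"]) auto
    qed
    show "(\<lambda>t. t - crossing k) ` {t. t < crossing k \<and> ux t = 0} \<subseteq> {t. t \<le> 0 \<and> xk k t = 0}"
      by (auto simp: xk_def V_def)
  qed
  also have "\<dots> = (\<lambda>i. tz i - crossing k) ` {..<k}" unfolding zeros_before_crossing by (simp add: image_image)
  finally have Z: "{t. t \<le> 0 \<and> xk k t = 0} = (\<lambda>i. tz i - crossing k) ` {..<k}" .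
  have "strict_mono tz" using tz_Suc by (simp add: strict_mono_Suc_iff)
  then have "inj_on (\<lambda>i. tz i - crossing k) {..<k}" by (auto simp: inj_on_def strict_mono_eq)
  then have "card {t. t \<le> 0 \<and> xk k t = 0} = k" unfolding Z by (simp add: card_image)
  then show ?thesis by (intro joined_nondegenerate[OF tk(1) xk_sol]) (use Z in auto)
qed

lemma J_0_pos: "r > 0 \<Longrightarrow> J 0 r > 0"
proof (cases "r > 1")
  case True then show ?thesis by (rule joined_outer_pos[OF tk(1) xk_sol])
next
  case False
  assume r: "r > 0"
  have "ln r \<le> 0" using r False by simp
  then have "crossing 0 + ln r \<in> bump 0" using crossing_bounds(1)[of 0] unfolding bump_def by simp
  from V_pos[OF this] show ?thesis using r False by (simp add: joined_def xk_def)
qed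

lemma regular_case:
  "regular n q K (- \<kappa>) (fast_decay_sol n q K (- \<kappa>) (Lk k))"
  "fast_decay n q K (- \<kappa>) (fast_decay_sol n q K (- \<kappa>) (Lk k))"
  "nondegenerate_zeroes k (fast_decay_sol n q K (- \<kappa>) (Lk k))"
proof -
  show "regular n q K (- \<kappa>) (fast_decay_sol n q K (- \<kappa>) (Lk k))"
    by (rule regular_cong[OF J_regular]) (simp add: J_eq)
  show "fast_decay n q K (- \<kappa>) (fast_decay_sol n q K (- \<kappa>) (Lk k))"
    by (rule fast_decay_cong[OF J_fast_decay J_eq])
  show "nondegenerate_zeroes k (fast_decay_sol n q K (- \<kappa>) (Lk k))"
    by (rule nondegenerate_zeroes_cong[OF J_zeroes J_eq])
qed

lemma ground_state_case: "ground_state n q K (- \<kappa>) (fast_decay_sol n q K (- \<kappa>) (Lk 0))"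
  unfolding ground_state_def
proof (intro conjI allI impI regular_case)
  show "fast_decay_sol n q K (- \<kappa>) (Lk 0) r > 0" if "r > 0" for r
    using J_0_pos[OF that] J_eq[OF that] by simp
  show "(fast_decay_sol n q K (- \<kappa>) (Lk 0) \<longlongrightarrow> 0) at_top"
    by (rule tendsto_at_top_cong_pos[OF joined_tendsto_0[OF tk(1) xk_sol] J_eq])
qed

text \<open>With \<open>L = exp (- \<mu> * t0)\<close> the bounds on \<open>L\<close> place \<open>Xs t0\<close> between \<open>X (k - 1)\<close> and \<open>X k\<close>, where
  \<open>singular_zero_count\<close> applies to the backward trajectory.\<close>

lemma singular_case:
  assumes L: "0 < L" "L < Lk k" and lo: "\<And>i. k = Suc i \<Longrightarrow> Lk i < L"
  shows "singular n q K (- \<kappa>) (fast_decay_sol n q K (- \<kappa>) L)" (is ?g1)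
    "fast_decay n q K (- \<kappa>) (fast_decay_sol n q K (- \<kappa>) L)" (is ?g2)
    "nondegenerate_zeroes k (fast_decay_sol n q K (- \<kappa>) L)" (is ?g3)
    "k = 0 \<Longrightarrow> singular_ground_state n q K (- \<kappa>) (fast_decay_sol n q K (- \<kappa>) L)" (is "_ \<Longrightarrow> ?g4")
proof -
  define t0 where "t0 = - ln L / \<mu>"
  have L0: "L = exp (- \<mu> * t0)" using L(1) \<mu>0 by (simp add: t0_def)
  have t0k: "tk k < t0" using L(2) \<mu>0 unfolding L0 Lk_def by simp
  have t0: "t0 \<in> tdom" by (rule dom_up[OF tk(1)[of k]]) (use t0k in simp)
  have lt: "Xs t0 < X k" using Xs_less[OF tk(1) t0k] tk(2) by simp
  have gt: "X i < Xs t0" if "k = Suc i" for i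
  proof -
    have "t0 < tk i" using lo[OF that] \<mu>0 unfolding L0 Lk_def by simp
    from Xs_less[OF t0 this] show ?thesis using tk(2) by simp
  qed
  obtain x y where S: "sol x y {..0}" "x 0 = Xs t0" "y 0 = Ys t0" using backward_sol_exists by blast
  have y0: "y 0 = hs (x 0)" using S hs_Xs[OF t0] by simp
  have x0: "x 0 > 0" using S Xs_pos[OF t0] by simp
  have Z: "finite {t. t \<le> 0 \<and> x t = 0}" "card {t. t \<le> 0 \<and> x t = 0} = k" "\<exists>t\<le>0. energy x y t < 0"
    using singular_zero_count[OF S(1) y0 x0, of k] lt gt S by auto
  note j = t0 S
  have eq: "joined t0 x r = fast_decay_sol n q K (- \<kappa>) L r" if "r > 0" for r
    unfolding L0 by (rule joined_eq[OF j that, symmetric])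
  show ?g1 by (rule singular_cong[OF joined_singular[OF j Z(3)] eq])
  show ?g2 by (rule fast_decay_cong[OF joined_fast_decay[OF j] eq])
  show ?g3 by (rule nondegenerate_zeroes_cong[OF joined_nondegenerate[OF j Z(1,2)] eq])
  show ?g4 if k: "k = 0" unfolding singular_ground_state_def
  proof (intro conjI allI impI \<open>?g1\<close>)
    have nz: "x t \<noteq> 0" if "t \<in> {..0}" for t using Z(1,2) k that by auto
    have pos: "x t > 0" if "t \<in> {..0}" for t
      by (rule const_sign[OF sol_cont(1)[OF S(1)] is_interval_ic nz _ x0 that]) auto
    show "fast_decay_sol n q K (- \<kappa>) L r > 0" if "r > 0" for r
    proof (cases "r > 1")
      case True then show ?thesis using joined_outer_pos[OF j True] eq[OF that] by simp
    next
      case False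
      then show ?thesis using pos[of "ln r"] eq[OF that, symmetric] that by (simp add: joined_def)
    qed
    show "(fast_decay_sol n q K (- \<kappa>) L \<longlongrightarrow> 0) at_top"
      by (rule tendsto_at_top_cong_pos[OF joined_tendsto_0[OF j] eq])
  qed
qed

text \<open>Shifting time by \<open>crossing k\<close> multiplies the value of the regular solution at the origin, which
  is 1 for \<open>U\<close>, by this factor.\<close>

definition Dk :: "nat \<Rightarrow> real" where "Dk k = exp (\<alpha> * crossing k)"

lemma Dk_mono: "strict_mono Dk"
  using crossing_mono \<alpha>0 by (simp add: Dk_def strict_mono_def)

lemma Dk_unbounded: "filterlim Dk at_top sequentially"
  unfolding Dk_def
  by (intro filterlim_compose[OF exp_at_top] filterlim_tendsto_pos_mult_at_top[OF tendsto_const \<alpha>0 crossing_unbounded])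

text \<open>The solution \<open>u(r, Dk k)\<close> is \<open>v(r, Lk k)\<close> up to the sign \<open>(-1) ^ k\<close>: the reflection brings the \<open>k\<close>-th
  crossing into \<open>x > 0\<close>, whereas \<open>U\<close> itself starts with a positive value.\<close>

lemma shooting_case:
  "regular n q K (- \<kappa>) (regular_sol n q K (- \<kappa>) (Dk k))"
  "fast_decay n q K (- \<kappa>) (regular_sol n q K (- \<kappa>) (Dk k))"
  "nondegenerate_zeroes k (regular_sol n q K (- \<kappa>) (Dk k))"
proof -
  define u where "u = (\<lambda>r. sg k * ((J k)(0 := sg k * Dk k)) r)"
  have "sg k * (sg k * Dk k) = Dk k" using sg[of k] by auto
  then have u: "regular_on n q K (- \<kappa>) {0..} (Dk k) u"
    using regular_on_sign[OF sg J_regular, of k k] unfolding u_def Dk_def by simp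
  note eq = regular_sol_eq[OF u, symmetric]
  have eq': "sg k * J k r = regular_sol n q K (- \<kappa>) (Dk k) r" if "r > 0" for r
    using eq[of r] that by (simp add: u_def)
  show "regular n q K (- \<kappa>) (regular_sol n q K (- \<kappa>) (Dk k))"
    by (rule regular_cong[OF u]) (simp add: eq)
  show "fast_decay n q K (- \<kappa>) (regular_sol n q K (- \<kappa>) (Dk k))"
    by (rule fast_decay_cong[OF fast_decay_sign[OF sg J_fast_decay] eq'])
  have "J k differentiable (at r)" if "r > 0" for r
    using joined_deriv[OF tk(1) xk_sol that] real_differentiable_def by blast
  then show "nondegenerate_zeroes k (regular_sol n q K (- \<kappa>) (Dk k))"
    by (intro nondegenerate_zeroes_cong[OF nondegenerate_zeroes_sign[OF sg J_zeroes] eq'])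
qed

end

lemma exponents:
  fixes n :: nat and q :: real
  assumes "n \<ge> 3" and "lower_exponent n < q" and "q < upper_exponent n"
  defines "\<alpha> \<equiv> 2 / (q - 2)"
  shows "q > 2" "0 < real n - 2 - \<alpha>" "real n - 2 - \<alpha> < \<alpha>"
proof -
  have n: "real n - 2 > 0" using assms(1) by simp
  have l: "(q - 2) * (real n - 2) > 2" using assms(2) n by (simp add: lower_exponent_def field_simps)
  then show q: "q > 2" using n by (smt (verit) mult_nonpos_nonneg)
  have u: "(q - 2) * (real n - 2) < 4" using assms(3) n by (simp add: upper_exponent_def field_simps)
  show "0 < real n - 2 - \<alpha>" using l q by (simp add: \<alpha>_def field_simps)
  have "real n - 2 < 4 / (q - 2)" using u q by (simp add: pos_less_divide_eq mult.commute)
  then show "real n - 2 - \<alpha> < \<alpha>" by (simp add: \<alpha>_def)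
qed

theorem corollary1p2:
  fixes n :: nat and q K1 K2 :: real
  assumes "n \<ge> 3" and "lower_exponent n < q" and "q < upper_exponent n"
    and "K1 > 0" and "K2 < 0"
  shows "(\<exists>(Lk :: nat \<Rightarrow> real) (Linf :: real).
      strict_mono Lk \<and> (\<forall>k. Lk k > 0) \<and> Lk \<longlonglongrightarrow> Linf \<and>
      (ground_state n q K1 K2 (fast_decay_sol n q K1 K2 (Lk 0)) \<and>
       fast_decay n q K1 K2 (fast_decay_sol n q K1 K2 (Lk 0)) \<and>
       (\<forall>k. regular n q K1 K2 (fast_decay_sol n q K1 K2 (Lk k)) \<and>
            fast_decay n q K1 K2 (fast_decay_sol n q K1 K2 (Lk k)) \<and>
            nondegenerate_zeroes k (fast_decay_sol n q K1 K2 (Lk k)))) \<and>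
      (\<forall>L. 0 < L \<and> L < Lk 0 \<longrightarrow>
            singular_ground_state n q K1 K2 (fast_decay_sol n q K1 K2 L) \<and>
            fast_decay n q K1 K2 (fast_decay_sol n q K1 K2 L)) \<and>
      (\<forall>k\<ge>1. \<forall>L. Lk (k - 1) < L \<and> L < Lk k \<longrightarrow>
            singular n q K1 K2 (fast_decay_sol n q K1 K2 L) \<and>
            fast_decay n q K1 K2 (fast_decay_sol n q K1 K2 L) \<and>
            nondegenerate_zeroes k (fast_decay_sol n q K1 K2 L)))
    \<and> (\<exists>D :: nat \<Rightarrow> real. strict_mono D \<and> filterlim D at_top sequentially \<and>
        (\<forall>k. regular n q K1 K2 (regular_sol n q K1 K2 (D k)) \<and>
             fast_decay n q K1 K2 (regular_sol n q K1 K2 (D k)) \<and>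
             nondegenerate_zeroes k (regular_sol n q K1 K2 (D k))))"
proof -
  define \<alpha> where "\<alpha> = 2 / (q - 2)"
  define \<mu> where "\<mu> = real n - 2 - \<alpha>"
  define \<kappa> where "\<kappa> = - K2"
  have K2: "K2 = - \<kappa>" by (simp add: \<kappa>_def)
  note e = exponents[OF assms(1-3), folded \<alpha>_def]
  have "\<alpha> * (q - 2) = 2" using e(1) by (intro nonzero_eq_divide_eq[THEN iffD1]) (auto simp: \<alpha>_def)
  then interpret R: emden_radial q \<alpha> \<mu> K1 \<kappa> n
    by unfold_locales (use e assms in \<open>auto simp: \<mu>_def \<kappa>_def\<close>)
  obtain w p ux uy where w: "w 0 = 1" "continuous_on {0..} p"
      "\<forall>t\<ge>0. (w has_real_derivative p t) (at t within {0..})"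
      "R.sol ux uy UNIV" "\<forall>t. ux t = exp (\<alpha> * t) * w (exp (2 * t))"
      "\<forall>t. uy t = exp (\<alpha> * t) * (\<alpha> * w (exp (2 * t)) + 2 * exp (2 * t) * p (exp (2 * t)))"
    using R.regular_sol_exists by blast
  interpret U: emden_regular q \<alpha> \<mu> K1 \<kappa> n w p ux uy
    by unfold_locales (use w in auto)
  obtain tz :: "nat \<Rightarrow> real" where tz: "\<forall>k. ux (tz k) = 0" "\<forall>k. tz k < tz (Suc k)" "\<forall>t<tz 0. ux t > 0"
      "\<forall>k. \<forall>t\<in>{tz k<..<tz (Suc k)}. (-1) ^ Suc k * ux t > 0"
    using U.zeros_of_U_exist by blast
  interpret F: emden_full q \<alpha> \<mu> K1 \<kappa> n w p ux uy tz
    by unfold_locales (use tz in auto)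
  obtain Linf where Linf: "F.Lk \<longlonglongrightarrow> Linf" using F.Lk_converges by blast
  have sing0: "singular_ground_state n q K1 K2 (fast_decay_sol n q K1 K2 L) \<and> fast_decay n q K1 K2 (fast_decay_sol n q K1 K2 L)"
    if "0 < L" "L < F.Lk 0" for L
    unfolding K2 using F.singular_case(2,4)[OF that] by auto
  have sing: "singular n q K1 K2 (fast_decay_sol n q K1 K2 L) \<and> fast_decay n q K1 K2 (fast_decay_sol n q K1 K2 L) \<and>
      nondegenerate_zeroes k (fast_decay_sol n q K1 K2 L)"
    if "k \<ge> 1" "F.Lk (k - 1) < L" "L < F.Lk k" for k L
  proof -
    have "0 < L" using F.Lk_pos[of "k - 1"] that by linarith
    moreover have "F.Lk i < L" if "k = Suc i" for i using that \<open>F.Lk (k - 1) < L\<close> by simp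
    ultimately show ?thesis unfolding K2 using F.singular_case(1-3)[of L k] that by blast
  qed
  show ?thesis
  proof (intro conjI)
    show "\<exists>D :: nat \<Rightarrow> real. strict_mono D \<and> filterlim D at_top sequentially \<and>
        (\<forall>k. regular n q K1 K2 (regular_sol n q K1 K2 (D k)) \<and>
             fast_decay n q K1 K2 (regular_sol n q K1 K2 (D k)) \<and>
             nondegenerate_zeroes k (regular_sol n q K1 K2 (D k)))"
      unfolding K2 using F.Dk_mono F.Dk_unbounded F.shooting_case by blast
  qed (intro exI[of _ F.Lk] exI[of _ Linf] conjI allI impI F.Lk_mono F.Lk_pos Linf sing0 sing;
       (simp add: K2 F.ground_state_case F.regular_case | (use sing0 sing in blast)))
qed

end
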